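(* Consider a discrete memoryless multiple-relay channel with nodes $1,\dots,K$, source node $1$, destination node $K$, relays $\mathcal T=\{2,\dots,K-1\}$ and channel $P(y_2,\dots,y_K|x_1,\dots,x_{K-1})$. For a permutation $\pi$ of $\{1,\dots,K\}$ with $\pi(1)=1$, $\pi(K)=K$ and an integer $K_1$ with $1\le K_1\le K-1$, let $\mathcal T_{1(\pi)}=\{\pi(k):2\le k\le K_1\}$, $\mathcal T_{2(\pi)}=\mathcal T\setminus\mathcal T_{1(\pi)}$, and $\pi(j:k)=\{\pi(j),\pi(j+1),\dots,\pi(k)\}$. SNNC-DF achieves the rates satisfying $$R_{\text{SNNC-DF}}<\max_{\pi}\ \max_{K_1}\ \min\Big\{\min_{1\le k\le K_1-1} I\big(X_{\pi(1:k)};Y_{\pi(k+1)}\,|\,X_{\pi(k+1:K_1)}\big),\ I(X_1X_{\mathcal T_{1(\pi)}}X_{\mathcal S};\hat Y_{\mathcal S^{c}}Y_K\,|\,X_{\mathcal S^{c}})-I(\hat Y_{\mathcal S};Y_{\mathcal S}\,|\,X_1X_{\mathcal T}\hat Y_{\mathcal S^{c}}Y_K)\Big\}$$ for all $\mathcal S\subseteq\mathcal T_{2(\pi)}$, where $\mathcal S^{c}=\mathcal T_{2(\pi)}\setminus\mathcal S$, and where the joint distribution factors as $$P(x_1,x_{\mathcal T_{1(\pi)}})\Big[\prod_{k\in\mathcal T_{2(\pi)}}P(x_k)P(\hat y_k|y_k,x_k)\Big]P(y_2,\dots,y_K|x_1,\dots,x_{K-1}).$$ That is, for every such $\pi$,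 $K_1$ and joint distribution, every rate $R$ that is smaller than the first (inner) minimum and, for every $\mathcal S\subseteq\mathcal T_{2(\pi)}$, smaller than the second expression, is achievable by SNNC-DF.
   Context: **Channel and achievability.** All alphabets are finite. At time $i$ nodes $1,\dots,K-1$ send $x_{1i},\dots,x_{(K-1)i}$ and nodes $2,\dots,K$ receive $y_{2i},\dots,y_{Ki}$. The channel is memoryless and time invariant: given the message and the past, the outputs at time $i$ have law $P(y_{2i},\dots,y_{Ki}|x_{1i},\dots,x_{(K-1)i})$. Node $1$ has a message $W$ uniform on $\{1,\dots,2^{nR}\}$ destined for node $K$. The input $X_{1i}$ is a function of $W$, and for each relay $k$ the input $X_{ki}$ is a function of $Y_k^{i-1}$. The destination forms an estimate $\hat W$ from $Y_K^n$. A rate $R$ is achievable if for every $\epsilon>0$ there are a sufficiently large $n$ and such functions with $\Pr[\hat W\neq W]\le\epsilon$. **Notation.** For a set $\mathcal S$ of nodes, $X_{\mathcal S}=[X_i:i\in\mathcal S]$, and similarly $Y_{\mathcal S},\hat Y_{\mathcal S}$. $\hat Y_k$ is an auxiliary (quantization) random variable, with finite alphabet, at relay $k\in\mathcal T_{2(\pi)}$. A minimum over an empty index set (the case $K_1=1$) imposes no constraint. **Standing assumption on connectivity.** Let $C_{ij}=\max_{x}\max_{P_{X_i}} I(X_i;Y_j|\text{all inputs other than } X_i \text{ fixed to } x)$ and let $R_{ij}$ be the maximum, over all directed paths from $i$ to $j$, of the minimum of $C_{k\ell}$ over the edges $(k,\ell)$ of the path. It is assumed that $R_{1K}>0$. **SNNC-DF**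 (short message noisy network coding with a decode-forward option). The message is split into many short messages sent in successive blocks. The relays in $\mathcal T_{1(\pi)}$ use decode-forward: in the order given by $\pi$ they decode the short messages and, together with the source, use block Markov coding with the joint input law $P(x_1,x_{\mathcal T_{1(\pi)}})$. The relays in $\mathcal T_{2(\pi)}$ use quantize-forward: in each block relay $k$ sends a codeword indexed by the previous block's quantization index, and it quantizes its received block to a sequence $\hat{\mathbf y}_k$ from a codebook generated from $P_{\hat Y_k|X_k}$ given its transmitted codeword. The last quantization indices are conveyed to the destination by multihopping in extra blocks of negligible total length. The destination decodes the short messages and quantization indices backward, block by block, by joint typicality, and it may treat the signals of some quantize-forward relays as noise. *)

theory Defs
  imports "HOL-Probability.Probability" "HOL-Combinatorics.Permutations"
begin

section \<open>Information measures of discrete laws\<close>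

text \<open>
  The library's information measures, in bits, for random variables on a finitely supported law.
  The sample space is cut down to the support, so that all variables are simple functions and the
  count spaces below are the ones of the library notation for discrete variables.
\<close>

definition supp_space :: "'a pmf \<Rightarrow> 'a measure" where
  "supp_space p = restrict_space (measure_pmf p) (set_pmf p)"

definition mi :: "'a pmf \<Rightarrow> ('a \<Rightarrow> 'b) \<Rightarrow> ('a \<Rightarrow> 'c) \<Rightarrow> real" where
  "mi p A B = prob_space.mutual_information (supp_space p) 2
     (count_space (A ` set_pmf p)) (count_space (B ` set_pmf p)) A B"

definition cmi :: "'a pmf \<Rightarrow> ('a \<Rightarrow> 'b) \<Rightarrow> ('a \<Rightarrow> 'c) \<Rightarrow> ('a \<Rightarrow> 'd) \<Rightarrow> real" where
  "cmi p A B C = prob_space.conditional_mutual_information (supp_space p) 2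
     (count_space (A ` set_pmf p)) (count_space (B ` set_pmf p)) (count_space (C ` set_pmf p)) A B C"

lemma space_supp_space [simp]: "space (supp_space p) = set_pmf p"
  by (simp add: supp_space_def space_restrict_space)

lemma information_space_supp: "information_space (supp_space p) 2"
proof -
  have "prob_space (supp_space p)"
    unfolding supp_space_def
    by (rule prob_space_restrict_space) (auto simp: emeasure_pmf)
  then show ?thesis
    by (simp add: information_space_def information_space_axioms_def)
qed


section \<open>Memoryless multiple-relay channels and their codes\<close>

record ('x, 'y) relay_channel =
  last_node :: nat
  inp :: "nat \<Rightarrow> 'x set"
  outp :: "nat \<Rightarrow> 'y set"
  law :: "(nat \<Rightarrow> 'x) \<Rightarrow> (nat \<Rightarrow> 'y) pmf"

definition senders :: "('x, 'y) relay_channel \<Rightarrow> nat set" where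
  "senders Ch = {1..last_node Ch - 1}"

definition receivers :: "('x, 'y) relay_channel \<Rightarrow> nat set" where
  "receivers Ch = {2..last_node Ch}"

definition relays :: "('x, 'y) relay_channel \<Rightarrow> nat set" where
  "relays Ch = {2..last_node Ch - 1}"

definition relay_channel :: "('x, 'y) relay_channel \<Rightarrow> bool" where
  "relay_channel Ch \<longleftrightarrow>
     2 \<le> last_node Ch \<and>
     (\<forall>k\<in>senders Ch. finite (inp Ch k) \<and> inp Ch k \<noteq> {}) \<and>
     (\<forall>k\<in>receivers Ch. finite (outp Ch k)) \<and>
     (\<forall>x \<in> PiE (senders Ch) (inp Ch). set_pmf (law Ch x) \<subseteq> PiE (receivers Ch) (outp Ch))"

text \<open>
  \<open>src f w i\<close> is the source input at time \<open>i \<ge> 1\<close>; \<open>rel f k ys\<close> is the input of relay \<open>k\<close> at time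
  \<open>length ys + 1\<close> after it has received \<open>ys\<close>.
\<close>

record ('x, 'y) code =
  src :: "nat \<Rightarrow> nat \<Rightarrow> 'x"
  rel :: "nat \<Rightarrow> 'y list \<Rightarrow> 'x"
  dec :: "'y list \<Rightarrow> nat"

definition is_code :: "('x, 'y) relay_channel \<Rightarrow> nat \<Rightarrow> nat \<Rightarrow> ('x, 'y) code \<Rightarrow> bool" where
  "is_code Ch n M f \<longleftrightarrow>
     (\<forall>w\<in>{1..M}. \<forall>i\<in>{1..n}. src f w i \<in> inp Ch 1) \<and>
     (\<forall>k\<in>relays Ch. \<forall>ys. length ys < n \<and> set ys \<subseteq> outp Ch k \<longrightarrow> rel f k ys \<in> inp Ch k)"

definition inputs ::
  "('x, 'y) relay_channel \<Rightarrow> ('x, 'y) code \<Rightarrow> nat \<Rightarrow> (nat \<Rightarrow> 'y) list \<Rightarrow> nat \<Rightarrow> 'x" where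
  "inputs Ch f w ys = (\<lambda>k\<in>senders Ch.
     if k = 1 then src f w (length ys + 1) else rel f k (map (\<lambda>y. y k) ys))"

primrec outputs ::
  "('x, 'y) relay_channel \<Rightarrow> ('x, 'y) code \<Rightarrow> nat \<Rightarrow> nat \<Rightarrow> (nat \<Rightarrow> 'y) list pmf" where
  "outputs Ch f w 0 = return_pmf []"
| "outputs Ch f w (Suc i) =
     bind_pmf (outputs Ch f w i) (\<lambda>ys. map_pmf (\<lambda>y. ys @ [y]) (law Ch (inputs Ch f w ys)))"

definition error_prob :: "('x, 'y) relay_channel \<Rightarrow> nat \<Rightarrow> nat \<Rightarrow> ('x, 'y) code \<Rightarrow> real" where
  "error_prob Ch n M f =
     measure_pmf.prob
       (bind_pmf (pmf_of_set {1..M}) (\<lambda>w.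
          map_pmf (\<lambda>ys. (w, dec f (map (\<lambda>y. y (last_node Ch)) ys))) (outputs Ch f w n)))
       {(w, v). v \<noteq> w}"

definition num_messages :: "nat \<Rightarrow> real \<Rightarrow> nat" where
  "num_messages n R = nat \<lceil>2 powr (real n * R)\<rceil>"

text \<open>Achievability by codes from a class \<open>\<C>\<close>, which may depend on the accuracy, the length and
  the number of messages.\<close>

definition achievable_within ::
  "('x, 'y) relay_channel \<Rightarrow> (real \<Rightarrow> nat \<Rightarrow> nat \<Rightarrow> ('x, 'y) code \<Rightarrow> bool) \<Rightarrow> real \<Rightarrow> bool" where
  "achievable_within Ch \<C> R \<longleftrightarrow>
     (\<forall>\<epsilon>>0. \<forall>n0. \<exists>n\<ge>n0. \<exists>f.
        is_code Ch n (num_messages n R) f \<and> \<C> \<epsilon> n (num_messages n R) f \<and>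
        error_prob Ch n (num_messages n R) f \<le> \<epsilon>)"

definition achievable :: "('x, 'y) relay_channel \<Rightarrow> real \<Rightarrow> bool" where
  "achievable Ch = achievable_within Ch (\<lambda>\<epsilon> n M f. True)"


section \<open>Connectivity\<close>

definition link_law ::
  "('x, 'y) relay_channel \<Rightarrow> nat \<Rightarrow> nat \<Rightarrow> (nat \<Rightarrow> 'x) \<Rightarrow> 'x pmf \<Rightarrow> ('x \<times> 'y) pmf" where
  "link_law Ch i j x q = bind_pmf q (\<lambda>a. map_pmf (\<lambda>y. (a, y j)) (law Ch (x(i := a))))"

text \<open>\<open>C\<^sub>i\<^sub>j\<close>; the maximum exists by compactness and is written as a supremum.\<close>

definition link_capacity :: "('x, 'y) relay_channel \<Rightarrow> nat \<Rightarrow> nat \<Rightarrow> real" where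
  "link_capacity Ch i j =
     Sup {mi (link_law Ch i j x q) fst snd | x q.
            x \<in> PiE (senders Ch) (inp Ch) \<and> set_pmf q \<subseteq> inp Ch i}"

definition is_path :: "('x, 'y) relay_channel \<Rightarrow> nat \<Rightarrow> nat \<Rightarrow> nat list \<Rightarrow> bool" where
  "is_path Ch i j p \<longleftrightarrow>
     2 \<le> length p \<and> hd p = i \<and> last p = j \<and> distinct p \<and>
     set (butlast p) \<subseteq> senders Ch \<and> set (tl p) \<subseteq> receivers Ch"

definition multihop_rate :: "('x, 'y) relay_channel \<Rightarrow> nat \<Rightarrow> nat \<Rightarrow> real" where
  "multihop_rate Ch i j =
     Max {Min {link_capacity Ch (p ! m) (p ! Suc m) | m. Suc m < length p} | p. is_path Ch i j p}"


section \<open>Relay sets and the joint law\<close>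

text \<open>A sample is a triple: channel inputs, channel outputs, quantizations, each indexed by node.\<close>

type_synonym ('x, 'y, 'z) sample = "(nat \<Rightarrow> 'x) \<times> (nat \<Rightarrow> 'y) \<times> (nat \<Rightarrow> 'z)"

definition Xs :: "nat set \<Rightarrow> ('x, 'y, 'z) sample \<Rightarrow> nat \<Rightarrow> 'x" where
  "Xs S = (\<lambda>(x, y, z). restrict x S)"

definition Ys :: "nat set \<Rightarrow> ('x, 'y, 'z) sample \<Rightarrow> nat \<Rightarrow> 'y" where
  "Ys S = (\<lambda>(x, y, z). restrict y S)"

definition Zs :: "nat set \<Rightarrow> ('x, 'y, 'z) sample \<Rightarrow> nat \<Rightarrow> 'z" where
  "Zs S = (\<lambda>(x, y, z). restrict z S)"

definition DF_relays :: "(nat \<Rightarrow> nat) \<Rightarrow> nat \<Rightarrow> nat set" where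
  "DF_relays \<pi> K1 = \<pi> ` {2..K1}"

definition QF_relays :: "('x, 'y) relay_channel \<Rightarrow> (nat \<Rightarrow> nat) \<Rightarrow> nat \<Rightarrow> nat set" where
  "QF_relays Ch \<pi> K1 = relays Ch - DF_relays \<pi> K1"

definition joint_law ::
  "('x, 'y) relay_channel \<Rightarrow> (nat \<Rightarrow> nat) \<Rightarrow> nat \<Rightarrow> (nat \<Rightarrow> 'z set) \<Rightarrow> ('x, 'y, 'z) sample pmf \<Rightarrow> bool"
  where
  "joint_law Ch \<pi> K1 Z P \<longleftrightarrow>
     (let T1 = DF_relays \<pi> K1; T2 = QF_relays Ch \<pi> K1;
          XX = PiE (senders Ch) (inp Ch); YY = PiE (receivers Ch) (outp Ch); ZZ = PiE T2 Z
      in set_pmf P \<subseteq> XX \<times> YY \<times> ZZ \<and>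
         (\<exists>(p1 :: (nat \<Rightarrow> 'x) pmf) (px :: nat \<Rightarrow> 'x pmf) (pz :: nat \<Rightarrow> 'y \<Rightarrow> 'x \<Rightarrow> 'z pmf).
            \<forall>x\<in>XX. \<forall>y\<in>YY. \<forall>z\<in>ZZ.
              pmf P (x, y, z) =
                pmf p1 (restrict x ({1} \<union> T1)) *
                (\<Prod>k\<in>T2. pmf (px k) (x k) * pmf (pz k (y k) (x k)) (z k)) *
                pmf (law Ch x) y))"


section \<open>Short message noisy network coding with decode-forward\<close>

text \<open>Robust typicality: relative frequencies within a factor \<open>1 \<plusminus> \<delta>\<close> of the probabilities.\<close>

definition typical :: "real \<Rightarrow> 'a pmf \<Rightarrow> 'a list \<Rightarrow> bool" where
  "typical \<delta> p s \<longleftrightarrow>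
     (\<forall>a. \<bar>real (count_list s a) / real (length s) - pmf p a\<bar> \<le> \<delta> * pmf p a)"

text \<open>
  Time is divided into \<open>blocks\<close> blocks of length \<open>bl\<close> and a final phase of length \<open>xl\<close>.  The first
  \<open>nb\<close> blocks introduce one short message each; the remaining \<open>K1 - 1\<close> blocks flush the
  decode-forward pipeline.  Positions \<open>m = 1, \<dots>, K1\<close> stand for the source and the decode-forward
  relays \<open>\<pi> m\<close>.

  \<^item> \<open>split W j\<close>: the short message \<open>w\<^sub>j\<close> of \<open>W\<close>;
  \<^item> \<open>cx m c [w\<^sub>c\<^sub>-\<^sub>m\<^sub>+\<^sub>1, \<dots>, w\<^sub>c\<^sub>-\<^sub>K\<^sub>1\<^sub>+\<^sub>1]\<close>: block \<open>c\<close> codeword of position \<open>m\<close> (block Markov coding);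
  \<^item> \<open>dfd m j ys\<close>: estimate of \<open>w\<^sub>j\<close> at position \<open>m\<close> from its outputs \<open>ys\<close> in blocks \<open>1, \<dots>, j+m-2\<close>;
  \<^item> \<open>qx k c l\<close>: block \<open>c\<close> codeword of quantize-forward relay \<open>k\<close> for the index \<open>l\<close> of block \<open>c-1\<close>;
  \<^item> \<open>qz k c l l'\<close>: block \<open>c\<close> quantization number \<open>l\<close> in the codebook that goes with \<open>qx k c l'\<close>;
  \<^item> \<open>dq\<close>, \<open>dd\<close>: typicality parameters of the quantizers and of the destination;
  \<^item> \<open>xsrc\<close>, \<open>xrel\<close>, \<open>xdec\<close>: the final phase, which conveys the last quantization indices: \<open>xrel k l ys\<close>
    is sent by relay \<open>k\<close>, with last index \<open>l\<close>, after receiving \<open>ys\<close> in this phase, and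
    \<open>xdec k ys\<close> is the destination's estimate of the last index of relay \<open>k\<close>.
\<close>

record ('x, 'y, 'z) scheme =
  bl :: nat
  nb :: nat
  xl :: nat
  nmsg :: nat
  nidx :: "nat \<Rightarrow> nat"
  split :: "nat \<Rightarrow> nat \<Rightarrow> nat"
  cx :: "nat \<Rightarrow> nat \<Rightarrow> nat list \<Rightarrow> 'x list"
  dfd :: "nat \<Rightarrow> nat \<Rightarrow> 'y list \<Rightarrow> nat"
  qx :: "nat \<Rightarrow> nat \<Rightarrow> nat \<Rightarrow> 'x list"
  qz :: "nat \<Rightarrow> nat \<Rightarrow> nat \<Rightarrow> nat \<Rightarrow> 'z list"
  dq :: real
  dd :: real
  xsrc :: "nat \<Rightarrow> 'x"
  xrel :: "nat \<Rightarrow> nat \<Rightarrow> 'y list \<Rightarrow> 'x"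
  xdec :: "nat \<Rightarrow> 'y list \<Rightarrow> nat"

definition blocks :: "nat \<Rightarrow> ('x, 'y, 'z) scheme \<Rightarrow> nat" where
  "blocks K1 s = nb s + K1 - 1"

definition main_length :: "nat \<Rightarrow> ('x, 'y, 'z) scheme \<Rightarrow> nat" where
  "main_length K1 s = blocks K1 s * bl s"

definition valid_scheme ::
  "('x, 'y) relay_channel \<Rightarrow> (nat \<Rightarrow> nat) \<Rightarrow> nat \<Rightarrow> (nat \<Rightarrow> 'z set) \<Rightarrow> nat \<Rightarrow> ('x, 'y, 'z) scheme \<Rightarrow> bool"
  where
  "valid_scheme Ch \<pi> K1 Z M s \<longleftrightarrow>
     (let T2 = QF_relays Ch \<pi> K1 in
      1 \<le> bl s \<and> 1 \<le> nb s \<and> 1 \<le> nmsg s \<and> (\<forall>k\<in>T2. 1 \<le> nidx s k) \<and> 0 < dq s \<and> 0 < dd s \<and>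
      (\<forall>w\<in>{1..M}. \<forall>j\<in>{1..nb s}. split s w j \<in> {1..nmsg s}) \<and>
      inj_on (\<lambda>w. restrict (split s w) {1..nb s}) {1..M} \<and>
      (\<forall>m\<in>{1..K1}. \<forall>c\<in>{1..blocks K1 s}. \<forall>u. length u = K1 + 1 - m \<and> set u \<subseteq> {1..nmsg s} \<longrightarrow>
         length (cx s m c u) = bl s \<and> set (cx s m c u) \<subseteq> inp Ch (\<pi> m)) \<and>
      (\<forall>m\<in>{2..K1}. \<forall>j\<in>{1..nb s}. \<forall>ys. dfd s m j ys \<in> {1..nmsg s}) \<and>
      (\<forall>k\<in>T2. \<forall>c\<in>{1..blocks K1 s}. \<forall>l'\<in>{1..nidx s k}.
         length (qx s k c l') = bl s \<and> set (qx s k c l') \<subseteq> inp Ch k \<and>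
         (\<forall>l\<in>{1..nidx s k}. length (qz s k c l l') = bl s \<and> set (qz s k c l l') \<subseteq> Z k)) \<and>
      (\<forall>t. xsrc s t \<in> inp Ch 1) \<and>
      (\<forall>k\<in>relays Ch. \<forall>l ys. xrel s k l ys \<in> inp Ch k) \<and>
      (\<forall>k\<in>T2. \<forall>ys. xdec s k ys \<in> {1..nidx s k}))"

definition block :: "nat \<Rightarrow> 'a list \<Rightarrow> nat \<Rightarrow> 'a list" where
  "block N ys c = take N (drop ((c - 1) * N) ys)"

text \<open>
  The short messages encoded in block \<open>c\<close> at position \<open>m\<close>.  Messages outside \<open>1, \<dots>, nb\<close> are fixed
  to \<open>1\<close>; a subtraction \<open>c + 1 - i\<close> truncated to \<open>0\<close> stands for such a message as well.
\<close>

definition pipeline :: "nat \<Rightarrow> ('x, 'y, 'z) scheme \<Rightarrow> (nat \<Rightarrow> nat) \<Rightarrow> nat \<Rightarrow> nat \<Rightarrow> nat list" where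
  "pipeline K1 s w m c =
     map (\<lambda>i. let j = c + 1 - i in if j \<in> {1..nb s} then w j else 1) [m..<Suc K1]"

text \<open>The quantization index \<open>l\<^sub>c\<close> of relay \<open>k\<close> with outputs \<open>ys\<close>.\<close>

primrec qidx ::
  "('x, 'y, 'z) sample pmf \<Rightarrow> ('x, 'y, 'z) scheme \<Rightarrow> nat \<Rightarrow> 'y list \<Rightarrow> nat \<Rightarrow> nat" where
  "qidx P s k ys 0 = 1"
| "qidx P s k ys (Suc c) =
     (let l' = qidx P s k ys c;
          good = (\<lambda>l. l \<in> {1..nidx s k} \<and>
            typical (dq s) (map_pmf (\<lambda>(x, y, z). (x k, y k, z k)) P)
              (zip (qx s k (Suc c) l') (zip (block (bl s) ys (Suc c)) (qz s k (Suc c) l l'))))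
      in if \<exists>l. good l then LEAST l. good l else 1)"

definition snnc_src :: "nat \<Rightarrow> ('x, 'y, 'z) scheme \<Rightarrow> nat \<Rightarrow> nat \<Rightarrow> 'x" where
  "snnc_src K1 s W i =
     (if i \<le> main_length K1 s
      then let c = (i - 1) div bl s + 1 in cx s 1 c (pipeline K1 s (split s W) 1 c) ! ((i - 1) mod bl s)
      else xsrc s (i - main_length K1 s))"

definition snnc_rel ::
  "(nat \<Rightarrow> nat) \<Rightarrow> nat \<Rightarrow> ('x, 'y, 'z) sample pmf \<Rightarrow> ('x, 'y, 'z) scheme \<Rightarrow> nat \<Rightarrow> 'y list \<Rightarrow> 'x" where
  "snnc_rel \<pi> K1 P s k ys =
     (let c = length ys div bl s + 1; t = length ys mod bl s; DF = (k \<in> DF_relays \<pi> K1)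
      in if length ys < main_length K1 s
         then if DF
              then let m = inv \<pi> k;
                       w = (\<lambda>j. dfd s m j (take ((j + m - 2) * bl s) ys))
                   in cx s m c (pipeline K1 s w m c) ! t
              else qx s k c (qidx P s k ys (c - 1)) ! t
         else xrel s k (if DF then 1 else qidx P s k ys (blocks K1 s)) (drop (main_length K1 s) ys))"

text \<open>
  Backward decoding, where the relays outside \<open>Q\<close> are treated as noise.  After \<open>i\<close> steps the
  destination has processed the last \<open>i\<close> blocks and holds estimates of the quantization indices of the
  block before them and of the short messages decoded so far.  In block \<open>c\<close> it looks for the unique
  pair of a short message \<open>w\<^sub>c\<^sub>-\<^sub>K\<^sub>1\<^sub>+\<^sub>1\<close> and previous indices \<open>(l'\<^sub>k)\<close> that passes the typicality test.
\<close>

definition test_law ::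
  "('x, 'y) relay_channel \<Rightarrow> (nat \<Rightarrow> nat) \<Rightarrow> nat \<Rightarrow> nat set \<Rightarrow> ('x, 'y, 'z) sample pmf \<Rightarrow>
   ((nat \<Rightarrow> 'x) \<times> (nat \<Rightarrow> 'z) \<times> 'y) pmf" where
  "test_law Ch \<pi> K1 Q P =
     map_pmf (\<lambda>(x, y, z). (restrict x (\<pi> ` {1..K1} \<union> Q), restrict z Q, y (last_node Ch))) P"

definition test_seq ::
  "(nat \<Rightarrow> nat) \<Rightarrow> nat \<Rightarrow> nat set \<Rightarrow> ('x, 'y, 'z) scheme \<Rightarrow> 'y list \<Rightarrow> nat \<Rightarrow> (nat \<Rightarrow> nat) \<Rightarrow>
   (nat \<Rightarrow> nat) \<Rightarrow> (nat \<Rightarrow> nat) \<Rightarrow> ((nat \<Rightarrow> 'x) \<times> (nat \<Rightarrow> 'z) \<times> 'y) list" where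
  "test_seq \<pi> K1 Q s ys c w l l' =
     map (\<lambda>t.
       (\<lambda>k\<in>\<pi> ` {1..K1} \<union> Q. if k \<in> Q then qx s k c (l' k) ! t
                            else cx s (inv \<pi> k) c (pipeline K1 s w (inv \<pi> k) c) ! t,
        \<lambda>k\<in>Q. qz s k c (l k) (l' k) ! t,
        block (bl s) ys c ! t)) [0..<bl s]"

primrec backward ::
  "('x, 'y) relay_channel \<Rightarrow> (nat \<Rightarrow> nat) \<Rightarrow> nat \<Rightarrow> nat set \<Rightarrow> ('x, 'y, 'z) sample pmf \<Rightarrow>
   ('x, 'y, 'z) scheme \<Rightarrow> 'y list \<Rightarrow> nat \<Rightarrow> (nat \<Rightarrow> nat) \<times> (nat \<Rightarrow> nat)" where
  "backward Ch \<pi> K1 Q P s ys 0 =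
     (\<lambda>k\<in>Q. xdec s k (drop (main_length K1 s) ys), \<lambda>j. 1)"
| "backward Ch \<pi> K1 Q P s ys (Suc i) =
     (let (l, w) = backward Ch \<pi> K1 Q P s ys i;
          c = blocks K1 s - i;
          j = c + 1 - K1;
          good = {(v, l'). v \<in> {1..nmsg s} \<and> l' \<in> PiE Q (\<lambda>k. {1..nidx s k}) \<and>
            typical (dd s) (test_law Ch \<pi> K1 Q P) (test_seq \<pi> K1 Q s ys c (w(j := v)) l l')};
          (v, l') = (if \<exists>!g. g \<in> good then THE g. g \<in> good else (1, \<lambda>k\<in>Q. 1))
      in (l', w(j := v)))"

definition snnc_dec ::
  "('x, 'y) relay_channel \<Rightarrow> (nat \<Rightarrow> nat) \<Rightarrow> nat \<Rightarrow> nat set \<Rightarrow> ('x, 'y, 'z) sample pmf \<Rightarrow> nat \<Rightarrow>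
   ('x, 'y, 'z) scheme \<Rightarrow> 'y list \<Rightarrow> nat" where
  "snnc_dec Ch \<pi> K1 Q P M s ys =
     (let w = snd (backward Ch \<pi> K1 Q P s ys (nb s));
          hit = (\<lambda>W. W \<in> {1..M} \<and> (\<forall>j\<in>{1..nb s}. split s W j = w j))
      in if \<exists>W. hit W then THE W. hit W else 1)"

text \<open>
  At accuracy \<open>\<epsilon>\<close> there are at least \<open>1 / \<epsilon>\<close> short messages, the final phase takes at most a fraction
  \<open>\<epsilon>\<close> of the total length, and the typicality parameters are at most \<open>\<epsilon>\<close>.
\<close>

definition snnc_df_code ::
  "('x, 'y) relay_channel \<Rightarrow> (nat \<Rightarrow> nat) \<Rightarrow> nat \<Rightarrow> (nat \<Rightarrow> 'z set) \<Rightarrow> ('x, 'y, 'z) sample pmf \<Rightarrow>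
   real \<Rightarrow> nat \<Rightarrow> nat \<Rightarrow> ('x, 'y) code \<Rightarrow> bool" where
  "snnc_df_code Ch \<pi> K1 Z P \<epsilon> n M f \<longleftrightarrow>
     (\<exists>s :: ('x, 'y, 'z) scheme. \<exists>Q \<subseteq> QF_relays Ch \<pi> K1.
        valid_scheme Ch \<pi> K1 Z M s \<and>
        n = main_length K1 s + xl s \<and>
        1 \<le> \<epsilon> * real (nb s) \<and> real (xl s) \<le> \<epsilon> * real n \<and> dq s \<le> \<epsilon> \<and> dd s \<le> \<epsilon> \<and>
        f = \<lparr>src = snnc_src K1 s, rel = snnc_rel \<pi> K1 P s, dec = snnc_dec Ch \<pi> K1 Q P M s\<rparr>)"

definition snnc_df_achievable ::
  "('x, 'y) relay_channel \<Rightarrow> (nat \<Rightarrow> nat) \<Rightarrow> nat \<Rightarrow> (nat \<Rightarrow> 'z set) \<Rightarrow> ('x, 'y, 'z) sample pmf \<Rightarrow>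
   real \<Rightarrow> bool" where
  "snnc_df_achievable Ch \<pi> K1 Z P = achievable_within Ch (snnc_df_code Ch \<pi> K1 Z P)"

lemma snnc_df_achievable_imp_achievable:
  "snnc_df_achievable Ch \<pi> K1 Z P R \<Longrightarrow> achievable Ch R"
  unfolding snnc_df_achievable_def achievable_def achievable_within_def by meson

end

theory Submission
  imports Defs "HOL-Real_Asymp.Real_Asymp"
begin

text \<open>
  Let \<open>A\<close> be the source together with the decode-forward relays. First replace the set of quantize-forward
  relays that are not treated as noise by a suitable \<open>Q\<close>, for which all error exponents are positive. Then use
  random coding: superposition codebooks for \<open>A\<close>, and for each quantize-forward relay independent codewords
  and quantization codebooks drawn from \<open>P(z|x)\<close>. Codebooks and channel noise form one finite family of
  independent letters, so that the events of a block can be bounded after conditioning on the past of a genie-aided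
  transmission in which the decode-forward relays know the true short messages. As long as none of these events
  occurs, the genie-aided transmission is the actual one.

  A decode-forward relay compares with a threshold the product of likelihood ratios over the blocks in which a
  short message occurs; under a wrong message this product has mean at most 1, so Markov's inequality suffices.
  The destination fails only if the quantizers fail, if the true tuple is atypical, or if a wrong tuple passes
  the test. Each of these probabilities is exponentially small in the block length \<open>N\<close>, whereas the
  number of blocks and the length of the final phase are polynomial in \<open>N\<close>.
\<close>

section \<open>Discrete laws and independent coordinates\<close>

text \<open>Backward decoding must find a unique pair of a short message and an index tuple, so
  pairs in which only indices are wrong have to be excluded too. Their exponent is
  \<open>FA (Q - S) - FA Q\<close>, which the hypotheses do not control when \<open>Q\<close> is the
  set of all quantize-forward relays. For a minimizer \<open>Q\<close> of \<open>FA\<close> of least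
  size these differences are positive, and \<open>FA Q \<le> FA T2\<close> preserves the given
  bounds on \<open>R\<close>. The same inequalities show that no part of \<open>Q\<close> is cut off
  from the destination, so the last indices can be delivered. The selected quantization has no
  product law, since the selection reads the codebooks. A union bound over all index tuples takes
  its place; once the quantization rates cancel, it costs only the excess rates. These are chosen
  after the tolerance \<open>dd\<close> of the test, hence small against the exponent of the
  typicality tail. The final phase takes \<open>C * N ^ e\<close> channel uses. With
  \<open>N ^ Suc e\<close> short messages it is a vanishing fraction of the whole, and the number of
  blocks stays polynomial.\<close>

lemma prob_bind_pmf:
  "measure_pmf.prob (bind_pmf p f) X = measure_pmf.expectation p (\<lambda>a. measure_pmf.prob (f a) X)"
proof -
  have "ennreal (measure_pmf.prob (bind_pmf p f) X)
      = (\<integral>\<^sup>+ a. ennreal (measure_pmf.prob (f a) X) \<partial>measure_pmf p)"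
    unfolding measure_pmf.emeasure_eq_measure[symmetric] by (rule emeasure_bind_pmf)
  also have "\<dots> = ennreal (measure_pmf.expectation p (\<lambda>a. measure_pmf.prob (f a) X))"
    by (rule nn_integral_eq_integral) (auto intro: measure_pmf.integrable_const_bound[where B=1])
  finally have "ennreal (measure_pmf.prob (bind_pmf p f) X) = ennreal (measure_pmf.expectation p (\<lambda>a. measure_pmf.prob (f a) X))" .
  moreover have "0 \<le> measure_pmf.expectation p (\<lambda>a. measure_pmf.prob (f a) X)" by simp
  ultimately show ?thesis by (metis ennreal_inj measure_nonneg)
qed

lemma prob_bind_pmf_le:
  assumes "\<And>a. a \<in> set_pmf p \<Longrightarrow> measure_pmf.prob (f a) X \<le> \<beta>"
  shows "measure_pmf.prob (bind_pmf p f) X \<le> \<beta>"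
proof -
  have "measure_pmf.expectation p (\<lambda>a. measure_pmf.prob (f a) X) \<le> measure_pmf.expectation p (\<lambda>a. \<beta>)"
    using assms by (intro integral_mono_AE measure_pmf.integrable_const_bound[where B="max 1 \<bar>\<beta>\<bar>"] AE_pmfI)
      (auto simp: le_max_iff_disj)
  then show ?thesis by (simp add: prob_bind_pmf)
qed

lemma exists_prob_le:
  assumes "measure_pmf.prob (bind_pmf p f) X \<le> \<beta>"
  shows "\<exists>a\<in>set_pmf p. measure_pmf.prob (f a) X \<le> \<beta>"
proof (rule ccontr)
  assume "\<not> ?thesis"
  then have "\<beta> < measure_pmf.expectation p (\<lambda>a. measure_pmf.prob (f a) X)"
    by (intro measure_pmf.expectation_greater measure_pmf.integrable_const_bound[where B=1] AE_pmfI) auto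
  with assms show False by (simp add: prob_bind_pmf)
qed

lemma prob_change_of_measure:
  assumes "\<And>x. x \<in> E \<Longrightarrow> pmf q x \<le> \<gamma> * pmf p x" "0 \<le> \<gamma>"
  shows "measure_pmf.prob q E \<le> \<gamma> * measure_pmf.prob p E"
proof -
  have "emeasure q E = (\<integral>\<^sup>+x. pmf q x \<partial>count_space E)" by (rule nn_integral_pmf[symmetric])
  also have "\<dots> \<le> (\<integral>\<^sup>+x. \<gamma> * ennreal (pmf p x) \<partial>count_space E)"
    using assms by (intro nn_integral_mono) (auto simp: ennreal_mult[symmetric])
  also have "\<dots> = ennreal \<gamma> * emeasure (measure_pmf p) E" by (simp add: nn_integral_cmult nn_integral_pmf)
  finally show ?thesis
    using assms(2) by (simp add: measure_pmf.emeasure_eq_measure ennreal_mult[symmetric])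
qed

lemma prob_mono:
  assumes "\<And>x. x \<in> set_pmf p \<Longrightarrow> x \<in> A \<Longrightarrow> x \<in> B"
  shows "measure_pmf.prob p A \<le> measure_pmf.prob p B"
  using assms by (intro measure_pmf.finite_measure_mono_AE AE_pmfI) auto

lemma prob_Un_le: "measure_pmf.prob p (A \<union> B) \<le> measure_pmf.prob p A + measure_pmf.prob p B"
  by (rule measure_Un_le) auto

lemma prob_UN_le:
  assumes "finite J" "\<And>j. j \<in> J \<Longrightarrow> measure_pmf.prob p (A j) \<le> \<beta> j"
  shows "measure_pmf.prob p (\<Union>j\<in>J. A j) \<le> (\<Sum>j\<in>J. \<beta> j)"
proof -
  have "measure_pmf.prob p (\<Union>j\<in>J. A j) \<le> (\<Sum>j\<in>J. measure_pmf.prob p (A j))"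
    using assms by (intro measure_pmf.finite_measure_subadditive_finite) auto
  also have "\<dots> \<le> (\<Sum>j\<in>J. \<beta> j)" using assms by (intro sum_mono) auto
  finally show ?thesis .
qed

text \<open>Both laws have total mass 1, so agreement on the support of \<open>p\<close> leaves no
  mass of \<open>q\<close> outside it. This suits a density that is prescribed on finite alphabets
  only.\<close>

lemma pmf_eqI_set:
  assumes "\<And>x. x \<in> set_pmf p \<Longrightarrow> pmf p x = pmf q x"
  shows "p = q"
proof (rule pmf_eqI)
  fix x
  have "measure_pmf.prob q (set_pmf p) = measure_pmf.prob p (set_pmf p)"
  proof -
    have "emeasure q (set_pmf p) = (\<integral>\<^sup>+x. pmf q x \<partial>count_space (set_pmf p))" by (rule nn_integral_pmf[symmetric])
    also have "\<dots> = (\<integral>\<^sup>+x. pmf p x \<partial>count_space (set_pmf p))" using assms by (intro nn_integral_cong) auto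
    also have "\<dots> = emeasure p (set_pmf p)" by (rule nn_integral_pmf)
    finally show ?thesis by (simp add: measure_pmf.emeasure_eq_measure)
  qed
  also have "\<dots> = 1" by (simp add: measure_pmf.prob_eq_1 AE_measure_pmf)
  finally have "set_pmf q \<subseteq> set_pmf p"
    by (auto simp: measure_pmf.prob_eq_1 AE_measure_pmf_iff)
  with assms show "pmf p x = pmf q x" by (cases "x \<in> set_pmf p") (auto simp: set_pmf_iff subset_iff)
qed

text \<open>Measurability with respect to the coordinates in \<open>D\<close>, without
  sigma-algebras; \<open>D\<close> may be larger than what \<open>f\<close> reads.\<close>

definition depends_on :: "'i set \<Rightarrow> (('i \<Rightarrow> 'v) \<Rightarrow> 'b) \<Rightarrow> bool" where
  "depends_on D f \<longleftrightarrow> (\<forall>a b. (\<forall>i\<in>D. a i = b i) \<longrightarrow> f a = f b)"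

lemma depends_onI: "(\<And>a b. (\<And>i. i \<in> D \<Longrightarrow> a i = b i) \<Longrightarrow> f a = f b) \<Longrightarrow> depends_on D f"
  unfolding depends_on_def by blast

lemma depends_onD: "depends_on D f \<Longrightarrow> (\<And>i. i \<in> D \<Longrightarrow> a i = b i) \<Longrightarrow> f a = f b"
  unfolding depends_on_def by blast

text \<open>A product law splits into independent parts over \<open>I - D\<close> and
  \<open>I \<inter> D\<close>, and the second part may be drawn from another copy. This resampling
  makes conditioning on the coordinates outside \<open>D\<close> elementary.\<close>

lemma Pi_pmf_override:
  assumes "finite I"
  shows "map_pmf (\<lambda>(f, g). override_on f g D) (pair_pmf (Pi_pmf I d p) (Pi_pmf I d p)) = Pi_pmf I d p"
proof -
  have I: "I = (I - D) \<union> (I \<inter> D)" by auto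
  have "Pi_pmf I d p = map_pmf (\<lambda>(f,g) x. if x \<in> I - D then f x else g x)
      (pair_pmf (Pi_pmf (I - D) d p) (Pi_pmf (I \<inter> D) d p))"
    by (subst I, subst Pi_pmf_union) (use assms in auto)
  also have "Pi_pmf (I - D) d p = map_pmf (\<lambda>f x. if x \<in> I - D then f x else d) (Pi_pmf I d p)"
    by (rule Pi_pmf_subset) (use assms in auto)
  also have "Pi_pmf (I \<inter> D) d p = map_pmf (\<lambda>f x. if x \<in> I \<inter> D then f x else d) (Pi_pmf I d p)"
    by (rule Pi_pmf_subset) (use assms in auto)
  also have "map_pmf (\<lambda>(f,g) x. if x \<in> I - D then f x else g x)
      (pair_pmf (map_pmf (\<lambda>f x. if x \<in> I - D then f x else d) (Pi_pmf I d p))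
        (map_pmf (\<lambda>f x. if x \<in> I \<inter> D then f x else d) (Pi_pmf I d p)))
    = map_pmf (\<lambda>(f,g) x. if x \<in> I - D then f x else if x \<in> I \<inter> D then g x else d)
      (pair_pmf (Pi_pmf I d p) (Pi_pmf I d p))"
    unfolding map_pair[symmetric] pmf.map_comp by (simp only: o_def case_prod_unfold, rule map_pmf_cong, rule refl, simp add: fun_eq_iff)
  also have "\<dots> = map_pmf (\<lambda>(f, g). override_on f g D) (pair_pmf (Pi_pmf I d p) (Pi_pmf I d p))"
  proof (intro map_pmf_cong refl)
    fix h assume "h \<in> set_pmf (pair_pmf (Pi_pmf I d p) (Pi_pmf I d p))"
    moreover obtain f g where h: "h = (f, g)" by fastforce
    ultimately have fg: "\<And>x. x \<notin> I \<Longrightarrow> f x = d" "\<And>x. x \<notin> I \<Longrightarrow> g x = d"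
      using set_Pi_pmf_subset[OF assms, of d p] by auto
    show "(case h of (f, g) \<Rightarrow> \<lambda>x. if x \<in> I - D then f x else if x \<in> I \<inter> D then g x else d)
        = (case h of (f, g) \<Rightarrow> override_on f g D)"
      unfolding h prod.case by (rule ext) (simp add: override_on_def fg)
  qed
  finally show ?thesis by (rule sym)
qed

text \<open>After resampling on \<open>D\<close>, \<open>f\<close> sees only the old copy and
  \<open>g h\<close> only the new one, so the value of \<open>f\<close> can be frozen before
  \<open>g\<close> is evaluated. This handles adaptive choices: which coordinates of
  \<open>D\<close> are read may depend on \<open>f\<close>.\<close>

lemma Pi_pmf_disintegrate:
  assumes "finite I" "depends_on (- D) f" "\<And>h. depends_on D (g h)"
  shows "map_pmf (\<lambda>\<omega>. (f \<omega>, g (f \<omega>) \<omega>)) (Pi_pmf I d p)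
    = bind_pmf (map_pmf f (Pi_pmf I d p)) (\<lambda>h. map_pmf (\<lambda>\<omega>. (h, g h \<omega>)) (Pi_pmf I d p))"
proof -
  have f: "f (override_on a b D) = f a" for a b
    by (rule depends_onD[OF assms(2)]) auto
  have g: "g h (override_on a b D) = g h b" for a b h
    by (rule depends_onD[OF assms(3)]) auto
  show ?thesis
    by (subst Pi_pmf_override[OF assms(1), of D, symmetric])
      (simp only: map_pmf_def pair_pmf_def bind_assoc_pmf bind_return_pmf prod.case f g)
qed

lemma Pi_pmf_indep:
  assumes "finite I" "depends_on (- D) f" "depends_on D g"
  shows "map_pmf (\<lambda>\<omega>. (f \<omega>, g \<omega>)) (Pi_pmf I d p) = pair_pmf (map_pmf f (Pi_pmf I d p)) (map_pmf g (Pi_pmf I d p))"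
  by (subst Pi_pmf_disintegrate[OF assms(1,2), of "\<lambda>h. g"])
    (use assms in \<open>simp_all only: map_pmf_def pair_pmf_def bind_assoc_pmf bind_return_pmf\<close>)

text \<open>The form in which conditioning on the past is used: a bound for each frozen past
  \<open>f \<omega>\<close> carries over to the event in which past and fresh coordinates come from
  the same outcome.\<close>

lemma Pi_pmf_prob_cond_le:
  assumes "finite I" "depends_on (- D) f" "\<And>h. depends_on D (E h)"
    and "\<And>\<omega>. \<omega> \<in> set_pmf (Pi_pmf I d p) \<Longrightarrow> measure_pmf.prob (Pi_pmf I d p) {\<omega>'. E (f \<omega>) \<omega>'} \<le> \<beta>"
  shows "measure_pmf.prob (Pi_pmf I d p) {\<omega>. E (f \<omega>) \<omega>} \<le> \<beta>"
proof -
  have "measure_pmf.prob (Pi_pmf I d p) {\<omega>. E (f \<omega>) \<omega>}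
      = measure_pmf.prob (map_pmf (\<lambda>\<omega>. (f \<omega>, E (f \<omega>) \<omega>)) (Pi_pmf I d p)) {h. snd h}"
    by (simp add: vimage_def)
  also have "\<dots> \<le> \<beta>"
    unfolding Pi_pmf_disintegrate[OF assms(1,2), of "\<lambda>h \<omega>. E h \<omega>", OF assms(3)]
    by (rule prob_bind_pmf_le) (use assms(4) in \<open>auto simp: vimage_def\<close>)
  finally show ?thesis .
qed

text \<open>Disjoint sets of coordinates are split off one at a time by \<open>Pi_pmf_indep\<close>.
  Product laws over times, relays and codewords are obtained from it.\<close>

lemma Pi_pmf_parts:
  fixes p :: "'i \<Rightarrow> 'v pmf" and f :: "'t \<Rightarrow> ('i \<Rightarrow> 'v) \<Rightarrow> 'b"
  assumes "finite I" "finite J" "\<And>t. t \<in> J \<Longrightarrow> depends_on (D t) (f t)"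
    "\<And>s t. s \<in> J \<Longrightarrow> t \<in> J \<Longrightarrow> s \<noteq> t \<Longrightarrow> D s \<inter> D t = {}"
  shows "map_pmf (\<lambda>\<omega> t. if t \<in> J then f t \<omega> else u) (Pi_pmf I d p)
    = Pi_pmf J u (\<lambda>t. map_pmf (f t) (Pi_pmf I d p))"
  using assms(2-)
proof (induction J rule: finite_induct)
  case empty then show ?case by (simp add: map_pmf_const)
next
  case (insert j J)
  have "map_pmf (\<lambda>\<omega> t. if t \<in> insert j J then f t \<omega> else u) (Pi_pmf I d p)
    = map_pmf (\<lambda>(y, h). h(j := y)) (map_pmf (\<lambda>\<omega>. (f j \<omega>, \<lambda>t. if t \<in> J then f t \<omega> else u)) (Pi_pmf I d p))"
    by (auto simp: pmf.map_comp o_def fun_eq_iff intro!: map_pmf_cong)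
  also have "map_pmf (\<lambda>\<omega>. (f j \<omega>, \<lambda>t. if t \<in> J then f t \<omega> else u)) (Pi_pmf I d p)
    = pair_pmf (map_pmf (f j) (Pi_pmf I d p)) (map_pmf (\<lambda>\<omega> t. if t \<in> J then f t \<omega> else u) (Pi_pmf I d p))"
  proof (rule Pi_pmf_indep[OF assms(1), of "- D j"])
    show "depends_on (- (- D j)) (f j)" using insert.prems by simp
    show "depends_on (- D j) (\<lambda>\<omega> t. if t \<in> J then f t \<omega> else u)"
    proof (rule depends_onI)
      fix a b :: "'i \<Rightarrow> 'v" assume ab: "\<And>i. i \<in> - D j \<Longrightarrow> a i = b i"
      have "f t a = f t b" if "t \<in> J" for t
      proof -
        have "D j \<inter> D t = {}" using insert that by (metis insertCI)
        then have "\<And>i. i \<in> D t \<Longrightarrow> a i = b i" using ab by auto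
        moreover have "depends_on (D t) (f t)" using insert.prems that by simp
        ultimately show ?thesis unfolding depends_on_def by blast
      qed
      then show "(\<lambda>t. if t \<in> J then f t a else u) = (\<lambda>t. if t \<in> J then f t b else u)" by auto
    qed
  qed
  also have "map_pmf (\<lambda>\<omega> t. if t \<in> J then f t \<omega> else u) (Pi_pmf I d p)
     = Pi_pmf J u (\<lambda>t. map_pmf (f t) (Pi_pmf I d p))"
    by (rule insert.IH) (use insert.prems in auto)
  finally show ?case unfolding Pi_pmf_insert[OF insert(1,2)] .
qed

lemma Pi_pmf_select:
  assumes "finite I" "finite J" "inj_on i J" "i ` J \<subseteq> I"
  shows "map_pmf (\<lambda>\<omega> t. if t \<in> J then \<omega> (i t) else u) (Pi_pmf I d p) = Pi_pmf J u (\<lambda>t. p (i t))"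
proof -
  have "map_pmf (\<lambda>\<omega> t. if t \<in> J then \<omega> (i t) else u) (Pi_pmf I d p)
     = Pi_pmf J u (\<lambda>t. map_pmf (\<lambda>\<omega>. \<omega> (i t)) (Pi_pmf I d p))"
  proof (rule Pi_pmf_parts[OF assms(1,2), where D="\<lambda>t. {i t}"])
    show "depends_on {i t} (\<lambda>\<omega>. \<omega> (i t))" for t by (rule depends_onI) simp
    show "{i s} \<inter> {i t} = {}" if "s \<in> J" "t \<in> J" "s \<noteq> t" for s t
      using inj_onD[OF assms(3) _ that(1,2)] that(3) by blast
  qed
  also have "\<dots> = Pi_pmf J u (\<lambda>t. p (i t))"
    using assms(4) by (intro Pi_pmf_cong refl) (simp add: Pi_pmf_component[OF assms(1)] image_subset_iff)
  finally show ?thesis .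
qed

lemma expectation_indicator_mult:
  "measure_pmf.expectation p (\<lambda>b. indicator {a} b * (c :: real)) = pmf p a * c"
proof -
  have "measure_pmf.expectation p (\<lambda>b. indicator {a} b * c) = measure_pmf.expectation p (indicator {a}) * c"
    by (rule integral_mult_left_zero)
  also have "measure_pmf.expectation p (indicator {a}) = pmf p a"
    by (simp add: measure_pmf_single)
  finally show ?thesis .
qed

lemma pmf_bind_map_Pair: "pmf (bind_pmf p (\<lambda>a. map_pmf (Pair a) (k a))) (a, b) = pmf p a * pmf (k a) b"
proof -
  have "pmf (map_pmf (Pair a') (k a')) (a, b) = indicator {a} a' * pmf (k a) b" for a'
  proof (cases "a' = a")
    case True then show ?thesis by (simp add: pmf_map_inj' inj_def)
  next
    case False
    then have "(a, b) \<notin> set_pmf (map_pmf (Pair a') (k a'))" by auto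
    with False show ?thesis by (simp add: pmf_eq_0_set_pmf)
  qed
  then show ?thesis by (simp only: pmf_bind expectation_indicator_mult)
qed

text \<open>Supplies the conditional laws behind \<open>next_law\<close> and \<open>pzx\<close>;
  \<open>cond_pmf\<close> is evaluated only on fibers of positive mass.\<close>

lemma pmf_disintegrate:
  "p = bind_pmf (map_pmf f p) (\<lambda>b. cond_pmf p {a. f a = b})"
proof (rule pmf_eqI)
  fix a
  have "pmf (cond_pmf p {a'. f a' = b}) a = indicator {f a} b * (pmf p a / pmf (map_pmf f p) (f a))"
    if b: "b \<in> set_pmf (map_pmf f p)" for b
    using b by (subst pmf_cond) (auto simp: pmf_map vimage_def indicator_def)
  then have "pmf (bind_pmf (map_pmf f p) (\<lambda>b. cond_pmf p {a. f a = b})) a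
      = measure_pmf.expectation (map_pmf f p) (\<lambda>b. indicator {f a} b * (pmf p a / pmf (map_pmf f p) (f a)))"
    unfolding pmf_bind by (intro integral_cong_AE) (auto simp: AE_measure_pmf_iff)
  also have "\<dots> = pmf (map_pmf f p) (f a) * (pmf p a / pmf (map_pmf f p) (f a))"
    by (rule expectation_indicator_mult)
  also have "\<dots> = pmf p a"
    by (cases "a \<in> set_pmf p") (auto simp: set_pmf_iff[of "f a"] pmf_eq_0_set_pmf)
  finally show "pmf p a = pmf (bind_pmf (map_pmf f p) (\<lambda>b. cond_pmf p {a. f a = b})) a" by (rule sym)
qed

section \<open>Robust typicality\<close>

text \<open>Sequences are functions with value \<open>undefined\<close> from \<open>N\<close> on,
  the format of \<open>Pi_pmf\<close>; \<open>map s [0..<N]\<close> turns them into the lists that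
  \<open>typical\<close> expects.\<close>

definition iid :: "nat \<Rightarrow> 'a pmf \<Rightarrow> (nat \<Rightarrow> 'a) pmf" where
  "iid N p = Pi_pmf {..<N} undefined (\<lambda>_. p)"

definition mean :: "'a pmf \<Rightarrow> ('a \<Rightarrow> real) \<Rightarrow> real" where
  "mean p f = (\<Sum>a\<in>set_pmf p. pmf p a * f a)"

lemma mean_add: "mean p (\<lambda>a. f a + g a) = mean p f + mean p g"
  by (simp add: mean_def algebra_simps sum.distrib)

lemma mean_diff: "mean p (\<lambda>a. f a - g a) = mean p f - mean p g"
  by (simp add: mean_def algebra_simps sum_subtractf)

lemma mean_sum: "mean p (\<lambda>a. \<Sum>k\<in>S. f k a) = (\<Sum>k\<in>S. mean p (f k))"
  unfolding mean_def sum_distrib_left by (rule sum.swap)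

lemma mean_cong: "(\<And>a. a \<in> set_pmf p \<Longrightarrow> f a = g a) \<Longrightarrow> mean p f = mean p g"
  unfolding mean_def by (rule sum.cong) auto

lemma mean_nonneg: "(\<And>a. a \<in> set_pmf p \<Longrightarrow> 0 \<le> f a) \<Longrightarrow> 0 \<le> mean p f"
  unfolding mean_def by (rule sum_nonneg) auto

lemma expectation_eq_mean:
  assumes "finite (set_pmf p)"
  shows "measure_pmf.expectation p f = mean p f"
proof -
  have "measure_pmf.expectation p f = (\<Sum>a\<in>set_pmf p. f a * pmf p a)"
    by (rule integral_measure_pmf_real[OF assms]) simp
  then show ?thesis by (simp only: mean_def mult.commute)
qed

lemma mean_map:
  assumes "finite (set_pmf p)"
  shows "mean (map_pmf g p) f = mean p (\<lambda>a. f (g a))"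
  using expectation_eq_mean[of "map_pmf g p" f] expectation_eq_mean[OF assms, of "\<lambda>a. f (g a)"] assms
  by simp

lemma count_list_map_upt: "count_list (map s [0..<N]) a = card {t\<in>{..<N}. s t = a}"
proof -
  have "count_list (map s [0..<N]) a = length (filter (\<lambda>t. s t = a) [0..<N])"
    by (induction N) auto
  also have "\<dots> = card (set (filter (\<lambda>t. s t = a) [0..<N]))"
    by (intro distinct_card[symmetric]) simp
  also have "set (filter (\<lambda>t. s t = a) [0..<N]) = {t\<in>{..<N}. s t = a}" by auto
  finally show ?thesis .
qed

text \<open>The deviation allowed by robust typicality is proportional to the probability, so
  letters of probability zero cannot occur. Hence logarithms of likelihood ratios are finite along
  typical sequences.\<close>

lemma typical_in_set:
  assumes "typical \<delta> p (map s [0..<N])" "t < N"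
  shows "s t \<in> set_pmf p"
proof (rule ccontr)
  assume "s t \<notin> set_pmf p"
  then have "pmf p (s t) = 0" by (simp add: set_pmf_iff)
  with assms(1)[unfolded typical_def, rule_format, of "s t"] \<open>t < N\<close>
  have "count_list (map s [0..<N]) (s t) = 0" by (simp add: divide_le_0_iff)
  then show False using assms(2) by (auto simp: count_list_0_iff)
qed

text \<open>Grouping the sum over time by letters makes the error linear in the deviations of the
  frequencies. Each of these is relative to \<open>pmf p a\<close>, hence the mean of the absolute
  value on the right.\<close>

lemma typical_sum:
  assumes "typical \<delta> p (map s [0..<N])" "finite (set_pmf p)"
  shows "\<bar>(\<Sum>t<N. f (s t)) - real N * mean p f\<bar> \<le> real N * (\<delta> * mean p (\<lambda>a. \<bar>f a\<bar>))"
proof -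
  let ?c = "\<lambda>a. real (count_list (map s [0..<N]) a)"
  have "(\<Sum>t<N. f (s t)) = (\<Sum>a\<in>set_pmf p. \<Sum>t\<in>{t\<in>{..<N}. s t = a}. f (s t))"
    by (rule sum.group[symmetric]) (use assms typical_in_set[OF assms(1)] in auto)
  also have "\<dots> = (\<Sum>a\<in>set_pmf p. ?c a * f a)"
    unfolding count_list_map_upt by (intro sum.cong refl) simp
  finally have "(\<Sum>t<N. f (s t)) - real N * mean p f = (\<Sum>a\<in>set_pmf p. (?c a - real N * pmf p a) * f a)"
    unfolding mean_def by (simp add: algebra_simps sum_subtractf sum_distrib_left)
  also have "\<bar>\<dots>\<bar> \<le> (\<Sum>a\<in>set_pmf p. \<bar>(?c a - real N * pmf p a) * f a\<bar>)"
    by (rule sum_abs)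
  also have "\<dots> \<le> (\<Sum>a\<in>set_pmf p. real N * (\<delta> * (pmf p a * \<bar>f a\<bar>)))"
  proof (rule sum_mono)
    fix a
    have "\<bar>?c a - real N * pmf p a\<bar> \<le> real N * (\<delta> * pmf p a)"
    proof (cases "N = 0")
      case False
      have "?c a - real N * pmf p a = real N * (?c a / real N - pmf p a)"
        using False by (simp add: field_simps)
      then have "\<bar>?c a - real N * pmf p a\<bar> = real N * \<bar>?c a / real N - pmf p a\<bar>"
        by (simp add: abs_mult)
      also have "\<dots> \<le> real N * (\<delta> * pmf p a)"
        using assms(1)[unfolded typical_def, rule_format, of a] by (intro mult_left_mono) auto
      finally show ?thesis .
    qed simp
    from mult_right_mono[OF this, of "\<bar>f a\<bar>"]
    show "\<bar>(?c a - real N * pmf p a) * f a\<bar> \<le> real N * (\<delta> * (pmf p a * \<bar>f a\<bar>))"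
      by (simp add: abs_mult mult_ac)
  qed
  also have "\<dots> = real N * (\<delta> * mean p (\<lambda>a. \<bar>f a\<bar>))"
    by (simp add: mean_def sum_distrib_left)
  finally show ?thesis .
qed

text \<open>The averaging bound, applied to \<open>log 2 (r a)\<close>. The lower bound serves the
  threshold tests; both bounds serve the change of measure between quantization kernels.\<close>

lemma typical_prod:
  fixes r :: "'a \<Rightarrow> real"
  assumes "typical \<delta> p (map s [0..<N])" "finite (set_pmf p)" "\<And>a. a \<in> set_pmf p \<Longrightarrow> r a > 0"
  shows "2 powr (real N * (mean p (\<lambda>a. log 2 (r a)) - \<delta> * mean p (\<lambda>a. \<bar>log 2 (r a)\<bar>))) \<le> (\<Prod>t<N. r (s t))" (is ?A)
    and "(\<Prod>t<N. r (s t)) \<le> 2 powr (real N * (mean p (\<lambda>a. log 2 (r a)) + \<delta> * mean p (\<lambda>a. \<bar>log 2 (r a)\<bar>)))" (is ?B)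
proof -
  have "(\<Prod>t<N. r (s t)) = (\<Prod>t<N. 2 powr log 2 (r (s t)))"
    using assms(3) typical_in_set[OF assms(1)] by (intro prod.cong) auto
  also have "\<dots> = 2 powr (\<Sum>t<N. log 2 (r (s t)))"
    by (rule powr_sum[symmetric]) simp
  finally have eq: "(\<Prod>t<N. r (s t)) = 2 powr (\<Sum>t<N. log 2 (r (s t)))" .
  have "real N * (mean p (\<lambda>a. log 2 (r a)) - \<delta> * mean p (\<lambda>a. \<bar>log 2 (r a)\<bar>)) \<le> (\<Sum>t<N. log 2 (r (s t)))"
    "(\<Sum>t<N. log 2 (r (s t))) \<le> real N * (mean p (\<lambda>a. log 2 (r a)) + \<delta> * mean p (\<lambda>a. \<bar>log 2 (r a)\<bar>))"
    using typical_sum[OF assms(1,2), of "\<lambda>a. log 2 (r a)"] unfolding abs_le_iff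
    by (simp_all add: algebra_simps)
  then show ?A ?B
    unfolding eq by (simp_all add: powr_mono)
qed

lemma map_pmf_eq_bernoulli: "map_pmf (\<lambda>x. x = a) p = bernoulli_pmf (pmf p a)"
proof (rule pmf_eqI)
  fix b :: bool
  have "pmf (map_pmf (\<lambda>x. x = a) p) True = pmf p a"
    by (simp add: pmf_map vimage_def measure_pmf_single)
  moreover have "pmf (map_pmf (\<lambda>x. x = a) p) False = 1 - pmf p a"
  proof -
    have "(\<lambda>x. x = a) -` {False} = UNIV - {a}" by auto
    then show ?thesis
      using measure_pmf.prob_compl[of "{a}" p] by (simp add: pmf_map measure_pmf_single)
  qed
  ultimately show "pmf (map_pmf (\<lambda>x. x = a) p) b = pmf (bernoulli_pmf (pmf p a)) b"
    by (cases b) (simp_all add: pmf_le_1)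
qed

lemma iid_count: "map_pmf (\<lambda>s. card {t\<in>{..<N}. s t = a}) (iid N p) = binomial_pmf N (pmf p a)"
proof -
  have "binomial_pmf N (pmf p a)
      = map_pmf (\<lambda>f. card {t\<in>{..<N}. f t}) (Pi_pmf {..<N} (undefined = a) (\<lambda>_. map_pmf (\<lambda>x. x = a) p))"
    unfolding map_pmf_eq_bernoulli by (rule binomial_pmf_altdef') (auto simp: pmf_le_1)
  also have "Pi_pmf {..<N} (undefined = a) (\<lambda>_. map_pmf (\<lambda>x. x = a) p) = map_pmf (\<lambda>h. (\<lambda>x. x = a) \<circ> h) (iid N p)"
    unfolding iid_def by (rule Pi_pmf_map) auto
  finally show ?thesis by (simp add: pmf.map_comp o_def)
qed

lemma set_iid: "s \<in> set_pmf (iid N p) \<Longrightarrow> t < N \<Longrightarrow> s t \<in> set_pmf p"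
  unfolding iid_def by (subst (asm) set_Pi_pmf) (auto simp: PiE_dflt_def)

text \<open>Hoeffding's inequality for the count of each letter of the support, with the common
  tolerance \<open>\<delta> * m\<close>, where \<open>m\<close> is the least positive probability.
  Letters outside the support almost surely do not occur.\<close>

lemma typical_tail:
  assumes "finite (set_pmf p)" "\<delta> > 0"
  shows "\<exists>c>0. \<exists>C>0. \<forall>N. measure_pmf.prob (iid N p) {s. \<not> typical \<delta> p (map s [0..<N])} \<le> C * exp (- c * real N)"
proof -
  define m where "m = Min (pmf p ` set_pmf p)"
  have m: "m > 0" "\<And>a. a \<in> set_pmf p \<Longrightarrow> m \<le> pmf p a"
    using assms(1) by (auto simp: m_def set_pmf_not_empty pmf_positive)
  define c where "c = 2 * (\<delta> * m)\<^sup>2"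
  define C where "C = (\<Sum>a\<in>set_pmf p. 2 :: real)"
  have card: "real (card (set_pmf p)) \<ge> 1"
    using assms(1) set_pmf_not_empty[of p] by (simp add: Suc_le_eq card_gt_0_iff)
  have "measure_pmf.prob (iid N p) {s. \<not> typical \<delta> p (map s [0..<N])} \<le> C * exp (- c * real N)" for N
  proof (cases "N = 0")
    case True
    have "measure_pmf.prob (iid N p) {s. \<not> typical \<delta> p (map s [0..<N])} \<le> 1" by simp
    also have "1 \<le> C * exp (- c * real N)" using True card by (simp add: C_def)
    finally show ?thesis .
  next
    case False
    have "measure_pmf.prob (iid N p) {s. \<not> typical \<delta> p (map s [0..<N])}
        \<le> measure_pmf.prob (iid N p) (\<Union>a\<in>set_pmf p.
            {s. \<delta> * m \<le> \<bar>real (card {t\<in>{..<N}. s t = a}) / real N - pmf p a\<bar>})"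
    proof (rule prob_mono)
      fix s assume s: "s \<in> set_pmf (iid N p)" "s \<in> {s. \<not> typical \<delta> p (map s [0..<N])}"
      then obtain a where a: "\<not> \<bar>real (card {t\<in>{..<N}. s t = a}) / real N - pmf p a\<bar> \<le> \<delta> * pmf p a"
        unfolding typical_def count_list_map_upt by auto
      have "a \<in> set_pmf p"
      proof (rule ccontr)
        assume na: "a \<notin> set_pmf p"
        then have "{t\<in>{..<N}. s t = a} = {}" using set_iid[OF s(1)] by auto
        with a na show False by (simp add: set_pmf_iff del: Collect_empty_eq)
      qed
      moreover from m(2)[OF this] have "\<delta> * m \<le> \<delta> * pmf p a" using assms(2) by simp
      ultimately show "s \<in> (\<Union>a\<in>set_pmf p.
            {s. \<delta> * m \<le> \<bar>real (card {t\<in>{..<N}. s t = a}) / real N - pmf p a\<bar>})"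
        using a by force
    qed
    also have "\<dots> \<le> (\<Sum>a\<in>set_pmf p. 2 * exp (- 2 * real N * (\<delta> * m)\<^sup>2))"
    proof (rule prob_UN_le[OF assms(1)])
      fix a
      interpret binomial_distribution N "pmf p a" by standard (auto simp: pmf_le_1)
      have "measure_pmf.prob (iid N p) {s. \<delta> * m \<le> \<bar>real (card {t\<in>{..<N}. s t = a}) / real N - pmf p a\<bar>}
        = measure_pmf.prob (binomial_pmf N (pmf p a)) {x. \<bar>real x / real N - pmf p a\<bar> \<ge> \<delta> * m}"
        unfolding iid_count[symmetric] by (simp add: vimage_def)
      also have "\<dots> \<le> 2 * exp (- 2 * real N * (\<delta> * m)\<^sup>2)"
        using prob_abs_ge'[of "\<delta> * m"] assms(2) m(1) False by simp
      finally show "measure_pmf.prob (iid N p) {s. \<delta> * m \<le> \<bar>real (card {t\<in>{..<N}. s t = a}) / real N - pmf p a\<bar>}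
          \<le> 2 * exp (- 2 * real N * (\<delta> * m)\<^sup>2)" .
    qed
    also have "\<dots> = C * exp (- c * real N)" by (simp add: C_def c_def)
    finally show ?thesis .
  qed
  moreover have "c > 0" "C > 0" using m assms(2) card by (auto simp: c_def C_def)
  ultimately show ?thesis by blast
qed

text \<open>Markov's inequality, with the mean of the product factored by independence. Applied to
  likelihood ratios, it takes the place of counting typical sequences.\<close>

lemma prob_prod_ge_le:
  fixes r :: "'j \<Rightarrow> 'a \<Rightarrow> real"
  assumes "finite J" "\<And>j a. 0 \<le> r j a" "c > 0"
    and "\<And>j. j \<in> J \<Longrightarrow> (\<integral>\<^sup>+a. ennreal (r j a) \<partial>measure_pmf (q j)) \<le> 1"
  shows "measure_pmf.prob (Pi_pmf J u q) {h. c \<le> (\<Prod>j\<in>J. r j (h j))} \<le> 1 / c"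
proof -
  let ?g = "\<lambda>h. \<Prod>j\<in>J. ennreal (r j (h j))"
  have "emeasure (Pi_pmf J u q) {h. c \<le> (\<Prod>j\<in>J. r j (h j))}
      \<le> emeasure (Pi_pmf J u q) ({h\<in>UNIV. 1 \<le> ennreal (1 / c) * ?g h} \<inter> UNIV)"
  proof (intro emeasure_mono subsetI)
    fix h assume "h \<in> {h. c \<le> (\<Prod>j\<in>J. r j (h j))}"
    then have "1 \<le> 1 / c * (\<Prod>j\<in>J. r j (h j))" using assms(3) by (simp add: field_simps)
    then have "ennreal 1 \<le> ennreal (1 / c * (\<Prod>j\<in>J. r j (h j)))" by (rule ennreal_leI)
    also have "\<dots> = ennreal (1 / c) * ?g h"
      using assms by (subst ennreal_mult) (auto intro!: prod_nonneg simp: prod_ennreal)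
    finally show "h \<in> {h\<in>UNIV. 1 \<le> ennreal (1 / c) * ?g h} \<inter> UNIV" by simp
  qed simp
  also have "\<dots> \<le> ennreal (1 / c) * (\<integral>\<^sup>+h. ?g h * indicator UNIV h \<partial>Pi_pmf J u q)"
    by (subst Int_UNIV_right, rule nn_integral_Markov_inequality) auto
  also have "(\<integral>\<^sup>+h. ?g h * indicator UNIV h \<partial>Pi_pmf J u q) = (\<Prod>j\<in>J. \<integral>\<^sup>+a. ennreal (r j a) \<partial>measure_pmf (q j))"
    unfolding indicator_UNIV mult_1_right by (rule nn_integral_prod_Pi_pmf[OF assms(1)])
  also have "ennreal (1 / c) * \<dots> \<le> ennreal (1 / c) * 1"
    using assms(4) by (intro mult_left_mono prod_le_1) auto
  finally show ?thesis
    using assms(3) by (simp add: measure_pmf.emeasure_eq_measure)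
qed

section \<open>Entropies of a finitely supported law\<close>

text \<open>Log-likelihood of the observed value of \<open>f\<close>; minus its mean is the entropy
  in bits. Keeping it pointwise lets entropy identities be proved by adding logarithms sample by
  sample.\<close>

definition lg :: "'a pmf \<Rightarrow> ('a \<Rightarrow> 'b) \<Rightarrow> 'a \<Rightarrow> real" where
  "lg P f \<omega> = log 2 (pmf (map_pmf f P) (f \<omega>))"

definition ent :: "'a pmf \<Rightarrow> ('a \<Rightarrow> 'b) \<Rightarrow> real" where
  "ent P f = - mean P (lg P f)"

lemma pmf_map_pos: "\<omega> \<in> set_pmf P \<Longrightarrow> 0 < pmf (map_pmf f P) (f \<omega>)"
  by (rule pmf_positive) auto

lemma simple_function_supp:
  assumes "finite (set_pmf P)"
  shows "simple_function (supp_space P) X"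
proof -
  have "sets (supp_space P) = Pow (set_pmf P)"
    unfolding supp_space_def by (auto simp: sets_restrict_space)
  then show ?thesis using assms unfolding simple_function_def by auto
qed

lemma simple_distributed_supp:
  assumes "finite (set_pmf P)"
  shows "simple_distributed (supp_space P) X (pmf (map_pmf X P))"
proof -
  interpret information_space "supp_space P" 2 by (rule information_space_supp)
  show ?thesis
  proof (rule simple_distributedI)
    show "simple_function (supp_space P) X" by (rule simple_function_supp[OF assms])
    fix x
    have "measure (supp_space P) (X -` {x} \<inter> space (supp_space P)) = measure_pmf.prob P (X -` {x} \<inter> set_pmf P)"
      unfolding space_supp_space unfolding supp_space_def by (rule measure_restrict_space) auto
    also have "\<dots> = pmf (map_pmf X P) x"
      unfolding pmf_map by (rule measure_prob_cong_0) (auto simp: set_pmf_iff)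
    finally show "pmf (map_pmf X P) x = prob (X -` {x} \<inter> space (supp_space P))" by simp
  qed auto
qed

lemma cmi_nonneg: "finite (set_pmf P) \<Longrightarrow> 0 \<le> cmi P A B C"
proof -
  assume fin: "finite (set_pmf P)"
  interpret information_space "supp_space P" 2 by (rule information_space_supp)
  show ?thesis
    using conditional_mutual_information_nonneg[OF simple_function_supp[OF fin, of A]
        simple_function_supp[OF fin, of B] simple_function_supp[OF fin, of C]]
    unfolding cmi_def by simp
qed

text \<open>Turns every information quantity of the theorem into four entropies, so that the later
  identities are linear.\<close>

lemma cmi_eq:
  assumes fin: "finite (set_pmf P)"
  shows "cmi P A B C = ent P (\<lambda>\<omega>. (A \<omega>, C \<omega>)) + ent P (\<lambda>\<omega>. (B \<omega>, C \<omega>)) - ent P C - ent P (\<lambda>\<omega>. (A \<omega>, B \<omega>, C \<omega>))"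
proof -
  interpret information_space "supp_space P" 2 by (rule information_space_supp)
  note sd = simple_distributed_supp[OF fin]
  let ?g = "\<lambda>(a, b, c). log 2 (pmf (map_pmf (\<lambda>\<omega>. (A \<omega>, B \<omega>, C \<omega>)) P) (a, b, c) /
     (pmf (map_pmf (\<lambda>\<omega>. (A \<omega>, C \<omega>)) P) (a, c) * (pmf (map_pmf (\<lambda>\<omega>. (B \<omega>, C \<omega>)) P) (b, c) / pmf (map_pmf C P) c)))"
  have "cmi P A B C = mean (map_pmf (\<lambda>\<omega>. (A \<omega>, B \<omega>, C \<omega>)) P) ?g"
    unfolding mean_def cmi_def using conditional_mutual_information_eq[OF sd sd sd sd, of A B C]
    by (simp add: case_prod_unfold)
  also have "\<dots> = mean P (\<lambda>\<omega>. ?g (A \<omega>, B \<omega>, C \<omega>))"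
    by (rule mean_map[OF fin])
  also have "\<dots> = mean P (\<lambda>\<omega>. lg P (\<lambda>\<omega>. (A \<omega>, B \<omega>, C \<omega>)) \<omega> - lg P (\<lambda>\<omega>. (A \<omega>, C \<omega>)) \<omega>
      - (lg P (\<lambda>\<omega>. (B \<omega>, C \<omega>)) \<omega> - lg P C \<omega>))"
  proof (rule mean_cong)
    fix \<omega> assume \<omega>: "\<omega> \<in> set_pmf P"
    note pos = pmf_map_pos[OF \<omega>]
    show "?g (A \<omega>, B \<omega>, C \<omega>) = lg P (\<lambda>\<omega>. (A \<omega>, B \<omega>, C \<omega>)) \<omega> - lg P (\<lambda>\<omega>. (A \<omega>, C \<omega>)) \<omega>
      - (lg P (\<lambda>\<omega>. (B \<omega>, C \<omega>)) \<omega> - lg P C \<omega>)"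
      using pos[of C] pos[of "\<lambda>\<omega>. (A \<omega>, C \<omega>)"] pos[of "\<lambda>\<omega>. (B \<omega>, C \<omega>)"] pos[of "\<lambda>\<omega>. (A \<omega>, B \<omega>, C \<omega>)"]
      by (simp add: lg_def log_divide log_mult)
  qed
  finally show ?thesis by (simp add: ent_def mean_diff)
qed

lemma prob_fiber_cong:
  assumes "\<And>\<omega>'. \<omega>' \<in> set_pmf P \<Longrightarrow> f \<omega>' = f \<omega> \<longleftrightarrow> g \<omega>' = g \<omega>"
  shows "pmf (map_pmf f P) (f \<omega>) = pmf (map_pmf g P) (g \<omega>)"
  unfolding pmf_map by (rule measure_prob_cong_0) (use assms in \<open>auto simp: set_pmf_iff\<close>)

lemma lg_cong:
  assumes "\<And>\<omega>'. \<omega>' \<in> set_pmf P \<Longrightarrow> f \<omega>' = f \<omega> \<longleftrightarrow> g \<omega>' = g \<omega>"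
  shows "lg P f \<omega> = lg P g \<omega>"
proof -
  have "pmf (map_pmf f P) (f \<omega>) = pmf (map_pmf g P) (g \<omega>)" by (rule prob_fiber_cong) (rule assms)
  then show ?thesis unfolding lg_def by (rule arg_cong)
qed

text \<open>Entropy depends only on the partition that \<open>f\<close> induces on the support, so
  tuples may be regrouped or merged by comparing fibers.\<close>

lemma ent_cong:
  assumes "\<And>\<omega> \<omega>'. \<omega> \<in> set_pmf P \<Longrightarrow> \<omega>' \<in> set_pmf P \<Longrightarrow> f \<omega>' = f \<omega> \<longleftrightarrow> g \<omega>' = g \<omega>"
  shows "ent P f = ent P g"
proof -
  have "mean P (lg P f) = mean P (lg P g)" by (intro mean_cong lg_cong assms)
  then show ?thesis unfolding ent_def by simp
qed

section \<open>The joint law\<close>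

text \<open>The factors of the joint law become parameters. The factorization constrains them on the
  alphabets only; that their supports lie there is derived in \<open>set_p1\<close> and
  \<open>set_px\<close>.\<close>

locale relay_law =
  fixes Ch :: "('x, 'y) relay_channel" and \<pi> :: "nat \<Rightarrow> nat" and K1 :: nat
    and Z :: "nat \<Rightarrow> 'z set" and P :: "('x, 'y, 'z) sample pmf"
    and p1 :: "(nat \<Rightarrow> 'x) pmf" and px :: "nat \<Rightarrow> 'x pmf" and pz :: "nat \<Rightarrow> 'y \<Rightarrow> 'x \<Rightarrow> 'z pmf"
  assumes channel: "relay_channel Ch"
    and perm: "\<pi> permutes {1..last_node Ch}" "\<pi> 1 = 1" "\<pi> (last_node Ch) = last_node Ch"
    and K1: "1 \<le> K1" "K1 \<le> last_node Ch - 1"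
    and finite_Z: "\<And>k. k \<in> QF_relays Ch \<pi> K1 \<Longrightarrow> finite (Z k)"
    and supp: "set_pmf P \<subseteq> PiE (senders Ch) (inp Ch) \<times> PiE (receivers Ch) (outp Ch) \<times> PiE (QF_relays Ch \<pi> K1) Z"
    and fac: "\<And>x y z. x \<in> PiE (senders Ch) (inp Ch) \<Longrightarrow> y \<in> PiE (receivers Ch) (outp Ch) \<Longrightarrow>
      z \<in> PiE (QF_relays Ch \<pi> K1) Z \<Longrightarrow>
      pmf P (x, y, z) = pmf p1 (restrict x ({1} \<union> DF_relays \<pi> K1)) *
        (\<Prod>k\<in>QF_relays Ch \<pi> K1. pmf (px k) (x k) * pmf (pz k (y k) (x k)) (z k)) * pmf (law Ch x) y"
begin

abbreviation "K \<equiv> last_node Ch"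
abbreviation "T2 \<equiv> QF_relays Ch \<pi> K1"
abbreviation "XX \<equiv> PiE (senders Ch) (inp Ch)"
abbreviation "YY \<equiv> PiE (receivers Ch) (outp Ch)"

definition A :: "nat set" where "A = \<pi> ` {1..K1}"

lemma K2: "2 \<le> K" using channel by (simp add: relay_channel_def)

lemma inj_pi: "inj \<pi>" using perm(1) by (rule permutes_inj)

lemma inv_pi [simp]: "inv \<pi> (\<pi> m) = m" using inj_pi by (rule inv_f_f)

lemma A_eq: "A = {1} \<union> DF_relays \<pi> K1"
proof -
  have "{1..K1} = insert 1 {2..K1}" using K1 by auto
  then show ?thesis unfolding A_def DF_relays_def by (simp only: image_insert perm(2) insert_is_Un[symmetric])
qed

lemma finite_A [simp]: "finite A" by (simp add: A_def)

lemma A_senders: "A \<subseteq> senders Ch"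
proof
  fix k assume "k \<in> A"
  then obtain m where m: "k = \<pi> m" "1 \<le> m" "m \<le> K1" by (auto simp: A_def)
  have "m \<in> {1..K}" using m K1 by auto
  then have "\<pi> m \<in> {1..K}" using perm(1) by (simp only: permutes_in_image)
  moreover have "\<pi> m \<noteq> K"
  proof
    assume "\<pi> m = K"
    then have "\<pi> m = \<pi> K" using perm(3) by simp
    then have "m = K" using inj_pi by (simp add: inj_eq)
    then show False using m K1 K2 by simp
  qed
  ultimately show "k \<in> senders Ch" using m by (auto simp: senders_def)
qed

lemma T2_eq: "T2 = senders Ch - A"
  using K2 unfolding A_eq QF_relays_def relays_def senders_def by auto

lemma senders_eq: "senders Ch = A \<union> T2" and A_T2: "A \<inter> T2 = {}"
  using A_senders by (auto simp: T2_eq)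

lemma one_A: "1 \<in> A" by (simp add: A_eq)

lemma finite_senders [simp]: "finite (senders Ch)" by (simp add: senders_def)
lemma finite_T2 [simp]: "finite T2" by (simp add: T2_eq)
lemma finite_receivers [simp]: "finite (receivers Ch)" by (simp add: receivers_def)

lemma finite_inp: "k \<in> senders Ch \<Longrightarrow> finite (inp Ch k)" and inp_nonempty: "k \<in> senders Ch \<Longrightarrow> inp Ch k \<noteq> {}"
  using channel by (auto simp: relay_channel_def)

lemma finite_XX [simp]: "finite XX" by (intro finite_PiE finite_inp) auto
lemma finite_YY [simp]: "finite YY"
  using channel by (intro finite_PiE) (auto simp: relay_channel_def)

lemma law_YY: "x \<in> XX \<Longrightarrow> set_pmf (law Ch x) \<subseteq> YY"
  using channel by (auto simp: relay_channel_def)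

lemma finite_P [simp]: "finite (set_pmf P)"
  by (rule finite_subset[OF supp], intro finite_cartesian_product finite_XX finite_YY finite_PiE)
    (auto intro: finite_Z)

definition glue :: "(nat \<Rightarrow> 'x) \<times> (nat \<Rightarrow> 'x) \<Rightarrow> nat \<Rightarrow> 'x" where
  "glue = (\<lambda>(a, b). \<lambda>k\<in>senders Ch. if k \<in> A then a k else b k)"

definition PX :: "(nat \<Rightarrow> 'x) pmf" where
  "PX = map_pmf glue (pair_pmf p1 (Pi_pmf T2 undefined px))"

definition PXY :: "((nat \<Rightarrow> 'x) \<times> (nat \<Rightarrow> 'y)) pmf" where
  "PXY = bind_pmf PX (\<lambda>x. map_pmf (Pair x) (law Ch x))"

definition zker :: "nat set \<Rightarrow> (nat \<Rightarrow> 'x) \<times> (nat \<Rightarrow> 'y) \<Rightarrow> (nat \<Rightarrow> 'z) pmf" where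
  "zker S = (\<lambda>(x, y). Pi_pmf S undefined (\<lambda>k. pz k (y k) (x k)))"

definition cut :: "('x, 'y, 'z) sample \<Rightarrow> ((nat \<Rightarrow> 'x) \<times> (nat \<Rightarrow> 'x)) \<times> (nat \<Rightarrow> 'y) \<times> (nat \<Rightarrow> 'z)" where
  "cut = (\<lambda>(x, y, z). ((restrict x A, restrict x T2), y, z))"

lemma glue_restrict: "x \<in> XX \<Longrightarrow> glue (restrict x A, restrict x T2) = x"
  by (auto simp: glue_def fun_eq_iff senders_eq PiE_def extensional_def restrict_def)

definition raw :: "(((nat \<Rightarrow> 'x) \<times> (nat \<Rightarrow> 'x)) \<times> (nat \<Rightarrow> 'y) \<times> (nat \<Rightarrow> 'z)) pmf" where
  "raw = bind_pmf (pair_pmf p1 (Pi_pmf T2 undefined px)) (\<lambda>ab. map_pmf (Pair ab)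
     (bind_pmf (law Ch (glue ab)) (\<lambda>y. map_pmf (Pair y) (zker T2 (glue ab, y)))))"

text \<open>The factorization is known on the alphabets, which contain the support of
  \<open>P\<close>; by \<open>pmf_eqI_set\<close> this identifies the whole law. \<open>cut\<close>
  separates the jointly coded inputs from the independent ones, so that \<open>raw\<close> is built
  from kernels.\<close>

lemma map_cut: "map_pmf cut P = raw"
proof (rule pmf_eqI_set)
  fix v assume "v \<in> set_pmf (map_pmf cut P)"
  then obtain x y z where v: "v = cut (x, y, z)" and P: "(x, y, z) \<in> set_pmf P" by auto
  have sets: "x \<in> XX" "y \<in> YY" "z \<in> PiE T2 Z" using supp P by auto
  have "inj_on cut (set_pmf P)"
  proof (rule inj_onI)
    fix \<omega> \<omega>' assume "\<omega> \<in> set_pmf P" "\<omega>' \<in> set_pmf P" "cut \<omega> = cut \<omega>'"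
    then show "\<omega> = \<omega>'"
      using supp glue_restrict[of "fst \<omega>"] glue_restrict[of "fst \<omega>'"] by (auto simp: cut_def split: prod.splits)
  qed
  from pmf_map_inj[OF this P] have "pmf (map_pmf cut P) v = pmf P (x, y, z)" by (simp add: v)
  also have "\<dots> = pmf p1 (restrict x A) * (\<Prod>k\<in>T2. pmf (px k) (x k) * pmf (pz k (y k) (x k)) (z k)) * pmf (law Ch x) y"
    unfolding A_eq by (rule fac[OF sets])
  also have "\<dots> = pmf raw v"
  proof -
    have "pmf (Pi_pmf T2 undefined px) (restrict x T2) = (\<Prod>k\<in>T2. pmf (px k) (x k))"
      by (subst pmf_Pi) auto
    moreover have "pmf (zker T2 (x, y)) z = (\<Prod>k\<in>T2. pmf (pz k (y k) (x k)) (z k))"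
      using sets(3) unfolding zker_def by (subst prod.case, subst pmf_Pi) (auto simp: PiE_def extensional_def)
    ultimately show ?thesis
      by (simp add: v cut_def raw_def pmf_bind_map_Pair glue_restrict[OF sets(1)] pmf_pair prod.distrib)
  qed
  finally show "pmf (map_pmf cut P) v = pmf raw v" .
qed

lemma P_eq: "P = bind_pmf PXY (\<lambda>(x, y). map_pmf (\<lambda>z. (x, y, z)) (zker T2 (x, y)))"
proof -
  let ?g = "\<lambda>(ab, y, z). (glue ab, y, z)"
  have "P = map_pmf ?g (map_pmf cut P)"
    unfolding pmf.map_comp
    by (rule map_pmf_idI[symmetric]) (use supp glue_restrict in \<open>auto simp: cut_def\<close>)
  also have "\<dots> = bind_pmf PXY (\<lambda>(x, y). map_pmf (\<lambda>z. (x, y, z)) (zker T2 (x, y)))"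
    unfolding map_cut raw_def PXY_def PX_def
    by (simp add: map_bind_pmf bind_map_pmf bind_assoc_pmf pmf.map_comp o_def)
  finally show ?thesis .
qed

lemma set_raw: "set_pmf raw \<subseteq> (PiE A (inp Ch) \<times> PiE T2 (inp Ch)) \<times> YY \<times> PiE T2 Z"
proof
  fix v assume "v \<in> set_pmf raw"
  then obtain \<omega> where "\<omega> \<in> set_pmf P" "v = cut \<omega>" unfolding map_cut[symmetric] by auto
  then show "v \<in> (PiE A (inp Ch) \<times> PiE T2 (inp Ch)) \<times> YY \<times> PiE T2 Z"
    using supp by (fastforce simp: cut_def senders_eq PiE_iff)
qed

text \<open>Every pair drawn from \<open>p1\<close> and \<open>px\<close> extends to a sample of
  \<open>raw\<close>, which is a cut sample of \<open>P\<close> and stays in the alphabets. So the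
  factors have no mass where the factorization is silent.\<close>

lemma set_p1: "set_pmf p1 \<subseteq> PiE A (inp Ch)" and set_px: "k \<in> T2 \<Longrightarrow> set_pmf (px k) \<subseteq> inp Ch k"
proof -
  have ab: "set_pmf p1 \<times> set_pmf (Pi_pmf T2 undefined px) \<subseteq> PiE A (inp Ch) \<times> PiE T2 (inp Ch)"
  proof
    fix ab assume ab: "ab \<in> set_pmf p1 \<times> set_pmf (Pi_pmf T2 undefined px)"
    obtain y where y: "y \<in> set_pmf (law Ch (glue ab))" by (meson set_pmf_not_empty ex_in_conv)
    obtain z where z: "z \<in> set_pmf (zker T2 (glue ab, y))" by (meson set_pmf_not_empty ex_in_conv)
    have "(ab, y, z) \<in> set_pmf raw"
      unfolding raw_def set_bind_pmf set_map_pmf set_pair_pmf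
      by (intro UN_I[OF ab] imageI UN_I[OF y] z)
    then show "ab \<in> PiE A (inp Ch) \<times> PiE T2 (inp Ch)" using set_raw by blast
  qed
  then show "set_pmf p1 \<subseteq> PiE A (inp Ch)" using set_pmf_not_empty[of "Pi_pmf T2 undefined px"] by auto
  have "set_pmf (Pi_pmf T2 undefined px) \<subseteq> PiE T2 (inp Ch)" using ab set_pmf_not_empty[of p1] by auto
  then have "set_pmf (map_pmf (\<lambda>f. f k) (Pi_pmf T2 undefined px)) \<subseteq> inp Ch k" if "k \<in> T2"
    using that by auto
  then show "k \<in> T2 \<Longrightarrow> set_pmf (px k) \<subseteq> inp Ch k" by (simp add: Pi_pmf_component)
qed

lemma set_PX: "set_pmf PX \<subseteq> XX"
  using set_p1 set_px unfolding PX_def glue_def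
  by (auto simp: set_Pi_pmf PiE_dflt_def senders_eq PiE_iff subset_iff)

lemma set_PXY: "set_pmf PXY \<subseteq> XX \<times> YY"
  using set_PX law_YY by (fastforce simp: PXY_def)

lemma finite_PXY [simp]: "finite (set_pmf PXY)" by (rule finite_subset[OF set_PXY]) simp

lemma Z_nonempty: "k \<in> T2 \<Longrightarrow> Z k \<noteq> {}"
  using set_pmf_not_empty[of P] supp by (fastforce simp: PiE_iff)

lemma fst_PXY: "map_pmf fst PXY = PX"
  by (simp add: PXY_def map_bind_pmf pmf.map_comp o_def map_pmf_const bind_return_pmf')

lemma map_PXY: "map_pmf (\<lambda>(x, y, z). (x, y)) P = PXY"
  by (subst P_eq) (simp add: map_bind_pmf pmf.map_comp o_def case_prod_unfold map_pmf_const bind_return_pmf')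

lemma fst_P: "map_pmf fst P = PX"
  unfolding fst_PXY[symmetric] map_PXY[symmetric] by (simp add: pmf.map_comp o_def case_prod_unfold)

end

section \<open>Entropy identities from the factorization of the joint law\<close>

lemma log_prod:
  assumes "finite S" "\<And>k. k \<in> S \<Longrightarrow> f k > (0 :: real)"
  shows "log 2 (\<Prod>k\<in>S. f k) = (\<Sum>k\<in>S. log 2 (f k))"
  using assms by (induction S rule: finite_induct) (auto simp: log_mult prod_pos less_imp_neq[symmetric] intro!: log_mult_pos)

context relay_law begin

definition zl :: "nat \<Rightarrow> ('x, 'y, 'z) sample \<Rightarrow> real" where
  "zl k = (\<lambda>(x, y, z). log 2 (pmf (pz k (y k) (x k)) (z k)))"

definition xl1 :: "nat \<Rightarrow> ('x, 'y, 'z) sample \<Rightarrow> real" where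
  "xl1 k = (\<lambda>(x, y, z). log 2 (pmf (px k) (x k)))"

lemma P_bind: "map_pmf f P = bind_pmf PXY (\<lambda>(x, y). map_pmf (\<lambda>z. f (x, y, z)) (zker T2 (x, y)))"
  by (subst P_eq) (simp add: map_bind_pmf pmf.map_comp o_def case_prod_unfold)

lemma zker_restrict: "S \<subseteq> V \<Longrightarrow> finite V \<Longrightarrow> map_pmf (\<lambda>z. restrict z S) (zker V xy) = zker S xy"
  by (simp add: zker_def case_prod_unfold restrict_def Pi_pmf_subset[of V S])

text \<open>A quantizer sees only the input and the output of its own relay. The function
  \<open>q\<close> certifies that \<open>f\<close> reveals both for every \<open>k\<close> in
  \<open>S\<close>, and \<open>depends_on (- S)\<close> keeps \<open>f\<close> from looking at the
  quantizations that are split off.\<close>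

lemma markov:
  fixes f :: "('x, 'y, 'z) sample \<Rightarrow> 'b"
  assumes "S \<subseteq> T2" "\<And>x y. depends_on (- S) (\<lambda>z. f (x, y, z))"
    and q: "\<And>x y z k. k \<in> S \<Longrightarrow> q (f (x, y, z)) k = (x k, y k)"
  shows "map_pmf (\<lambda>\<omega>. (f \<omega>, Zs S \<omega>)) P
    = bind_pmf (map_pmf f P) (\<lambda>b. map_pmf (Pair b) (Pi_pmf S undefined (\<lambda>k. pz k (snd (q b k)) (fst (q b k)))))"
proof -
  have "map_pmf (\<lambda>\<omega>. (f \<omega>, Zs S \<omega>)) P
      = bind_pmf PXY (\<lambda>(x, y). map_pmf (\<lambda>z. (f (x, y, z), restrict z S)) (zker T2 (x, y)))"
    unfolding P_bind by (simp add: Zs_def)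
  also have "\<dots> = bind_pmf PXY (\<lambda>(x, y). pair_pmf (map_pmf (\<lambda>z. f (x, y, z)) (zker T2 (x, y))) (zker S (x, y)))"
  proof (rule bind_pmf_cong[OF refl], clarify)
    fix x y
    have dep: "depends_on S (\<lambda>z. restrict z S :: nat \<Rightarrow> 'z)" by (auto simp: depends_on_def restrict_def)
    have "map_pmf (\<lambda>z. (f (x, y, z), restrict z S)) (zker T2 (x, y))
      = pair_pmf (map_pmf (\<lambda>z. f (x, y, z)) (zker T2 (x, y))) (map_pmf (\<lambda>z. restrict z S) (zker T2 (x, y)))"
      unfolding zker_def prod.case by (rule Pi_pmf_indep[OF finite_T2 assms(2) dep])
    then show "map_pmf (\<lambda>z. (f (x, y, z), restrict z S)) (zker T2 (x, y))
      = pair_pmf (map_pmf (\<lambda>z. f (x, y, z)) (zker T2 (x, y))) (zker S (x, y))"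
      unfolding zker_restrict[OF assms(1) finite_T2] .
  qed
  also have "\<dots> = bind_pmf PXY (\<lambda>(x, y). bind_pmf (map_pmf (\<lambda>z. f (x, y, z)) (zker T2 (x, y)))
      (\<lambda>b. map_pmf (Pair b) (Pi_pmf S undefined (\<lambda>k. pz k (snd (q b k)) (fst (q b k))))))"
  proof (rule bind_pmf_cong[OF refl], clarify)
    fix x y
    have "pair_pmf (map_pmf (\<lambda>z. f (x, y, z)) (zker T2 (x, y))) (zker S (x, y))
      = bind_pmf (map_pmf (\<lambda>z. f (x, y, z)) (zker T2 (x, y))) (\<lambda>b. map_pmf (Pair b) (zker S (x, y)))"
      by (simp only: pair_pmf_def map_pmf_def)
    also have "\<dots> = bind_pmf (map_pmf (\<lambda>z. f (x, y, z)) (zker T2 (x, y)))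
      (\<lambda>b. map_pmf (Pair b) (Pi_pmf S undefined (\<lambda>k. pz k (snd (q b k)) (fst (q b k)))))"
    proof (rule bind_pmf_cong[OF refl])
      fix b assume "b \<in> set_pmf (map_pmf (\<lambda>z. f (x, y, z)) (zker T2 (x, y)))"
      then obtain z where b: "b = f (x, y, z)" by auto
      have "Pi_pmf S undefined (\<lambda>k. pz k (snd (q b k)) (fst (q b k))) = zker S (x, y)"
        unfolding zker_def prod.case by (rule Pi_pmf_cong) (simp_all add: b q)
      then show "map_pmf (Pair b) (zker S (x, y))
        = map_pmf (Pair b) (Pi_pmf S undefined (\<lambda>k. pz k (snd (q b k)) (fst (q b k))))" by simp
    qed
    finally show "pair_pmf (map_pmf (\<lambda>z. f (x, y, z)) (zker T2 (x, y))) (zker S (x, y))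
      = bind_pmf (map_pmf (\<lambda>z. f (x, y, z)) (zker T2 (x, y)))
      (\<lambda>b. map_pmf (Pair b) (Pi_pmf S undefined (\<lambda>k. pz k (snd (q b k)) (fst (q b k)))))" .
  qed
  also have "\<dots> = bind_pmf (map_pmf f P) (\<lambda>b. map_pmf (Pair b) (Pi_pmf S undefined (\<lambda>k. pz k (snd (q b k)) (fst (q b k)))))"
    unfolding P_bind[of f] by (simp add: bind_assoc_pmf case_prod_unfold)
  finally show ?thesis .
qed

lemma pz_pos:
  assumes "(x, y, z) \<in> set_pmf P" "k \<in> T2"
  shows "pmf (pz k (y k) (x k)) (z k) > 0" "pmf (px k) (x k) > 0"
proof -
  have "((restrict x A, restrict x T2), y, z) \<in> set_pmf raw"
    using assms(1) unfolding map_cut[symmetric] by (force simp: cut_def)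
  moreover have x: "x \<in> XX" using assms(1) supp by auto
  ultimately have "restrict x T2 \<in> set_pmf (Pi_pmf T2 undefined px)" "z \<in> set_pmf (zker T2 (x, y))"
    by (auto simp: raw_def glue_restrict)
  then show "pmf (px k) (x k) > 0" "pmf (pz k (y k) (x k)) (z k) > 0"
    using assms(2) by (auto simp: set_Pi_pmf zker_def PiE_dflt_def pmf_positive_iff)
qed

lemma lg_markov:
  assumes "S \<subseteq> T2" "\<And>x y. depends_on (- S) (\<lambda>z. f (x, y, z))"
    and q: "\<And>x y z k. k \<in> S \<Longrightarrow> q (f (x, y, z)) k = (x k, y k)"
    and \<omega>: "\<omega> \<in> set_pmf P"
  shows "lg P (\<lambda>\<omega>. (f \<omega>, Zs S \<omega>)) \<omega> = lg P f \<omega> + (\<Sum>k\<in>S. zl k \<omega>)"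
proof -
  obtain x y z where w: "\<omega> = (x, y, z)" by (cases \<omega>)
  have S: "finite S" using assms(1) by (rule finite_subset) simp
  have "pmf (map_pmf (\<lambda>\<omega>. (f \<omega>, Zs S \<omega>)) P) (f \<omega>, Zs S \<omega>)
    = pmf (map_pmf f P) (f \<omega>) * (\<Prod>k\<in>S. pmf (pz k (y k) (x k)) (z k))"
    by (subst markov[OF assms(1,2), of q], erule q, subst pmf_bind_map_Pair, subst pmf_Pi[OF S])
      (auto simp: w q Zs_def)
  moreover have pos: "\<And>k. k \<in> S \<Longrightarrow> pmf (pz k (y k) (x k)) (z k) > 0" using pz_pos[of x y z] \<omega> w assms(1) by auto
  then have "(\<Prod>k\<in>S. pmf (pz k (y k) (x k)) (z k)) > 0" by (rule prod_pos)
  moreover have "log 2 (\<Prod>k\<in>S. pmf (pz k (y k) (x k)) (z k)) = (\<Sum>k\<in>S. zl k \<omega>)"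
    using pos by (subst log_prod[OF S]) (auto simp: zl_def w)
  ultimately show ?thesis
    using pmf_map_pos[OF \<omega>, of f] by (simp add: lg_def log_mult)
qed

lemma ent_markov:
  assumes "S \<subseteq> T2" "\<And>x y. depends_on (- S) (\<lambda>z. f (x, y, z))"
    and q: "\<And>x y z k. k \<in> S \<Longrightarrow> q (f (x, y, z)) k = (x k, y k)"
  shows "ent P (\<lambda>\<omega>. (f \<omega>, Zs S \<omega>)) = ent P f - (\<Sum>k\<in>S. mean P (zl k))"
proof -
  have "mean P (lg P (\<lambda>\<omega>. (f \<omega>, Zs S \<omega>))) = mean P (\<lambda>\<omega>. lg P f \<omega> + (\<Sum>k\<in>S. zl k \<omega>))"
    by (rule mean_cong) (rule lg_markov[OF assms])
  then show ?thesis by (simp add: ent_def mean_add mean_sum)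
qed

lemma map_AX:
  assumes "V \<subseteq> T2"
  shows "map_pmf (\<lambda>\<omega>. (Xs A \<omega>, Xs V \<omega>)) P = pair_pmf p1 (Pi_pmf V undefined px)"
proof -
  have "map_pmf (\<lambda>\<omega>. (Xs A \<omega>, Xs V \<omega>)) P = map_pmf (\<lambda>x. (restrict x A, restrict x V)) PX"
    unfolding fst_P[symmetric] by (simp add: pmf.map_comp o_def Xs_def case_prod_unfold)
  also have "\<dots> = map_pmf (\<lambda>(a, b). (a, restrict b V)) (pair_pmf p1 (Pi_pmf T2 undefined px))"
    unfolding PX_def pmf.map_comp
  proof (rule map_pmf_cong[OF refl])
    fix ab assume ab: "ab \<in> set_pmf (pair_pmf p1 (Pi_pmf T2 undefined px))"
    obtain a b where abe: "ab = (a, b)" by (cases ab)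
    have "a \<in> PiE A (inp Ch)" using set_p1 ab abe by auto
    then have "restrict (glue (a, b)) A = a"
      by (auto simp: glue_def fun_eq_iff senders_eq restrict_def PiE_def extensional_def)
    moreover have "restrict (glue (a, b)) V = restrict b V"
      using assms A_T2 by (auto simp: glue_def fun_eq_iff senders_eq restrict_def)
    ultimately show "((\<lambda>x. (restrict x A, restrict x V)) \<circ> glue) ab = (case ab of (a, b) \<Rightarrow> (a, restrict b V))"
      by (simp add: abe)
  qed
  also have "\<dots> = pair_pmf p1 (map_pmf (\<lambda>b. restrict b V) (Pi_pmf T2 undefined px))"
    using map_pair[of "\<lambda>a. a" "\<lambda>b. restrict b V" p1 "Pi_pmf T2 undefined px"] by (simp add: pmf.map_ident)
  also have "map_pmf (\<lambda>b. restrict b V) (Pi_pmf T2 undefined px) = Pi_pmf V undefined px"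
    using assms by (simp add: restrict_def Pi_pmf_subset[of T2 V])
  finally show ?thesis .
qed

lemma map_A: "map_pmf (Xs A) P = p1" and map_X: "V \<subseteq> T2 \<Longrightarrow> map_pmf (Xs V) P = Pi_pmf V undefined px"
proof -
  show "map_pmf (Xs A) P = p1"
    using arg_cong[OF map_AX[of "{}"], of "map_pmf fst"] by (simp add: pmf.map_comp o_def map_fst_pair_pmf)
  show "map_pmf (Xs V) P = Pi_pmf V undefined px" if "V \<subseteq> T2"
    using arg_cong[OF map_AX[OF that], of "map_pmf snd"] by (simp add: pmf.map_comp o_def map_snd_pair_pmf)
qed

lemma map_X1: "k \<in> T2 \<Longrightarrow> map_pmf (\<lambda>(x, y, z). x k) P = px k"
proof -
  assume k: "k \<in> T2"
  have "map_pmf (\<lambda>(x, y, z). x k) P = map_pmf (\<lambda>f. f k) (map_pmf (Xs T2) P)"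
    using k by (simp add: pmf.map_comp o_def Xs_def case_prod_unfold)
  also have "\<dots> = px k" using k by (simp add: map_X Pi_pmf_component)
  finally show ?thesis .
qed

lemma log_pmf_X:
  assumes "V \<subseteq> T2" "(x, y, z) \<in> set_pmf P"
  shows "log 2 (pmf (Pi_pmf V undefined px) (restrict x V)) = (\<Sum>k\<in>V. xl1 k (x, y, z))"
    and "pmf (Pi_pmf V undefined px) (restrict x V) > 0"
proof -
  have V: "finite V" using assms(1) by (rule finite_subset) simp
  have e: "pmf (Pi_pmf V undefined px) (restrict x V) = (\<Prod>k\<in>V. pmf (px k) (x k))"
    by (subst pmf_Pi[OF V]) auto
  have pos: "\<And>k. k \<in> V \<Longrightarrow> pmf (px k) (x k) > 0" using pz_pos[OF assms(2)] assms(1) by auto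
  show "log 2 (pmf (Pi_pmf V undefined px) (restrict x V)) = (\<Sum>k\<in>V. xl1 k (x, y, z))"
    unfolding e using pos by (subst log_prod[OF V]) (auto simp: xl1_def)
  show "pmf (Pi_pmf V undefined px) (restrict x V) > 0" unfolding e using pos by (rule prod_pos)
qed

lemma ent_AX: "V \<subseteq> T2 \<Longrightarrow> ent P (\<lambda>\<omega>. (Xs A \<omega>, Xs V \<omega>)) = ent P (Xs A) - (\<Sum>k\<in>V. mean P (xl1 k))"
proof -
  assume V: "V \<subseteq> T2"
  have "mean P (lg P (\<lambda>\<omega>. (Xs A \<omega>, Xs V \<omega>))) = mean P (\<lambda>\<omega>. lg P (Xs A) \<omega> + (\<Sum>k\<in>V. xl1 k \<omega>))"
  proof (rule mean_cong)
    fix \<omega> assume w: "\<omega> \<in> set_pmf P"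
    obtain x y z where w2: "\<omega> = (x, y, z)" by (cases \<omega>)
    show "lg P (\<lambda>\<omega>. (Xs A \<omega>, Xs V \<omega>)) \<omega> = lg P (Xs A) \<omega> + (\<Sum>k\<in>V. xl1 k \<omega>)"
      using pmf_map_pos[OF w, of "Xs A"] log_pmf_X[OF V w[unfolded w2]]
      unfolding lg_def map_AX[OF V] map_A
      by (simp add: w2 pmf_pair log_mult Xs_def)
  qed
  then show ?thesis by (simp add: ent_def mean_add mean_sum)
qed

lemma ent_X: "V \<subseteq> T2 \<Longrightarrow> ent P (Xs V) = - (\<Sum>k\<in>V. mean P (xl1 k))"
proof -
  assume V: "V \<subseteq> T2"
  have "mean P (lg P (Xs V)) = mean P (\<lambda>\<omega>. \<Sum>k\<in>V. xl1 k \<omega>)"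
  proof (rule mean_cong)
    fix \<omega> assume w: "\<omega> \<in> set_pmf P"
    obtain x y z where w2: "\<omega> = (x, y, z)" by (cases \<omega>)
    show "lg P (Xs V) \<omega> = (\<Sum>k\<in>V. xl1 k \<omega>)"
      using log_pmf_X[OF V w[unfolded w2]] unfolding lg_def map_X[OF V] by (simp add: w2 Xs_def)
  qed
  then show ?thesis by (simp add: ent_def mean_sum)
qed

text \<open>This is H(X_k) + H(Z_k|X_k,Y_k). It is additive over relays because the inputs in
  \<open>T2\<close> are independent and the quantizers act separately, which makes \<open>FA\<close>
  and \<open>FB\<close> functions of one set.\<close>

definition cc :: "nat \<Rightarrow> real" where
  "cc k = - mean P (xl1 k) - mean P (zl k)"

text \<open>
  \<open>H(X\<^sub>A) + FB U - FA Q\<close> is the second bound of the theorem when the relays outside \<open>Q\<close> are treated as noise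
  and \<open>S = Q - U\<close>. The exponents of the decoder's error events are differences of \<open>FA\<close> and \<open>FB\<close>, too.
\<close>

definition hA :: "nat set \<Rightarrow> real" where
  "hA U = ent P (\<lambda>\<omega>. (Xs A \<omega>, Xs U \<omega>, Zs U \<omega>, Ys {K} \<omega>))"

definition hB :: "nat set \<Rightarrow> real" where
  "hB U = ent P (\<lambda>\<omega>. (Xs U \<omega>, Zs U \<omega>, Ys {K} \<omega>))"

definition FA :: "nat set \<Rightarrow> real" where "FA U = hA U - (\<Sum>k\<in>U. cc k)"
definition FB :: "nat set \<Rightarrow> real" where "FB U = hB U - (\<Sum>k\<in>U. cc k)"

lemma Xs_eq_iff: "Xs S \<omega> = Xs S \<omega>' \<longleftrightarrow> (\<forall>k\<in>S. fst \<omega> k = fst \<omega>' k)"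
  by (auto simp: Xs_def case_prod_unfold fun_eq_iff restrict_def)
lemma Ys_eq_iff: "Ys S \<omega> = Ys S \<omega>' \<longleftrightarrow> (\<forall>k\<in>S. fst (snd \<omega>) k = fst (snd \<omega>') k)"
  by (auto simp: Ys_def case_prod_unfold fun_eq_iff restrict_def)
lemma Zs_eq_iff: "Zs S \<omega> = Zs S \<omega>' \<longleftrightarrow> (\<forall>k\<in>S. snd (snd \<omega>) k = snd (snd \<omega>') k)"
  by (auto simp: Zs_def case_prod_unfold fun_eq_iff restrict_def)
lemmas sample_eq_iffs = Xs_eq_iff Ys_eq_iff Zs_eq_iff

text \<open>Given the inputs and \<open>Ys S\<close>, the quantizations \<open>Zs S\<close> are
  independent of the rest, so they add exactly the entropies of their kernels. This evaluates the
  term that is subtracted in the second bound of the theorem.\<close>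

lemma ent_YC:
  assumes "S \<subseteq> V" "V \<subseteq> T2"
  defines "C \<equiv> \<lambda>\<omega> :: ('x, 'y, 'z) sample. (Xs (A \<union> V) \<omega>, Zs (V - S) \<omega>, Ys {K} \<omega>)"
  shows "ent P (\<lambda>\<omega>. (Zs S \<omega>, Ys S \<omega>, C \<omega>)) = ent P (\<lambda>\<omega>. (Ys S \<omega>, C \<omega>)) - (\<Sum>k\<in>S. mean P (zl k))"
proof -
  have "ent P (\<lambda>\<omega>. ((Ys S \<omega>, C \<omega>), Zs S \<omega>)) = ent P (\<lambda>\<omega>. (Ys S \<omega>, C \<omega>)) - (\<Sum>k\<in>S. mean P (zl k))"
  proof (rule ent_markov[where q = "\<lambda>(ys, (xs, zs, yk)) k. (xs k, ys k)"])
    show "S \<subseteq> T2" using assms by auto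
    show "depends_on (- S) (\<lambda>z. (Ys S (x, y, z), C (x, y, z)))" for x y
      by (rule depends_onI) (auto simp: C_def Ys_def Xs_def Zs_def fun_eq_iff restrict_def)
    show "(case (Ys S (x, y, z), C (x, y, z)) of (ys, xs, zs, yk) \<Rightarrow> \<lambda>k. (xs k, ys k)) k = (x k, y k)"
      if "k \<in> S" for x y z k
      using that assms(1) by (auto simp: C_def Ys_def Xs_def)
  qed
  also have "ent P (\<lambda>\<omega>. ((Ys S \<omega>, C \<omega>), Zs S \<omega>)) = ent P (\<lambda>\<omega>. (Zs S \<omega>, Ys S \<omega>, C \<omega>))"
    by (rule ent_cong) auto
  finally show ?thesis .
qed

lemma ent_ZC:
  assumes "S \<subseteq> V"
  shows "ent P (\<lambda>\<omega>. (Zs S \<omega>, Xs (A \<union> V) \<omega>, Zs (V - S) \<omega>, Ys {K} \<omega>)) = hA V"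
  unfolding hA_def by (rule ent_cong) (use assms in \<open>auto simp: sample_eq_iffs\<close>)

text \<open>In terms of entropies, those containing \<open>Ys S\<close> cancel, and \<open>S\<close>
  enters only through \<open>FB\<close> of its complement. In this form the bounds for different
  sets of relays treated as noise can be compared.\<close>

lemma rate_eq:
  assumes "S \<subseteq> T2"
  shows "cmi P (Xs ({1} \<union> DF_relays \<pi> K1 \<union> S)) (\<lambda>\<omega>. (Zs (T2 - S) \<omega>, Ys {K} \<omega>)) (Xs (T2 - S))
         - cmi P (Zs S) (Ys S) (\<lambda>\<omega>. (Xs ({1} \<union> relays Ch) \<omega>, Zs (T2 - S) \<omega>, Ys {K} \<omega>))
       = ent P (Xs A) + FB (T2 - S) - FA T2"
proof -
  let ?C = "\<lambda>\<omega> :: ('x, 'y, 'z) sample. (Xs (A \<union> T2) \<omega>, Zs (T2 - S) \<omega>, Ys {K} \<omega>)"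
  have sen: "{1} \<union> relays Ch = A \<union> T2"
    using K2 by (auto simp: senders_eq[symmetric] relays_def senders_def)
  have "cmi P (Zs S) (Ys S) ?C = hA T2 + ent P (\<lambda>\<omega>. (Ys S \<omega>, ?C \<omega>)) - ent P ?C
      - (ent P (\<lambda>\<omega>. (Ys S \<omega>, ?C \<omega>)) - (\<Sum>k\<in>S. mean P (zl k)))"
    by (subst cmi_eq) (simp_all add: ent_YC[OF assms] ent_ZC[OF assms])
  moreover have "ent P (\<lambda>\<omega>. (Xs (A \<union> S) \<omega>, (Zs (T2 - S) \<omega>, Ys {K} \<omega>), Xs (T2 - S) \<omega>)) = ent P ?C"
    by (rule ent_cong) (use assms in \<open>auto simp: sample_eq_iffs\<close>)
  moreover have "ent P (\<lambda>\<omega>. (Xs (A \<union> S) \<omega>, Xs (T2 - S) \<omega>)) = ent P (\<lambda>\<omega>. (Xs A \<omega>, Xs T2 \<omega>))"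
    by (rule ent_cong) (use assms in \<open>auto simp: sample_eq_iffs\<close>)
  moreover have "ent P (\<lambda>\<omega>. ((Zs (T2 - S) \<omega>, Ys {K} \<omega>), Xs (T2 - S) \<omega>)) = hB (T2 - S)"
    unfolding hB_def by (rule ent_cong) auto
  moreover have "(\<Sum>k\<in>T2. g k) = (\<Sum>k\<in>S. g k) + (\<Sum>k\<in>T2 - S. g k)" for g :: "nat \<Rightarrow> real"
    using sum.subset_diff[OF assms finite_T2, of g] by simp
  ultimately show ?thesis
    unfolding A_eq[symmetric] sen
    by (subst cmi_eq) (simp_all add: ent_AX ent_X FA_def FB_def cc_def sum_negf sum_subtractf sum.distrib)
qed

text \<open>
  A minimizer of \<open>FA\<close> of least size makes every error exponent of backward decoding strictly positive, also
  those of events where only the quantization indices are wrong, which the theorem does not mention.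
\<close>

lemma exists_Q:
  assumes "\<And>S. S \<subseteq> T2 \<Longrightarrow> R < ent P (Xs A) + FB (T2 - S) - FA T2"
  shows "\<exists>Q\<subseteq>T2. (\<forall>U\<subseteq>Q. R < ent P (Xs A) + FB U - FA Q) \<and> (\<forall>U\<subset>Q. FA Q < FA U)"
proof -
  define m where "m = Min (FA ` Pow T2)"
  have m: "m \<le> FA U" if "U \<subseteq> T2" for U using that by (auto simp: m_def)
  have "m \<in> FA ` Pow T2" unfolding m_def by (rule Min_in) auto
  then obtain Q0 where "Q0 \<subseteq> T2" "FA Q0 = m" by auto
  then obtain Q where Q: "Q \<subseteq> T2 \<and> FA Q = m" "\<And>U. U \<subseteq> T2 \<and> FA U = m \<Longrightarrow> card Q \<le> card U"
    using ex_has_least_nat[of "\<lambda>U. U \<subseteq> T2 \<and> FA U = m" Q0 card] by blast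
  have "FA Q < FA U" if "U \<subset> Q" for U
  proof (rule ccontr)
    assume "\<not> FA Q < FA U"
    moreover have "m \<le> FA U" using that Q by (intro m) auto
    ultimately have "FA U = m" using Q by auto
    then have "card Q \<le> card U" using Q that by auto
    moreover have "card U < card Q" using that Q(1) by (intro psubset_card_mono) (auto intro: finite_subset)
    ultimately show False by simp
  qed
  moreover have "R < ent P (Xs A) + FB U - FA Q" if "U \<subseteq> Q" for U
  proof -
    have "T2 - (T2 - U) = U" using that Q by auto
    then have "R < ent P (Xs A) + FB U - FA T2" using assms[of "T2 - U"] by auto
    \<comment> \<open>Only \<open>FA T2\<close> is exchanged, for a smaller value;
      \<open>FB U\<close> does not refer to the ambient set.\<close>
    moreover have "FA Q \<le> FA T2" using m[of T2] Q by simp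
    ultimately show ?thesis by simp
  qed
  ultimately show ?thesis using Q by blast
qed

end

section \<open>Reachability of the destination from the quantize-forward relays\<close>

context relay_law begin

text \<open>Only one input is varied at a time, so that a witness is a usable link with all other
  inputs held fixed. Simultaneous changes are covered as well: \<open>not_influences\<close> makes
  them successively.\<close>

definition influences :: "nat set \<Rightarrow> nat set \<Rightarrow> bool" where
  "influences S V \<longleftrightarrow> (\<exists>k\<in>S. \<exists>x\<in>XX. \<exists>a\<in>inp Ch k. \<exists>a'\<in>inp Ch k.
     map_pmf (\<lambda>y. restrict y V) (law Ch (x(k := a))) \<noteq> map_pmf (\<lambda>y. restrict y V) (law Ch (x(k := a'))))"

lemma not_influences:
  assumes "\<not> influences S V" "S \<subseteq> T2" "x \<in> XX" "x' \<in> XX" "\<And>k. k \<notin> S \<Longrightarrow> x k = x' k"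
  shows "map_pmf (\<lambda>y. restrict y V) (law Ch x) = map_pmf (\<lambda>y. restrict y V) (law Ch x')"
proof -
  let ?g = "\<lambda>x. map_pmf (\<lambda>y. restrict y V) (law Ch x)"
  have "finite S" using assms(2) by (rule finite_subset) simp
  then have "\<forall>x\<in>XX. \<forall>x'\<in>XX. (\<forall>k. k \<notin> S \<longrightarrow> x k = x' k) \<longrightarrow> ?g x = ?g x'"
    if "S \<subseteq> T2" "\<not> influences S V"
    using that
  proof (induction S rule: finite_induct)
    case empty
    have "x = x'" if "\<forall>k. k \<notin> {} \<longrightarrow> x k = x' k" for x x' :: "nat \<Rightarrow> 'x" using that by (intro ext) simp
    then show ?case by blast
  next
    case (insert s S)
    show ?case
    proof (intro ballI impI)
      fix x x' assume xx: "x \<in> XX" "x' \<in> XX" "\<forall>k. k \<notin> insert s S \<longrightarrow> x k = x' k"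
      have s: "s \<in> senders Ch" using insert.prems by (auto simp: senders_eq)
      then have xs: "x s \<in> inp Ch s" "x' s \<in> inp Ch s" using xx by auto
      then have "x(s := x' s) \<in> XX" using xx(1) s by (auto simp: PiE_iff extensional_def)
      moreover have ni: "\<not> influences S V" using insert.prems(2) unfolding influences_def by blast
      moreover have "S \<subseteq> T2" using insert.prems(1) by simp
      moreover have "(x(s := x' s)) k = x' k" if "k \<notin> S" for k using xx(3) that by simp
      ultimately have "?g (x(s := x' s)) = ?g x'"
        using insert.IH xx(2) by blast
      moreover have "?g (x(s := x s)) = ?g (x(s := x' s))"
        using insert.prems(2) xx(1) xs unfolding influences_def by blast
      ultimately show "?g x = ?g x'" by simp
    qed
  qed
  with assms show ?thesis by blast
qed

text \<open>The law \<open>\<kappa> x\<close> of \<open>g\<close> given the inputs is insensitive to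
  the inputs in \<open>S\<close>, which can be frozen at arbitrary letters \<open>s0\<close>. The
  actual inputs in \<open>S\<close> are independent of all that remains.\<close>

lemma indep_unreachable:
  assumes "S \<subseteq> T2" "U \<subseteq> T2" "S \<inter> U = {}" "\<not> influences S (insert K U)"
  defines "g \<equiv> \<lambda>\<omega> :: ('x, 'y, 'z) sample. (Xs A \<omega>, Xs U \<omega>, Zs U \<omega>, Ys {K} \<omega>)"
  shows "map_pmf (\<lambda>\<omega>. (Xs S \<omega>, g \<omega>)) P = pair_pmf (Pi_pmf S undefined px) (map_pmf g P)"
proof -
  define \<kappa> where "\<kappa> x = bind_pmf (law Ch x) (\<lambda>y. map_pmf (\<lambda>z. g (x, y, z)) (zker T2 (x, y)))" for x
  have \<kappa>_eq: "\<kappa> x = \<kappa> x'" if "x \<in> XX" "x' \<in> XX" "\<And>k. k \<notin> S \<Longrightarrow> x k = x' k" for x x'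
  proof -
    have *: "\<kappa> x = bind_pmf (map_pmf (\<lambda>y. restrict y (insert K U)) (law Ch x))
       (\<lambda>v. map_pmf (\<lambda>z. (restrict x A, restrict x U, z, restrict v {K})) (zker U (x, v)))" for x
    proof -
      have "map_pmf (\<lambda>z. g (x, y, z)) (zker T2 (x, y)) =
        map_pmf (\<lambda>z. (restrict x A, restrict x U, z, restrict (restrict y (insert K U)) {K})) (zker U (x, restrict y (insert K U)))" for y
      proof -
        have "zker U (x, restrict y (insert K U)) = zker U (x, y)"
          unfolding zker_def prod.case by (rule Pi_pmf_cong) auto
        also have "\<dots> = map_pmf (\<lambda>z. restrict z U) (zker T2 (x, y))"
          by (rule zker_restrict[OF assms(2) finite_T2, symmetric])
        finally have e: "zker U (x, restrict y (insert K U)) = map_pmf (\<lambda>z. restrict z U) (zker T2 (x, y))" .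
        have "restrict (restrict y (insert K U)) {K} = restrict y {K}" by (simp add: restrict_restrict)
        then show ?thesis
          unfolding e pmf.map_comp by (simp only: o_def g_def Xs_def Ys_def Zs_def prod.case)
      qed
      then show ?thesis unfolding \<kappa>_def bind_map_pmf by simp
    qed
    have "zker U (x, v) = zker U (x', v)" for v
      unfolding zker_def prod.case using that(3) assms(3)
      by (intro Pi_pmf_cong refl) (metis disjoint_iff)
    moreover have "restrict x A = restrict x' A" "restrict x U = restrict x' U"
      using that(3) assms(1,3) A_T2 by (auto simp: fun_eq_iff restrict_def)
    moreover have "map_pmf (\<lambda>y. restrict y (insert K U)) (law Ch x) = map_pmf (\<lambda>y. restrict y (insert K U)) (law Ch x')"
      using not_influences[OF assms(4,1)] that by blast
    ultimately show ?thesis unfolding * by simp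
  qed
  have "\<exists>s0. \<forall>k\<in>T2. s0 k \<in> inp Ch k"
    using inp_nonempty by (intro bchoice) (auto simp: senders_eq)
  then obtain s0 where s0: "\<And>k. k \<in> T2 \<Longrightarrow> s0 k \<in> inp Ch k" by blast
  define off where "off b = (\<lambda>k. if k \<in> S then s0 k else b k)" for b :: "nat \<Rightarrow> 'x"
  let ?B = "Pi_pmf T2 undefined px"
  define \<mu> where "\<mu> = bind_pmf p1 (\<lambda>a. bind_pmf (map_pmf off ?B) (\<lambda>o'. \<kappa> (glue (a, o'))))"
  have indep: "map_pmf (\<lambda>b. (off b, restrict b S)) ?B = pair_pmf (map_pmf off ?B) (Pi_pmf S undefined px)"
  proof -
    have "map_pmf (\<lambda>b. (off b, restrict b S)) ?B = pair_pmf (map_pmf off ?B) (map_pmf (\<lambda>b. restrict b S) ?B)"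
      by (rule Pi_pmf_indep[of _ S]) (auto simp: depends_on_def off_def restrict_def fun_eq_iff)
    also have "map_pmf (\<lambda>b. restrict b S) ?B = Pi_pmf S undefined px"
      using assms(1) by (simp add: restrict_def Pi_pmf_subset[of T2 S])
    finally show ?thesis .
  qed
  have "map_pmf (\<lambda>\<omega>. (Xs S \<omega>, g \<omega>)) P = bind_pmf PX (\<lambda>x. map_pmf (Pair (restrict x S)) (\<kappa> x))"
    unfolding P_bind PXY_def \<kappa>_def
    by (simp add: bind_assoc_pmf bind_map_pmf map_bind_pmf pmf.map_comp o_def Xs_def)
  also have "\<dots> = bind_pmf p1 (\<lambda>a. bind_pmf ?B (\<lambda>b. map_pmf (Pair (restrict (glue (a, b)) S)) (\<kappa> (glue (a, b)))))"
    unfolding PX_def by (simp add: bind_map_pmf pair_pmf_def bind_assoc_pmf bind_return_pmf)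
  also have "\<dots> = bind_pmf p1 (\<lambda>a. bind_pmf ?B (\<lambda>b. map_pmf (Pair (restrict b S)) (\<kappa> (glue (a, off b)))))"
  proof (intro bind_pmf_cong refl)
    fix a b assume a: "a \<in> set_pmf p1" and b: "b \<in> set_pmf ?B"
    have "glue (a, b) \<in> XX" using set_PX a b unfolding PX_def by auto
    moreover from this have "glue (a, off b) \<in> XX"
      using s0 assms(1) by (auto simp: glue_def off_def PiE_iff)
    moreover have "glue (a, b) k = glue (a, off b) k" if "k \<notin> S" for k
      using that by (simp add: glue_def off_def)
    ultimately have "\<kappa> (glue (a, b)) = \<kappa> (glue (a, off b))" by (intro \<kappa>_eq)
    moreover have "restrict (glue (a, b)) S = restrict b S"
      using assms(1) A_T2 by (auto simp: glue_def fun_eq_iff restrict_def senders_eq)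
    ultimately show "map_pmf (Pair (restrict (glue (a, b)) S)) (\<kappa> (glue (a, b))) =
        map_pmf (Pair (restrict b S)) (\<kappa> (glue (a, off b)))" by simp
  qed
  also have "\<dots> = bind_pmf p1 (\<lambda>a. bind_pmf (map_pmf (\<lambda>b. (off b, restrict b S)) ?B) (\<lambda>(o', s). map_pmf (Pair s) (\<kappa> (glue (a, o')))))"
    by (simp add: bind_map_pmf)
  also have "\<dots> = bind_pmf (Pi_pmf S undefined px) (\<lambda>s. map_pmf (Pair s) \<mu>)"
  proof -
    let ?O = "map_pmf off ?B" and ?S = "Pi_pmf S undefined px"
    have "bind_pmf (pair_pmf ?O ?S) (\<lambda>(o', s). map_pmf (Pair s) (\<kappa> (glue (a, o'))))
      = bind_pmf ?S (\<lambda>s. bind_pmf ?O (\<lambda>o'. map_pmf (Pair s) (\<kappa> (glue (a, o')))))" for a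
      unfolding pair_pmf_def bind_assoc_pmf bind_return_pmf prod.case by (rule bind_commute_pmf)
    then show ?thesis
      unfolding indep \<mu>_def map_bind_pmf by (subst bind_commute_pmf) simp
  qed
  also have "\<dots> = pair_pmf (Pi_pmf S undefined px) \<mu>"
    by (simp only: pair_pmf_def map_pmf_def)
  finally have eq: "map_pmf (\<lambda>\<omega>. (Xs S \<omega>, g \<omega>)) P = pair_pmf (Pi_pmf S undefined px) \<mu>" .
  from arg_cong[OF this, of "map_pmf snd"] have "map_pmf g P = \<mu>"
    by (simp add: pmf.map_comp o_def map_snd_pair_pmf)
  with eq show ?thesis by simp
qed

text \<open>
  Hence every nonempty subset \<open>S\<close> of the relays chosen in \<open>exists_Q\<close> has a link to the others or to the destination,
  and the final phase can convey the last indices by forwarding bits along such links.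
\<close>

lemma FA_unreachable:
  assumes "S \<subseteq> Q" "Q \<subseteq> T2" "\<not> influences S (insert K (Q - S))"
  shows "FA (Q - S) \<le> FA Q"
proof -
  define U where "U = Q - S"
  have S: "S \<subseteq> T2" "U \<subseteq> T2" "S \<inter> U = {}" using assms by (auto simp: U_def)
  let ?g = "\<lambda>\<omega> :: ('x, 'y, 'z) sample. (Xs A \<omega>, Xs U \<omega>, Zs U \<omega>, Ys {K} \<omega>)"
  let ?C = "\<lambda>\<omega> :: ('x, 'y, 'z) sample. (Xs (A \<union> Q) \<omega>, Zs U \<omega>, Ys {K} \<omega>)"
  have "mean P (lg P (\<lambda>\<omega>. (Xs S \<omega>, ?g \<omega>))) = mean P (\<lambda>\<omega>. (\<Sum>k\<in>S. xl1 k \<omega>) + lg P ?g \<omega>)"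
  proof (rule mean_cong)
    fix \<omega> assume w: "\<omega> \<in> set_pmf P"
    obtain x y z where w2: "\<omega> = (x, y, z)" by (cases \<omega>)
    have ind: "map_pmf (\<lambda>\<omega>. (Xs S \<omega>, ?g \<omega>)) P = pair_pmf (Pi_pmf S undefined px) (map_pmf ?g P)"
      using indep_unreachable[OF S] assms(3) by (simp add: U_def)
    have "pmf (map_pmf (\<lambda>\<omega>. (Xs S \<omega>, ?g \<omega>)) P) (Xs S \<omega>, ?g \<omega>)
      = pmf (Pi_pmf S undefined px) (restrict x S) * pmf (map_pmf ?g P) (?g \<omega>)"
      unfolding ind pmf_pair by (simp add: w2 Xs_def)
    then show "lg P (\<lambda>\<omega>. (Xs S \<omega>, ?g \<omega>)) \<omega> = (\<Sum>k\<in>S. xl1 k \<omega>) + lg P ?g \<omega>"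
      using pmf_map_pos[OF w, of ?g] log_pmf_X[OF S(1) w[unfolded w2]]
      unfolding lg_def by (simp add: log_mult w2)
  qed
  then have "ent P (\<lambda>\<omega>. (Xs S \<omega>, ?g \<omega>)) = hA U - (\<Sum>k\<in>S. mean P (xl1 k))"
    by (simp add: ent_def mean_add mean_sum hA_def)
  moreover have "ent P (\<lambda>\<omega>. (Xs S \<omega>, ?g \<omega>)) = ent P ?C"
  proof (rule ent_cong)
    have "Q = S \<union> U" using assms(1) by (auto simp: U_def)
    then show "(Xs S \<omega>', ?g \<omega>') = (Xs S \<omega>, ?g \<omega>) \<longleftrightarrow> ?C \<omega>' = ?C \<omega>" for \<omega> \<omega>'
      by (simp add: sample_eq_iffs ball_Un conj_ac)
  qed
  \<comment> \<open>By the independence just shown, this conditional mutual information equals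
    \<open>FA Q - FA (Q - S)\<close>.\<close>
  moreover have "0 \<le> cmi P (Zs S) (Ys S) ?C" by (rule cmi_nonneg) simp
  moreover have "cmi P (Zs S) (Ys S) ?C = hA Q + ent P (\<lambda>\<omega>. (Ys S \<omega>, ?C \<omega>)) - ent P ?C
      - (ent P (\<lambda>\<omega>. (Ys S \<omega>, ?C \<omega>)) - (\<Sum>k\<in>S. mean P (zl k)))"
    by (subst cmi_eq) (simp_all add: ent_YC[OF assms(1,2)] ent_ZC[OF assms(1)] U_def)
  moreover have "finite Q" using assms(2) by (rule finite_subset) simp
  then have "(\<Sum>k\<in>Q. g k) = (\<Sum>k\<in>S. g k) + (\<Sum>k\<in>U. g k)" for g :: "nat \<Rightarrow> real"
    using sum.subset_diff[OF assms(1), of g] by (simp add: U_def)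
  ultimately show ?thesis
    by (simp add: U_def[symmetric] FA_def cc_def sum_negf sum_subtractf)
qed

end

section \<open>Forwarding bits to the destination\<close>

lemma iid_Suc: "map_pmf (\<lambda>s. map s [0..<Suc n]) (iid (Suc n) p)
    = bind_pmf (map_pmf (\<lambda>s. map s [0..<n]) (iid n p)) (\<lambda>l. map_pmf (\<lambda>a. l @ [a]) p)"
proof -
  have "{..<Suc n} = insert n {..<n}" by auto
  then have "iid (Suc n) p = map_pmf (\<lambda>(y, f). f(n := y)) (pair_pmf p (iid n p))"
    unfolding iid_def by (simp add: Pi_pmf_insert)
  then show ?thesis
    by (simp add: pmf.map_comp o_def case_prod_unfold pair_pmf_def map_bind_pmf bind_map_pmf
        map_pmf_def[of "\<lambda>a. _ @ [a]"] bind_commute_pmf[of p])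
qed

lemma bits_inject:
  assumes "l < 2 ^ m" "l' < (2::nat) ^ m" "\<And>b. b < m \<Longrightarrow> bit l b = bit l' b"
  shows "l = l'"
proof (rule bit_eqI)
  fix n :: nat
  show "bit l n = bit l' n"
  proof (cases "n < m")
    case False
    then have "(2::nat) ^ m \<le> 2 ^ n" by simp
    then have "l < 2 ^ n" "l' < 2 ^ n" using assms(1,2) by linarith+
    then show ?thesis by (simp add: bit_iff_odd)
  qed (rule assms(3))
qed

context relay_law begin

text \<open>The channel driven by an arbitrary function \<open>\<phi>\<close> of the past outputs.
  It detaches \<open>outputs\<close> from codes, so that phases of a transmission can be
  composed.\<close>

primrec proc :: "((nat \<Rightarrow> 'y) list \<Rightarrow> nat \<Rightarrow> 'x) \<Rightarrow> nat \<Rightarrow> (nat \<Rightarrow> 'y) list pmf" where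
  "proc \<phi> 0 = return_pmf []"
| "proc \<phi> (Suc i) = bind_pmf (proc \<phi> i) (\<lambda>ys. map_pmf (\<lambda>y. ys @ [y]) (law Ch (\<phi> ys)))"

lemma outputs_eq_proc: "outputs Ch f w n = proc (inputs Ch f w) n"
  by (induction n) simp_all

lemma length_proc: "ys \<in> set_pmf (proc \<phi> n) \<Longrightarrow> length ys = n"
  by (induction n arbitrary: ys) auto

lemma proc_cong: "(\<And>ys. length ys < n \<Longrightarrow> \<phi> ys = \<psi> ys) \<Longrightarrow> proc \<phi> n = proc \<psi> n"
proof (induction n)
  case (Suc n)
  then have IH: "proc \<phi> n = proc \<psi> n" by simp
  show ?case
    unfolding proc.simps IH using Suc.prems by (intro bind_pmf_cong refl) (simp add: length_proc)
qed simp

lemma proc_add: "proc \<phi> (a + b) = bind_pmf (proc \<phi> a) (\<lambda>ys. map_pmf ((@) ys) (proc (\<lambda>zs. \<phi> (ys @ zs)) b))"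
proof (induction b)
  case 0
  then show ?case by (simp add: bind_return_pmf')
next
  case (Suc b)
  show ?case
    by (simp add: Suc bind_assoc_pmf bind_map_pmf map_bind_pmf pmf.map_comp o_def)
qed

lemma proc_const: "proc (\<lambda>_. x) n = map_pmf (\<lambda>s. map s [0..<n]) (iid n (law Ch x))"
proof (induction n)
  case 0
  then show ?case by (simp add: iid_def map_pmf_const)
next
  case (Suc n)
  show ?case unfolding iid_Suc by (simp add: Suc)
qed

text \<open>
  A strategy gives the input of a node from its private state and what it has received so far.
  The source receives nothing and has no state.
\<close>

definition act :: "(nat \<Rightarrow> 's \<Rightarrow> 'y list \<Rightarrow> 'x) \<Rightarrow> (nat \<Rightarrow> 's) \<Rightarrow> (nat \<Rightarrow> 'y) list \<Rightarrow> nat \<Rightarrow> 'x" where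
  "act \<sigma> st ys = (\<lambda>k\<in>senders Ch. \<sigma> k (st k) (map (\<lambda>y. y k) ys))"

definition strat :: "(nat \<Rightarrow> 's \<Rightarrow> 'y list \<Rightarrow> 'x) \<Rightarrow> bool" where
  "strat \<sigma> \<longleftrightarrow> (\<forall>k\<in>senders Ch. \<forall>s ys. \<sigma> k s ys \<in> inp Ch k) \<and>
     (\<forall>s s' ys ys'. length ys = length ys' \<longrightarrow> \<sigma> 1 s ys = \<sigma> 1 s' ys')"

abbreviation "at_dest \<equiv> map (\<lambda>y. y K)"

text \<open>The second strategy may use as its state whatever the node has received in the first
  \<open>a\<close> channel uses; \<open>h1\<close> and \<open>h2\<close> produce the states of the
  two phases.\<close>

definition compose ::
  "nat \<Rightarrow> (nat \<Rightarrow> 's1 \<Rightarrow> 'y list \<Rightarrow> 'x) \<Rightarrow> ('s \<Rightarrow> 's1) \<Rightarrow> (nat \<Rightarrow> 's2 \<Rightarrow> 'y list \<Rightarrow> 'x) \<Rightarrow> ('s \<Rightarrow> 'y list \<Rightarrow> 's2)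
    \<Rightarrow> nat \<Rightarrow> 's \<Rightarrow> 'y list \<Rightarrow> 'x" where
  "compose a \<sigma>1 h1 \<sigma>2 h2 k s ys =
     (if length ys < a then \<sigma>1 k (h1 s) ys else \<sigma>2 k (h2 s (take a ys)) (drop a ys))"

lemma strat_compose: "strat \<sigma>1 \<Longrightarrow> strat \<sigma>2 \<Longrightarrow> strat (compose a \<sigma>1 h1 \<sigma>2 h2)"
  unfolding strat_def compose_def by (auto simp: Ball_def)

lemma proc_compose:
  "proc (act (compose a \<sigma>1 h1 \<sigma>2 h2) st) (a + b)
    = bind_pmf (proc (act \<sigma>1 (\<lambda>k. h1 (st k))) a)
        (\<lambda>ys. map_pmf ((@) ys) (proc (act \<sigma>2 (\<lambda>k. h2 (st k) (map (\<lambda>y. y k) ys))) b))"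
proof -
  have "proc (act (compose a \<sigma>1 h1 \<sigma>2 h2) st) a = proc (act \<sigma>1 (\<lambda>k. h1 (st k))) a"
    by (rule proc_cong) (auto simp: act_def compose_def)
  then show ?thesis
    unfolding proc_add
    by (intro bind_pmf_cong arg_cong[where f="map_pmf _"] proc_cong)
      (auto simp: act_def compose_def length_proc)
qed

text \<open>The bit is the private state of node \<open>k\<close>, and the bound is uniform over the
  states of all nodes, so that transmissions for different nodes can follow one another.\<close>

definition bitp :: "nat \<Rightarrow> nat \<Rightarrow> real \<Rightarrow> bool" where
  "bitp k d \<eta> \<longleftrightarrow> (\<exists>\<sigma> g. strat \<sigma> \<and>
     (\<forall>\<beta>. measure_pmf.prob (proc (act \<sigma> \<beta>) d) {ys. g (at_dest ys) \<noteq> (\<beta> k :: bool)} \<le> \<eta>))"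

lemma exists_XX: "\<exists>x. x \<in> XX" using set_PX set_pmf_not_empty[of PX] by blast

text \<open>Time sharing: every bit has its own phase, and the failure probabilities add up. A task
  \<open>(k, h)\<close> stands for the bit that \<open>h\<close> extracts from the state of node
  \<open>k\<close>.\<close>

lemma bits_seq:
  fixes ts :: "(nat \<times> ('s \<Rightarrow> bool)) list"
  assumes "\<And>k h. (k, h) \<in> set ts \<Longrightarrow> bitp k (D k) (E k)"
  shows "\<exists>\<sigma> G. strat \<sigma> \<and> (\<forall>st. measure_pmf.prob (proc (act \<sigma> st) (\<Sum>(k, h)\<leftarrow>ts. D k))
     {ys. G (at_dest ys) \<noteq> map (\<lambda>(k, h). h (st k)) ts} \<le> (\<Sum>(k, h)\<leftarrow>ts. E k))"
  using assms
proof (induction ts)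
  case Nil
  obtain x where "x \<in> XX" using exists_XX by blast
  then have "strat (\<lambda>k (s::'s) ys. x k)" by (auto simp: strat_def)
  then show ?case by (intro exI[of _ "\<lambda>k s ys. x k"] exI[of _ "\<lambda>_. []"]) simp
next
  case (Cons t ts)
  obtain k h where t: "t = (k, h)" by (cases t)
  have "bitp k (D k) (E k)" using Cons.prems[of k h] t by simp
  then obtain \<sigma>1 g where 1: "strat \<sigma>1"
    "\<And>\<beta>. measure_pmf.prob (proc (act \<sigma>1 \<beta>) (D k)) {ys. g (at_dest ys) \<noteq> (\<beta> k :: bool)} \<le> E k"
    unfolding bitp_def by blast
  have "\<exists>\<sigma> G. strat \<sigma> \<and> (\<forall>st. measure_pmf.prob (proc (act \<sigma> st) (\<Sum>(k, h)\<leftarrow>ts. D k))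
     {ys. G (at_dest ys) \<noteq> map (\<lambda>(k, h). h (st k)) ts} \<le> (\<Sum>(k, h)\<leftarrow>ts. E k))"
    by (rule Cons.IH) (use Cons.prems in auto)
  then obtain \<sigma>2 G where 2: "strat \<sigma>2"
    "\<And>st :: nat \<Rightarrow> 's. measure_pmf.prob (proc (act \<sigma>2 st) (\<Sum>(k, h)\<leftarrow>ts. D k))
      {ys. G (at_dest ys) \<noteq> map (\<lambda>(k, h). h (st k)) ts} \<le> (\<Sum>(k, h)\<leftarrow>ts. E k)"
    by blast
  let ?d = "\<Sum>(k, h)\<leftarrow>ts. D k"
  define \<sigma> where "\<sigma> = compose (D k) \<sigma>1 h \<sigma>2 (\<lambda>s _. s)"
  define G' where "G' ys = g (take (D k) ys) # G (drop (D k) ys)" for ys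
  have "measure_pmf.prob (proc (act \<sigma> st) (D k + ?d)) {ys. G' (at_dest ys) \<noteq> map (\<lambda>(k, h). h (st k)) (t # ts)}
      \<le> E k + (\<Sum>(k, h)\<leftarrow>ts. E k)" for st
  proof -
    let ?P1 = "proc (act \<sigma>1 (\<lambda>k. h (st k))) (D k)" and ?P2 = "proc (act \<sigma>2 st) ?d"
    have "proc (act \<sigma> st) (D k + ?d) = bind_pmf ?P1 (\<lambda>ys. map_pmf ((@) ys) ?P2)"
      unfolding \<sigma>_def by (rule proc_compose)
    also have "\<dots> = map_pmf (\<lambda>(ys, zs). ys @ zs) (pair_pmf ?P1 ?P2)"
      by (simp only: pair_pmf_def map_pmf_def bind_assoc_pmf bind_return_pmf prod.case)
    finally have "measure_pmf.prob (proc (act \<sigma> st) (D k + ?d)) {ys. G' (at_dest ys) \<noteq> map (\<lambda>(k, h). h (st k)) (t # ts)}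
       = measure_pmf.prob (pair_pmf ?P1 ?P2) {(ys, zs). G' (at_dest (ys @ zs)) \<noteq> map (\<lambda>(k, h). h (st k)) (t # ts)}"
      by (simp add: vimage_def case_prod_unfold)
    also have "\<dots> \<le> measure_pmf.prob (pair_pmf ?P1 ?P2) ((fst -` {ys. g (at_dest ys) \<noteq> h (st k)})
        \<union> (snd -` {ys. G (at_dest ys) \<noteq> map (\<lambda>(k, h). h (st k)) ts}))"
      by (rule prob_mono) (auto simp: G'_def t length_proc)
    also have "\<dots> \<le> measure_pmf.prob (map_pmf fst (pair_pmf ?P1 ?P2)) {ys. g (at_dest ys) \<noteq> h (st k)}
        + measure_pmf.prob (map_pmf snd (pair_pmf ?P1 ?P2)) {ys. G (at_dest ys) \<noteq> map (\<lambda>(k, h). h (st k)) ts}"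
      unfolding measure_map_pmf by (rule prob_Un_le)
    also have "\<dots> \<le> E k + (\<Sum>(k, h)\<leftarrow>ts. E k)"
      unfolding map_fst_pair_pmf map_snd_pair_pmf by (intro add_mono 1(2) 2(2))
    finally show ?thesis .
  qed
  moreover have "strat \<sigma>" unfolding \<sigma>_def by (rule strat_compose[OF 1(1) 2(1)])
  ultimately show ?case unfolding t by (intro exI[of _ \<sigma>] exI[of _ G']) simp
qed

text \<open>Polynomial length together with an error of order \<open>1 / N\<close> is preserved by
  one more hop, because \<open>N\<close> bits can be forwarded with parameter \<open>N ^ 2\<close>
  each. The number of blocks will be fixed from the degree \<open>e\<close>.\<close>

definition conveys :: "nat \<Rightarrow> bool" where
  "conveys k \<longleftrightarrow> (\<exists>C e. \<forall>N\<ge>1. \<exists>d \<eta>. bitp k d \<eta> \<and> real d \<le> real (C * N ^ e) \<and> \<eta> \<le> real C / real N)"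

text \<open>Hoeffding's bound, weakened by \<open>u \<le> exp u\<close> to the order
  \<open>1 / N\<close> that \<open>conveys\<close> asks for.\<close>

lemma iid_frequency_tail:
  assumes "\<theta> > 0" "N \<ge> 1"
  shows "measure_pmf.prob (iid N q) {s. \<theta> \<le> \<bar>real (card {t\<in>{..<N}. s t = v}) / real N - pmf q v\<bar>}
    \<le> 1 / (real N * \<theta>\<^sup>2)"
proof -
  interpret binomial_distribution N "pmf q v" by standard (auto simp: pmf_le_1)
  have "measure_pmf.prob (iid N q) {s. \<theta> \<le> \<bar>real (card {t\<in>{..<N}. s t = v}) / real N - pmf q v\<bar>}
    = measure_pmf.prob (binomial_pmf N (pmf q v)) {x. \<bar>real x / real N - pmf q v\<bar> \<ge> \<theta>}"
    unfolding iid_count[symmetric] by (simp add: vimage_def)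
  also have "\<dots> \<le> 2 * exp (- 2 * real N * \<theta>\<^sup>2)"
    using prob_abs_ge'[of \<theta>] assms by simp
  also have "\<dots> \<le> 2 * (1 / (2 * real N * \<theta>\<^sup>2))"
  proof -
    have "2 * real N * \<theta>\<^sup>2 > 0" using assms by simp
    moreover have "2 * real N * \<theta>\<^sup>2 \<le> exp (2 * real N * \<theta>\<^sup>2)"
      using exp_ge_add_one_self[of "2 * real N * \<theta>\<^sup>2"] by linarith
    ultimately have "1 / exp (2 * real N * \<theta>\<^sup>2) \<le> 1 / (2 * real N * \<theta>\<^sup>2)"
      by (intro divide_left_mono) auto
    from mult_left_mono[OF this, of 2] show ?thesis by (simp add: exp_minus inverse_eq_divide)
  qed
  finally show ?thesis by simp
qed

text \<open>Node \<open>k\<close> repeats one of two inputs \<open>N\<close> times, for which the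
  joint output laws on \<open>insert K B\<close> differ at some value \<open>v\<close>. A single
  receiver need not notice the difference. So each node of \<open>B\<close> forwards, for every
  time, whether its own output agrees with \<open>v\<close>, and the destination counts joint
  occurrences.\<close>

lemma conveys_step:
  assumes B: "finite B" "\<And>j. j \<in> B \<Longrightarrow> conveys j" and k: "k \<in> T2" "influences {k} (insert K B)"
  shows "conveys k"
proof -
  define V where "V = insert K B"
  obtain x a a' where x: "x \<in> XX" "a \<in> inp Ch k" "a' \<in> inp Ch k"
    "map_pmf (\<lambda>y. restrict y V) (law Ch (x(k := a))) \<noteq> map_pmf (\<lambda>y. restrict y V) (law Ch (x(k := a')))"
    using k(2) by (auto simp: influences_def V_def)
  define xb where "xb b = x(k := if b then a else a')" for b
  define q where "q b = map_pmf (\<lambda>y. restrict y V) (law Ch (xb b))" for b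
  have "q True \<noteq> q False" using x(4) by (simp add: q_def xb_def)
  then obtain v where v: "pmf (q True) v \<noteq> pmf (q False) v" by (meson pmf_eqI)
  then have "v \<in> set_pmf (q True) \<or> v \<in> set_pmf (q False)" by (auto simp: set_pmf_iff)
  then have v_ext: "restrict v V = v" by (auto simp: q_def)
  \<comment> \<open>Half the gap between the two probabilities of \<open>v\<close>: a frequency
    within \<open>\<theta>\<close> of the true one is not within \<open>\<theta>\<close> of the
    other.\<close>
  define \<theta> where "\<theta> = \<bar>pmf (q True) v - pmf (q False) v\<bar> / 2"
  have \<theta>: "\<theta> > 0" using v by (simp add: \<theta>_def)
  have k1: "k \<in> senders Ch" "k \<noteq> 1" using k(1) one_A A_T2 by (auto simp: senders_eq)
  have "\<exists>C e. \<forall>j\<in>B. \<forall>N\<ge>1. \<exists>d \<eta>. bitp j d \<eta> \<and> real d \<le> real (C j * N ^ e j) \<and> \<eta> \<le> real (C j) / real N"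
    using B(2) unfolding conveys_def by metis
  then obtain C :: "nat \<Rightarrow> nat" and e :: "nat \<Rightarrow> nat" where Ce: "\<And>j N. j \<in> B \<Longrightarrow> N \<ge> 1 \<Longrightarrow>
      \<exists>d \<eta>. bitp j d \<eta> \<and> real d \<le> real (C j * N ^ e j) \<and> \<eta> \<le> real (C j) / real N" by metis
  define c where "c = sum C B"
  define e' where "e' = sum e B"
  obtain Bl where Bl: "set Bl = B" "distinct Bl" using finite_distinct_list[OF B(1)] by blast
  have C_le: "C j \<le> c" "e j \<le> e'" if "j \<in> B" for j
    using that B(1) by (auto simp: c_def e'_def intro: member_le_sum)
  show ?thesis unfolding conveys_def
  \<comment> \<open>The degree doubles and grows by one: for each of \<open>N\<close> times the
    nodes of \<open>B\<close> forward a bit with parameter \<open>N ^ 2\<close> in place of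
    \<open>N\<close>, which leaves a total error of order \<open>1 / N\<close>.\<close>
  proof (rule exI[of _ "1 + length Bl * c + nat \<lceil>1 / \<theta>\<^sup>2\<rceil>"], rule exI[of _ "1 + 2 * e'"], intro allI impI)
    fix N :: nat assume N: "N \<ge> 1"
    have "\<exists>D E. \<forall>j\<in>B. bitp j (D j) (E j) \<and> real (D j) \<le> real (C j * (N ^ 2) ^ e j) \<and> E j \<le> real (C j) / real (N ^ 2)"
    proof -
      have "N ^ 2 \<ge> 1" using N by simp
      from Ce[OF _ this] show ?thesis by metis
    qed
    then obtain D E where DE: "\<And>j. j \<in> B \<Longrightarrow> bitp j (D j) (E j)"
      "\<And>j. j \<in> B \<Longrightarrow> real (D j) \<le> real (C j * (N ^ 2) ^ e j)" "\<And>j. j \<in> B \<Longrightarrow> E j \<le> real (C j) / real (N ^ 2)"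
      by metis
    define il where "il = List.product [0..<N] Bl"
    define ts :: "(nat \<times> ('y list \<Rightarrow> bool)) list" where "ts = map (\<lambda>(n, j). (j, \<lambda>ys. ys ! n = v j)) il"
    let ?d = "\<Sum>(k, h)\<leftarrow>ts. D k" and ?E = "\<Sum>(k, h)\<leftarrow>ts. E k"
    have "\<exists>\<sigma> G. strat \<sigma> \<and> (\<forall>st. measure_pmf.prob (proc (act \<sigma> st) ?d)
       {ys. G (at_dest ys) \<noteq> map (\<lambda>(k, h). h (st k)) ts} \<le> ?E)"
      by (rule bits_seq) (use DE(1) Bl in \<open>auto simp: ts_def il_def\<close>)
    then obtain \<sigma>2 G where 2: "strat \<sigma>2"
      "\<And>st. measure_pmf.prob (proc (act \<sigma>2 st) ?d) {ys. G (at_dest ys) \<noteq> map (\<lambda>(k, h). h (st k)) ts} \<le> ?E" by blast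
    define \<sigma>1 :: "nat \<Rightarrow> bool \<Rightarrow> 'y list \<Rightarrow> 'x" where "\<sigma>1 j b ys = (if j = k then if b then a else a' else x j)" for j b ys
    define \<sigma> where "\<sigma> = compose N \<sigma>1 (\<lambda>b. b) \<sigma>2 (\<lambda>b ys. ys)"
    define cnt where "cnt yK bs = card {n\<in>{..<N}. yK ! n = v K \<and> (\<forall>i<length il. fst (il ! i) = n \<longrightarrow> bs ! i)}"
      for yK :: "'y list" and bs
    define g where "g yK \<longleftrightarrow> \<bar>real (cnt (take N yK) (G (drop N yK))) / real N - pmf (q True) v\<bar> < \<theta>" for yK
    have strat: "strat \<sigma>"
      unfolding \<sigma>_def
      by (rule strat_compose[OF _ 2(1)]) (use x k1 in \<open>auto simp: strat_def \<sigma>1_def PiE_iff\<close>)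
    have act1: "act \<sigma>1 \<beta> = (\<lambda>_. xb (\<beta> k))" for \<beta>
      using x(1) k1 by (auto simp: act_def \<sigma>1_def xb_def fun_eq_iff PiE_def extensional_def restrict_def)
    have cnt: "cnt (at_dest ys) (map (\<lambda>(k, h). h (map (\<lambda>y. y k) ys)) ts) = card {n\<in>{..<N}. restrict (ys ! n) V = v}"
      if "length ys = N" for ys
    proof -
      have "(\<forall>i<length il. fst (il ! i) = n \<longrightarrow> map (\<lambda>(k, h). h (map (\<lambda>y. y k) ys)) ts ! i) \<longleftrightarrow> (\<forall>j\<in>B. (ys ! n) j = v j)"
        if n: "n < N" for n
      proof -
        have "(\<forall>i<length il. fst (il ! i) = n \<longrightarrow> map (\<lambda>(k, h). h (map (\<lambda>y. y k) ys)) ts ! i)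
          \<longleftrightarrow> (\<forall>p\<in>set il. fst p = n \<longrightarrow> map (\<lambda>y. y (snd p)) ys ! fst p = v (snd p))"
          by (auto simp: all_set_conv_all_nth ts_def case_prod_unfold)
        also have "\<dots> \<longleftrightarrow> (\<forall>j\<in>B. (ys ! n) j = v j)"
          using n Bl \<open>length ys = N\<close> by (auto simp: il_def)
        finally show ?thesis .
      qed
      moreover have "restrict w V = v \<longleftrightarrow> w K = v K \<and> (\<forall>j\<in>B. w j = v j)" for w
      proof -
        have "v j = undefined" if "j \<notin> V" for j using fun_cong[OF v_ext, of j] that by simp
        then show ?thesis by (auto simp: V_def fun_eq_iff restrict_def)
      qed
      ultimately show ?thesis
        unfolding cnt_def using that by (intro arg_cong[where f=card] Collect_cong) auto
    qed
    have err: "measure_pmf.prob (proc (act \<sigma> \<beta>) (N + ?d)) {ys. g (at_dest ys) \<noteq> \<beta> k} \<le> 1 / (real N * \<theta>\<^sup>2) + ?E" for \<beta>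
    proof -
      define Bad1 where "Bad1 = {ys. length ys = N \<and> \<theta> \<le> \<bar>real (card {n\<in>{..<N}. restrict (ys ! n) V = v}) / real N - pmf (q (\<beta> k)) v\<bar>}"
      let ?P1 = "proc (act \<sigma>1 \<beta>) N"
      let ?P2 = "\<lambda>ys. proc (act \<sigma>2 (\<lambda>k. map (\<lambda>y. y k) ys)) ?d"
      let ?Q = "bind_pmf ?P1 (\<lambda>ys. map_pmf (Pair ys) (?P2 ys))"
      have "proc (act \<sigma> \<beta>) (N + ?d) = bind_pmf ?P1 (\<lambda>ys. map_pmf ((@) ys) (?P2 ys))"
        unfolding \<sigma>_def by (rule proc_compose)
      also have "\<dots> = map_pmf (\<lambda>(ys, zs). ys @ zs) ?Q"
        by (simp add: map_bind_pmf pmf.map_comp o_def)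
      finally have "measure_pmf.prob (proc (act \<sigma> \<beta>) (N + ?d)) {ys. g (at_dest ys) \<noteq> \<beta> k}
         = measure_pmf.prob ?Q {(ys, zs). g (at_dest (ys @ zs)) \<noteq> \<beta> k}"
        by (simp add: vimage_def case_prod_unfold)
      also have "\<dots> \<le> measure_pmf.prob ?Q ((fst -` Bad1)
          \<union> {(ys, zs). G (at_dest zs) \<noteq> map (\<lambda>(k, h). h (map (\<lambda>y. y k) ys)) ts})"
      proof (rule prob_mono, rule ccontr)
        fix w assume w: "w \<in> set_pmf ?Q" "w \<in> {(ys, zs). g (at_dest (ys @ zs)) \<noteq> \<beta> k}"
          "w \<notin> (fst -` Bad1) \<union> {(ys, zs). G (at_dest zs) \<noteq> map (\<lambda>(k, h). h (map (\<lambda>y. y k) ys)) ts}"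
        obtain ys zs where yz: "w = (ys, zs)" by (cases w)
        have len: "length ys = N" using w(1) yz by (auto dest: length_proc)
        have ok: "G (at_dest zs) = map (\<lambda>(k, h). h (map (\<lambda>y. y k) ys)) ts"
          "\<bar>real (card {n\<in>{..<N}. restrict (ys ! n) V = v}) / real N - pmf (q (\<beta> k)) v\<bar> < \<theta>"
          using w(3) len by (auto simp: yz Bad1_def)
        have "g (at_dest (ys @ zs)) \<longleftrightarrow> \<bar>real (card {n\<in>{..<N}. restrict (ys ! n) V = v}) / real N - pmf (q True) v\<bar> < \<theta>"
          using len ok(1) cnt[OF len] by (simp add: g_def)
        also have "\<dots> \<longleftrightarrow> \<beta> k"
        proof -
          have tri: "\<theta> \<le> \<bar>X - u\<bar>" if "\<bar>X - w\<bar> < \<bar>u - w\<bar> / 2" "\<theta> = \<bar>u - w\<bar> / 2" for X u w :: real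
          proof -
            have "\<bar>u - w\<bar> \<le> \<bar>X - u\<bar> + \<bar>X - w\<bar>"
              using abs_triangle_ineq[of "u - X" "X - w"] by (simp add: abs_minus_commute)
            then show ?thesis using that by (simp add: field_simps)
          qed
          show ?thesis
          proof (cases "\<beta> k")
            case False
            have "\<theta> \<le> \<bar>real (card {n\<in>{..<N}. restrict (ys ! n) V = v}) / real N - pmf (q True) v\<bar>"
            proof (rule tri[OF _ \<theta>_def])
              show "\<bar>real (card {n\<in>{..<N}. restrict (ys ! n) V = v}) / real N - pmf (q False) v\<bar>
                  < \<bar>pmf (q True) v - pmf (q False) v\<bar> / 2"
                unfolding \<theta>_def[symmetric] using ok(2) unfolding False[THEN eq_False[THEN iffD2]] .
            qed
            with False show ?thesis by (simp only: not_less simp_thms)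
          qed (use ok(2) in simp)
        qed
        finally show False using w(2) yz by simp
      qed
      also have "\<dots> \<le> measure_pmf.prob (map_pmf fst ?Q) Bad1
          + measure_pmf.prob ?Q {(ys, zs). G (at_dest zs) \<noteq> map (\<lambda>(k, h). h (map (\<lambda>y. y k) ys)) ts}"
        unfolding measure_map_pmf by (rule prob_Un_le)
      also have "\<dots> \<le> 1 / (real N * \<theta>\<^sup>2) + ?E"
      proof (rule add_mono)
        have "map_pmf fst ?Q = ?P1"
          by (simp add: map_bind_pmf pmf.map_comp o_def map_pmf_const bind_return_pmf')
        also have "\<dots> = map_pmf (\<lambda>s. map s [0..<N]) (iid N (law Ch (xb (\<beta> k))))"
          unfolding act1 by (rule proc_const)
        finally have "measure_pmf.prob (map_pmf fst ?Q) Bad1 = measure_pmf.prob (iid N (law Ch (xb (\<beta> k))))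
            {s. \<theta> \<le> \<bar>real (card {n\<in>{..<N}. restrict (s n) V = v}) / real N - pmf (q (\<beta> k)) v\<bar>}"
          by (auto simp: Bad1_def vimage_def intro!: arg_cong2[where f=measure] Collect_cong
              arg_cong[where f="\<lambda>c. \<theta> \<le> \<bar>real (card c) / _ - _\<bar>"])
        also have "\<dots> = measure_pmf.prob (iid N (q (\<beta> k)))
            {s. \<theta> \<le> \<bar>real (card {n\<in>{..<N}. s n = v}) / real N - pmf (q (\<beta> k)) v\<bar>}"
        proof -
          have "Pi_pmf {..<N} (restrict undefined V) (\<lambda>_. q (\<beta> k)) = map_pmf (\<lambda>h. (\<lambda>y. restrict y V) \<circ> h) (iid N (law Ch (xb (\<beta> k))))"
            unfolding q_def iid_def by (rule Pi_pmf_map) auto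
          moreover have "iid N (q (\<beta> k)) = map_pmf (\<lambda>f n. if n \<in> {..<N} then f n else undefined) (Pi_pmf {..<N} (restrict undefined V) (\<lambda>_. q (\<beta> k)))"
            unfolding iid_def by (rule Pi_pmf_default_swap[symmetric]) auto
          ultimately have "iid N (q (\<beta> k)) = map_pmf (\<lambda>h n. if n < N then restrict (h n) V else undefined) (iid N (law Ch (xb (\<beta> k))))"
            by (simp add: pmf.map_comp o_def)
          then show ?thesis by (simp add: vimage_def cong: conj_cong)
        qed
        also have "\<dots> \<le> 1 / (real N * \<theta>\<^sup>2)" by (rule iid_frequency_tail[OF \<theta> N])
        finally show "measure_pmf.prob (map_pmf fst ?Q) Bad1 \<le> 1 / (real N * \<theta>\<^sup>2)" .
        show "measure_pmf.prob ?Q {(ys, zs). G (at_dest zs) \<noteq> map (\<lambda>(k, h). h (map (\<lambda>y. y k) ys)) ts} \<le> ?E"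
        proof (rule prob_bind_pmf_le)
          fix ys
          show "measure_pmf.prob (map_pmf (Pair ys) (?P2 ys)) {(ys, zs). G (at_dest zs) \<noteq> map (\<lambda>(k, h). h (map (\<lambda>y. y k) ys)) ts} \<le> ?E"
            using 2(2)[of "\<lambda>k. map (\<lambda>y. y k) ys"] by (simp add: vimage_def)
        qed
      qed
      finally show ?thesis .
    qed
    have len_il: "length il = N * length Bl" by (simp add: il_def)
    have N1: "1 \<le> N ^ i" for i using N by simp
    have "?d = (\<Sum>(n, j)\<leftarrow>il. D j)" by (simp add: ts_def o_def case_prod_unfold)
    also have "real \<dots> \<le> real (length il) * real (c * N ^ (2 * e'))"
    proof -
      have "(\<Sum>(n, j)\<leftarrow>il. D j) \<le> (\<Sum>p\<leftarrow>il. c * N ^ (2 * e'))"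
      proof (rule sum_list_mono)
        fix p assume "p \<in> set il"
        then have j: "snd p \<in> B" using Bl by (auto simp: il_def)
        have "D (snd p) \<le> C (snd p) * (N ^ 2) ^ e (snd p)" using DE(2)[OF j] by linarith
        also have "\<dots> \<le> c * N ^ (2 * e')"
          unfolding power_mult[symmetric] using C_le[OF j] N by (intro mult_mono power_increasing) auto
        finally show "(case p of (n, j) \<Rightarrow> D j) \<le> c * N ^ (2 * e')" by (simp add: case_prod_unfold)
      qed
      also have "\<dots> = length il * (c * N ^ (2 * e'))" by (simp add: sum_list_triv)
      finally show ?thesis by (metis of_nat_le_iff of_nat_mult)
    qed
    finally have d: "real ?d \<le> real (N * length Bl * (c * N ^ (2 * e')))" by (simp add: len_il)
    have "?E = (\<Sum>(n, j)\<leftarrow>il. E j)" by (simp add: ts_def o_def case_prod_unfold)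
    also have "\<dots> \<le> (\<Sum>p\<leftarrow>il. real c / real (N ^ 2))"
    proof (rule sum_list_mono)
      fix p assume "p \<in> set il"
      then have j: "snd p \<in> B" using Bl by (auto simp: il_def)
      have "E (snd p) \<le> real (C (snd p)) / real (N ^ 2)" by (rule DE(3)[OF j])
      also have "\<dots> \<le> real c / real (N ^ 2)" using C_le[OF j] by (intro divide_right_mono) auto
      finally show "(case p of (n, j) \<Rightarrow> E j) \<le> real c / real (N ^ 2)" by (simp add: case_prod_unfold)
    qed
    also have "\<dots> = real (length Bl * c) / real N"
      using N by (simp add: sum_list_triv len_il power2_eq_square)
    finally have E: "?E \<le> real (length Bl * c) / real N" .
    have "bitp k (N + ?d) (1 / (real N * \<theta>\<^sup>2) + ?E)"
      unfolding bitp_def using strat err by blast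
    moreover have "real (N + ?d) \<le> real ((1 + length Bl * c + nat \<lceil>1 / \<theta>\<^sup>2\<rceil>) * N ^ (1 + 2 * e'))"
    proof -
      have "real (N + ?d) \<le> real (N + N * length Bl * (c * N ^ (2 * e')))" using d by simp
      also have "N + N * length Bl * (c * N ^ (2 * e')) \<le> N * N ^ (2 * e') + N * length Bl * (c * N ^ (2 * e')) + nat \<lceil>1 / \<theta>\<^sup>2\<rceil> * N ^ (1 + 2 * e')"
        using mult_le_mono2[OF N1[of "2 * e'"], of N]
        by (intro of_nat_mono trans_le_add1 add_right_mono) (simp only: mult_1_right)
      also have "\<dots> = (1 + length Bl * c + nat \<lceil>1 / \<theta>\<^sup>2\<rceil>) * N ^ (1 + 2 * e')" by (simp add: algebra_simps)
      finally show ?thesis by simp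
    qed
    moreover have "1 / (real N * \<theta>\<^sup>2) + ?E \<le> real (1 + length Bl * c + nat \<lceil>1 / \<theta>\<^sup>2\<rceil>) / real N"
    proof -
      have "1 / (real N * \<theta>\<^sup>2) = (1 / \<theta>\<^sup>2) / real N" by simp
      also have "\<dots> \<le> real (nat \<lceil>1 / \<theta>\<^sup>2\<rceil>) / real N" by (intro divide_right_mono real_nat_ceiling_ge) simp
      finally have "1 / (real N * \<theta>\<^sup>2) \<le> real (nat \<lceil>1 / \<theta>\<^sup>2\<rceil>) / real N" .
      moreover have "0 \<le> 1 / real N" by simp
      moreover have "real (1 + length Bl * c + nat \<lceil>1 / \<theta>\<^sup>2\<rceil>) / real N
        = 1 / real N + real (length Bl * c) / real N + real (nat \<lceil>1 / \<theta>\<^sup>2\<rceil>) / real N"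
        by (simp only: of_nat_add add_divide_distrib of_nat_1)
      ultimately show ?thesis using E by linarith
    qed
    ultimately show "\<exists>d \<eta>. bitp k d \<eta> \<and> real d \<le> real ((1 + length Bl * c + nat \<lceil>1 / \<theta>\<^sup>2\<rceil>) * N ^ (1 + 2 * e'))
        \<and> \<eta> \<le> real (1 + length Bl * c + nat \<lceil>1 / \<theta>\<^sup>2\<rceil>) / real N" by blast
  qed
qed

text \<open>Otherwise the relays of \<open>Q\<close> that cannot convey form a nonempty set. One of
  them influences the destination and the remaining relays jointly, and could convey by one more
  hop.\<close>

lemma conveys_all:
  assumes "Q \<subseteq> T2" "\<And>S. S \<subseteq> Q \<Longrightarrow> S \<noteq> {} \<Longrightarrow> influences S (insert K (Q - S))" "k \<in> Q"
  shows "conveys k"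
proof (rule ccontr)
  assume nk: "\<not> conveys k"
  define B where "B = {k\<in>Q. conveys k}"
  have "influences (Q - B) (insert K (Q - (Q - B)))" using nk assms(3) by (intro assms(2)) (auto simp: B_def)
  moreover have "Q - (Q - B) = B" by (auto simp: B_def)
  ultimately obtain j where j: "j \<in> Q - B" "influences {j} (insert K B)" unfolding influences_def by auto
  have "finite Q" using assms(1) by (rule finite_subset) simp
  have "conveys j"
  proof (rule conveys_step[of B])
    show "finite B" using \<open>finite Q\<close> by (simp add: B_def)
    show "conveys i" if "i \<in> B" for i using that by (simp add: B_def)
    show "j \<in> T2" using j(1) assms(1) by blast
  qed (rule j(2))
  with j show False by (auto simp: B_def)
qed

text \<open>The \<open>b * N\<close> binary digits of each last index are sent one by one.
  \<open>C\<close> and \<open>e\<close> are chosen before \<open>N\<close> and \<open>L\<close>,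
  which later allows the number of blocks to depend on \<open>e\<close>.\<close>

lemma final_phase:
  fixes b :: nat
  assumes Q: "Q \<subseteq> T2" "\<And>k. k \<in> Q \<Longrightarrow> conveys k"
  shows "\<exists>C e. \<forall>N\<ge>1. \<forall>L :: nat \<Rightarrow> nat. (\<forall>k\<in>Q. 1 \<le> L k \<and> L k < 2 ^ (b * N)) \<longrightarrow>
    (\<exists>d \<sigma> g. real d \<le> real (C * N ^ e) \<and> strat \<sigma> \<and> (\<forall>k\<in>Q. \<forall>ys. g k ys \<in> {1..L k}) \<and>
      (\<forall>l. (\<forall>k\<in>Q. l k \<in> {1..L k}) \<longrightarrow>
        measure_pmf.prob (proc (act \<sigma> l) d) {ys. \<exists>k\<in>Q. g k (at_dest ys) \<noteq> l k} \<le> real C / real N))"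
proof -
  have "finite Q" using Q(1) by (rule finite_subset) simp
  then obtain Ql where Ql: "set Ql = Q" "distinct Ql" using finite_distinct_list by blast
  have "\<exists>C e. \<forall>j\<in>Q. \<forall>N\<ge>1. \<exists>d \<eta>. bitp j d \<eta> \<and> real d \<le> real (C j * N ^ e j) \<and> \<eta> \<le> real (C j) / real N"
    using Q(2) unfolding conveys_def by metis
  then obtain C :: "nat \<Rightarrow> nat" and e :: "nat \<Rightarrow> nat" where Ce: "\<And>j N. j \<in> Q \<Longrightarrow> N \<ge> 1 \<Longrightarrow>
      \<exists>d \<eta>. bitp j d \<eta> \<and> real d \<le> real (C j * N ^ e j) \<and> \<eta> \<le> real (C j) / real N" by metis
  define c where "c = sum C Q"
  define e' where "e' = sum e Q"
  have C_le: "C j \<le> c" "e j \<le> e'" if "j \<in> Q" for j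
    using that \<open>finite Q\<close> by (auto simp: c_def e'_def intro: member_le_sum)
  show ?thesis
  proof (rule exI[of _ "length Ql * b * c"], rule exI[of _ "1 + 2 * e'"], intro allI impI)
    fix N :: nat and L :: "nat \<Rightarrow> nat"
    assume N: "N \<ge> 1" and L: "\<forall>k\<in>Q. 1 \<le> L k \<and> L k < 2 ^ (b * N)"
    have "\<exists>D E. \<forall>j\<in>Q. bitp j (D j) (E j) \<and> real (D j) \<le> real (C j * (N ^ 2) ^ e j) \<and> E j \<le> real (C j) / real (N ^ 2)"
    proof -
      have "N ^ 2 \<ge> 1" using N by simp
      from Ce[OF _ this] show ?thesis by metis
    qed
    then obtain D E where DE: "\<And>j. j \<in> Q \<Longrightarrow> bitp j (D j) (E j)"
      "\<And>j. j \<in> Q \<Longrightarrow> real (D j) \<le> real (C j * (N ^ 2) ^ e j)" "\<And>j. j \<in> Q \<Longrightarrow> E j \<le> real (C j) / real (N ^ 2)"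
      by metis
    define il where "il = List.product Ql [0..<b * N]"
    define ts :: "(nat \<times> (nat \<Rightarrow> bool)) list" where "ts = map (\<lambda>(k, n). (k, \<lambda>l. bit l n)) il"
    let ?d = "\<Sum>(k, h)\<leftarrow>ts. D k" and ?E = "\<Sum>(k, h)\<leftarrow>ts. E k"
    have "\<exists>\<sigma> G. strat \<sigma> \<and> (\<forall>st. measure_pmf.prob (proc (act \<sigma> st) ?d)
       {ys. G (at_dest ys) \<noteq> map (\<lambda>(k, h). h (st k)) ts} \<le> ?E)"
      by (rule bits_seq) (use DE(1) Ql in \<open>auto simp: ts_def il_def\<close>)
    then obtain \<sigma> G where 2: "strat \<sigma>"
      "\<And>st. measure_pmf.prob (proc (act \<sigma> st) ?d) {ys. G (at_dest ys) \<noteq> map (\<lambda>(k, h). h (st k)) ts} \<le> ?E" by blast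
    define good where "good k ys l \<longleftrightarrow> l \<in> {1..L k} \<and> (\<forall>i<length il. fst (il ! i) = k \<longrightarrow> G ys ! i = bit l (snd (il ! i)))"
      for k ys l
    \<comment> \<open>Some index that matches the received bits; after transmission errors there may
      be none, and the default \<open>1\<close> keeps the estimate in range.\<close>
    define g where "g k ys = (if \<exists>l. good k ys l then SOME l. good k ys l else 1)" for k ys
    have g: "g k ys \<in> {1..L k}" if "k \<in> Q" for k ys
    proof (cases "\<exists>l. good k ys l")
      case True
      then have "good k ys (g k ys)" unfolding g_def by (simp add: someI_ex)
      then show ?thesis by (simp add: good_def)
    qed (use L that in \<open>simp add: g_def\<close>)
    have dec: "g k ys = l k" if k: "k \<in> Q" and l: "\<forall>k\<in>Q. l k \<in> {1..L k}" and G: "G ys = map (\<lambda>(k, h). h (l k)) ts" for k ys l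
    proof -
      have "good k ys (l k)" using k l by (auto simp: good_def G ts_def case_prod_unfold)
      then have sg: "good k ys (g k ys)" unfolding g_def using someI[of "good k ys" "l k"] by auto
      show ?thesis
      proof (rule bits_inject)
        show "g k ys < 2 ^ (b * N)" "l k < 2 ^ (b * N)" using g[OF k, of ys] L l k by (fastforce)+
        fix n assume n: "n < b * N"
        then have "(k, n) \<in> set il" using k Ql by (simp add: il_def)
        then obtain i where i: "i < length il" "il ! i = (k, n)" by (auto simp: in_set_conv_nth)
        then have "G ys ! i = bit (g k ys) n" using sg by (auto simp: good_def)
        moreover have "G ys ! i = bit (l k) n" using i by (simp add: G ts_def)
        ultimately show "bit (g k ys) n = bit (l k) n" by simp
      qed
    qed
    have len_il: "length il = length Ql * (b * N)" by (simp add: il_def)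
    have N1: "1 \<le> N ^ i" for i using N by simp
    have "?d = (\<Sum>(j, n)\<leftarrow>il. D j)" by (simp add: ts_def o_def case_prod_unfold)
    also have "\<dots> \<le> (\<Sum>p\<leftarrow>il. c * N ^ (2 * e'))"
    proof (rule sum_list_mono)
      fix p assume "p \<in> set il"
      then have j: "fst p \<in> Q" using Ql by (auto simp: il_def)
      have "D (fst p) \<le> C (fst p) * (N ^ 2) ^ e (fst p)" using DE(2)[OF j] by linarith
      also have "\<dots> \<le> c * N ^ (2 * e')"
        unfolding power_mult[symmetric] using C_le[OF j] N by (intro mult_mono power_increasing) auto
      finally show "(case p of (j, n) \<Rightarrow> D j) \<le> c * N ^ (2 * e')" by (simp add: case_prod_unfold)
    qed
    also have "\<dots> = length Ql * b * c * N ^ (1 + 2 * e')" by (simp add: sum_list_triv len_il algebra_simps)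
    finally have d: "real ?d \<le> real (length Ql * b * c * N ^ (1 + 2 * e'))" by (simp only: of_nat_le_iff)
    have "?E = (\<Sum>(j, n)\<leftarrow>il. E j)" by (simp add: ts_def o_def case_prod_unfold)
    also have "\<dots> \<le> (\<Sum>p\<leftarrow>il. real c / real (N ^ 2))"
    proof (rule sum_list_mono)
      fix p assume "p \<in> set il"
      then have j: "fst p \<in> Q" using Ql by (auto simp: il_def)
      have "E (fst p) \<le> real (C (fst p)) / real (N ^ 2)" by (rule DE(3)[OF j])
      also have "\<dots> \<le> real c / real (N ^ 2)" using C_le[OF j] by (intro divide_right_mono) auto
      finally show "(case p of (j, n) \<Rightarrow> E j) \<le> real c / real (N ^ 2)" by (simp add: case_prod_unfold)
    qed
    also have "\<dots> = real (length Ql * b * c) / real N"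
      using N by (simp add: sum_list_triv len_il power2_eq_square)
    finally have E: "?E \<le> real (length Ql * b * c) / real N" .
    have "measure_pmf.prob (proc (act \<sigma> l) ?d) {ys. \<exists>k\<in>Q. g k (at_dest ys) \<noteq> l k} \<le> real (length Ql * b * c) / real N"
      if l: "\<forall>k\<in>Q. l k \<in> {1..L k}" for l
    proof -
      have "measure_pmf.prob (proc (act \<sigma> l) ?d) {ys. \<exists>k\<in>Q. g k (at_dest ys) \<noteq> l k}
        \<le> measure_pmf.prob (proc (act \<sigma> l) ?d) {ys. G (at_dest ys) \<noteq> map (\<lambda>(k, h). h (l k)) ts}"
        by (rule prob_mono) (use dec[OF _ l] in blast)
      also note 2(2)
      also note E
      finally show ?thesis .
    qed
    then show "\<exists>d \<sigma> g. real d \<le> real (length Ql * b * c * N ^ (1 + 2 * e')) \<and> strat \<sigma> \<and> (\<forall>k\<in>Q. \<forall>ys. g k ys \<in> {1..L k}) \<and>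
      (\<forall>l. (\<forall>k\<in>Q. l k \<in> {1..L k}) \<longrightarrow>
        measure_pmf.prob (proc (act \<sigma> l) d) {ys. \<exists>k\<in>Q. g k (at_dest ys) \<noteq> l k} \<le> real (length Ql * b * c) / real N)"
      using d 2(1) g by blast
  qed
qed

end

section \<open>Single-letter laws of the random code\<close>

context relay_law begin

text \<open>The inputs of \<open>A\<close> in the order of \<open>\<pi>\<close>, the source at the
  head. Dropping a prefix leaves the later positions, on which the earlier ones are
  superposed.\<close>

definition xsA :: "(nat \<Rightarrow> 'x) \<Rightarrow> 'x list" where
  "xsA x = map (\<lambda>m. x (\<pi> m)) [1..<Suc K1]"

definition toA :: "'x list \<Rightarrow> nat \<Rightarrow> 'x" where
  "toA xs = (\<lambda>k\<in>A. xs ! (inv \<pi> k - 1))"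

text \<open>Law of the letters at the last \<open>j\<close> positions; the recursion on
  \<open>j\<close> runs from position \<open>K1\<close> down to the source.\<close>

definition PA :: "nat \<Rightarrow> 'x list pmf" where
  "PA j = map_pmf (\<lambda>x. drop (K1 - j) (xsA x)) p1"

text \<open>Conditional law of the letter at position \<open>K1 - length xs\<close>, given the
  letters at all later positions. The default covers lists of probability zero, where the
  conditioning is undefined.\<close>

definition next_law :: "'x list \<Rightarrow> 'x pmf" where
  "next_law xs = (if xs \<in> set_pmf (PA (length xs)) then map_pmf hd (cond_pmf (PA (Suc (length xs))) {ys. tl ys = xs})
     else return_pmf (SOME a. a \<in> inp Ch (\<pi> (K1 - length xs))))"

lemma length_xsA [simp]: "length (xsA x) = K1" by (simp add: xsA_def)

lemma xsA_nth: "m \<in> {1..K1} \<Longrightarrow> xsA x ! (m - 1) = x (\<pi> m)"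
proof -
  assume m: "m \<in> {1..K1}"
  then have "m - 1 < length [1..<Suc K1]" by auto
  then have "xsA x ! (m - 1) = x (\<pi> ([1..<Suc K1] ! (m - 1)))" unfolding xsA_def by (rule nth_map)
  also have "[1..<Suc K1] ! (m - 1) = m" using m by (subst nth_upt) auto
  finally show ?thesis .
qed

lemma A_cases: "k \<in> A \<Longrightarrow> (\<And>m. m \<in> {1..K1} \<Longrightarrow> k = \<pi> m \<Longrightarrow> thesis) \<Longrightarrow> thesis"
  by (auto simp: A_def)

lemma pi_A: "m \<in> {1..K1} \<Longrightarrow> \<pi> m \<in> A" by (auto simp: A_def)

lemma toA_xsA: "toA (xsA x) = restrict x A"
  by (rule ext) (auto simp: toA_def xsA_nth[simplified] restrict_def elim!: A_cases)

lemma xsA_toA: "length xs = K1 \<Longrightarrow> xsA (toA xs) = xs"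
  by (rule nth_equalityI) (auto simp: xsA_def toA_def pi_A simp del: upt_Suc)

lemma xsA_cong: "(\<And>k. k \<in> A \<Longrightarrow> x k = x' k) \<Longrightarrow> xsA x = xsA x'"
  by (auto simp: xsA_def pi_A simp del: upt_Suc)

lemma xsA_restrict: "A \<subseteq> V \<Longrightarrow> xsA (restrict x V) = xsA x"
  by (rule xsA_cong) auto

lemma PA_set:
  assumes "xs \<in> set_pmf (PA j)" "j \<le> K1"
  shows "length xs = j" "\<And>i. i < j \<Longrightarrow> xs ! i \<in> inp Ch (\<pi> (K1 - j + i + 1))"
proof -
  obtain x where x: "x \<in> set_pmf p1" "xs = drop (K1 - j) (xsA x)" using assms(1) by (auto simp: PA_def)
  then show "length xs = j" using assms(2) by simp
  fix i assume i: "i < j"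
  have "K1 - j + i + 1 \<in> {1..K1}" using i assms(2) by auto
  from xsA_nth[OF this, of x] have "xs ! i = x (\<pi> (K1 - j + i + 1))" using x(2) i assms(2) by simp
  moreover have "x \<in> PiE A (inp Ch)" using x(1) set_p1 by auto
  moreover have "\<pi> (K1 - j + i + 1) \<in> A" using i assms(2) by (intro pi_A) auto
  ultimately show "xs ! i \<in> inp Ch (\<pi> (K1 - j + i + 1))" by (auto simp: PiE_iff)
qed

lemma map_tl_PA: "j < K1 \<Longrightarrow> map_pmf tl (PA (Suc j)) = PA j"
  unfolding PA_def pmf.map_comp by (rule map_pmf_cong) (auto simp: tl_drop drop_Suc[symmetric] Suc_diff_Suc)

lemma PA_step:
  assumes "j < K1"
  shows "PA (Suc j) = bind_pmf (PA j) (\<lambda>xs. map_pmf (\<lambda>x. x # xs) (next_law xs))"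
proof -
  have "PA (Suc j) = bind_pmf (map_pmf tl (PA (Suc j))) (\<lambda>xs. cond_pmf (PA (Suc j)) {ys. tl ys = xs})"
    by (rule pmf_disintegrate)
  also have "\<dots> = bind_pmf (PA j) (\<lambda>xs. map_pmf (\<lambda>x. x # xs) (next_law xs))"
    unfolding map_tl_PA[OF assms]
  proof (rule bind_pmf_cong[OF refl])
    fix xs assume xs: "xs \<in> set_pmf (PA j)"
    then have len: "length xs = j" using PA_set assms by simp
    have "xs \<in> tl ` set_pmf (PA (Suc j))" using xs map_tl_PA[OF assms] by (metis set_map_pmf)
    then have ne: "set_pmf (PA (Suc j)) \<inter> {ys. tl ys = xs} \<noteq> {}" by auto
    have "map_pmf (\<lambda>x. x # xs) (next_law xs) = map_pmf (\<lambda>ys. hd ys # xs) (cond_pmf (PA (Suc j)) {ys. tl ys = xs})"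
      using xs by (simp add: next_law_def len pmf.map_comp o_def)
    also have "\<dots> = cond_pmf (PA (Suc j)) {ys. tl ys = xs}"
    proof (rule map_pmf_idI)
      fix ys assume "ys \<in> set_pmf (cond_pmf (PA (Suc j)) {ys. tl ys = xs})"
      then have "ys \<in> set_pmf (PA (Suc j))" "tl ys = xs" using ne by (auto simp: set_cond_pmf)
      moreover from this(1) have "length ys = Suc j" using PA_set(1) assms by simp
      ultimately show "hd ys # xs = ys" by (cases ys) auto
    qed
    finally show "cond_pmf (PA (Suc j)) {ys. tl ys = xs} = map_pmf (\<lambda>x. x # xs) (next_law xs)" by (rule sym)
  qed
  finally show ?thesis .
qed

lemma PA_0: "PA 0 = return_pmf []"
  by (simp add: PA_def map_pmf_const)

lemma map_toA_PA: "map_pmf toA (PA K1) = p1"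
  unfolding PA_def pmf.map_comp
  by (rule map_pmf_idI) (use set_p1 in \<open>auto simp: toA_xsA PiE_def extensional_restrict\<close>)

lemma pmf_PA_step: "j < K1 \<Longrightarrow> pmf (PA (Suc j)) (x # xs) = pmf (PA j) xs * pmf (next_law xs) x"
proof -
  assume j: "j < K1"
  have "PA (Suc j) = map_pmf (\<lambda>(xs, x). x # xs) (bind_pmf (PA j) (\<lambda>xs. map_pmf (Pair xs) (next_law xs)))"
    unfolding PA_step[OF j] by (simp add: map_bind_pmf pmf.map_comp o_def)
  then have "pmf (PA (Suc j)) (x # xs) = pmf (map_pmf (\<lambda>(xs, x). x # xs) (bind_pmf (PA j) (\<lambda>xs. map_pmf (Pair xs) (next_law xs)))) ((\<lambda>(xs, x). x # xs) (xs, x))"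
    by simp
  also have "\<dots> = pmf (bind_pmf (PA j) (\<lambda>xs. map_pmf (Pair xs) (next_law xs))) (xs, x)"
    by (rule pmf_map_inj') (auto simp: inj_def)
  finally show ?thesis by (simp only: pmf_bind_map_Pair)
qed

definition JY :: "nat \<Rightarrow> nat \<Rightarrow> ('x list \<times> 'y) pmf" where
  "JY m j = map_pmf (\<lambda>(x, y, z). (drop (K1 - j) (xsA x), y (\<pi> m))) P"

text \<open>Likelihood ratio of the output at position \<open>m\<close> for the codeword letter \<open>hd xs\<close>, given the letters \<open>tl xs\<close>.\<close>

definition lratio :: "nat \<Rightarrow> 'x list \<Rightarrow> 'y \<Rightarrow> real" where
  "lratio m xs y = (pmf (JY m (length xs)) (xs, y) / pmf (PA (length xs)) xs)
     / (pmf (JY m (length xs - 1)) (tl xs, y) / pmf (PA (length xs - 1)) (tl xs))"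

lemma lratio_nonneg: "0 \<le> lratio m xs y" by (simp add: lratio_def)

lemma nn_integral_pmf_real:
  assumes "\<And>a. 0 \<le> f a"
  shows "(\<integral>\<^sup>+a. ennreal (f a) \<partial>measure_pmf q) = (\<integral>\<^sup>+a. ennreal (pmf q a * f a) \<partial>count_space UNIV)"
  unfolding measure_pmf_eq_density using assms by (subst nn_integral_density) (auto simp: ennreal_mult)

text \<open>Integrating the ratio against \<open>q\<close> leaves the conditional mass, given
  \<open>b\<close>, of those \<open>a\<close> that \<open>q\<close> charges. This is at most 1 for
  every law \<open>q\<close> of a wrong codeword.\<close>

lemma nn_integral_likelihood_le:
  fixes J :: "('a \<times> 'b) pmf"
  shows "(\<integral>\<^sup>+a. ennreal (pmf J (a, b) / (pmf q a * pmf (map_pmf snd J) b)) \<partial>measure_pmf q) \<le> 1"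
proof (cases "pmf (map_pmf snd J) b = 0")
  case True
  then show ?thesis by simp
next
  case False
  then have pos: "pmf (map_pmf snd J) b > 0" by (simp add: pmf_nonneg order_less_le)
  have "(\<integral>\<^sup>+a. ennreal (pmf J (a, b) / (pmf q a * pmf (map_pmf snd J) b)) \<partial>measure_pmf q)
    = (\<integral>\<^sup>+a. ennreal (pmf q a * (pmf J (a, b) / (pmf q a * pmf (map_pmf snd J) b))) \<partial>count_space UNIV)"
    by (rule nn_integral_pmf_real) simp
  also have "\<dots> \<le> (\<integral>\<^sup>+a. ennreal (1 / pmf (map_pmf snd J) b) * ennreal (pmf J (a, b)) \<partial>count_space UNIV)"
  proof (intro nn_integral_mono)
    fix a :: 'a
    have "pmf q a * (pmf J (a, b) / (pmf q a * pmf (map_pmf snd J) b)) \<le> 1 / pmf (map_pmf snd J) b * pmf J (a, b)"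
      using pos by (cases "pmf q a = 0") auto
    then show "ennreal (pmf q a * (pmf J (a, b) / (pmf q a * pmf (map_pmf snd J) b)))
      \<le> ennreal (1 / pmf (map_pmf snd J) b) * ennreal (pmf J (a, b))"
      using pos by (subst ennreal_mult[symmetric]) (auto intro: ennreal_leI)
  qed
  also have "\<dots> = ennreal (1 / pmf (map_pmf snd J) b) * (\<integral>\<^sup>+a. ennreal (pmf J (a, b)) \<partial>count_space UNIV)"
    by (rule nn_integral_cmult) simp
  also have "(\<integral>\<^sup>+a. ennreal (pmf J (a, b)) \<partial>count_space UNIV) = (\<integral>\<^sup>+p. ennreal (pmf J p) \<partial>count_space (range (\<lambda>a. (a, b))))"
    by (rule nn_integral_bij_count_space[where g="\<lambda>a. (a, b)"]) (auto simp: bij_betw_def inj_on_def)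
  also have "\<dots> = emeasure J (range (\<lambda>a. (a, b)))" by (rule nn_integral_pmf)
  also have "\<dots> = ennreal (pmf (map_pmf snd J) b)"
    by (simp add: pmf_map measure_pmf.emeasure_eq_measure) (intro arg_cong[where f="measure _"], auto)
  also have "ennreal (1 / pmf (map_pmf snd J) b) * \<dots> = 1"
    using pos by (subst ennreal_mult[symmetric]) auto
  finally show ?thesis .
qed

text \<open>By \<open>pmf_PA_step\<close> the quotient of the two values of \<open>PA\<close> is
  \<open>next_law\<close>, so \<open>lratio\<close> compares a joint law with the product of
  \<open>next_law\<close> and the law of what is already known.\<close>

lemma lratio_mean_le:
  assumes "xs \<in> set_pmf (PA j)" "j < K1"
  shows "(\<integral>\<^sup>+x. ennreal (lratio m (x # xs) y) \<partial>measure_pmf (next_law xs)) \<le> 1"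
proof -
  have len: "length xs = j" using PA_set assms by simp
  have pos: "pmf (PA j) xs > 0" using assms(1) by (rule pmf_positive)
  define J where "J = map_pmf (\<lambda>(x, y, z). (xsA x ! (K1 - Suc j), drop (K1 - j) (xsA x), y (\<pi> m))) P"
  have J1: "pmf (JY m (Suc j)) (x # xs, y) = pmf J (x, (xs, y))" for x
  proof -
    have "JY m (Suc j) = map_pmf (\<lambda>(x, xs, y). (x # xs, y)) J"
      unfolding JY_def J_def pmf.map_comp
      by (rule map_pmf_cong)
        (use assms(2) Cons_nth_drop_Suc[of "K1 - Suc j" "xsA _"] in \<open>auto simp: Suc_diff_Suc\<close>)
    then have "pmf (JY m (Suc j)) (x # xs, y) = pmf (map_pmf (\<lambda>(x, xs, y). (x # xs, y)) J) ((\<lambda>(x, xs, y). (x # xs, y)) (x, xs, y))" by simp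
    also have "\<dots> = pmf J (x, (xs, y))" by (rule pmf_map_inj') (auto simp: inj_def)
    finally show ?thesis .
  qed
  have J2: "map_pmf snd J = JY m j" by (simp add: J_def JY_def pmf.map_comp o_def case_prod_unfold)
  have "lratio m (x # xs) y \<le> pmf J (x, (xs, y)) / (pmf (next_law xs) x * pmf (map_pmf snd J) (xs, y))" for x
    using pos by (simp add: lratio_def len J1 J2 pmf_PA_step[OF assms(2)] field_simps)
  then have "(\<integral>\<^sup>+x. ennreal (lratio m (x # xs) y) \<partial>measure_pmf (next_law xs))
    \<le> (\<integral>\<^sup>+x. ennreal (pmf J (x, (xs, y)) / (pmf (next_law xs) x * pmf (map_pmf snd J) (xs, y))) \<partial>measure_pmf (next_law xs))"
    by (intro nn_integral_mono ennreal_leI)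
  also have "\<dots> \<le> 1" by (rule nn_integral_likelihood_le)
  finally show ?thesis .
qed

text \<open>\<open>P(z|x)\<close>, the law of the quantization codebooks.\<close>

definition pzx :: "nat \<Rightarrow> 'x \<Rightarrow> 'z pmf" where
  "pzx k x0 = (if x0 \<in> set_pmf (px k) then map_pmf (\<lambda>(x, y, z). z k) (cond_pmf P {\<omega>. fst \<omega> k = x0})
     else return_pmf (SOME z. z \<in> Z k))"

lemma map_XZ:
  assumes "k \<in> T2"
  shows "map_pmf (\<lambda>(x, y, z). (x k, z k)) P = bind_pmf (px k) (\<lambda>x. map_pmf (Pair x) (pzx k x))"
proof -
  have m: "map_pmf (\<lambda>\<omega>. fst \<omega> k) P = px k" using map_X1[OF assms] by (simp add: case_prod_unfold)
  have "P = bind_pmf (px k) (\<lambda>x0. cond_pmf P {\<omega>. fst \<omega> k = x0})"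
    using pmf_disintegrate[of P "\<lambda>\<omega>. fst \<omega> k"] unfolding m .
  then have "map_pmf (\<lambda>(x, y, z). (x k, z k)) P = map_pmf (\<lambda>(x, y, z). (x k, z k)) (bind_pmf (px k) (\<lambda>x0. cond_pmf P {\<omega>. fst \<omega> k = x0}))"
    by simp
  also have "\<dots> = bind_pmf (px k) (\<lambda>x0. map_pmf (\<lambda>(x, y, z). (x k, z k)) (cond_pmf P {\<omega>. fst \<omega> k = x0}))"
    by (rule map_bind_pmf)
  also have "\<dots> = bind_pmf (px k) (\<lambda>x. map_pmf (Pair x) (pzx k x))"
  proof (rule bind_pmf_cong[OF refl])
    fix x0 assume x0: "x0 \<in> set_pmf (px k)"
    then have "x0 \<in> (\<lambda>\<omega>. fst \<omega> k) ` set_pmf P" using m by (metis set_map_pmf)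
    then have ne: "set_pmf P \<inter> {\<omega>. fst \<omega> k = x0} \<noteq> {}" by auto
    then have fib: "fst \<omega> k = x0" if "\<omega> \<in> set_pmf (cond_pmf P {\<omega>. fst \<omega> k = x0})" for \<omega>
      using that unfolding set_cond_pmf[OF ne] by simp
    have "map_pmf (\<lambda>(x, y, z). (x k, z k)) (cond_pmf P {\<omega>. fst \<omega> k = x0})
      = map_pmf (\<lambda>(x, y, z). (x0, z k)) (cond_pmf P {\<omega>. fst \<omega> k = x0})"
      by (rule map_pmf_cong[OF refl]) (metis (mono_tags, lifting) case_prod_unfold fib)
    also have "\<dots> = map_pmf (Pair x0) (pzx k x0)"
      using x0 by (simp only: pzx_def if_True pmf.map_comp) (simp add: o_def case_prod_unfold)
    finally show "map_pmf (\<lambda>(x, y, z). (x k, z k)) (cond_pmf P {\<omega>. fst \<omega> k = x0}) = map_pmf (Pair x0) (pzx k x0)" .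
  qed
  finally show ?thesis .
qed

lemma set_pzx: "k \<in> T2 \<Longrightarrow> set_pmf (pzx k x) \<subseteq> Z k"
proof (cases "x \<in> set_pmf (px k)")
  case True
  assume k: "k \<in> T2"
  show ?thesis
  proof
    fix z assume "z \<in> set_pmf (pzx k x)"
    then have "(x, z) \<in> set_pmf (map_pmf (\<lambda>(x, y, z). (x k, z k)) P)" unfolding map_XZ[OF k] using True by auto
    then show "z \<in> Z k" using supp k by (fastforce simp: PiE_iff)
  qed
next
  case False
  assume "k \<in> T2"
  then have "(SOME z. z \<in> Z k) \<in> Z k" using Z_nonempty by (simp add: some_in_eq)
  with False show ?thesis by (simp add: pzx_def)
qed

definition zxl :: "nat \<Rightarrow> ('x, 'y, 'z) sample \<Rightarrow> real" where
  "zxl k = (\<lambda>(x, y, z). log 2 (pmf (pzx k (x k)) (z k)))"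

lemma pzx_pos: "(x, y, z) \<in> set_pmf P \<Longrightarrow> k \<in> T2 \<Longrightarrow> pmf (pzx k (x k)) (z k) > 0"
proof -
  assume P: "(x, y, z) \<in> set_pmf P" and k: "k \<in> T2"
  have "(x k, z k) \<in> set_pmf (map_pmf (\<lambda>(x, y, z). (x k, z k)) P)" using P by force
  then show ?thesis unfolding map_XZ[OF k] by (auto intro: pmf_positive)
qed

text \<open>\<open>I(Z\<^sub>k;Y\<^sub>k|X\<^sub>k)\<close>, the rate of quantizer \<open>k\<close>.\<close>

definition qrate :: "nat \<Rightarrow> real" where "qrate k = mean P (zl k) - mean P (zxl k)"

end

section \<open>The random code\<close>

text \<open>
  All randomness is one family of independent letters: a fresh letter of the superposition codebook for
  every choice of the letters above it (\<open>RG\<close>), the codewords of the quantize-forward relays (\<open>RX\<close>), a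
  quantization letter for every channel input letter (\<open>RZ\<close>), and the outputs for every vector of inputs
  (\<open>RN\<close>). The first two arguments are the block and the position in it.
\<close>

datatype 'x ridx = RG nat nat "nat list" "'x list" | RX nat nat nat nat | RZ nat nat nat nat nat 'x
  | RN nat nat "nat \<Rightarrow> 'x"

datatype ('x, 'y, 'z) rval = VX (valX: 'x) | VZ (valZ: 'z) | VY (valY: "nat \<Rightarrow> 'y")

type_synonym ('x, 'y, 'z) outcome = "'x ridx \<Rightarrow> ('x, 'y, 'z) rval"

text \<open>The list is built from the last message to the first: the letter for
  \<open>v # u\<close> is superposed on those for \<open>u\<close>. Its index records both the
  messages and the letters above, so that each random letter has a fixed law.\<close>

primrec cxl :: "(nat list \<Rightarrow> 'x list \<Rightarrow> 'x) \<Rightarrow> nat list \<Rightarrow> 'x list" where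
  "cxl G [] = []"
| "cxl G (v # u) = G (v # u) (cxl G u) # cxl G u"

lemma length_cxl [simp]: "length (cxl G u) = length u" by (induction u) auto

lemma drop_cxl: "drop n (cxl G u) = cxl G (drop n u)"
  by (induction u arbitrary: n) (auto split: nat.splits simp: drop_Cons)

lemma cxl_cong: "(\<And>n xs. n < length u \<Longrightarrow> G (drop n u) xs = G' (drop n u) xs) \<Longrightarrow> cxl G u = cxl G' u"
proof (induction u)
  case (Cons v u)
  have "cxl G u = cxl G' u" by (rule Cons.IH) (use Cons.prems[of "Suc _"] in auto)
  then show ?case using Cons.prems[of 0] by simp
qed simp

locale random_code = relay_law Ch \<pi> K1 Z P p1 px pz
  for Ch :: "('x, 'y) relay_channel" and \<pi> K1 Z and P :: "('x, 'y, 'z) sample pmf" and p1 px pz +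
  fixes N nb msg :: nat and L :: "nat \<Rightarrow> nat" and Q :: "nat set" and dq dd :: real
  assumes Q: "Q \<subseteq> T2" and N: "1 \<le> N" and nb: "1 \<le> nb" and msg: "1 \<le> msg"
    and L: "\<And>k. k \<in> T2 \<Longrightarrow> 1 \<le> L k"
    and dq: "0 < dq" and dd: "0 < dd"
begin

definition B :: nat where "B = nb + K1 - 1"

definition XS :: "'x set" where "XS = (\<Union>k\<in>senders Ch. inp Ch k)"

text \<open>Finiteness of the index set is what the product law requires; the ranges are wide enough
  for all letters whose law is used below.\<close>

primrec used :: "'x ridx \<Rightarrow> bool" where
  "used (RG c t u xs) \<longleftrightarrow> c \<in> {1..B} \<and> t < N \<and> set u \<subseteq> {1..msg} \<and> length u \<le> K1 \<and> set xs \<subseteq> XS \<and> length xs \<le> K1"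
| "used (RX c t k l) \<longleftrightarrow> c \<in> {1..B} \<and> t < N \<and> k \<in> T2 \<and> l \<in> {1..L k}"
| "used (RZ c t k l l' x) \<longleftrightarrow> c \<in> {1..B} \<and> t < N \<and> k \<in> T2 \<and> l \<in> {1..L k} \<and> l' \<in> {1..L k} \<and> x \<in> XS"
| "used (RN c t xv) \<longleftrightarrow> c \<in> {1..B} \<and> t < N \<and> xv \<in> XX"

definition IX :: "'x ridx set" where "IX = Collect used"

lemma IX_iff [simp]: "i \<in> IX \<longleftrightarrow> used i" by (simp add: IX_def)

lemma finite_XS [simp]: "finite XS" unfolding XS_def by (auto intro: finite_inp)

lemma finite_IX [simp]: "finite IX"
proof (rule finite_subset)
  let ?U = "(\<lambda>(c, t, u, xs). RG c t u xs) `
      ({1..B} \<times> {..<N} \<times> {u. set u \<subseteq> {1..msg} \<and> length u \<le> K1} \<times> {xs. set xs \<subseteq> XS \<and> length xs \<le> K1})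
    \<union> (\<lambda>(c, t, k, l). RX c t k l) ` ({1..B} \<times> {..<N} \<times> (SIGMA k:T2. {1..L k}))
    \<union> (\<lambda>(c, t, k, l, l', x). RZ c t k l l' x) ` ({1..B} \<times> {..<N} \<times> (SIGMA k:T2. {1..L k} \<times> {1..L k} \<times> XS))
    \<union> (\<lambda>(c, t, x). RN c t x) ` ({1..B} \<times> {..<N} \<times> XX)"
  show "IX \<subseteq> ?U"
  proof
    fix i assume "i \<in> IX"
    then show "i \<in> ?U" by (cases i) (force simp: image_iff)+
  qed
  show "finite ?U"
    by (intro finite_UnI finite_imageI finite_cartesian_product finite_SigmaI finite_lists_length_le) auto
qed

primrec lawI :: "'x ridx \<Rightarrow> ('x, 'y, 'z) rval pmf" where
  "lawI (RG c t u xs) = map_pmf VX (next_law xs)"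
| "lawI (RX c t k l) = map_pmf VX (px k)"
| "lawI (RZ c t k l l' x) = map_pmf VZ (pzx k x)"
| "lawI (RN c t xv) = map_pmf VY (law Ch xv)"

definition \<Omega> :: "('x, 'y, 'z) outcome pmf" where "\<Omega> = Pi_pmf IX undefined lawI"

lemma \<Omega>_component: "i \<in> IX \<Longrightarrow> map_pmf (\<lambda>\<omega>. \<omega> i) \<Omega> = lawI i"
  unfolding \<Omega>_def by (simp add: Pi_pmf_component)

lemma set_\<Omega>: "\<omega> \<in> set_pmf \<Omega> \<Longrightarrow> i \<in> IX \<Longrightarrow> \<omega> i \<in> set_pmf (lawI i)"
  unfolding \<Omega>_def by (subst (asm) set_Pi_pmf) (auto simp: PiE_dflt_def)

definition cw :: "('x, 'y, 'z) outcome \<Rightarrow> nat \<Rightarrow> nat \<Rightarrow> nat list \<Rightarrow> 'x list" where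
  "cw \<omega> c t u = cxl (\<lambda>u xs. valX (\<omega> (RG c t u xs))) u"

lemma length_cw [simp]: "length (cw \<omega> c t u) = length u" by (simp add: cw_def)

lemma cw_Cons: "cw \<omega> c t (v # u) = valX (\<omega> (RG c t (v # u) (cw \<omega> c t u))) # cw \<omega> c t u"
  by (simp add: cw_def)

lemma drop_cw: "drop n (cw \<omega> c t u) = cw \<omega> c t (drop n u)"
  by (simp add: cw_def drop_cxl)

lemma cw_depends: "depends_on {RG c t (drop n u) xs |n xs. n < length u} (\<lambda>\<omega>. cw \<omega> c t u)"
proof (rule depends_onI)
  fix a b :: "('x, 'y, 'z) outcome"
  assume ab: "\<And>i. i \<in> {RG c t (drop n u) xs |n xs. n < length u} \<Longrightarrow> a i = b i"
  show "cw a c t u = cw b c t u" unfolding cw_def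
  proof (rule cxl_cong)
    fix n xs assume "n < length u"
    then show "valX (a (RG c t (drop n u) xs)) = valX (b (RG c t (drop n u) xs))"
      by (intro arg_cong[where f=valX] ab) blast
  qed
qed

lemma depends_on_mono: "depends_on D f \<Longrightarrow> D \<subseteq> D' \<Longrightarrow> depends_on D' f"
  unfolding depends_on_def by blast

lemma pi_senders: "m \<in> {1..K1} \<Longrightarrow> \<pi> m \<in> senders Ch"
  using pi_A A_senders by blast

lemma PA_XS: "xs \<in> set_pmf (PA j) \<Longrightarrow> j \<le> K1 \<Longrightarrow> set xs \<subseteq> XS"
proof
  fix x assume xs: "xs \<in> set_pmf (PA j)" "j \<le> K1" and "x \<in> set xs"
  then obtain i where i: "i < j" "x = xs ! i" using PA_set(1)[OF xs] by (auto simp: in_set_conv_nth)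
  have "\<pi> (K1 - j + i + 1) \<in> senders Ch" using i xs(2) by (intro pi_senders) auto
  then show "x \<in> XS" using PA_set(2)[OF xs i(1)] i(2) unfolding XS_def by blast
qed

text \<open>Induction along the superposition: the letters above carry shorter message lists in
  their indices, so the new letter is independent of them and its index can be frozen at their
  values.\<close>

lemma cw_law:
  assumes "c \<in> {1..B}" "t < N" "set u \<subseteq> {1..msg}" "length u \<le> K1"
  shows "map_pmf (\<lambda>\<omega>. cw \<omega> c t u) \<Omega> = PA (length u)"
  using assms(3,4)
proof (induction u)
  case Nil
  then show ?case by (simp add: cw_def PA_0 map_pmf_const)
next
  case (Cons v u)
  let ?D = "{RG c t (v # u) xs |xs. True}"
  have IH: "map_pmf (\<lambda>\<omega>. cw \<omega> c t u) \<Omega> = PA (length u)" using Cons by simp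
  have "map_pmf (\<lambda>\<omega>. cw \<omega> c t (v # u)) \<Omega> = map_pmf (\<lambda>(xs, x). x # xs)
      (map_pmf (\<lambda>\<omega>. (cw \<omega> c t u, valX (\<omega> (RG c t (v # u) (cw \<omega> c t u))))) \<Omega>)"
    by (simp add: pmf.map_comp o_def cw_Cons)
  also have "map_pmf (\<lambda>\<omega>. (cw \<omega> c t u, valX (\<omega> (RG c t (v # u) (cw \<omega> c t u))))) \<Omega>
      = bind_pmf (map_pmf (\<lambda>\<omega>. cw \<omega> c t u) \<Omega>) (\<lambda>xs. map_pmf (\<lambda>\<omega>. (xs, valX (\<omega> (RG c t (v # u) xs)))) \<Omega>)"
    unfolding \<Omega>_def
  proof (rule Pi_pmf_disintegrate[OF finite_IX])
    show "depends_on (- ?D) (\<lambda>\<omega>. cw \<omega> c t u)"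
    proof (rule depends_on_mono[OF cw_depends])
      have "length (drop n u) \<noteq> length (v # u)" for n by simp
      then have ne: "drop n u \<noteq> v # u" for n by metis
      show "{RG c t (drop n u) xs |n xs. n < length u} \<subseteq> - ?D"
      proof (rule subsetI, rule ComplI)
        fix i assume "i \<in> {RG c t (drop n u) xs |n xs. n < length u}" "i \<in> ?D"
        then obtain n where "drop n u = v # u" by auto
        with ne show False by simp
      qed
    qed
    show "depends_on ?D (\<lambda>\<omega>. valX (\<omega> (RG c t (v # u) h)))" for h by (rule depends_onI) auto
  qed
  also have "\<dots> = bind_pmf (PA (length u)) (\<lambda>xs. map_pmf (Pair xs) (next_law xs))"
    unfolding IH
  proof (rule bind_pmf_cong[OF refl])
    fix xs assume xs: "xs \<in> set_pmf (PA (length u))"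
    have "RG c t (v # u) xs \<in> IX"
      using assms(1,2) Cons.prems PA_XS[OF xs] PA_set(1)[OF xs] by auto
    then have "map_pmf (Pair xs \<circ> valX) (map_pmf (\<lambda>\<omega>. \<omega> (RG c t (v # u) xs)) \<Omega>) = map_pmf (Pair xs) (next_law xs)"
      by (simp add: \<Omega>_component pmf.map_comp o_def)
    then show "map_pmf (\<lambda>\<omega>. (xs, valX (\<omega> (RG c t (v # u) xs)))) \<Omega> = map_pmf (Pair xs) (next_law xs)"
      by (simp add: pmf.map_comp o_def)
  qed
  finally show ?case using Cons.prems by (simp add: PA_step map_bind_pmf pmf.map_comp o_def)
qed

text \<open>Channel inputs for an arbitrary list \<open>u\<close> of short messages and arbitrary
  indices \<open>l'\<close>. Wrong hypotheses of the destination are thus expressed by the same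
  function as the true transmission.\<close>

definition tx :: "('x, 'y, 'z) outcome \<Rightarrow> nat \<Rightarrow> nat \<Rightarrow> nat list \<Rightarrow> (nat \<Rightarrow> nat) \<Rightarrow> nat \<Rightarrow> 'x" where
  "tx \<omega> c t u l' = glue (toA (cw \<omega> c t u), \<lambda>k. valX (\<omega> (RX c t k (l' k))))"

definition ty :: "('x, 'y, 'z) outcome \<Rightarrow> nat \<Rightarrow> nat \<Rightarrow> nat list \<Rightarrow> (nat \<Rightarrow> nat) \<Rightarrow> nat \<Rightarrow> 'y" where
  "ty \<omega> c t u l' = valY (\<omega> (RN c t (tx \<omega> c t u l')))"

definition tz :: "('x, 'y, 'z) outcome \<Rightarrow> nat \<Rightarrow> nat \<Rightarrow> (nat \<Rightarrow> nat) \<Rightarrow> (nat \<Rightarrow> 'x) \<Rightarrow> nat \<Rightarrow> nat \<Rightarrow> 'z" where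
  "tz \<omega> c t l' x k l = valZ (\<omega> (RZ c t k l (l' k) (x k)))"

lemma glue_cong: "(\<And>k. k \<in> A \<Longrightarrow> a k = a' k) \<Longrightarrow> (\<And>k. k \<in> T2 \<Longrightarrow> b k = b' k) \<Longrightarrow> glue (a, b) = glue (a', b')"
  by (auto simp: glue_def fun_eq_iff restrict_def senders_eq)

text \<open>\<open>dG\<close>, \<open>dX\<close>, \<open>dN\<close> and \<open>dZ\<close> enclose
  the indices read by superposed codewords, relay codewords, channel noise and quantization
  codebooks. Independence is later checked as disjointness of such sets.\<close>

definition dG :: "nat \<Rightarrow> nat \<Rightarrow> nat list \<Rightarrow> 'x ridx set" where
  "dG c t u = {RG c t (drop n u) xs |n xs. n < length u}"

definition dX :: "nat \<Rightarrow> nat \<Rightarrow> (nat \<Rightarrow> nat) \<Rightarrow> 'x ridx set" where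
  "dX c t l' = {RX c t k (l' k) |k. k \<in> T2}"

definition dN :: "nat \<Rightarrow> nat \<Rightarrow> 'x ridx set" where "dN c t = {RN c t x |x. True}"

definition dZ :: "nat \<Rightarrow> nat \<Rightarrow> (nat \<Rightarrow> nat) \<Rightarrow> 'x ridx set" where
  "dZ c t l' = {RZ c t k l (l' k) x |k l x. True}"

lemma tx_depends: "depends_on (dG c t u \<union> dX c t l') (\<lambda>\<omega>. tx \<omega> c t u l')"
proof (rule depends_onI)
  fix a b :: "('x, 'y, 'z) outcome" assume ab: "\<And>i. i \<in> dG c t u \<union> dX c t l' \<Longrightarrow> a i = b i"
  have "cw a c t u = cw b c t u"
    by (rule depends_onD[OF cw_depends]) (rule ab, simp add: dG_def)
  moreover have "valX (a (RX c t k (l' k))) = valX (b (RX c t k (l' k)))" if "k \<in> T2" for k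
    using ab[of "RX c t k (l' k)"] that by (auto simp: dX_def)
  ultimately show "tx a c t u l' = tx b c t u l'" unfolding tx_def by (intro glue_cong) auto
qed

lemma ty_depends: "depends_on (dG c t u \<union> dX c t l' \<union> dN c t) (\<lambda>\<omega>. ty \<omega> c t u l')"
proof (rule depends_onI)
  fix a b :: "('x, 'y, 'z) outcome" assume ab: "\<And>i. i \<in> dG c t u \<union> dX c t l' \<union> dN c t \<Longrightarrow> a i = b i"
  have "tx a c t u l' = tx b c t u l'" by (rule depends_onD[OF tx_depends]) (simp add: ab)
  then show "ty a c t u l' = ty b c t u l'" unfolding ty_def using ab by (simp add: dN_def)
qed

lemma tx_law:
  assumes "c \<in> {1..B}" "t < N" "set u \<subseteq> {1..msg}" "length u = K1" "\<And>k. k \<in> T2 \<Longrightarrow> l' k \<in> {1..L k}"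
  shows "map_pmf (\<lambda>\<omega>. tx \<omega> c t u l') \<Omega> = PX"
proof -
  let ?f = "\<lambda>\<omega>. toA (cw \<omega> c t u)" and ?g = "\<lambda>\<omega> k. if k \<in> T2 then valX (\<omega> (RX c t k (l' k))) else undefined"
  have "map_pmf (\<lambda>\<omega>. tx \<omega> c t u l') \<Omega> = map_pmf glue (map_pmf (\<lambda>\<omega>. (?f \<omega>, ?g \<omega>)) \<Omega>)"
    by (auto simp: pmf.map_comp o_def tx_def intro!: map_pmf_cong glue_cong)
  also have "map_pmf (\<lambda>\<omega>. (?f \<omega>, ?g \<omega>)) \<Omega> = pair_pmf (map_pmf ?f \<Omega>) (map_pmf ?g \<Omega>)"
    unfolding \<Omega>_def
  proof (rule Pi_pmf_indep[OF finite_IX, of "dX c t l'"])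
    have "depends_on (- dX c t l') (\<lambda>\<omega>. cw \<omega> c t u)"
      by (rule depends_on_mono[OF cw_depends]) (auto simp: dX_def)
    then show "depends_on (- dX c t l') ?f" unfolding depends_on_def by metis
    show "depends_on (dX c t l') ?g" by (rule depends_onI) (auto simp: dX_def fun_eq_iff)
  qed
  also have "map_pmf ?f \<Omega> = p1"
  proof -
    have "map_pmf ?f \<Omega> = map_pmf toA (map_pmf (\<lambda>\<omega>. cw \<omega> c t u) \<Omega>)" by (simp add: pmf.map_comp o_def)
    also have "\<dots> = p1" using cw_law[OF assms(1-3)] assms(4) map_toA_PA by simp
    finally show ?thesis .
  qed
  also have "map_pmf ?g \<Omega> = Pi_pmf T2 undefined px"
  proof -
    have "map_pmf ?g \<Omega> = Pi_pmf T2 undefined (\<lambda>k. map_pmf (\<lambda>\<omega>. valX (\<omega> (RX c t k (l' k)))) \<Omega>)"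
      unfolding \<Omega>_def
      by (rule Pi_pmf_parts[OF finite_IX finite_T2, where D="\<lambda>k. {RX c t k (l' k)}"]) (auto intro: depends_onI)
    also have "\<dots> = Pi_pmf T2 undefined px"
    proof (rule Pi_pmf_cong[OF refl refl])
      fix k assume k: "k \<in> T2"
      have "map_pmf valX (map_pmf (\<lambda>\<omega>. \<omega> (RX c t k (l' k))) \<Omega>) = px k"
        using assms k by (subst \<Omega>_component) (auto simp: pmf.map_comp o_def pmf.map_ident)
      then show "map_pmf (\<lambda>\<omega>. valX (\<omega> (RX c t k (l' k)))) \<Omega> = px k" by (simp add: pmf.map_comp o_def)
    qed
    finally show ?thesis .
  qed
  finally show ?thesis by (simp add: PX_def)
qed

text \<open>The noise letter is selected by the input vector, which reads no noise; once that vector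
  is frozen, the letter has law \<open>law Ch x\<close>.\<close>

lemma txy_law:
  assumes "c \<in> {1..B}" "t < N" "set u \<subseteq> {1..msg}" "length u = K1" "\<And>k. k \<in> T2 \<Longrightarrow> l' k \<in> {1..L k}"
  shows "map_pmf (\<lambda>\<omega>. (tx \<omega> c t u l', ty \<omega> c t u l')) \<Omega> = PXY"
proof -
  have "map_pmf (\<lambda>\<omega>. (tx \<omega> c t u l', ty \<omega> c t u l')) \<Omega>
    = bind_pmf (map_pmf (\<lambda>\<omega>. tx \<omega> c t u l') \<Omega>) (\<lambda>x. map_pmf (\<lambda>\<omega>. (x, valY (\<omega> (RN c t x)))) \<Omega>)"
    unfolding \<Omega>_def ty_def
  proof (rule Pi_pmf_disintegrate[OF finite_IX, of "dN c t"])
    show "depends_on (- dN c t) (\<lambda>\<omega>. tx \<omega> c t u l')"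
      by (rule depends_on_mono[OF tx_depends]) (auto simp: dX_def dG_def dN_def)
    show "depends_on (dN c t) (\<lambda>\<omega>. valY (\<omega> (RN c t h)))" for h by (rule depends_onI) (auto simp: dN_def)
  qed
  also have "map_pmf (\<lambda>\<omega>. tx \<omega> c t u l') \<Omega> = PX" by (rule tx_law[OF assms])
  also have "bind_pmf PX (\<lambda>x. map_pmf (\<lambda>\<omega>. (x, valY (\<omega> (RN c t x)))) \<Omega>) = PXY" unfolding PXY_def
  proof (rule bind_pmf_cong[OF refl])
    fix x assume "x \<in> set_pmf PX"
    then have "RN c t x \<in> IX" using assms set_PX by auto
    then have "map_pmf (Pair x \<circ> valY) (map_pmf (\<lambda>\<omega>. \<omega> (RN c t x)) \<Omega>) = map_pmf (Pair x) (law Ch x)"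
      by (simp add: \<Omega>_component pmf.map_comp o_def)
    then show "map_pmf (\<lambda>\<omega>. (x, valY (\<omega> (RN c t x)))) \<Omega> = map_pmf (Pair x) (law Ch x)"
      by (simp add: pmf.map_comp o_def)
  qed
  finally show ?thesis .
qed

lemma z_law:
  assumes "finite J" "c \<in> {1..B}" "t < N" "\<And>k. k \<in> T2 \<Longrightarrow> l' k \<in> {1..L k}"
    "\<And>j. j \<in> J \<Longrightarrow> kk j \<in> T2 \<and> ll j \<in> {1..L (kk j)}" "inj_on (\<lambda>j. (kk j, ll j)) J" "x \<in> XX"
  shows "map_pmf (\<lambda>\<omega> j. if j \<in> J then tz \<omega> c t l' x (kk j) (ll j) else undefined) \<Omega>
    = Pi_pmf J undefined (\<lambda>j. pzx (kk j) (x (kk j)))"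
proof -
  let ?i = "\<lambda>j. RZ c t (kk j) (ll j) (l' (kk j)) (x (kk j))"
  have "map_pmf (\<lambda>\<omega> j. if j \<in> J then tz \<omega> c t l' x (kk j) (ll j) else undefined) \<Omega>
    = Pi_pmf J undefined (\<lambda>j. map_pmf (\<lambda>\<omega>. tz \<omega> c t l' x (kk j) (ll j)) \<Omega>)"
    unfolding \<Omega>_def
    by (rule Pi_pmf_parts[OF finite_IX assms(1), where D="\<lambda>j. {?i j}"])
      (use assms(6) in \<open>auto intro: depends_onI simp: tz_def inj_on_def\<close>)
  also have "\<dots> = Pi_pmf J undefined (\<lambda>j. pzx (kk j) (x (kk j)))"
  proof (rule Pi_pmf_cong[OF refl refl])
    fix j assume j: "j \<in> J"
    have "x (kk j) \<in> XS" using assms(5)[OF j] assms(7) unfolding XS_def senders_eq by auto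
    then have "?i j \<in> IX" using assms j by auto
    then have "map_pmf valZ (map_pmf (\<lambda>\<omega>. \<omega> (?i j)) \<Omega>) = pzx (kk j) (x (kk j))"
      by (simp add: \<Omega>_component pmf.map_comp o_def pmf.map_ident)
    then show "map_pmf (\<lambda>\<omega>. tz \<omega> c t l' x (kk j) (ll j)) \<Omega> = pzx (kk j) (x (kk j))"
      by (simp add: tz_def pmf.map_comp o_def)
  qed
  finally show ?thesis .
qed

end

section \<open>Typical blocks and quantizer failures\<close>

lemma Pi_pmf_map_dep:
  assumes "finite J"
  shows "Pi_pmf J d (\<lambda>x. map_pmf (f x) (g x)) = map_pmf (\<lambda>h x. if x \<in> J then f x (h x) else d) (Pi_pmf J d' g)"
  unfolding map_pmf_def Pi_pmf_bind[OF assms, where d'=d'] Pi_pmf_return_pmf[OF assms] ..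

lemma map_upt_cong: "(\<And>t. t < N \<Longrightarrow> f t = g t) \<Longrightarrow> map f [0..<N] = map g [0..<N]"
  by auto

definition tailp :: "nat \<Rightarrow> real \<Rightarrow> 'a pmf \<Rightarrow> real" where
  "tailp N \<delta> q = measure_pmf.prob (iid N q) {s. \<not> typical \<delta> q (map s [0..<N])}"

lemma iid_map: "iid N (map_pmf f q) = map_pmf (\<lambda>h t. if t < N then f (h t) else undefined) (iid N q)"
  unfolding iid_def using Pi_pmf_map_dep[of "{..<N}" undefined "\<lambda>_. f" "\<lambda>_. q" undefined] by simp

lemma tailp_map:
  "measure_pmf.prob (iid N q) {s. \<not> typical \<delta> (map_pmf f q) (map (\<lambda>t. f (s t)) [0..<N])} = tailp N \<delta> (map_pmf f q)"
proof -
  have "map (\<lambda>t. if t < N then f (h t) else undefined) [0..<N] = map (\<lambda>t. f (h t)) [0..<N]" for h :: "nat \<Rightarrow> 'a"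
    by (rule map_upt_cong) simp
  then show ?thesis unfolding tailp_def iid_map measure_map_pmf vimage_def mem_Collect_eq by (simp only:)
qed

lemma pmf_Pi_mono:
  assumes "finite J" "(\<And>x. x \<notin> J \<Longrightarrow> s x = d) \<Longrightarrow> (\<Prod>x\<in>J. pmf (q x) (s x)) \<le> \<gamma> * (\<Prod>x\<in>J. pmf (p x) (s x))"
  shows "pmf (Pi_pmf J d q) s \<le> \<gamma> * pmf (Pi_pmf J d p) s"
  using assms by (cases "\<forall>x. x \<notin> J \<longrightarrow> s x = d") (auto simp: pmf_Pi)

context random_code begin

primrec bt :: "'x ridx \<Rightarrow> nat \<times> nat" where
  "bt (RG c t u xs) = (c, t)" | "bt (RX c t k l) = (c, t)" | "bt (RZ c t k l l' x) = (c, t)" | "bt (RN c t x) = (c, t)"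

text \<open>Letters at different times have disjoint index sets, so a sequence built letter by
  letter has a product law.\<close>

lemma seq_law:
  assumes "\<And>t. t < N \<Longrightarrow> depends_on {i. bt i = (c, t)} (f t)" "\<And>t. t < N \<Longrightarrow> map_pmf (f t) \<Omega> = q t"
  shows "map_pmf (\<lambda>\<omega> t. if t < N then f t \<omega> else undefined) \<Omega> = Pi_pmf {..<N} undefined q"
proof -
  have "map_pmf (\<lambda>\<omega> t. if t \<in> {..<N} then f t \<omega> else undefined) \<Omega> = Pi_pmf {..<N} undefined (\<lambda>t. map_pmf (f t) \<Omega>)"
    unfolding \<Omega>_def by (rule Pi_pmf_parts[OF finite_IX, where D="\<lambda>t. {i. bt i = (c, t)}"]) (use assms(1) in auto)
  also have "\<dots> = Pi_pmf {..<N} undefined q" by (rule Pi_pmf_cong) (use assms(2) in auto)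
  finally show ?thesis by simp
qed

lemma prob_seq:
  assumes "\<And>t. t < N \<Longrightarrow> depends_on {i. bt i = (c, t)} (f t)" "\<And>t. t < N \<Longrightarrow> map_pmf (f t) \<Omega> = q t"
    and E: "\<And>s s'. (\<And>t. t < N \<Longrightarrow> s t = s' t) \<Longrightarrow> E s \<longleftrightarrow> E s'"
  shows "measure_pmf.prob \<Omega> {\<omega>. E (\<lambda>t. f t \<omega>)} = measure_pmf.prob (Pi_pmf {..<N} undefined q) {s. E s}"
proof -
  have "E (\<lambda>t. if t < N then f t \<omega> else undefined) = E (\<lambda>t. f t \<omega>)" for \<omega> by (rule E) simp
  moreover have "map_pmf (\<lambda>\<omega> t. if t < N then f t \<omega> else undefined) \<Omega> = Pi_pmf {..<N} undefined q"
    by (rule seq_law[where c=c, OF assms(1,2)])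
  then have "measure_pmf.prob (Pi_pmf {..<N} undefined q) {s. E s}
      = measure_pmf.prob (map_pmf (\<lambda>\<omega> t. if t < N then f t \<omega> else undefined) \<Omega>) {s. E s}" by (simp only:)
  ultimately show ?thesis by (simp add: vimage_def)
qed

text \<open>The ranges in which the single-letter laws apply. The indices are constrained on all of
  \<open>T2\<close>, also outside \<open>Q\<close>, as the channel input involves every
  relay.\<close>

definition admissible :: "nat \<Rightarrow> nat list \<Rightarrow> (nat \<Rightarrow> nat) \<Rightarrow> bool" where
  "admissible c u l' \<longleftrightarrow> c \<in> {1..B} \<and> set u \<subseteq> {1..msg} \<and> length u = K1 \<and> (\<forall>k\<in>T2. l' k \<in> {1..L k})"

lemma txy_bt: "depends_on {i. bt i = (c, t)} (\<lambda>\<omega>. (tx \<omega> c t u l', ty \<omega> c t u l'))"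
proof (rule depends_onI)
  fix a b :: "('x, 'y, 'z) outcome" assume ab: "\<And>i. i \<in> {i. bt i = (c, t)} \<Longrightarrow> a i = b i"
  have "tx a c t u l' = tx b c t u l'"
    by (rule depends_onD[OF tx_depends], rule ab) (auto simp: dG_def dX_def)
  moreover have "ty a c t u l' = ty b c t u l'"
    by (rule depends_onD[OF ty_depends], rule ab) (auto simp: dG_def dX_def dN_def)
  ultimately show "(tx a c t u l', ty a c t u l') = (tx b c t u l', ty b c t u l')" by simp
qed

lemma admissible_txy_law: "admissible c u l' \<Longrightarrow> t < N \<Longrightarrow> map_pmf (\<lambda>\<omega>. (tx \<omega> c t u l', ty \<omega> c t u l')) \<Omega> = PXY"
  by (rule txy_law) (auto simp: admissible_def)

lemma txy_set:
  assumes "admissible c u l'" "t < N" "\<omega> \<in> set_pmf \<Omega>"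
  shows "(tx \<omega> c t u l', ty \<omega> c t u l') \<in> set_pmf PXY"
  unfolding admissible_txy_law[OF assms(1,2), symmetric] set_map_pmf using assms(3) by (rule imageI)

lemma typ_bound:
  assumes "admissible c u l'"
  shows "measure_pmf.prob \<Omega> {\<omega>. \<not> typical dd PXY (map (\<lambda>t. (tx \<omega> c t u l', ty \<omega> c t u l')) [0..<N])} = tailp N dd PXY"
proof -
  have "measure_pmf.prob \<Omega> {\<omega>. \<not> typical dd PXY (map (\<lambda>t. (tx \<omega> c t u l', ty \<omega> c t u l')) [0..<N])}
    = measure_pmf.prob (Pi_pmf {..<N} undefined (\<lambda>t. PXY)) {s. \<not> typical dd PXY (map s [0..<N])}"
  proof (rule prob_seq[where c=c])
    show "map_pmf (\<lambda>\<omega>. (tx \<omega> c t u l', ty \<omega> c t u l')) \<Omega> = PXY" if "t < N" for t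
      by (rule admissible_txy_law[OF assms that])
    show "(\<not> typical dd PXY (map s [0..<N])) = (\<not> typical dd PXY (map s' [0..<N]))" if "\<And>t. t < N \<Longrightarrow> s t = s' t" for s s'
      by (simp only: map_upt_cong[OF that])
  qed (rule txy_bt)
  then show ?thesis by (simp add: tailp_def iid_def)
qed

definition PXYZ :: "nat \<Rightarrow> ('x \<times> 'y \<times> 'z) pmf" where
  "PXYZ k = map_pmf (\<lambda>(x, y, z). (x k, y k, z k)) P"

lemma finite_PXYZ [simp]: "finite (set_pmf (PXYZ k))" by (simp add: PXYZ_def)

lemma PXYZ_bind:
  assumes "k \<in> T2"
  shows "PXYZ k = bind_pmf PXY (\<lambda>(x, y). map_pmf (\<lambda>z. (x k, y k, z)) (pz k (y k) (x k)))"
proof -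
  have 1: "map_pmf (\<lambda>z. (x k, y k, z k)) (zker T2 (x, y)) = map_pmf (\<lambda>z. (x k, y k, z)) (map_pmf (\<lambda>z. z k) (zker T2 (x, y)))" for x y
    by (simp add: pmf.map_comp o_def)
  have 2: "map_pmf (\<lambda>z. z k) (zker T2 (x, y)) = pz k (y k) (x k)" for x y
    using assms by (simp add: zker_def Pi_pmf_component)
  show ?thesis unfolding PXYZ_def P_bind prod.case 1 2 ..
qed

text \<open>Likelihood ratio of the kernel P(z|x,y) against the codebook law P(z|x); its mean
  logarithm is \<open>qrate k\<close>.\<close>

definition zr :: "nat \<Rightarrow> 'x \<times> 'y \<times> 'z \<Rightarrow> real" where
  "zr k = (\<lambda>(x, y, z). pmf (pz k y x) z / pmf (pzx k x) z)"

definition qdev :: "nat \<Rightarrow> real" where "qdev k = mean (PXYZ k) (\<lambda>a. \<bar>log 2 (zr k a)\<bar>)"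

lemma PXYZ_pos:
  assumes "k \<in> T2" "(x, y, z) \<in> set_pmf (PXYZ k)"
  shows "pmf (pz k y x) z > 0" "pmf (pzx k x) z > 0"
  using assms pz_pos pzx_pos by (auto simp: PXYZ_def)

lemma zr_pos: "k \<in> T2 \<Longrightarrow> a \<in> set_pmf (PXYZ k) \<Longrightarrow> zr k a > 0"
  using PXYZ_pos by (cases a) (auto simp: zr_def)

lemma mean_zr: "k \<in> T2 \<Longrightarrow> mean (PXYZ k) (\<lambda>a. log 2 (zr k a)) = qrate k"
proof -
  assume k: "k \<in> T2"
  have "mean (PXYZ k) (\<lambda>a. log 2 (zr k a)) = mean P (\<lambda>\<omega>. zl k \<omega> - zxl k \<omega>)"
    unfolding PXYZ_def mean_map[OF finite_P]
  proof (rule mean_cong)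
    fix \<omega> assume w: "\<omega> \<in> set_pmf P"
    obtain x y z where w2: "\<omega> = (x, y, z)" by (cases \<omega>)
    show "log 2 (zr k (case \<omega> of (x, y, z) \<Rightarrow> (x k, y k, z k))) = zl k \<omega> - zxl k \<omega>"
      using pz_pos(1)[OF w[unfolded w2] k] pzx_pos[OF w[unfolded w2] k]
      by (simp add: w2 zr_def zl_def zxl_def log_divide)
  qed
  then show ?thesis by (simp add: mean_diff qrate_def)
qed

text \<open>Typicality of the triple pins the exponent of the product of ratios to within
  \<open>dq * qdev k\<close>. The first bound serves the existence of a good codeword, the second
  the control of the selected one.\<close>

lemma zr_prod:
  fixes xs :: "nat \<Rightarrow> 'x" and ys :: "nat \<Rightarrow> 'y" and zs :: "nat \<Rightarrow> 'z"
  assumes "k \<in> T2" "typical dq (PXYZ k) (map (\<lambda>t. (xs t, ys t, zs t)) [0..<N])"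
  shows "(\<Prod>t<N. pmf (pz k (ys t) (xs t)) (zs t)) \<le> 2 powr (real N * (qrate k + dq * qdev k)) * (\<Prod>t<N. pmf (pzx k (xs t)) (zs t))"
    and "(\<Prod>t<N. pmf (pzx k (xs t)) (zs t)) \<le> 2 powr (- real N * (qrate k - dq * qdev k)) * (\<Prod>t<N. pmf (pz k (ys t) (xs t)) (zs t))"
proof -
  have pos: "pmf (pz k (ys t) (xs t)) (zs t) > 0" "pmf (pzx k (xs t)) (zs t) > 0" if "t < N" for t
    using PXYZ_pos[OF assms(1)] typical_in_set[OF assms(2) that] by auto
  have e: "(\<Prod>t<N. zr k (xs t, ys t, zs t)) = (\<Prod>t<N. pmf (pz k (ys t) (xs t)) (zs t)) / (\<Prod>t<N. pmf (pzx k (xs t)) (zs t))"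
    by (simp add: zr_def prod_dividef)
  have p0: "(\<Prod>t<N. pmf (pzx k (xs t)) (zs t)) > 0" by (rule prod_pos) (use pos in auto)
  note tp = typical_prod[of dq "PXYZ k" "\<lambda>t. (xs t, ys t, zs t)" N "zr k", OF assms(2) finite_PXYZ zr_pos[OF assms(1)],
      simplified mean_zr[OF assms(1)] qdev_def[symmetric] e]
  show "(\<Prod>t<N. pmf (pz k (ys t) (xs t)) (zs t)) \<le> 2 powr (real N * (qrate k + dq * qdev k)) * (\<Prod>t<N. pmf (pzx k (xs t)) (zs t))"
    using tp(2) p0 by (simp add: divide_le_eq)
  have "2 powr (real N * (qrate k - dq * qdev k)) * (\<Prod>t<N. pmf (pzx k (xs t)) (zs t)) \<le> (\<Prod>t<N. pmf (pz k (ys t) (xs t)) (zs t))"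
    using tp(1) p0 by (simp add: le_divide_eq)
  then show "(\<Prod>t<N. pmf (pzx k (xs t)) (zs t)) \<le> 2 powr (- real N * (qrate k - dq * qdev k)) * (\<Prod>t<N. pmf (pz k (ys t) (xs t)) (zs t))"
  proof -
    let ?M = "real N * (qrate k - dq * qdev k)" and ?X = "\<Prod>t<N. pmf (pzx k (xs t)) (zs t)"
    assume "2 powr ?M * ?X \<le> (\<Prod>t<N. pmf (pz k (ys t) (xs t)) (zs t))"
    then have "2 powr (- ?M) * (2 powr ?M * ?X) \<le> 2 powr (- ?M) * (\<Prod>t<N. pmf (pz k (ys t) (xs t)) (zs t))"
      by (rule mult_left_mono) simp
    then show ?thesis by (simp add: mult.assoc[symmetric] powr_add[symmetric])
  qed
qed

definition qtyp :: "nat \<Rightarrow> (nat \<Rightarrow> nat \<Rightarrow> 'x) \<Rightarrow> (nat \<Rightarrow> nat \<Rightarrow> 'y) \<Rightarrow> (nat \<Rightarrow> 'z) \<Rightarrow> bool" where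
  "qtyp k xs ys zs \<longleftrightarrow> typical dq (PXYZ k) (map (\<lambda>t. (xs t k, ys t k, zs t)) [0..<N])"

lemma qtyp_cong: "(\<And>t. t < N \<Longrightarrow> xs t = xs' t) \<Longrightarrow> (\<And>t. t < N \<Longrightarrow> ys t = ys' t) \<Longrightarrow> (\<And>t. t < N \<Longrightarrow> zs t = zs' t)
  \<Longrightarrow> qtyp k xs ys zs = qtyp k xs' ys' zs'"
  unfolding qtyp_def by (auto cong: map_upt_cong intro!: arg_cong[where f="typical _ _"])

text \<open>
  By Markov's inequality all but few pairs \<open>(x, y)\<close> leave probability at least \<open>1/2\<close> to typical \<open>z\<close>; for
  these, a change of measure bounds from below the chance of a codeword drawn from \<open>P(z|x)\<close>.
\<close>

lemma cov_bound:
  assumes v: "admissible c u l'" and k: "k \<in> T2"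
  shows "measure_pmf.prob \<Omega> {\<omega>. \<forall>l\<in>{1..L k}. \<not> qtyp k (\<lambda>t. tx \<omega> c t u l') (\<lambda>t. ty \<omega> c t u l')
       (\<lambda>t. tz \<omega> c t l' (tx \<omega> c t u l') k l)}
    \<le> 2 * tailp N dq (PXYZ k) + exp (- (real (L k) / (2 * 2 powr (real N * (qrate k + dq * qdev k)))))"
proof -
  let ?G = "2 powr (real N * (qrate k + dq * qdev k))"
  let ?K1 = "\<lambda>s :: nat \<Rightarrow> (nat \<Rightarrow> 'x) \<times> (nat \<Rightarrow> 'y). Pi_pmf {..<N} undefined (\<lambda>t. pz k (snd (s t) k) (fst (s t) k))"
  let ?K0 = "\<lambda>s :: nat \<Rightarrow> (nat \<Rightarrow> 'x) \<times> (nat \<Rightarrow> 'y). Pi_pmf {..<N} undefined (\<lambda>t. pzx k (fst (s t) k))"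
  define T where "T s z = qtyp k (\<lambda>t. fst (s t)) (\<lambda>t. snd (s t)) z" for s :: "nat \<Rightarrow> (nat \<Rightarrow> 'x) \<times> (nat \<Rightarrow> 'y)" and z
  define bad where "bad s \<longleftrightarrow> measure_pmf.prob (?K1 s) {z. \<not> T s z} > 1 / 2" for s
  have bad_cong: "bad s = bad s'" if "\<And>t. t < N \<Longrightarrow> s t = s' t" for s s'
  proof -
    have "?K1 s = ?K1 s'" by (rule Pi_pmf_cong) (use that in auto)
    moreover have "T s z = T s' z" for z unfolding T_def by (rule qtyp_cong) (use that in auto)
    ultimately show ?thesis by (simp add: bad_def)
  qed
  define s where "s \<omega> = (\<lambda>t. (tx \<omega> c t u l', ty \<omega> c t u l'))" for \<omega>
  have 1: "measure_pmf.prob \<Omega> {\<omega>. bad (s \<omega>)} \<le> 2 * tailp N dq (PXYZ k)"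
  proof -
    have "measure_pmf.prob \<Omega> {\<omega>. bad (s \<omega>)} = measure_pmf.prob (iid N PXY) {s. bad s}"
      unfolding s_def iid_def
    proof (rule prob_seq[where c=c])
      show "map_pmf (\<lambda>\<omega>. (tx \<omega> c t u l', ty \<omega> c t u l')) \<Omega> = PXY" if "t < N" for t
        by (rule admissible_txy_law[OF v that])
    qed (rule txy_bt, rule bad_cong)
    also have "\<dots> \<le> 2 * tailp N dq (PXYZ k)"
    proof -
      have "iid N (PXYZ k) = bind_pmf (iid N PXY) (\<lambda>s. Pi_pmf {..<N} undefined
          (\<lambda>t. map_pmf (\<lambda>z. (fst (s t) k, snd (s t) k, z)) (pz k (snd (s t) k) (fst (s t) k))))"
        unfolding iid_def PXYZ_bind[OF k] by (subst Pi_pmf_bind[where d'=undefined]) (auto simp: case_prod_unfold)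
      also have "\<dots> = bind_pmf (iid N PXY) (\<lambda>s. map_pmf (\<lambda>h t. if t \<in> {..<N} then (fst (s t) k, snd (s t) k, h t) else undefined) (?K1 s))"
        by (intro bind_pmf_cong refl Pi_pmf_map_dep) simp
      finally have e: "iid N (PXYZ k) = bind_pmf (iid N PXY) (\<lambda>s. map_pmf (\<lambda>h t. if t \<in> {..<N} then (fst (s t) k, snd (s t) k, h t) else undefined) (?K1 s))" .
      have "tailp N dq (PXYZ k) = measure_pmf.expectation (iid N PXY) (\<lambda>s. measure_pmf.prob (?K1 s) {z. \<not> T s z})"
      proof -
        have "(\<lambda>h t. if t \<in> {..<N} then (fst (s t) k, snd (s t) k, h t) else undefined) -` {s. \<not> typical dq (PXYZ k) (map s [0..<N])} = {z. \<not> T s z}" for s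
          unfolding T_def qtyp_def by (auto cong: map_upt_cong)
        then show ?thesis unfolding tailp_def e prob_bind_pmf measure_map_pmf by simp
      qed
      also have "\<dots> \<ge> measure_pmf.expectation (iid N PXY) (\<lambda>s. indicator {s. bad s} s * (1 / 2))"
        by (intro integral_mono measure_pmf.integrable_const_bound[where B=1])
          (auto simp: bad_def indicator_def less_imp_le split: if_splits)
      moreover have "measure_pmf.expectation (iid N PXY) (\<lambda>s. indicator {s. bad s} s * (1 / 2)) = measure_pmf.prob (iid N PXY) {s. bad s} / 2"
        by simp
      ultimately show ?thesis by simp
    qed
    finally show ?thesis .
  qed
  have 2: "measure_pmf.prob \<Omega> {\<omega>. \<not> bad (s \<omega>) \<and> (\<forall>l\<in>{1..L k}. \<not> T (s \<omega>) (\<lambda>t. tz \<omega> c t l' (fst (s \<omega> t)) k l))}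
    \<le> exp (- (real (L k) / (2 * ?G)))"
  proof -
    define fs where "fs \<omega> = (\<lambda>t. if t < N then s \<omega> t else undefined)" for \<omega>
    define E where "E h \<omega> \<longleftrightarrow> \<not> bad h \<and> (\<forall>l\<in>{1..L k}. \<not> T h (\<lambda>t. tz \<omega> c t l' (fst (h t)) k l))" for h \<omega>
    let ?D = "{i :: 'x ridx. \<exists>t k l x. i = RZ c t k l (l' k) x}"
    have "measure_pmf.prob \<Omega> {\<omega>. E (fs \<omega>) \<omega>} \<le> exp (- (real (L k) / (2 * ?G)))"
      unfolding \<Omega>_def
    proof (rule Pi_pmf_prob_cond_le[OF finite_IX, where D="?D" and f=fs and E=E])
      show "depends_on (- ?D) fs"
      proof (rule depends_onI)
        fix a b :: "('x, 'y, 'z) outcome" assume ab: "\<And>i. i \<in> - ?D \<Longrightarrow> a i = b i"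
        have "s a t = s b t" for t
        proof -
          have "tx a c t u l' = tx b c t u l'"
            by (rule depends_onD[OF tx_depends], rule ab) (auto simp: dG_def dX_def)
          moreover have "ty a c t u l' = ty b c t u l'"
            by (rule depends_onD[OF ty_depends], rule ab) (auto simp: dG_def dX_def dN_def)
          ultimately show ?thesis by (simp add: s_def)
        qed
        then show "fs a = fs b" by (auto simp: fs_def)
      qed
      show "depends_on ?D (E h)" for h
      proof (rule depends_onI)
        fix a b :: "('x, 'y, 'z) outcome" assume ab: "\<And>i. i \<in> ?D \<Longrightarrow> a i = b i"
        have "tz a c t l' x k l = tz b c t l' x k l" for t x k l
          unfolding tz_def by (intro arg_cong[where f=valZ] ab) blast
        then show "E h a = E h b" unfolding E_def by simp
      qed
      fix \<omega>0 assume "\<omega>0 \<in> set_pmf (Pi_pmf IX undefined lawI)"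
      then have \<omega>0: "\<omega>0 \<in> set_pmf \<Omega>" by (simp add: \<Omega>_def)
      define h where "h = fs \<omega>0"
      have h: "fst (h t) \<in> XX" if "t < N" for t
        using txy_set[OF v that \<omega>0] set_PXY that unfolding h_def fs_def s_def by auto
      show "measure_pmf.prob (Pi_pmf IX undefined lawI) {\<omega>'. E (fs \<omega>0) \<omega>'} \<le> exp (- (real (L k) / (2 * ?G)))"
      proof (cases "bad h")
        case True
        then show ?thesis by (simp add: E_def h_def[symmetric])
      next
        case False
        let ?z = "\<lambda>l \<omega> t. if t < N then tz \<omega> c t l' (fst (h t)) k l else undefined"
        have zl: "map_pmf (?z l) \<Omega> = ?K0 h" if l: "l \<in> {1..L k}" for l
        proof (rule seq_law[where c=c])
          fix t assume t: "t < N"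
          show "depends_on {i. bt i = (c, t)} (\<lambda>\<omega>. tz \<omega> c t l' (fst (h t)) k l)"
            by (rule depends_onI) (simp add: tz_def)
          have "fst (h t) k \<in> XS" using h[OF t] k unfolding XS_def senders_eq by auto
          then have "RZ c t k l (l' k) (fst (h t) k) \<in> IX" using v k l t by (auto simp: admissible_def)
          then have "map_pmf valZ (map_pmf (\<lambda>\<omega>. \<omega> (RZ c t k l (l' k) (fst (h t) k))) \<Omega>) = pzx k (fst (h t) k)"
            by (simp only: \<Omega>_component) (simp add: pmf.map_comp o_def pmf.map_ident)
          then show "map_pmf (\<lambda>\<omega>. tz \<omega> c t l' (fst (h t)) k l) \<Omega> = pzx k (fst (h t) k)"
            by (simp add: tz_def pmf.map_comp o_def)
        qed
        have parts: "map_pmf (\<lambda>\<omega> l. if l \<in> {1..L k} then ?z l \<omega> else undefined) \<Omega>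
            = Pi_pmf {1..L k} undefined (\<lambda>l. map_pmf (?z l) \<Omega>)"
          unfolding \<Omega>_def
          by (rule Pi_pmf_parts[OF finite_IX, where D="\<lambda>l. {RZ c t k l (l' k) x |t x. True}"])
            (auto simp: depends_on_def tz_def fun_eq_iff)
        have Tz: "T h (\<lambda>t. tz \<omega> c t l' (fst (h t)) k l) = T h (?z l \<omega>)" for l \<omega>
          unfolding T_def by (rule qtyp_cong) auto
        \<comment> \<open>Typical sequences have probability at least 1/2 under the kernel
          \<open>?K1 h\<close>, hence at least \<open>1 / (2 * ?G)\<close> under the codebook law
          \<open>?K0 h\<close>; the \<open>L k\<close> codewords are independent trials.\<close>
        have "measure_pmf.prob (?K1 h) {z. T h z} \<le> ?G * measure_pmf.prob (?K0 h) {z. T h z}"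
          proof (rule prob_change_of_measure)
            fix z assume "z \<in> {z. T h z}"
            then have "typical dq (PXYZ k) (map (\<lambda>t. (fst (h t) k, snd (h t) k, z t)) [0..<N])"
              by (simp add: T_def qtyp_def)
            then show "pmf (?K1 h) z \<le> ?G * pmf (?K0 h) z"
              by (intro pmf_Pi_mono zr_prod(1)[OF k]) auto
          qed simp
          moreover have compl: "measure_pmf.prob p {z. T h z} = 1 - measure_pmf.prob p {z. \<not> T h z}" for p
            using measure_pmf.prob_compl[of "{z. \<not> T h z}" p] by (simp add: Compl_eq_Diff_UNIV[symmetric] Collect_neg_eq[symmetric])
          moreover have "measure_pmf.prob (?K1 h) {z. \<not> T h z} \<le> 1 / 2" using False by (simp add: bad_def)
          ultimately have "1 / 2 \<le> ?G * measure_pmf.prob (?K0 h) {z. T h z}" by simp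
          then have half: "1 / (2 * ?G) \<le> measure_pmf.prob (?K0 h) {z. T h z}" by (simp add: field_simps)
        have "measure_pmf.prob \<Omega> {\<omega>. E h \<omega>} = measure_pmf.prob (map_pmf (\<lambda>\<omega> l. if l \<in> {1..L k} then ?z l \<omega> else undefined) \<Omega>)
            (Pi {1..L k} (\<lambda>_. {z. \<not> T h z}))"
          using False by (auto simp: E_def Tz Pi_def intro!: arg_cong[where f="measure _"])
        also have "\<dots> = (\<Prod>l\<in>{1..L k}. measure_pmf.prob (map_pmf (?z l) \<Omega>) {z. \<not> T h z})"
          unfolding parts by (rule measure_Pi_pmf_Pi) simp
        also have "\<dots> = (\<Prod>l\<in>{1..L k}. measure_pmf.prob (?K0 h) {z. \<not> T h z})"
          by (rule prod.cong[OF refl]) (simp only: zl)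
        also have "\<dots> = (measure_pmf.prob (?K0 h) {z. \<not> T h z}) ^ L k" by simp
        also have "\<dots> \<le> (1 - 1 / (2 * ?G)) ^ L k"
        proof (rule power_mono)
          show "measure_pmf.prob (?K0 h) {z. \<not> T h z} \<le> 1 - 1 / (2 * ?G)" using half compl[of "?K0 h"] by simp
        qed simp
        also have "\<dots> \<le> exp (- (1 / (2 * ?G))) ^ L k"
        proof (rule power_mono)
          show "1 - 1 / (2 * ?G) \<le> exp (- (1 / (2 * ?G)))" using exp_ge_add_one_self[of "- (1 / (2 * ?G))"] by simp
          have "1 / (2 * ?G) \<le> 1" by (rule order.trans[OF half]) simp
          then show "0 \<le> 1 - 1 / (2 * ?G)" by simp
        qed
        also have "\<dots> = exp (- (real (L k) / (2 * ?G)))" by (simp add: exp_of_nat_mult[symmetric])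
        finally show ?thesis by (simp add: h_def \<Omega>_def)
      qed
    qed
    moreover have "E (fs \<omega>) \<omega> \<longleftrightarrow> \<not> bad (s \<omega>) \<and> (\<forall>l\<in>{1..L k}. \<not> T (s \<omega>) (\<lambda>t. tz \<omega> c t l' (fst (s \<omega> t)) k l))" for \<omega>
    proof -
      have "bad (fs \<omega>) = bad (s \<omega>)" by (rule bad_cong) (simp add: fs_def)
      moreover have "T (fs \<omega>) (\<lambda>t. tz \<omega> c t l' (fst (fs \<omega> t)) k l) = T (s \<omega>) (\<lambda>t. tz \<omega> c t l' (fst (s \<omega> t)) k l)" for l
        unfolding T_def by (rule qtyp_cong) (auto simp: fs_def)
      ultimately show ?thesis by (simp add: E_def)
    qed
    ultimately show ?thesis by simp
  qed
  have "measure_pmf.prob \<Omega> {\<omega>. \<forall>l\<in>{1..L k}. \<not> qtyp k (\<lambda>t. tx \<omega> c t u l') (\<lambda>t. ty \<omega> c t u l')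
       (\<lambda>t. tz \<omega> c t l' (tx \<omega> c t u l') k l)}
    \<le> measure_pmf.prob \<Omega> ({\<omega>. bad (s \<omega>)} \<union> {\<omega>. \<not> bad (s \<omega>) \<and> (\<forall>l\<in>{1..L k}. \<not> T (s \<omega>) (\<lambda>t. tz \<omega> c t l' (fst (s \<omega> t)) k l))})"
    by (rule prob_mono) (auto simp: s_def T_def)
  also have "\<dots> \<le> 2 * tailp N dq (PXYZ k) + exp (- (real (L k) / (2 * ?G)))"
    by (rule order.trans[OF prob_Un_le add_mono[OF 1 2]])
  finally show ?thesis .
qed

end

section \<open>True and wrong hypotheses in the test of the destination\<close>

context random_code begin

abbreviation "TL \<equiv> test_law Ch \<pi> K1 Q P"

definition asmb :: "((nat \<Rightarrow> 'x) \<times> (nat \<Rightarrow> 'y)) \<times> (nat \<Rightarrow> 'z) \<Rightarrow> (nat \<Rightarrow> 'x) \<times> (nat \<Rightarrow> 'z) \<times> 'y" where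
  "asmb = (\<lambda>((x, y), z). (restrict x (A \<union> Q), restrict z Q, y K))"

lemma TL_eq: "TL = map_pmf (\<lambda>(x, y, z). asmb ((x, y), z)) P"
  by (simp add: test_law_def A_def asmb_def)

lemma finite_TL [simp]: "finite (set_pmf TL)" by (simp add: TL_eq)

lemma finite_Q [simp]: "finite Q" using Q by (rule finite_subset) simp

text \<open>Here the quantizations follow the codebook law P(z|x), in \<open>PQ2\<close> the kernel
  P(z|x,y). Only \<open>PQ2\<close> projects to the law \<open>TL\<close> of the test.\<close>

definition PQ1 :: "(((nat \<Rightarrow> 'x) \<times> (nat \<Rightarrow> 'y)) \<times> (nat \<Rightarrow> 'z)) pmf" where
  "PQ1 = bind_pmf PXY (\<lambda>xy. map_pmf (Pair xy) (Pi_pmf Q undefined (\<lambda>k. pzx k (fst xy k))))"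

definition PQ2 :: "(((nat \<Rightarrow> 'x) \<times> (nat \<Rightarrow> 'y)) \<times> (nat \<Rightarrow> 'z)) pmf" where
  "PQ2 = bind_pmf PXY (\<lambda>xy. map_pmf (Pair xy) (Pi_pmf Q undefined (\<lambda>k. pz k (snd xy k) (fst xy k))))"

lemma map_asmb: "map_pmf asmb PQ2 = TL"
proof -
  have "map_pmf asmb PQ2 = bind_pmf PXY (\<lambda>(x, y). map_pmf (\<lambda>z. asmb ((x, y), z)) (zker Q (x, y)))"
    unfolding PQ2_def by (simp add: map_bind_pmf pmf.map_comp o_def zker_def case_prod_unfold)
  also have "\<dots> = bind_pmf PXY (\<lambda>(x, y). map_pmf (\<lambda>z. asmb ((x, y), z)) (zker T2 (x, y)))"
    unfolding zker_restrict[OF Q finite_T2, symmetric] pmf.map_comp by (simp add: o_def asmb_def)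
  also have "\<dots> = TL" unfolding TL_eq P_bind by simp
  finally show ?thesis .
qed

lemma letter_law:
  assumes v: "admissible c u l'" and t: "t < N" and l: "\<And>k. k \<in> S \<Longrightarrow> l k \<in> {1..L k}" and S: "S \<subseteq> T2"
  shows "map_pmf (\<lambda>\<omega>. ((tx \<omega> c t u l', ty \<omega> c t u l'), \<lambda>k. if k \<in> S then tz \<omega> c t l' (tx \<omega> c t u l') k (l k) else undefined)) \<Omega>
    = bind_pmf PXY (\<lambda>xy. map_pmf (Pair xy) (Pi_pmf S undefined (\<lambda>k. pzx k (fst xy k))))"
proof -
  let ?f = "\<lambda>\<omega>. (tx \<omega> c t u l', ty \<omega> c t u l')"
  define g where "g h \<omega> = (\<lambda>k. if k \<in> S then tz \<omega> c t l' (fst h) k (l k) else undefined)"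
    for h :: "(nat \<Rightarrow> 'x) \<times> (nat \<Rightarrow> 'y)" and \<omega>
  have "map_pmf (\<lambda>\<omega>. (?f \<omega>, g (?f \<omega>) \<omega>)) \<Omega> = bind_pmf (map_pmf ?f \<Omega>) (\<lambda>h. map_pmf (\<lambda>\<omega>. (h, g h \<omega>)) \<Omega>)"
    unfolding \<Omega>_def
  proof (rule Pi_pmf_disintegrate[OF finite_IX, of "dZ c t l'"])
    show "depends_on (- dZ c t l') ?f"
    proof (rule depends_onI)
      fix a b :: "('x, 'y, 'z) outcome" assume ab: "\<And>i. i \<in> - dZ c t l' \<Longrightarrow> a i = b i"
      have "tx a c t u l' = tx b c t u l'"
        by (rule depends_onD[OF tx_depends], rule ab) (auto simp: dG_def dX_def dZ_def)
      moreover have "ty a c t u l' = ty b c t u l'"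
        by (rule depends_onD[OF ty_depends], rule ab) (auto simp: dG_def dX_def dN_def dZ_def)
      ultimately show "?f a = ?f b" by simp
    qed
    show "depends_on (dZ c t l') (g h)" for h
    proof (rule depends_onI)
      fix a b :: "('x, 'y, 'z) outcome" assume ab: "\<And>i. i \<in> dZ c t l' \<Longrightarrow> a i = b i"
      have "tz a c t l' x k j = tz b c t l' x k j" for x k j
        unfolding tz_def by (intro arg_cong[where f=valZ] ab) (auto simp: dZ_def)
      then show "g h a = g h b" by (simp add: g_def cong: if_cong)
    qed
  qed
  also have "map_pmf ?f \<Omega> = PXY" by (rule admissible_txy_law[OF v t])
  also have "bind_pmf PXY (\<lambda>h. map_pmf (\<lambda>\<omega>. (h, g h \<omega>)) \<Omega>)
      = bind_pmf PXY (\<lambda>xy. map_pmf (Pair xy) (Pi_pmf S undefined (\<lambda>k. pzx k (fst xy k))))"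
  proof (rule bind_pmf_cong[OF refl])
    fix h assume "h \<in> set_pmf PXY"
    then have h: "fst h \<in> XX" using set_PXY by (metis mem_Times_iff subsetD)
    have "map_pmf (g h) \<Omega> = Pi_pmf S undefined (\<lambda>k. pzx k (fst h k))"
      unfolding g_def[abs_def]
      by (rule z_law) (use v t l S h finite_subset[OF S finite_T2] in \<open>auto simp: admissible_def inj_on_def\<close>)
    from arg_cong[OF this, of "map_pmf (Pair h)"]
    show "map_pmf (\<lambda>\<omega>. (h, g h \<omega>)) \<Omega> = map_pmf (Pair h) (Pi_pmf S undefined (\<lambda>k. pzx k (fst h k)))"
      by (simp add: pmf.map_comp o_def)
  qed
  finally show ?thesis unfolding g_def fst_conv .
qed

lemma letter_bt:
  "depends_on {i. bt i = (c, t)} (\<lambda>\<omega>. ((tx \<omega> c t u l', ty \<omega> c t u l'), \<lambda>k. if k \<in> S then tz \<omega> c t l' (tx \<omega> c t u l') k (l k) else undefined))"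
proof (rule depends_onI)
  fix a b :: "('x, 'y, 'z) outcome" assume ab: "\<And>i. i \<in> {i. bt i = (c, t)} \<Longrightarrow> a i = b i"
  have 1: "(tx a c t u l', ty a c t u l') = (tx b c t u l', ty b c t u l')"
    by (rule depends_onD[OF txy_bt]) (rule ab)
  have "tz a c t l' x k j = tz b c t l' x k j" for x k j
    unfolding tz_def by (intro arg_cong[where f=valZ] ab) simp
  with 1 show "((tx a c t u l', ty a c t u l'), \<lambda>k. if k \<in> S then tz a c t l' (tx a c t u l') k (l k) else undefined)
    = ((tx b c t u l', ty b c t u l'), \<lambda>k. if k \<in> S then tz b c t l' (tx b c t u l') k (l k) else undefined)" by (simp cong: if_cong)
qed

text \<open>
  In place of the Markov lemma: a union bound over all index tuples costs \<open>\<Prod> L k\<close>, which the change of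
  measure from \<open>P(z|x)\<close> to \<open>P(z|x,y)\<close> on typical sequences makes up for up to a small exponent.
\<close>

lemma atyp_bound:
  assumes v: "admissible c u l'" and l: "\<And>k. k \<in> Q \<Longrightarrow> l k \<in> {1..L k}"
  shows "measure_pmf.prob \<Omega> {\<omega>.
      (\<forall>k\<in>Q. qtyp k (\<lambda>t. tx \<omega> c t u l') (\<lambda>t. ty \<omega> c t u l') (\<lambda>t. tz \<omega> c t l' (tx \<omega> c t u l') k (l k))) \<and>
      \<not> typical dd TL (map (\<lambda>t. (restrict (tx \<omega> c t u l') (A \<union> Q), \<lambda>k\<in>Q. tz \<omega> c t l' (tx \<omega> c t u l') k (l k), ty \<omega> c t u l' K)) [0..<N])}
    \<le> (\<Prod>k\<in>Q. 2 powr (- real N * (qrate k - dq * qdev k))) * tailp N dd TL"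
proof -
  let ?\<gamma> = "\<Prod>k\<in>Q. 2 powr (- real N * (qrate k - dq * qdev k))"
  define f where "f t \<omega> = ((tx \<omega> c t u l', ty \<omega> c t u l'), \<lambda>k. if k \<in> Q then tz \<omega> c t l' (tx \<omega> c t u l') k (l k) else undefined)" for t \<omega>
  define E1 where "E1 s \<longleftrightarrow> (\<forall>k\<in>Q. qtyp k (\<lambda>t. fst (fst (s t))) (\<lambda>t. snd (fst (s t))) (\<lambda>t. snd (s t) k))"
    for s :: "nat \<Rightarrow> ((nat \<Rightarrow> 'x) \<times> (nat \<Rightarrow> 'y)) \<times> (nat \<Rightarrow> 'z)"
  define E2 where "E2 s \<longleftrightarrow> \<not> typical dd TL (map (\<lambda>t. asmb (s t)) [0..<N])" for s
  have "measure_pmf.prob \<Omega> {\<omega>. E1 (\<lambda>t. f t \<omega>) \<and> E2 (\<lambda>t. f t \<omega>)} = measure_pmf.prob (Pi_pmf {..<N} undefined (\<lambda>_. PQ1)) {s. E1 s \<and> E2 s}"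
  proof (rule prob_seq[where c=c])
    show "depends_on {i. bt i = (c, t)} (f t)" for t unfolding f_def[abs_def] by (rule letter_bt)
    show "map_pmf (f t) \<Omega> = PQ1" if "t < N" for t
      unfolding f_def[abs_def] PQ1_def by (rule letter_law[OF v that l Q])
    fix s s' :: "nat \<Rightarrow> ((nat \<Rightarrow> 'x) \<times> (nat \<Rightarrow> 'y)) \<times> (nat \<Rightarrow> 'z)" assume ss: "\<And>t. t < N \<Longrightarrow> s t = s' t"
    have "E1 s = E1 s'" unfolding E1_def by (intro ball_cong refl qtyp_cong) (simp_all add: ss)
    moreover have "map (\<lambda>t. asmb (s t)) [0..<N] = map (\<lambda>t. asmb (s' t)) [0..<N]" by (rule map_upt_cong) (simp add: ss)
    then have "E2 s = E2 s'" unfolding E2_def by (simp only:)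
    ultimately show "(E1 s \<and> E2 s) = (E1 s' \<and> E2 s')" by simp
  qed
  also have "\<dots> \<le> ?\<gamma> * measure_pmf.prob (Pi_pmf {..<N} undefined (\<lambda>_. PQ2)) {s. E1 s \<and> E2 s}"
  proof (rule prob_change_of_measure)
    fix s assume s: "s \<in> {s. E1 s \<and> E2 s}"
    show "pmf (Pi_pmf {..<N} undefined (\<lambda>_. PQ1)) s \<le> ?\<gamma> * pmf (Pi_pmf {..<N} undefined (\<lambda>_. PQ2)) s"
    proof (rule pmf_Pi_mono)
      define x y z where xyz: "x = (\<lambda>t. fst (fst (s t)))" "y = (\<lambda>t. snd (fst (s t)))" "z = (\<lambda>t. snd (s t))"
      have st: "s t = ((x t, y t), z t)" for t by (simp add: xyz)
      define q where "q = (\<Prod>t<N. pmf PXY (x t, y t))"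
      have q0: "q \<ge> 0" unfolding q_def by (intro prod_nonneg) simp
      show "(\<Prod>t<N. pmf PQ1 (s t)) \<le> ?\<gamma> * (\<Prod>t<N. pmf PQ2 (s t))"
      proof (cases "\<forall>t<N. \<forall>k. k \<notin> Q \<longrightarrow> z t k = undefined")
        case True
        have 1: "(\<Prod>t<N. pmf PQ1 (s t)) = q * (\<Prod>k\<in>Q. \<Prod>t<N. pmf (pzx k (x t k)) (z t k))"
        proof -
          have "(\<Prod>t<N. pmf PQ1 (s t)) = (\<Prod>t<N. pmf PXY (x t, y t) * (\<Prod>k\<in>Q. pmf (pzx k (x t k)) (z t k)))"
            using True by (intro prod.cong refl) (simp add: st PQ1_def pmf_bind_map_Pair pmf_Pi)
          then show ?thesis unfolding q_def by (simp add: prod.distrib prod.swap[of _ "{..<N}"])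
        qed
        have 2: "(\<Prod>t<N. pmf PQ2 (s t)) = q * (\<Prod>k\<in>Q. \<Prod>t<N. pmf (pz k (y t k) (x t k)) (z t k))"
        proof -
          have "(\<Prod>t<N. pmf PQ2 (s t)) = (\<Prod>t<N. pmf PXY (x t, y t) * (\<Prod>k\<in>Q. pmf (pz k (y t k) (x t k)) (z t k)))"
            using True by (intro prod.cong refl) (simp add: st PQ2_def pmf_bind_map_Pair pmf_Pi)
          then show ?thesis unfolding q_def by (simp add: prod.distrib prod.swap[of _ "{..<N}"])
        qed
        \<comment> \<open>The kernels are exchanged relay by relay. \<open>E1\<close> supplies the
          typicality on which \<open>zr_prod\<close> rests, so it has to stay in the event up to
          this point.\<close>
        have "(\<Prod>k\<in>Q. \<Prod>t<N. pmf (pzx k (x t k)) (z t k))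
          \<le> (\<Prod>k\<in>Q. 2 powr (- real N * (qrate k - dq * qdev k)) * (\<Prod>t<N. pmf (pz k (y t k) (x t k)) (z t k)))"
        proof (rule prod_mono)
          fix k assume k: "k \<in> Q"
          have "typical dq (PXYZ k) (map (\<lambda>t. (x t k, y t k, z t k)) [0..<N])"
            using s k by (auto simp: E1_def qtyp_def xyz)
          from zr_prod(2)[OF _ this] k Q
          show "0 \<le> (\<Prod>t<N. pmf (pzx k (x t k)) (z t k)) \<and> (\<Prod>t<N. pmf (pzx k (x t k)) (z t k))
            \<le> 2 powr (- real N * (qrate k - dq * qdev k)) * (\<Prod>t<N. pmf (pz k (y t k) (x t k)) (z t k))"
            by (auto intro: prod_nonneg)
        qed
        also have "\<dots> = ?\<gamma> * (\<Prod>k\<in>Q. \<Prod>t<N. pmf (pz k (y t k) (x t k)) (z t k))" by (rule prod.distrib)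
        finally show ?thesis unfolding 1 2 using mult_left_mono[OF _ q0] by (simp only: mult.left_commute)
      next
        case False
        then obtain t where t: "t < N" "\<not> (\<forall>k. k \<notin> Q \<longrightarrow> z t k = undefined)" by blast
        then have "pmf PQ1 (s t) = 0" unfolding st PQ1_def pmf_bind_map_Pair pmf_Pi[OF finite_Q] by auto
        then have z0: "(\<Prod>t<N. pmf PQ1 (s t)) = 0" using t(1) by (intro prod_zero) auto
        show ?thesis unfolding z0 by (intro mult_nonneg_nonneg prod_nonneg) auto
      qed
    qed simp
  qed (simp add: prod_nonneg)
  also have "\<dots> \<le> ?\<gamma> * tailp N dd TL"
  proof (rule mult_left_mono)
    have "measure_pmf.prob (Pi_pmf {..<N} undefined (\<lambda>_. PQ2)) {s. E1 s \<and> E2 s} \<le> measure_pmf.prob (iid N PQ2) {s. E2 s}"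
      unfolding iid_def by (rule prob_mono) auto
    also have "\<dots> = tailp N dd TL" unfolding E2_def map_asmb[symmetric] by (rule tailp_map)
    finally show "measure_pmf.prob (Pi_pmf {..<N} undefined (\<lambda>_. PQ2)) {s. E1 s \<and> E2 s} \<le> tailp N dd TL" .
  qed (simp add: prod_nonneg)
  finally have "measure_pmf.prob \<Omega> {\<omega>. E1 (\<lambda>t. f t \<omega>) \<and> E2 (\<lambda>t. f t \<omega>)} \<le> ?\<gamma> * tailp N dd TL" .
  moreover have "E1 (\<lambda>t. f t \<omega>) \<longleftrightarrow> (\<forall>k\<in>Q. qtyp k (\<lambda>t. tx \<omega> c t u l') (\<lambda>t. ty \<omega> c t u l') (\<lambda>t. tz \<omega> c t l' (tx \<omega> c t u l') k (l k)))" for \<omega>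
    unfolding E1_def by (intro ball_cong refl) (simp add: f_def)
  moreover have "asmb (f t \<omega>) = (restrict (tx \<omega> c t u l') (A \<union> Q), \<lambda>k\<in>Q. tz \<omega> c t l' (tx \<omega> c t u l') k (l k), ty \<omega> c t u l' K)" for t \<omega>
    by (auto simp: asmb_def f_def fun_eq_iff restrict_def)
  ultimately show ?thesis unfolding E2_def by (simp only:)
qed

text \<open>The part of a test letter that is freshly drawn under a wrong hypothesis: inputs in
  \<open>F\<close>, and inputs and quantizations in \<open>S\<close>. \<open>re\<close> is the rest,
  including the output.\<close>

definition fr :: "nat set \<Rightarrow> nat set \<Rightarrow> (nat \<Rightarrow> 'x) \<times> (nat \<Rightarrow> 'z) \<times> 'y \<Rightarrow> ((nat \<Rightarrow> 'x) \<times> (nat \<Rightarrow> 'x)) \<times> (nat \<Rightarrow> 'z)" where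
  "fr F S = (\<lambda>(x, z, y). ((restrict x F, restrict x S), restrict z S))"

definition re :: "nat set \<Rightarrow> nat set \<Rightarrow> (nat \<Rightarrow> 'x) \<times> (nat \<Rightarrow> 'z) \<times> 'y \<Rightarrow> (nat \<Rightarrow> 'x) \<times> (nat \<Rightarrow> 'x) \<times> (nat \<Rightarrow> 'z) \<times> 'y" where
  "re F S = (\<lambda>(x, z, y). (restrict x (A - F), restrict x (Q - S), restrict z (Q - S), y))"

definition q0 :: "nat set \<Rightarrow> nat set \<Rightarrow> (((nat \<Rightarrow> 'x) \<times> (nat \<Rightarrow> 'x)) \<times> (nat \<Rightarrow> 'z)) pmf" where
  "q0 F S = bind_pmf (pair_pmf (map_pmf (\<lambda>a. restrict a F) p1) (Pi_pmf S undefined px))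
     (\<lambda>ab. map_pmf (Pair ab) (Pi_pmf S undefined (\<lambda>k. pzx k (snd ab k))))"

definition JJ :: "nat set \<Rightarrow> nat set \<Rightarrow> ((((nat \<Rightarrow> 'x) \<times> (nat \<Rightarrow> 'x)) \<times> (nat \<Rightarrow> 'z)) \<times> ((nat \<Rightarrow> 'x) \<times> (nat \<Rightarrow> 'x) \<times> (nat \<Rightarrow> 'z) \<times> 'y)) pmf" where
  "JJ F S = map_pmf (\<lambda>\<tau>. (fr F S \<tau>, re F S \<tau>)) TL"

definition pass_ratio :: "nat set \<Rightarrow> nat set \<Rightarrow> ((nat \<Rightarrow> 'x) \<times> (nat \<Rightarrow> 'x)) \<times> (nat \<Rightarrow> 'z) \<Rightarrow> (nat \<Rightarrow> 'x) \<times> (nat \<Rightarrow> 'x) \<times> (nat \<Rightarrow> 'z) \<times> 'y \<Rightarrow> real" where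
  "pass_ratio F S a b = pmf (JJ F S) (a, b) / (pmf (q0 F S) a * pmf (map_pmf snd (JJ F S)) b)"

text \<open>Exponent of the probability that a codeword independent of the true one on \<open>F \<union> S\<close> passes the test.\<close>

definition pass_exp :: "nat set \<Rightarrow> nat set \<Rightarrow> real" where
  "pass_exp F S = mean TL (\<lambda>\<tau>. log 2 (pass_ratio F S (fr F S \<tau>) (re F S \<tau>)))"

definition pass_dev :: "nat set \<Rightarrow> nat set \<Rightarrow> real" where
  "pass_dev F S = mean TL (\<lambda>\<tau>. \<bar>log 2 (pass_ratio F S (fr F S \<tau>) (re F S \<tau>))\<bar>)"

lemma map_PX_restrict:
  assumes "F \<subseteq> A" "S \<subseteq> T2"
  shows "map_pmf (\<lambda>x. (restrict x F, restrict x S)) PX = pair_pmf (map_pmf (\<lambda>a. restrict a F) p1) (Pi_pmf S undefined px)"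
proof -
  have "map_pmf (\<lambda>x. (restrict x F, restrict x S)) PX
    = map_pmf (\<lambda>(a, b). (restrict a F, b)) (map_pmf (\<lambda>\<omega>. (Xs A \<omega>, Xs S \<omega>)) P)"
    unfolding fst_P[symmetric] using assms(1)
    by (simp add: pmf.map_comp o_def Xs_def case_prod_unfold restrict_restrict Int_absorb1)
  also have "\<dots> = pair_pmf (map_pmf (\<lambda>a. restrict a F) p1) (Pi_pmf S undefined px)"
    unfolding map_AX[OF assms(2)] using map_pair[of "\<lambda>a. restrict a F" "\<lambda>b. b" p1 "Pi_pmf S undefined px"]
    by (simp add: pmf.map_ident)
  finally show ?thesis .
qed

lemma q0_pmf_pos:
  assumes "F \<subseteq> A" "S \<subseteq> Q" "(x, y, z) \<in> set_pmf P"
  shows "pmf (q0 F S) ((restrict x F, restrict x S), restrict z S)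
      = pmf (map_pmf (\<lambda>a. restrict a F) p1) (restrict x F) * (\<Prod>k\<in>S. pmf (px k) (x k)) * (\<Prod>k\<in>S. pmf (pzx k (x k)) (z k))" (is ?eq)
    and "pmf (q0 F S) ((restrict x F, restrict x S), restrict z S) > 0"
proof -
  have S: "finite S" "S \<subseteq> T2" using assms(2) Q by (auto intro: finite_subset)
  show eq: ?eq
    unfolding q0_def pmf_bind_map_Pair pmf_pair by (simp add: pmf_Pi[OF S(1)])
  have "restrict x F \<in> set_pmf (map_pmf (\<lambda>a. restrict a F) p1)"
  proof -
    have "restrict x F \<in> set_pmf (map_pmf fst (map_pmf (\<lambda>x. (restrict x F, restrict x S)) PX))"
      unfolding fst_P[symmetric] using assms(3) by force
    then show ?thesis unfolding map_PX_restrict[OF assms(1) S(2)] by (simp only: map_fst_pair_pmf)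
  qed
  then have "pmf (map_pmf (\<lambda>a. restrict a F) p1) (restrict x F) > 0" by (rule pmf_positive)
  moreover have "(\<Prod>k\<in>S. pmf (px k) (x k)) > 0" by (rule prod_pos) (use pz_pos(2)[OF assms(3)] S in auto)
  moreover have "(\<Prod>k\<in>S. pmf (pzx k (x k)) (z k)) > 0" by (rule prod_pos) (use pzx_pos[OF assms(3)] S in auto)
  ultimately show "pmf (q0 F S) ((restrict x F, restrict x S), restrict z S) > 0" unfolding eq by simp
qed

lemma pass_ratio_pos:
  assumes "F \<subseteq> A" "S \<subseteq> Q" "\<tau> \<in> set_pmf TL"
  shows "pass_ratio F S (fr F S \<tau>) (re F S \<tau>) > 0"
proof -
  obtain x y z where P: "(x, y, z) \<in> set_pmf P" and t: "\<tau> = asmb ((x, y), z)"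
    using assms(3) unfolding TL_eq by auto
  have "fr F S \<tau> = ((restrict x F, restrict x S), restrict z S)"
    using assms(1,2) by (simp add: t asmb_def fr_def restrict_restrict) (auto simp: Int_absorb1 intro!: arg_cong[where f="restrict _"])
  then have "pmf (q0 F S) (fr F S \<tau>) > 0" using q0_pmf_pos(2)[OF assms(1,2) P] by simp
  moreover have "(fr F S \<tau>, re F S \<tau>) \<in> set_pmf (JJ F S)" unfolding JJ_def using assms(3) by auto
  then have "pmf (JJ F S) (fr F S \<tau>, re F S \<tau>) > 0" "pmf (map_pmf snd (JJ F S)) (re F S \<tau>) > 0"
    by (force intro: pmf_positive)+
  ultimately show ?thesis by (simp add: pass_ratio_def)
qed

lemma pass_ratio_nonneg: "0 \<le> pass_ratio F S a b" by (simp add: pass_ratio_def)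

definition test_letter :: "('x, 'y, 'z) outcome \<Rightarrow> nat \<Rightarrow> nat \<Rightarrow> nat list \<Rightarrow> (nat \<Rightarrow> nat) \<Rightarrow> (nat \<Rightarrow> nat) \<Rightarrow> 'y \<Rightarrow>
    (nat \<Rightarrow> 'x) \<times> (nat \<Rightarrow> 'z) \<times> 'y" where
  "test_letter \<omega> c t u lc l y = (restrict (tx \<omega> c t u lc) (A \<union> Q), \<lambda>k\<in>Q. tz \<omega> c t lc (tx \<omega> c t u lc) k (l k), y)"

text \<open>All letters that can affect block \<open>c\<close> of the true transmission and its
  quantization. \<open>dZ\<close> contains every codeword of the quantization codebooks in use,
  because the quantizer searches through them.\<close>

definition TR :: "nat \<Rightarrow> nat list \<Rightarrow> (nat \<Rightarrow> nat) \<Rightarrow> 'x ridx set" where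
  "TR c u l' = (\<Union>t. dG c t u \<union> dX c t l' \<union> dN c t \<union> dZ c t l')"

lemma tx_cw: "k \<in> A \<Longrightarrow> tx \<omega> c t u l' k = toA (cw \<omega> c t u) k"
  and tx_T2: "k \<in> T2 \<Longrightarrow> tx \<omega> c t u l' k = valX (\<omega> (RX c t k (l' k)))"
  using A_T2 by (auto simp: tx_def glue_def senders_eq)

text \<open>A wrong list of messages, all of whose suffixes are wrong, makes the letters of
  \<open>A\<close> fresh; a wrong index makes the codeword and the whole quantization codebook of
  that relay fresh. Given the rest, the product of \<open>pass_ratio\<close> has mean at most 1,
  whereas passing the test forces it to be exponentially large. The index \<open>lsel\<close> may be
  selected by the true transmission, of which the fresh letters are independent.\<close>

lemma wrong_bound:
  assumes v: "admissible c u l'" and v': "admissible c u' lc"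
    and F: "F = (if u' = u then {} else A)" and uu: "u' \<noteq> u \<Longrightarrow> (\<And>n. n < K1 \<Longrightarrow> drop n u' \<noteq> drop n u)"
    and S: "S = {k\<in>Q. lc k \<noteq> l' k}"
    and lsel: "depends_on (TR c u l') lsel" "\<And>\<omega> k. k \<in> Q \<Longrightarrow> lsel \<omega> k \<in> {1..L k}"
  shows "measure_pmf.prob \<Omega> {\<omega>. typical dd TL (map (\<lambda>t. test_letter \<omega> c t u' lc (lsel \<omega>) (ty \<omega> c t u l' K)) [0..<N])}
    \<le> 2 powr (- real N * (pass_exp F S - dd * pass_dev F S))"
proof -
  have FA: "F \<subseteq> A" and SQ: "S \<subseteq> Q" using F S by auto
  let ?c0 = "2 powr (real N * (pass_exp F S - dd * pass_dev F S))"
  define fresh where "fresh \<omega> l t = ((restrict (tx \<omega> c t u' lc) F, restrict (tx \<omega> c t u' lc) S),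
      \<lambda>k. if k \<in> S then tz \<omega> c t lc (tx \<omega> c t u' lc) k (l k) else undefined)" for \<omega> and l :: "nat \<Rightarrow> nat" and t
  define rest where "rest \<omega> = (\<lambda>t. if t < N then re F S (test_letter \<omega> c t u' lc (lsel \<omega>) (ty \<omega> c t u l' K)) else undefined)" for \<omega>
  define E where "E h \<omega> \<longleftrightarrow> ?c0 \<le> (\<Prod>t<N. pass_ratio F S (fresh \<omega> (snd h) t) (fst h t))"
    for h :: "(nat \<Rightarrow> (nat \<Rightarrow> 'x) \<times> (nat \<Rightarrow> 'x) \<times> (nat \<Rightarrow> 'z) \<times> 'y) \<times> (nat \<Rightarrow> nat)" and \<omega>
  \<comment> \<open>The fresh letters. They are disjoint from \<open>TR\<close>: suffixes of equal
    length differ, and so do the indices of the relays in \<open>S\<close>.\<close>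
  define FR where "FR = {i :: 'x ridx. (\<exists>t n xs. i = RG c t (drop n u') xs \<and> n < K1 \<and> u' \<noteq> u)
     \<or> (\<exists>t k. i = RX c t k (lc k) \<and> k \<in> S) \<or> (\<exists>t k j x. i = RZ c t k j (lc k) x \<and> k \<in> S)}"
  have len: "length u = K1" "length u' = K1" using v v' by (auto simp: admissible_def)
  have TRFR: "TR c u l' \<subseteq> - FR"
  proof -
    have "drop n u \<noteq> drop n' u'" if "u' \<noteq> u" "n < K1" "n' < K1" for n n'
    proof
      assume e: "drop n u = drop n' u'"
      then have "length (drop n u) = length (drop n' u')" by simp
      then have "n = n'" using len that by simp
      with e uu[OF that(1,3)] show False by simp
    qed
    then show ?thesis using len S by (auto simp: TR_def dG_def dX_def dN_def dZ_def FR_def)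
  qed
  have frF: "fr F S (test_letter \<omega> c t u' lc l y) = fresh \<omega> l t" for \<omega> t l y
    using FA SQ by (auto simp: fr_def test_letter_def fresh_def fun_eq_iff restrict_def)
  have "measure_pmf.prob \<Omega> {\<omega>. typical dd TL (map (\<lambda>t. test_letter \<omega> c t u' lc (lsel \<omega>) (ty \<omega> c t u l' K)) [0..<N])}
    \<le> measure_pmf.prob \<Omega> {\<omega>. E (rest \<omega>, lsel \<omega>) \<omega>}"
  proof (rule prob_mono)
    fix \<omega> assume "\<omega> \<in> {\<omega>. typical dd TL (map (\<lambda>t. test_letter \<omega> c t u' lc (lsel \<omega>) (ty \<omega> c t u l' K)) [0..<N])}"
    then have "typical dd TL (map (\<lambda>t. test_letter \<omega> c t u' lc (lsel \<omega>) (ty \<omega> c t u l' K)) [0..<N])" by simp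
    from typical_prod(1)[OF this finite_TL, of "\<lambda>\<tau>. pass_ratio F S (fr F S \<tau>) (re F S \<tau>)"] pass_ratio_pos[OF FA SQ]
    have "?c0 \<le> (\<Prod>t<N. pass_ratio F S (fr F S (test_letter \<omega> c t u' lc (lsel \<omega>) (ty \<omega> c t u l' K))) (re F S (test_letter \<omega> c t u' lc (lsel \<omega>) (ty \<omega> c t u l' K))))"
      by (simp add: pass_exp_def pass_dev_def)
    also have "\<dots> = (\<Prod>t<N. pass_ratio F S (fresh \<omega> (lsel \<omega>) t) (rest \<omega> t))"
      by (rule prod.cong) (auto simp: frF rest_def)
    finally show "\<omega> \<in> {\<omega>. E (rest \<omega>, lsel \<omega>) \<omega>}" by (simp add: E_def)
  qed
  also have "\<dots> \<le> 1 / ?c0"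
    unfolding \<Omega>_def
  proof (rule Pi_pmf_prob_cond_le[OF finite_IX, where D=FR and f="\<lambda>\<omega>. (rest \<omega>, lsel \<omega>)" and E=E])
    show "depends_on (- FR) (\<lambda>\<omega>. (rest \<omega>, lsel \<omega>))"
    proof (rule depends_onI)
      fix a b :: "('x, 'y, 'z) outcome" assume ab: "\<And>i. i \<in> - FR \<Longrightarrow> a i = b i"
      then have abT: "\<And>i. i \<in> TR c u l' \<Longrightarrow> a i = b i" using TRFR by blast
      have l: "lsel a = lsel b" by (rule depends_onD[OF lsel(1) abT])
      have "ty a c t u l' = ty b c t u l'" for t
        by (rule depends_onD[OF ty_depends], rule abT) (auto simp: TR_def)
      moreover have "tx a c t u' lc k = tx b c t u' lc k" if "k \<in> A - F" for t k
      proof -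
        have "u' = u" using that F by (auto split: if_splits)
        moreover have "cw a c t u = cw b c t u"
          by (rule depends_onD[OF cw_depends], rule abT) (auto simp: TR_def dG_def)
        ultimately show ?thesis using that by (simp add: tx_cw)
      qed
      moreover have txQ: "tx a c t u' lc k = tx b c t u' lc k" if "k \<in> Q - S" for t k
      proof -
        have "a (RX c t k (lc k)) = b (RX c t k (lc k))" by (rule ab) (use that in \<open>auto simp: FR_def\<close>)
        then show ?thesis using that Q by (subst (1 2) tx_T2) auto
      qed
      moreover have "tz a c t lc (tx a c t u' lc) k j = tz b c t lc (tx b c t u' lc) k j" if k: "k \<in> Q - S" for t k j
      proof -
        have "a (RZ c t k j (lc k) x) = b (RZ c t k j (lc k) x)" for x by (rule ab) (use k in \<open>auto simp: FR_def\<close>)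
        then show ?thesis using txQ[OF k] by (simp add: tz_def)
      qed
      ultimately show "(rest a, lsel a) = (rest b, lsel b)"
        by (auto simp: rest_def re_def test_letter_def l fun_eq_iff restrict_def)
    qed
    show "depends_on FR (E h)" for h
    proof (rule depends_onI)
      fix a b :: "('x, 'y, 'z) outcome" assume ab: "\<And>i. i \<in> FR \<Longrightarrow> a i = b i"
      have "tx a c t u' lc k = tx b c t u' lc k" if "k \<in> F" for t k
      proof -
        have "u' \<noteq> u" "k \<in> A" using that F by (auto split: if_splits)
        moreover from this have "cw a c t u' = cw b c t u'"
          by (intro depends_onD[OF cw_depends] ab) (use len in \<open>auto simp: FR_def\<close>)
        ultimately show ?thesis by (simp add: tx_cw)
      qed
      moreover have txS: "tx a c t u' lc k = tx b c t u' lc k" if "k \<in> S" for t k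
      proof -
        have "a (RX c t k (lc k)) = b (RX c t k (lc k))" by (rule ab) (use that in \<open>auto simp: FR_def\<close>)
        then show ?thesis using that Q SQ by (subst (1 2) tx_T2) auto
      qed
      moreover have "tz a c t lc (tx a c t u' lc) k j = tz b c t lc (tx b c t u' lc) k j" if k: "k \<in> S" for t k j
      proof -
        have "a (RZ c t k j (lc k) x) = b (RZ c t k j (lc k) x)" for x by (rule ab) (use k in \<open>auto simp: FR_def\<close>)
        then show ?thesis using txS[OF k] by (simp add: tz_def)
      qed
      ultimately have "fresh a l t = fresh b l t" for l t
        by (auto simp: fresh_def fun_eq_iff restrict_def)
      then show "E h a = E h b" by (simp add: E_def)
    qed
    fix \<omega>0
    define h where "h = (rest \<omega>0, lsel \<omega>0)"
    have law: "map_pmf (\<lambda>\<omega>. fresh \<omega> (snd h) t) \<Omega> = q0 F S" if t: "t < N" for t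
    proof -
      have ll: "snd h k \<in> {1..L k}" if "k \<in> S" for k using that SQ lsel(2) by (auto simp: h_def)
      have "map_pmf (\<lambda>\<omega>. fresh \<omega> (snd h) t) \<Omega> = map_pmf (\<lambda>(xy, z). ((restrict (fst xy) F, restrict (fst xy) S), z))
         (map_pmf (\<lambda>\<omega>. ((tx \<omega> c t u' lc, ty \<omega> c t u' lc), \<lambda>k. if k \<in> S then tz \<omega> c t lc (tx \<omega> c t u' lc) k (snd h k) else undefined)) \<Omega>)"
        by (simp add: pmf.map_comp o_def fresh_def)
      also have "\<dots> = map_pmf (\<lambda>(xy, z). ((restrict (fst xy) F, restrict (fst xy) S), z))
         (bind_pmf PXY (\<lambda>xy. map_pmf (Pair xy) (Pi_pmf S undefined (\<lambda>k. pzx k (fst xy k)))))"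
        using letter_law[OF v' t ll, of S] SQ Q by simp
      also have "\<dots> = bind_pmf PX (\<lambda>x. map_pmf (Pair (restrict x F, restrict x S)) (Pi_pmf S undefined (\<lambda>k. pzx k (x k))))"
        unfolding fst_PXY[symmetric] by (simp add: map_bind_pmf bind_map_pmf pmf.map_comp o_def)
      also have "\<dots> = bind_pmf (map_pmf (\<lambda>x. (restrict x F, restrict x S)) PX) (\<lambda>ab. map_pmf (Pair ab) (Pi_pmf S undefined (\<lambda>k. pzx k (snd ab k))))"
      proof -
        have "Pi_pmf S undefined (\<lambda>k. pzx k (restrict x S k)) = Pi_pmf S undefined (\<lambda>k. pzx k (x k))" for x
          by (rule Pi_pmf_cong) auto
        then show ?thesis by (simp add: bind_map_pmf)
      qed
      also have "\<dots> = q0 F S"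
        unfolding q0_def using map_PX_restrict[OF FA, of S] SQ Q by simp
      finally show ?thesis .
    qed
    have "measure_pmf.prob \<Omega> {\<omega>. E h \<omega>} = measure_pmf.prob (Pi_pmf {..<N} undefined (\<lambda>_. q0 F S)) {s. ?c0 \<le> (\<Prod>t<N. pass_ratio F S (s t) (fst h t))}"
      unfolding E_def
    proof (rule prob_seq[where c=c and f="\<lambda>t \<omega>. fresh \<omega> (snd h) t" and E="\<lambda>s. ?c0 \<le> (\<Prod>t<N. pass_ratio F S (s t) (fst h t))"])
      show "map_pmf (\<lambda>\<omega>. fresh \<omega> (snd h) t) \<Omega> = q0 F S" if "t < N" for t by (rule law[OF that])
      show "depends_on {i. bt i = (c, t)} (\<lambda>\<omega>. fresh \<omega> (snd h) t)" for t
      proof (rule depends_onI)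
        fix a b :: "('x, 'y, 'z) outcome" assume ab: "\<And>i. i \<in> {i. bt i = (c, t)} \<Longrightarrow> a i = b i"
        from depends_onD[OF letter_bt[of c t u' lc S "snd h"] ab]
        have "((tx a c t u' lc, ty a c t u' lc), \<lambda>k. if k \<in> S then tz a c t lc (tx a c t u' lc) k (snd h k) else undefined)
          = ((tx b c t u' lc, ty b c t u' lc), \<lambda>k. if k \<in> S then tz b c t lc (tx b c t u' lc) k (snd h k) else undefined)" .
        then show "fresh a (snd h) t = fresh b (snd h) t" by (simp add: fresh_def)
      qed
      show "(?c0 \<le> (\<Prod>t<N. pass_ratio F S (s t) (fst h t))) = (?c0 \<le> (\<Prod>t<N. pass_ratio F S (s' t) (fst h t)))"
        if "\<And>t. t < N \<Longrightarrow> s t = s' t" for s s'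
      proof -
        have "(\<Prod>t<N. pass_ratio F S (s t) (fst h t)) = (\<Prod>t<N. pass_ratio F S (s' t) (fst h t))"
          by (rule prod.cong) (simp_all add: that)
        then show ?thesis by (simp only:)
      qed
    qed
    also have "\<dots> \<le> 1 / ?c0"
    proof (rule prob_prod_ge_le)
      show "(\<integral>\<^sup>+a. ennreal (pass_ratio F S a (fst h t)) \<partial>measure_pmf (q0 F S)) \<le> 1" for t
        unfolding pass_ratio_def by (rule nn_integral_likelihood_le)
    qed (auto simp: pass_ratio_nonneg)
    finally show "measure_pmf.prob (Pi_pmf IX undefined lawI) {\<omega>'. E (rest \<omega>0, lsel \<omega>0) \<omega>'} \<le> 1 / ?c0"
      by (simp add: h_def \<Omega>_def)
  qed
  also have "1 / ?c0 = 2 powr (- real N * (pass_exp F S - dd * pass_dev F S))"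
    by (simp add: powr_minus inverse_eq_divide)
  finally show ?thesis .
qed

end

section \<open>Error events of the genie-aided transmission\<close>

context random_code begin

text \<open>The function \<open>pipeline\<close>, freed from the scheme record.\<close>

definition pipe :: "(nat \<Rightarrow> nat) \<Rightarrow> nat \<Rightarrow> nat \<Rightarrow> nat list" where
  "pipe w i c = map (\<lambda>i. let j = c + 1 - i in if j \<in> {1..nb} then w j else 1) [i..<Suc K1]"

lemma length_pipe [simp]: "length (pipe w i c) = Suc K1 - i" by (simp add: pipe_def del: upt_Suc)

lemma drop_pipe: "drop n (pipe w i c) = pipe w (i + n) c"
  by (simp add: pipe_def drop_map del: upt_Suc)

lemma pipe_Cons: "i \<le> K1 \<Longrightarrow> pipe w i c = (let j = c + 1 - i in if j \<in> {1..nb} then w j else 1) # pipe w (Suc i) c"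
  unfolding pipe_def by (subst upt_conv_Cons) (auto simp del: upt_Suc)

lemma set_pipe: "(\<And>j. j \<in> {1..nb} \<Longrightarrow> w j \<in> {1..msg}) \<Longrightarrow> set (pipe w i c) \<subseteq> {1..msg}"
  using msg by (auto simp: pipe_def Let_def simp del: upt_Suc)

definition qgood :: "('x, 'y, 'z) outcome \<Rightarrow> nat \<Rightarrow> nat list \<Rightarrow> (nat \<Rightarrow> nat) \<Rightarrow> nat \<Rightarrow> nat \<Rightarrow> bool" where
  "qgood \<omega> c u l' k l \<longleftrightarrow> l \<in> {1..L k} \<and>
     qtyp k (\<lambda>t. tx \<omega> c t u l') (\<lambda>t. ty \<omega> c t u l') (\<lambda>t. tz \<omega> c t l' (tx \<omega> c t u l') k l)"

text \<open>The rule of \<open>qidx\<close> for a single block, in terms of the letters of the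
  random code.\<close>

definition qindex :: "('x, 'y, 'z) outcome \<Rightarrow> nat \<Rightarrow> nat list \<Rightarrow> (nat \<Rightarrow> nat) \<Rightarrow> nat \<Rightarrow> nat" where
  "qindex \<omega> c u l' k = (if \<exists>l. qgood \<omega> c u l' k l then LEAST l. qgood \<omega> c u l' k l else 1)"

lemma qindex_range: "k \<in> T2 \<Longrightarrow> qindex \<omega> c u l' k \<in> {1..L k}"
proof (cases "\<exists>l. qgood \<omega> c u l' k l")
  case True
  then have "qgood \<omega> c u l' k (qindex \<omega> c u l' k)" unfolding qindex_def by (simp add: LeastI_ex)
  then show ?thesis by (simp add: qgood_def)
next
  case False
  assume "k \<in> T2"
  moreover have "qindex \<omega> c u l' k = 1" unfolding qindex_def using False by (simp only: if_False)
  ultimately show ?thesis using L[of k] by simp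
qed

lemma agree:
  assumes "\<And>i. i \<in> TR c u l' \<Longrightarrow> a i = b i"
  shows "tx a c t u l' = tx b c t u l'" "ty a c t u l' = ty b c t u l'" "tz a c t l' x k l = tz b c t l' x k l"
proof -
  show "tx a c t u l' = tx b c t u l'" by (rule depends_onD[OF tx_depends], rule assms) (auto simp: TR_def)
  show "ty a c t u l' = ty b c t u l'" by (rule depends_onD[OF ty_depends], rule assms) (auto simp: TR_def)
  show "tz a c t l' x k l = tz b c t l' x k l"
    unfolding tz_def by (intro arg_cong[where f=valZ] assms) (auto simp: TR_def dZ_def)
qed

lemma qindex_depends: "depends_on (TR c u l') (\<lambda>\<omega>. qindex \<omega> c u l')"
proof (rule depends_onI)
  fix a b :: "('x, 'y, 'z) outcome" assume ab: "\<And>i. i \<in> TR c u l' \<Longrightarrow> a i = b i"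
  have "qgood a c u l' = qgood b c u l'"
    unfolding qgood_def[abs_def] by (simp only: agree[OF ab])
  then show "qindex a c u l' = qindex b c u l'" unfolding qindex_def[abs_def] by (simp only:)
qed

lemma agree_block:
  assumes "\<And>i. fst (bt i) = c \<Longrightarrow> a i = b i"
  shows "tx a c t u l' = tx b c t u l'" "ty a c t u l' = ty b c t u l'" "tz a c t l' x k l = tz b c t l' x k l"
    "qindex a c u l' = qindex b c u l'" "test_letter a c t u l' m y = test_letter b c t u l' m y"
proof -
  have TR: "\<And>i. i \<in> TR c u l' \<Longrightarrow> a i = b i" for u l'
    by (rule assms) (auto simp: TR_def dG_def dX_def dN_def dZ_def)
  show "tx a c t u l' = tx b c t u l'" "ty a c t u l' = ty b c t u l'" "tz a c t l' x k l = tz b c t l' x k l"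
    by (rule agree, erule TR)+
  show "qindex a c u l' = qindex b c u l'" by (rule depends_onD[OF qindex_depends TR])
  have "tx a c t u l' = tx b c t u l'" "\<And>x k l. tz a c t l' x k l = tz b c t l' x k l" by (rule agree, erule TR)+
  then show "test_letter a c t u l' m y = test_letter b c t u l' m y" unfolding test_letter_def by (simp only:)
qed

text \<open>The quantization indices when every decode-forward relay knows the true short messages \<open>w\<close>.\<close>

primrec genie_idx :: "(nat \<Rightarrow> nat) \<Rightarrow> ('x, 'y, 'z) outcome \<Rightarrow> nat \<Rightarrow> nat \<Rightarrow> nat" where
  "genie_idx w \<omega> 0 = (\<lambda>k. 1)"
| "genie_idx w \<omega> (Suc c) = qindex \<omega> (Suc c) (pipe w 1 (Suc c)) (genie_idx w \<omega> c)"

lemma genie_idx_range: "k \<in> T2 \<Longrightarrow> genie_idx w \<omega> c k \<in> {1..L k}"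
  using L qindex_range by (cases c) auto

text \<open>What the genie-aided transmission can read up to block \<open>C\<close>. Of the
  superposition letters these are only the ones for suffixes of the true pipelines, so wrong
  codewords stay fresh even in the same blocks.\<close>

definition GR :: "(nat \<Rightarrow> nat) \<Rightarrow> nat \<Rightarrow> 'x ridx set" where
  "GR w C = {i. fst (bt i) \<le> C \<and> (\<forall>c t u xs. i = RG c t u xs \<longrightarrow> (\<exists>n<K1. u = drop n (pipe w 1 c)))}"

lemma TR_GR: "c \<le> C \<Longrightarrow> TR c (pipe w 1 c) l' \<subseteq> GR w C"
  by (auto simp: TR_def dG_def dX_def dN_def dZ_def GR_def)

lemma genie_idx_depends: "depends_on (GR w c) (\<lambda>\<omega>. genie_idx w \<omega> c)"
proof (induction c)
  case 0
  then show ?case by (auto intro: depends_onI)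
next
  case (Suc c)
  show ?case
  proof (rule depends_onI)
    fix a b :: "('x, 'y, 'z) outcome" assume ab: "\<And>i. i \<in> GR w (Suc c) \<Longrightarrow> a i = b i"
    have "genie_idx w a c = genie_idx w b c" by (rule depends_onD[OF Suc], rule ab) (auto simp: GR_def)
    moreover have "qindex a (Suc c) (pipe w 1 (Suc c)) l' = qindex b (Suc c) (pipe w 1 (Suc c)) l'" for l'
      by (rule depends_onD[OF qindex_depends], rule ab) (use TR_GR in blast)
    ultimately show "genie_idx w a (Suc c) = genie_idx w b (Suc c)" by simp
  qed
qed

definition genie_out :: "(nat \<Rightarrow> nat) \<Rightarrow> ('x, 'y, 'z) outcome \<Rightarrow> nat \<Rightarrow> nat \<Rightarrow> nat \<Rightarrow> 'y" where
  "genie_out w \<omega> c t = ty \<omega> c t (pipe w 1 c) (genie_idx w \<omega> (c - 1))"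

lemma genie_out_depends: "depends_on (GR w c) (\<lambda>\<omega>. genie_out w \<omega> c t)"
proof (rule depends_onI)
  fix a b :: "('x, 'y, 'z) outcome" assume ab: "\<And>i. i \<in> GR w c \<Longrightarrow> a i = b i"
  have "genie_idx w a (c - 1) = genie_idx w b (c - 1)" by (rule depends_onD[OF genie_idx_depends], rule ab) (auto simp: GR_def)
  moreover have "ty a c t (pipe w 1 c) l' = ty b c t (pipe w 1 c) l'" for l'
    by (rule agree(2), rule ab) (use TR_GR in blast)
  ultimately show "genie_out w a c t = genie_out w b c t" by (simp add: genie_out_def)
qed

text \<open>The indices inherited from block \<open>c - 1\<close> are functions of the letters of
  earlier blocks, and \<open>E l'\<close> reads only block \<open>c\<close>; so a bound for each
  fixed index vector suffices.\<close>

lemma genie_cond: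
  assumes c: "1 \<le> c" and E: "\<And>l'. depends_on {i. fst (bt i) = c} (E l')"
    and le: "\<And>l'. (\<And>k. k \<in> T2 \<Longrightarrow> l' k \<in> {1..L k}) \<Longrightarrow> measure_pmf.prob \<Omega> {\<omega>. E l' \<omega>} \<le> \<beta>"
  shows "measure_pmf.prob \<Omega> {\<omega>. E (genie_idx w \<omega> (c - 1)) \<omega>} \<le> \<beta>"
  unfolding \<Omega>_def
proof (rule Pi_pmf_prob_cond_le[OF finite_IX, where D="{i. fst (bt i) = c}" and f="\<lambda>\<omega>. genie_idx w \<omega> (c - 1)" and E=E])
  show "depends_on (- {i. fst (bt i) = c}) (\<lambda>\<omega>. genie_idx w \<omega> (c - 1))"
    by (rule depends_on_mono[OF genie_idx_depends]) (use c in \<open>auto simp: GR_def\<close>)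
  show "measure_pmf.prob (Pi_pmf IX undefined lawI) {\<omega>'. E (genie_idx w \<omega> (c - 1)) \<omega>'} \<le> \<beta>" for \<omega>
    using le[of "genie_idx w \<omega> (c - 1)"] genie_idx_range unfolding \<Omega>_def by blast
qed (rule E)

text \<open>For a wrong \<open>v\<close> the letter at position \<open>i\<close> in block
  \<open>j + i - 1\<close> belongs to a message list that no true codeword of that block uses. So it
  is independent of the outputs and of the letters on which it is superposed. The letters for
  different \<open>(i, t)\<close> are distinct coordinates, and each factor has mean at most
  1.\<close>

lemma lratio_bound:
  assumes m: "m \<in> {2..K1}" and j: "j \<in> {1..nb}" and v: "v \<in> {1..msg}" "v \<noteq> w j"
    and w: "\<And>j. j \<in> {1..nb} \<Longrightarrow> w j \<in> {1..msg}" and \<theta>: "\<theta> > 0"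
  shows "measure_pmf.prob \<Omega> {\<omega>. \<theta> \<le> (\<Prod>(i, t)\<in>{1..<m} \<times> {..<N}.
      lratio m (cw \<omega> (j + i - 1) t (v # pipe w (Suc i) (j + i - 1))) (genie_out w \<omega> (j + i - 1) t (\<pi> m)))} \<le> 1 / \<theta>"
proof -
  let ?J = "{1..<m} \<times> {..<N}"
  let ?c = "\<lambda>i. j + i - 1" and ?u = "\<lambda>i. pipe w (Suc i) (j + i - 1)"
  have cB: "?c i \<in> {1..B}" if "i \<in> {1..<m}" for i using that m j by (auto simp: B_def)
  define f where "f \<omega> = (\<lambda>(i, t). if (i, t) \<in> ?J then (cw \<omega> (?c i) t (?u i), genie_out w \<omega> (?c i) t (\<pi> m)) else undefined)" for \<omega>
  define E where "E h \<omega> \<longleftrightarrow> \<theta> \<le> (\<Prod>(i, t)\<in>?J. lratio m (valX (\<omega> (RG (?c i) t (v # ?u i) (fst (h (i, t))))) # fst (h (i, t))) (snd (h (i, t))))"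
    for h and \<omega> :: "('x, 'y, 'z) outcome"
  define D where "D = {r :: 'x ridx. \<exists>i t xs. r = RG (?c i) t (v # ?u i) xs \<and> i \<in> {1..<m}}"
  have "{\<omega>. \<theta> \<le> (\<Prod>(i, t)\<in>?J. lratio m (cw \<omega> (?c i) t (v # ?u i)) (genie_out w \<omega> (?c i) t (\<pi> m)))} = {\<omega>. E (f \<omega>) \<omega>}"
    unfolding E_def by (intro Collect_cong arg_cong[where f="\<lambda>x. \<theta> \<le> x"] prod.cong refl) (auto simp: f_def cw_Cons)
  moreover have "measure_pmf.prob \<Omega> {\<omega>. E (f \<omega>) \<omega>} \<le> 1 / \<theta>"
    unfolding \<Omega>_def
  proof (rule Pi_pmf_prob_cond_le[OF finite_IX, where D=D and f=f and E=E])
    show "depends_on (- D) f"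
    proof (rule depends_onI)
      fix a b :: "('x, 'y, 'z) outcome" assume ab: "\<And>i. i \<in> - D \<Longrightarrow> a i = b i"
      have GD: "GR w C \<subseteq> - D" for C
      proof (rule subsetI, rule ComplI)
        fix r :: "'x ridx" assume r: "r \<in> GR w C" "r \<in> D"
        then obtain i t xs where i: "r = RG (?c i) t (v # ?u i) xs" "i \<in> {1..<m}" by (auto simp: D_def)
        with r(1) obtain n where n: "n < K1" "v # ?u i = drop n (pipe w 1 (?c i))" by (auto simp: GR_def)
        then have e: "v # ?u i = pipe w (Suc n) (?c i)" by (simp add: drop_pipe)
        \<comment> \<open>Comparing lengths shows that the suffix starts at position
          \<open>i\<close>, where the true pipeline carries \<open>w j\<close> and not
          \<open>v\<close>.\<close>
        then have "length (v # ?u i) = length (pipe w (Suc n) (?c i))" by (rule arg_cong)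
        then have "Suc (K1 - i) = K1 - n" by simp
        then have "Suc n = i" using i(2) m n(1) unfolding atLeastLessThan_iff atLeastAtMost_iff by linarith
        then have "v # ?u i = pipe w i (?c i)" using e by simp
        moreover have "pipe w i (?c i) = w j # ?u i" using i(2) m j by (subst pipe_Cons) auto
        ultimately show False using v by simp
      qed
      have "genie_out w a (?c i) t = genie_out w b (?c i) t" for i t
        by (rule depends_onD[OF genie_out_depends], rule ab) (use GD in blast)
      moreover have "cw a (?c i) t (?u i) = cw b (?c i) t (?u i)" if "i \<in> {1..<m}" for i t
      proof (rule depends_onD[OF cw_depends], rule ab)
        fix r :: "'x ridx" assume r: "r \<in> {RG (?c i) t (drop n (?u i)) xs |n xs. n < length (?u i)}"
        show "r \<in> - D"
        proof
          assume "r \<in> D"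
          then obtain i' t' xs' where i': "r = RG (?c i') t' (v # ?u i') xs'" "i' \<in> {1..<m}" unfolding D_def by blast
          from r obtain n xs where n: "r = RG (?c i) t (drop n (?u i)) xs" by blast
          have "RG (?c i) t (drop n (?u i)) xs = RG (?c i') t' (v # ?u i') xs'" by (rule trans[OF n[symmetric] i'(1)])
          then have "?c i = ?c i'" "drop n (?u i) = v # ?u i'" unfolding ridx.inject by blast+
          moreover from this(1) have "i' = i" using j that i'(2) by auto
          ultimately have "v # ?u i = drop n (?u i)" by metis
          then have "length (v # ?u i) = length (drop n (?u i))" by (rule arg_cong)
          then show False using that m by auto
        qed
      qed
      ultimately show "f a = f b" by (auto simp: f_def fun_eq_iff)
    qed
    show "depends_on D (E h)" for h
    proof (rule depends_onI)
      fix a b :: "('x, 'y, 'z) outcome" assume ab: "\<And>i. i \<in> D \<Longrightarrow> a i = b i"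
      have "a (RG (?c i) t (v # ?u i) xs) = b (RG (?c i) t (v # ?u i) xs)" if "i \<in> {1..<m}" for i t xs
        by (rule ab) (use that in \<open>auto simp: D_def\<close>)
      then have "(\<Prod>(i, t)\<in>?J. lratio m (valX (a (RG (?c i) t (v # ?u i) (fst (h (i, t))))) # fst (h (i, t))) (snd (h (i, t))))
        = (\<Prod>(i, t)\<in>?J. lratio m (valX (b (RG (?c i) t (v # ?u i) (fst (h (i, t))))) # fst (h (i, t))) (snd (h (i, t))))"
        by (intro prod.cong refl) auto
      then show "E h a = E h b" unfolding E_def by (simp only:)
    qed
    fix \<omega>0 assume "\<omega>0 \<in> set_pmf (Pi_pmf IX undefined lawI)"
    then have \<omega>0: "\<omega>0 \<in> set_pmf \<Omega>" by (simp add: \<Omega>_def)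
    define h where "h = f \<omega>0"
    let ?i = "\<lambda>(i, t). RG (?c i) t (v # ?u i) (fst (h (i, t)))"
    have hPA: "fst (h (i, t)) \<in> set_pmf (PA (K1 - i))" if "(i, t) \<in> ?J" for i t
    proof -
      have "cw \<omega>0 (?c i) t (?u i) \<in> set_pmf (map_pmf (\<lambda>\<omega>. cw \<omega> (?c i) t (?u i)) \<Omega>)" using \<omega>0 by auto
      also have "map_pmf (\<lambda>\<omega>. cw \<omega> (?c i) t (?u i)) \<Omega> = PA (K1 - i)"
        using that cB[of i] set_pipe[of w, OF w] by (subst cw_law) auto
      finally show ?thesis using that by (simp add: h_def f_def)
    qed
    have used: "?i p \<in> IX" if "p \<in> ?J" for p
    proof -
      obtain i t where p: "p = (i, t)" by (cases p)
      have "set (fst (h (i, t))) \<subseteq> XS" "length (fst (h (i, t))) = K1 - i"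
        using PA_XS[OF hPA] PA_set(1)[OF hPA] that p by auto
      moreover have "set (?u i) \<subseteq> {1..msg}" by (rule set_pipe[OF w])
      ultimately show ?thesis using that p cB[of i] v m by (auto simp del: IX_iff) (auto simp: IX_iff)
    qed
    have inj: "inj_on ?i ?J" using j by (auto simp: inj_on_def)
    have "measure_pmf.prob \<Omega> {\<omega>. E h \<omega>} = measure_pmf.prob (map_pmf (\<lambda>\<omega> p. if p \<in> ?J then \<omega> (?i p) else undefined) \<Omega>)
       {s. \<theta> \<le> (\<Prod>p\<in>?J. lratio m (valX (s p) # fst (h p)) (snd (h p)))}"
      unfolding measure_map_pmf vimage_def mem_Collect_eq E_def
      by (intro arg_cong[where f="measure _"] Collect_cong arg_cong[where f="\<lambda>x. \<theta> \<le> x"] prod.cong refl) auto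
    also have "map_pmf (\<lambda>\<omega> p. if p \<in> ?J then \<omega> (?i p) else undefined) \<Omega> = Pi_pmf ?J undefined (\<lambda>p. lawI (?i p))"
      unfolding \<Omega>_def by (rule Pi_pmf_select) (use inj used in \<open>auto simp del: IX_iff\<close>)
    also have "measure_pmf.prob \<dots> {s. \<theta> \<le> (\<Prod>p\<in>?J. lratio m (valX (s p) # fst (h p)) (snd (h p)))} \<le> 1 / \<theta>"
    proof (rule prob_prod_ge_le)
      fix p assume "p \<in> ?J"
      then obtain i t where p: "p = (i, t)" "(i, t) \<in> ?J" by (cases p) auto
      have "(\<integral>\<^sup>+a. ennreal (lratio m (valX a # fst (h p)) (snd (h p))) \<partial>measure_pmf (lawI (?i p)))
        = (\<integral>\<^sup>+x. ennreal (lratio m (x # fst (h p)) (snd (h p))) \<partial>measure_pmf (next_law (fst (h p))))"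
        using p by simp
      also have "\<dots> \<le> 1"
        using p m hPA[OF p(2)] by (intro lratio_mean_le[of _ "K1 - i"]) auto
      finally show "(\<integral>\<^sup>+a. ennreal (lratio m (valX a # fst (h p)) (snd (h p))) \<partial>measure_pmf (lawI (?i p))) \<le> 1" .
    qed (use \<theta> in \<open>auto simp: lratio_nonneg\<close>)
    finally show "measure_pmf.prob (Pi_pmf IX undefined lawI) {\<omega>'. E (f \<omega>0) \<omega>'} \<le> 1 / \<theta>"
      by (simp add: h_def \<Omega>_def)
  qed
  ultimately show ?thesis by simp
qed

text \<open>The error events of a block are formulated for a fixed index vector \<open>l'\<close>,
  so that each reads the letters of one block only; \<open>BadB\<close> inserts the indices of the
  genie.\<close>

definition Bad1 :: "nat \<Rightarrow> nat list \<Rightarrow> (nat \<Rightarrow> nat) \<Rightarrow> ('x, 'y, 'z) outcome \<Rightarrow> bool" where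
  "Bad1 c u l' \<omega> \<longleftrightarrow> \<not> typical dd PXY (map (\<lambda>t. (tx \<omega> c t u l', ty \<omega> c t u l')) [0..<N])"

definition Bad2 :: "nat \<Rightarrow> nat list \<Rightarrow> (nat \<Rightarrow> nat) \<Rightarrow> ('x, 'y, 'z) outcome \<Rightarrow> bool" where
  "Bad2 c u l' \<omega> \<longleftrightarrow> (\<exists>k\<in>Q. \<forall>l\<in>{1..L k}. \<not> qtyp k (\<lambda>t. tx \<omega> c t u l') (\<lambda>t. ty \<omega> c t u l')
     (\<lambda>t. tz \<omega> c t l' (tx \<omega> c t u l') k l))"

text \<open>All index tuples are considered, not just the selected one: the selection depends on the
  codebooks and would spoil the product law.\<close>

definition Bad3 :: "nat \<Rightarrow> nat list \<Rightarrow> (nat \<Rightarrow> nat) \<Rightarrow> ('x, 'y, 'z) outcome \<Rightarrow> bool" where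
  "Bad3 c u l' \<omega> \<longleftrightarrow> (\<exists>l\<in>PiE Q (\<lambda>k. {1..L k}).
     (\<forall>k\<in>Q. qtyp k (\<lambda>t. tx \<omega> c t u l') (\<lambda>t. ty \<omega> c t u l') (\<lambda>t. tz \<omega> c t l' (tx \<omega> c t u l') k (l k))) \<and>
     \<not> typical dd TL (map (\<lambda>t. test_letter \<omega> c t u l' l (ty \<omega> c t u l' K)) [0..<N]))"

text \<open>The destination guesses indices for \<open>Q\<close> only. Outside \<open>Q\<close> the
  true ones complete the input vector, and test letters do not depend on them.\<close>

definition upd :: "(nat \<Rightarrow> nat) \<Rightarrow> (nat \<Rightarrow> nat) \<Rightarrow> nat \<Rightarrow> nat" where
  "upd l' m = (\<lambda>k. if k \<in> Q then m k else l' k)"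

text \<open>The index of the present block is the true one, known from the block decoded before or
  from the final phase. Unknown are the oldest message of the pipeline, at the end of
  \<open>u\<close>, and the previous indices.\<close>

definition Bad4 :: "nat \<Rightarrow> nat list \<Rightarrow> (nat \<Rightarrow> nat) \<Rightarrow> ('x, 'y, 'z) outcome \<Rightarrow> bool" where
  "Bad4 c u l' \<omega> \<longleftrightarrow> (\<exists>v\<in>{1..msg}. \<exists>m\<in>PiE Q (\<lambda>k. {1..L k}). (v \<noteq> last u \<or> m \<noteq> restrict l' Q) \<and>
     typical dd TL (map (\<lambda>t. test_letter \<omega> c t (butlast u @ [v]) (upd l' m) (qindex \<omega> c u l') (ty \<omega> c t u l' K)) [0..<N]))"

definition bb2 :: real where
  "bb2 = (\<Sum>k\<in>Q. 2 * tailp N dq (PXYZ k) + exp (- (real (L k) / (2 * 2 powr (real N * (qrate k + dq * qdev k))))))"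

definition bb3 :: real where
  "bb3 = (\<Prod>k\<in>Q. real (L k)) * ((\<Prod>k\<in>Q. 2 powr (- real N * (qrate k - dq * qdev k))) * tailp N dd TL)"

definition bb4 :: real where
  "bb4 = (\<Sum>S\<in>Pow Q - {{}}. (\<Prod>k\<in>S. real (L k)) * 2 powr (- real N * (pass_exp {} S - dd * pass_dev {} S)))
     + (\<Sum>S\<in>Pow Q. real msg * (\<Prod>k\<in>S. real (L k)) * 2 powr (- real N * (pass_exp A S - dd * pass_dev A S)))"

lemma Bad_depends:
  "depends_on {i. fst (bt i) = c} (Bad1 c u l')" "depends_on {i. fst (bt i) = c} (Bad2 c u l')"
  "depends_on {i. fst (bt i) = c} (Bad3 c u l')" "depends_on {i. fst (bt i) = c} (Bad4 c u l')"
proof -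
  have ag: "tx a c t u l' = tx b c t u l'" "ty a c t u l' = ty b c t u l'" "tz a c t l' x k l = tz b c t l' x k l"
    "qindex a c u l' = qindex b c u l'" "test_letter a c t u l' m y = test_letter b c t u l' m y"
    if "\<And>i. i \<in> {i. fst (bt i) = c} \<Longrightarrow> a i = b i" for a b :: "('x, 'y, 'z) outcome" and t x k l u l' m y
    by (rule agree_block, rule that, simp)+
  show "depends_on {i. fst (bt i) = c} (Bad1 c u l')"
  proof (rule depends_onI)
    fix a b :: "('x, 'y, 'z) outcome" assume ab: "\<And>i. i \<in> {i. fst (bt i) = c} \<Longrightarrow> a i = b i"
    show "Bad1 c u l' a = Bad1 c u l' b" unfolding Bad1_def by (simp only: ag[of a b, OF ab])
  qed
  show "depends_on {i. fst (bt i) = c} (Bad2 c u l')"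
  proof (rule depends_onI)
    fix a b :: "('x, 'y, 'z) outcome" assume ab: "\<And>i. i \<in> {i. fst (bt i) = c} \<Longrightarrow> a i = b i"
    show "Bad2 c u l' a = Bad2 c u l' b" unfolding Bad2_def by (simp only: ag[of a b, OF ab])
  qed
  show "depends_on {i. fst (bt i) = c} (Bad3 c u l')"
  proof (rule depends_onI)
    fix a b :: "('x, 'y, 'z) outcome" assume ab: "\<And>i. i \<in> {i. fst (bt i) = c} \<Longrightarrow> a i = b i"
    show "Bad3 c u l' a = Bad3 c u l' b" unfolding Bad3_def by (simp only: ag[of a b, OF ab])
  qed
  show "depends_on {i. fst (bt i) = c} (Bad4 c u l')"
  proof (rule depends_onI)
    fix a b :: "('x, 'y, 'z) outcome" assume ab: "\<And>i. i \<in> {i. fst (bt i) = c} \<Longrightarrow> a i = b i"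
    show "Bad4 c u l' a = Bad4 c u l' b" unfolding Bad4_def by (simp only: ag[of a b, OF ab])
  qed
qed

lemma prob_Bad1: "admissible c u l' \<Longrightarrow> measure_pmf.prob \<Omega> {\<omega>. Bad1 c u l' \<omega>} \<le> tailp N dd PXY"
  unfolding Bad1_def by (simp only: typ_bound)

lemma prob_Bad2: "admissible c u l' \<Longrightarrow> measure_pmf.prob \<Omega> {\<omega>. Bad2 c u l' \<omega>} \<le> bb2"
proof -
  assume v: "admissible c u l'"
  have "{\<omega>. Bad2 c u l' \<omega>} = (\<Union>k\<in>Q. {\<omega>. \<forall>l\<in>{1..L k}. \<not> qtyp k (\<lambda>t. tx \<omega> c t u l') (\<lambda>t. ty \<omega> c t u l')
     (\<lambda>t. tz \<omega> c t l' (tx \<omega> c t u l') k l)})" by (auto simp: Bad2_def)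
  then show ?thesis unfolding bb2_def
    by (simp only:) (rule prob_UN_le[OF finite_Q], rule cov_bound[OF v], rule subsetD[OF Q])
qed

lemma prob_Bad3: "admissible c u l' \<Longrightarrow> measure_pmf.prob \<Omega> {\<omega>. Bad3 c u l' \<omega>} \<le> bb3"
proof -
  assume v: "admissible c u l'"
  let ?b = "(\<Prod>k\<in>Q. 2 powr (- real N * (qrate k - dq * qdev k))) * tailp N dd TL"
  have "{\<omega>. Bad3 c u l' \<omega>} = (\<Union>l\<in>PiE Q (\<lambda>k. {1..L k}). {\<omega>. (\<forall>k\<in>Q. qtyp k (\<lambda>t. tx \<omega> c t u l') (\<lambda>t. ty \<omega> c t u l') (\<lambda>t. tz \<omega> c t l' (tx \<omega> c t u l') k (l k))) \<and>
     \<not> typical dd TL (map (\<lambda>t. (restrict (tx \<omega> c t u l') (A \<union> Q), \<lambda>k\<in>Q. tz \<omega> c t l' (tx \<omega> c t u l') k (l k), ty \<omega> c t u l' K)) [0..<N])})"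
    unfolding Bad3_def test_letter_def by blast
  moreover have "measure_pmf.prob \<Omega> (\<Union>l\<in>PiE Q (\<lambda>k. {1..L k}). {\<omega>. (\<forall>k\<in>Q. qtyp k (\<lambda>t. tx \<omega> c t u l') (\<lambda>t. ty \<omega> c t u l') (\<lambda>t. tz \<omega> c t l' (tx \<omega> c t u l') k (l k))) \<and>
     \<not> typical dd TL (map (\<lambda>t. (restrict (tx \<omega> c t u l') (A \<union> Q), \<lambda>k\<in>Q. tz \<omega> c t l' (tx \<omega> c t u l') k (l k), ty \<omega> c t u l' K)) [0..<N])})
     \<le> (\<Sum>l\<in>PiE Q (\<lambda>k. {1..L k}). ?b)"
    by (rule prob_UN_le, intro finite_PiE finite_Q finite_atLeastAtMost, rule atyp_bound[OF v], erule PiE_mem)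
  moreover have "(\<Sum>l\<in>PiE Q (\<lambda>k. {1..L k}). ?b) = bb3"
    by (simp add: bb3_def card_PiE)
  ultimately show ?thesis by simp
qed

text \<open>Wrong pairs are grouped by the set \<open>S\<close> of relays with a wrong index. For
  each message a group has at most the product of \<open>L k\<close> over \<open>S\<close> members,
  and these share one exponent.\<close>

lemma prob_Bad4:
  assumes v: "admissible c u l'"
  shows "measure_pmf.prob \<Omega> {\<omega>. Bad4 c u l' \<omega>} \<le> bb4"
proof -
  have len: "length u = K1" "u \<noteq> []" using v K1 by (auto simp: admissible_def)
  have lastu: "last u \<in> {1..msg}" using last_in_set[OF len(2)] v unfolding admissible_def by blast
  define W where "W v' m = {\<omega>. typical dd TL (map (\<lambda>t. test_letter \<omega> c t (butlast u @ [v']) (upd l' m) (qindex \<omega> c u l') (ty \<omega> c t u l' K)) [0..<N])}" for v' m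
  define LS where "LS S = {m \<in> PiE Q (\<lambda>k. {1..L k}). {k\<in>Q. m k \<noteq> l' k} = S}" for S
  have finLS: "finite (LS S)" for S unfolding LS_def by (rule finite_subset[of _ "PiE Q (\<lambda>k. {1..L k})"]) (auto intro!: finite_PiE)
  have cardLS: "real (card (LS S)) \<le> (\<Prod>k\<in>S. real (L k))" if S: "S \<subseteq> Q" for S
  proof -
    have finS: "finite S" using S by (rule finite_subset) simp
    have "inj_on (\<lambda>m. restrict m S) (LS S)"
    proof (rule inj_onI)
      fix m m' assume mm: "m \<in> LS S" "m' \<in> LS S" "restrict m S = restrict m' S"
      show "m = m'"
      proof
        fix k
        consider "k \<in> S" | "k \<in> Q - S" | "k \<notin> Q" using S by blast
        then show "m k = m' k"
        proof cases
          case 1 then show ?thesis using fun_cong[OF mm(3), of k] by simp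
        next
          case 2 then show ?thesis using mm(1,2) by (auto simp: LS_def)
        next
          case 3 then show ?thesis using mm(1,2) by (auto simp: LS_def PiE_def extensional_def)
        qed
      qed
    qed
    moreover have "(\<lambda>m. restrict m S) ` LS S \<subseteq> PiE S (\<lambda>k. {1..L k})" using S by (auto simp: LS_def PiE_iff)
    ultimately have "card (LS S) \<le> card (PiE S (\<lambda>k. {1..L k}))"
      by (rule card_inj_on_le) (auto intro!: finite_PiE finS)
    also have "\<dots> = (\<Prod>k\<in>S. L k)" using finS by (simp add: card_PiE)
    finally show ?thesis by (metis of_nat_le_iff of_nat_prod)
  qed
  have W: "measure_pmf.prob \<Omega> (W v' m) \<le> 2 powr (- real N * (pass_exp F S - dd * pass_dev F S))"
    if v': "v' \<in> {1..msg}" and F: "F = (if v' = last u then {} else A)" and m: "m \<in> LS S" for v' m F S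
    unfolding W_def
  proof (rule wrong_bound[OF v])
    show "admissible c (butlast u @ [v']) (upd l' m)"
      using v v' m len Q by (auto simp: admissible_def upd_def LS_def PiE_iff dest: in_set_butlastD)
    have e: "butlast u @ [v'] = u \<longleftrightarrow> v' = last u"
      using len(2) by (metis append_butlast_last_id last_snoc)
    show "F = (if butlast u @ [v'] = u then {} else A)" using F e by simp
    show "drop n (butlast u @ [v']) \<noteq> drop n u" if "butlast u @ [v'] \<noteq> u" "n < K1" for n
    proof
      assume "drop n (butlast u @ [v']) = drop n u"
      then have "last (drop n (butlast u @ [v'])) = last (drop n u)" by simp
      then have "v' = last u" using that(2) len by (simp add: last_drop)
      with that(1) e show False by simp
    qed
    show "S = {k \<in> Q. upd l' m k \<noteq> l' k}" using m by (auto simp: LS_def upd_def)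
    show "depends_on (TR c u l') (\<lambda>\<omega>. qindex \<omega> c u l')" by (rule qindex_depends)
    show "qindex \<omega> c u l' k \<in> {1..L k}" if "k \<in> Q" for \<omega> k using that Q by (intro qindex_range) auto
  qed
  have "{\<omega>. Bad4 c u l' \<omega>} \<subseteq> (\<Union>S\<in>Pow Q - {{}}. \<Union>m\<in>LS S. W (last u) m) \<union> (\<Union>S\<in>Pow Q. \<Union>v'\<in>{1..msg} - {last u}. \<Union>m\<in>LS S. W v' m)"
  proof
    fix \<omega> assume "\<omega> \<in> {\<omega>. Bad4 c u l' \<omega>}"
    then obtain v' m where vm: "v' \<in> {1..msg}" "m \<in> PiE Q (\<lambda>k. {1..L k})" "v' \<noteq> last u \<or> m \<noteq> restrict l' Q" "\<omega> \<in> W v' m"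
      by (auto simp: Bad4_def W_def)
    define S where "S = {k\<in>Q. m k \<noteq> l' k}"
    have S: "S \<in> Pow Q" "m \<in> LS S" using vm(2) by (auto simp: S_def LS_def)
    show "\<omega> \<in> (\<Union>S\<in>Pow Q - {{}}. \<Union>m\<in>LS S. W (last u) m) \<union> (\<Union>S\<in>Pow Q. \<Union>v'\<in>{1..msg} - {last u}. \<Union>m\<in>LS S. W v' m)"
    proof (cases "v' = last u")
      case True
      then have "m \<noteq> restrict l' Q" using vm(3) by simp
      moreover have "m = restrict l' Q" if "S = {}"
      proof
        fix k
        show "m k = restrict l' Q k"
        proof (cases "k \<in> Q")
          case True
          then show ?thesis using that by (auto simp: S_def)
        next
          case False
          then show ?thesis using PiE_arb[OF vm(2)] by simp
        qed
      qed
      ultimately have "S \<noteq> {}" by blast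
      then show ?thesis using S vm(4) True by blast
    next
      case False
      then show ?thesis using S vm by blast
    qed
  qed
  then have "measure_pmf.prob \<Omega> {\<omega>. Bad4 c u l' \<omega>} \<le> measure_pmf.prob \<Omega> ((\<Union>S\<in>Pow Q - {{}}. \<Union>m\<in>LS S. W (last u) m) \<union> (\<Union>S\<in>Pow Q. \<Union>v'\<in>{1..msg} - {last u}. \<Union>m\<in>LS S. W v' m))"
    by (intro prob_mono) blast
  also have "\<dots> \<le> measure_pmf.prob \<Omega> (\<Union>S\<in>Pow Q - {{}}. \<Union>m\<in>LS S. W (last u) m) + measure_pmf.prob \<Omega> (\<Union>S\<in>Pow Q. \<Union>v'\<in>{1..msg} - {last u}. \<Union>m\<in>LS S. W v' m)"
    by (rule prob_Un_le)
  also have "\<dots> \<le> bb4"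
    unfolding bb4_def
  proof (rule add_mono)
    show "measure_pmf.prob \<Omega> (\<Union>S\<in>Pow Q - {{}}. \<Union>m\<in>LS S. W (last u) m)
      \<le> (\<Sum>S\<in>Pow Q - {{}}. (\<Prod>k\<in>S. real (L k)) * 2 powr (- real N * (pass_exp {} S - dd * pass_dev {} S)))"
    proof (rule prob_UN_le)
      fix S assume S: "S \<in> Pow Q - {{}}"
      have "measure_pmf.prob \<Omega> (\<Union>m\<in>LS S. W (last u) m) \<le> (\<Sum>m\<in>LS S. 2 powr (- real N * (pass_exp {} S - dd * pass_dev {} S)))"
        by (intro prob_UN_le finLS W lastu) auto
      also have "\<dots> = real (card (LS S)) * 2 powr (- real N * (pass_exp {} S - dd * pass_dev {} S))" by simp
      also have "\<dots> \<le> (\<Prod>k\<in>S. real (L k)) * 2 powr (- real N * (pass_exp {} S - dd * pass_dev {} S))"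
        using S by (intro mult_right_mono cardLS) auto
      finally show "measure_pmf.prob \<Omega> (\<Union>m\<in>LS S. W (last u) m) \<le> (\<Prod>k\<in>S. real (L k)) * 2 powr (- real N * (pass_exp {} S - dd * pass_dev {} S))" .
    qed simp
    show "measure_pmf.prob \<Omega> (\<Union>S\<in>Pow Q. \<Union>v'\<in>{1..msg} - {last u}. \<Union>m\<in>LS S. W v' m)
      \<le> (\<Sum>S\<in>Pow Q. real msg * (\<Prod>k\<in>S. real (L k)) * 2 powr (- real N * (pass_exp A S - dd * pass_dev A S)))"
    proof (rule prob_UN_le)
      fix S assume S: "S \<in> Pow Q"
      let ?e = "2 powr (- real N * (pass_exp A S - dd * pass_dev A S))"
      have "measure_pmf.prob \<Omega> (\<Union>v'\<in>{1..msg} - {last u}. \<Union>m\<in>LS S. W v' m) \<le> (\<Sum>v'\<in>{1..msg} - {last u}. \<Sum>m\<in>LS S. ?e)"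
        by (intro prob_UN_le finLS W) auto
      also have "\<dots> = real (card ({1..msg} - {last u})) * (real (card (LS S)) * ?e)" by simp
      also have "\<dots> \<le> real msg * ((\<Prod>k\<in>S. real (L k)) * ?e)"
        using S card_mono[of "{1..msg}" "{1..msg} - {last u}"] by (intro mult_mono mult_right_mono cardLS) (auto intro!: mult_nonneg_nonneg prod_nonneg)
      finally show "measure_pmf.prob \<Omega> (\<Union>v'\<in>{1..msg} - {last u}. \<Union>m\<in>LS S. W v' m) \<le> real msg * (\<Prod>k\<in>S. real (L k)) * ?e"
        by (simp only: mult.assoc)
    qed simp
  qed
  finally show ?thesis .
qed

text \<open>Only wrong short messages above the threshold count; that the true one lies above it is
  a consequence of typicality, shown in \<open>score_true\<close>.\<close>

definition BadR :: "(nat \<Rightarrow> nat) \<Rightarrow> real \<Rightarrow> ('x, 'y, 'z) outcome \<Rightarrow> bool" where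
  "BadR w \<theta> \<omega> \<longleftrightarrow> (\<exists>m\<in>{2..K1}. \<exists>j\<in>{1..nb}. \<exists>v\<in>{1..msg} - {w j}. \<theta> \<le> (\<Prod>(i, t)\<in>{1..<m} \<times> {..<N}.
      lratio m (cw \<omega> (j + i - 1) t (v # pipe w (Suc i) (j + i - 1))) (genie_out w \<omega> (j + i - 1) t (\<pi> m))))"

definition BadB :: "(nat \<Rightarrow> nat) \<Rightarrow> nat \<Rightarrow> ('x, 'y, 'z) outcome \<Rightarrow> bool" where
  "BadB w c \<omega> \<longleftrightarrow> (let u = pipe w 1 c; l' = genie_idx w \<omega> (c - 1) in Bad1 c u l' \<omega> \<or> Bad2 c u l' \<omega> \<or> Bad3 c u l' \<omega> \<or> Bad4 c u l' \<omega>)"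

lemma prob_Bad:
  assumes w: "\<And>j. j \<in> {1..nb} \<Longrightarrow> w j \<in> {1..msg}" and \<theta>: "\<theta> > 0"
  shows "measure_pmf.prob \<Omega> {\<omega>. BadR w \<theta> \<omega> \<or> (\<exists>c\<in>{1..B}. BadB w c \<omega>)}
    \<le> real (K1 * nb * msg) / \<theta> + real B * (tailp N dd PXY + bb2 + bb3 + bb4)"
proof -
  have "measure_pmf.prob \<Omega> {\<omega>. BadR w \<theta> \<omega>} \<le> real (K1 * nb * msg) / \<theta>"
  proof -
    define X where "X m j v = {\<omega>. \<theta> \<le> (\<Prod>(i, t)\<in>{1..<m} \<times> {..<N}.
      lratio m (cw \<omega> (j + i - 1) t (v # pipe w (Suc i) (j + i - 1))) (genie_out w \<omega> (j + i - 1) t (\<pi> m)))}" for m j v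
    have X: "measure_pmf.prob \<Omega> (X m j v) \<le> 1 / \<theta>"
      if "m \<in> {2..K1}" "j \<in> {1..nb}" "v \<in> {1..msg} - {w j}" for m j v
      unfolding X_def
    proof (rule lratio_bound[OF that(1,2) _ _ w \<theta>])
      show "v \<in> {1..msg}" "v \<noteq> w j" using that(3) by auto
    qed
    have "{\<omega>. BadR w \<theta> \<omega>} = (\<Union>m\<in>{2..K1}. \<Union>j\<in>{1..nb}. \<Union>v\<in>{1..msg} - {w j}. X m j v)"
      unfolding BadR_def X_def by blast
    also have "measure_pmf.prob \<Omega> \<dots> \<le> (\<Sum>m\<in>{2..K1}. \<Sum>j\<in>{1..nb}. \<Sum>v\<in>{1..msg} - {w j}. 1 / \<theta>)"
      by (rule prob_UN_le[OF finite_atLeastAtMost prob_UN_le[OF finite_atLeastAtMost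
              prob_UN_le[OF finite_Diff[OF finite_atLeastAtMost]]]]) (rule X)
    also have "\<dots> \<le> (\<Sum>m\<in>{2..K1}. \<Sum>j\<in>{1..nb}. real msg * (1 / \<theta>))"
    proof (rule sum_mono, rule sum_mono)
      fix j
      have "real (card ({1..msg} - {w j})) \<le> real msg" using card_mono[of "{1..msg}" "{1..msg} - {w j}"] by simp
      then have "real (card ({1..msg} - {w j})) * (1 / \<theta>) \<le> real msg * (1 / \<theta>)"
        using \<theta> by (intro mult_right_mono) auto
      then show "(\<Sum>v\<in>{1..msg} - {w j}. 1 / \<theta>) \<le> real msg * (1 / \<theta>)"
        by (simp only: sum_constant)
    qed
    also have "\<dots> = real (K1 - 1) * (real nb * (real msg * (1 / \<theta>)))" by simp
    also have "\<dots> \<le> real K1 * (real nb * (real msg * (1 / \<theta>)))" using \<theta> by (intro mult_right_mono) auto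
    finally show ?thesis by simp
  qed
  moreover have "measure_pmf.prob \<Omega> {\<omega>. \<exists>c\<in>{1..B}. BadB w c \<omega>} \<le> real B * (tailp N dd PXY + bb2 + bb3 + bb4)"
  proof -
    have "measure_pmf.prob \<Omega> {\<omega>. BadB w c \<omega>} \<le> tailp N dd PXY + bb2 + bb3 + bb4" if c: "c \<in> {1..B}" for c
    proof -
      let ?u = "pipe w 1 c"
      have v: "admissible c ?u l'" if "\<And>k. k \<in> T2 \<Longrightarrow> l' k \<in> {1..L k}" for l'
        using that c set_pipe[of w, OF w] by (auto simp: admissible_def)
      have c1: "1 \<le> c" using c by simp
      have b1: "measure_pmf.prob \<Omega> {\<omega>. Bad1 c ?u (genie_idx w \<omega> (c - 1)) \<omega>} \<le> tailp N dd PXY"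
        by (rule genie_cond[OF c1 Bad_depends(1)]) (rule prob_Bad1[OF v])
      have b2: "measure_pmf.prob \<Omega> {\<omega>. Bad2 c ?u (genie_idx w \<omega> (c - 1)) \<omega>} \<le> bb2"
        by (rule genie_cond[OF c1 Bad_depends(2)]) (rule prob_Bad2[OF v])
      have b3: "measure_pmf.prob \<Omega> {\<omega>. Bad3 c ?u (genie_idx w \<omega> (c - 1)) \<omega>} \<le> bb3"
        by (rule genie_cond[OF c1 Bad_depends(3)]) (rule prob_Bad3[OF v])
      have b4: "measure_pmf.prob \<Omega> {\<omega>. Bad4 c ?u (genie_idx w \<omega> (c - 1)) \<omega>} \<le> bb4"
        by (rule genie_cond[OF c1 Bad_depends(4)]) (rule prob_Bad4[OF v])
      have e: "{\<omega>. BadB w c \<omega>} = {\<omega>. Bad1 c ?u (genie_idx w \<omega> (c - 1)) \<omega>} \<union> {\<omega>. Bad2 c ?u (genie_idx w \<omega> (c - 1)) \<omega>}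
          \<union> {\<omega>. Bad3 c ?u (genie_idx w \<omega> (c - 1)) \<omega>} \<union> {\<omega>. Bad4 c ?u (genie_idx w \<omega> (c - 1)) \<omega>}"
        unfolding BadB_def Let_def by blast
      show ?thesis unfolding e
        by (rule order.trans[OF prob_Un_le add_mono[OF order.trans[OF prob_Un_le add_mono[OF
              order.trans[OF prob_Un_le add_mono[OF b1 b2]] b3]] b4]])
    qed
    then have "measure_pmf.prob \<Omega> (\<Union>c\<in>{1..B}. {\<omega>. BadB w c \<omega>}) \<le> (\<Sum>c\<in>{1..B}. tailp N dd PXY + bb2 + bb3 + bb4)"
      by (intro prob_UN_le) auto
    moreover have "(\<Union>c\<in>{1..B}. {\<omega>. BadB w c \<omega>}) = {\<omega>. \<exists>c\<in>{1..B}. BadB w c \<omega>}" by auto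
    ultimately show ?thesis by simp
  qed
  moreover have "{\<omega>. BadR w \<theta> \<omega> \<or> (\<exists>c\<in>{1..B}. BadB w c \<omega>)} = {\<omega>. BadR w \<theta> \<omega>} \<union> {\<omega>. \<exists>c\<in>{1..B}. BadB w c \<omega>}" by auto
  ultimately show ?thesis using prob_Un_le[of \<Omega> "{\<omega>. BadR w \<theta> \<omega>}" "{\<omega>. \<exists>c\<in>{1..B}. BadB w c \<omega>}"] by simp
qed

end

section \<open>Exponents in terms of the rate bounds\<close>

context relay_law begin

text \<open>Information density between the letter of position \<open>i\<close> and the output at
  position \<open>m\<close>, given the letters of the positions after \<open>i\<close>.\<close>

definition ylog :: "nat \<Rightarrow> nat \<Rightarrow> ('x, 'y, 'z) sample \<Rightarrow> real" where
  "ylog m i = (\<lambda>(x, y, z). log 2 (lratio m (drop (i - 1) (xsA x)) (y (\<pi> m))))"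

lemma drop_xsA_eq_iff:
  assumes "1 \<le> i"
  shows "drop (i - 1) (xsA x) = drop (i - 1) (xsA x') \<longleftrightarrow> (\<forall>k\<in>\<pi> ` {i..K1}. x k = x' k)"
proof -
  have e: "drop (i - 1) (xsA x) = map (\<lambda>m. x (\<pi> m)) [i..<Suc K1]" for x :: "nat \<Rightarrow> 'x"
    using assms unfolding xsA_def drop_map drop_upt by simp
  show ?thesis unfolding e by (auto simp: map_eq_conv simp del: upt_Suc)
qed

lemma PA_P: "PA j = map_pmf (\<lambda>\<omega>. drop (K1 - j) (xsA (fst \<omega>))) P"
proof -
  have "PA j = map_pmf (\<lambda>a. drop (K1 - j) (xsA a)) (map_pmf (Xs A) P)" unfolding PA_def map_A ..
  also have "\<dots> = map_pmf (\<lambda>\<omega>. drop (K1 - j) (xsA (fst \<omega>))) P"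
    unfolding pmf.map_comp by (intro map_pmf_cong refl) (simp add: Xs_def xsA_restrict case_prod_unfold)
  finally show ?thesis .
qed

lemma ratio_pos:
  assumes "(x, y, z) \<in> set_pmf P" "i \<in> {1..K1}"
  shows "0 < lratio m (drop (i - 1) (xsA x)) (y (\<pi> m))"
    and "log 2 (lratio m (drop (i - 1) (xsA x)) (y (\<pi> m)))
      = lg P (\<lambda>(x, y, z). (drop (i - 1) (xsA x), y (\<pi> m))) (x, y, z) - lg P (\<lambda>(x, y, z). drop (i - 1) (xsA x)) (x, y, z)
      - (lg P (\<lambda>(x, y, z). (drop i (xsA x), y (\<pi> m))) (x, y, z) - lg P (\<lambda>(x, y, z). drop i (xsA x)) (x, y, z))"
proof -
  let ?xs = "drop (i - 1) (xsA x)"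
  have l: "length ?xs = K1 - (i - 1)" "K1 - (K1 - (i - 1)) = i - 1" "length ?xs - 1 = K1 - i" "K1 - (K1 - i) = i" "tl ?xs = drop i (xsA x)"
    using assms(2) by (auto simp: tl_drop drop_Suc[symmetric])
  have 1: "pmf (JY m (length ?xs)) (?xs, y (\<pi> m)) = pmf (map_pmf (\<lambda>(x, y, z). (drop (i - 1) (xsA x), y (\<pi> m))) P) (?xs, y (\<pi> m))"
    unfolding l JY_def ..
  have 2: "pmf (PA (length ?xs)) ?xs = pmf (map_pmf (\<lambda>(x, y, z). drop (i - 1) (xsA x)) P) ?xs"
    unfolding l by (subst PA_P) (simp only: l case_prod_unfold)
  have 3: "pmf (JY m (length ?xs - 1)) (tl ?xs, y (\<pi> m)) = pmf (map_pmf (\<lambda>(x, y, z). (drop i (xsA x), y (\<pi> m))) P) (drop i (xsA x), y (\<pi> m))"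
    unfolding l(3,4,5) JY_def ..
  have 4: "pmf (PA (length ?xs - 1)) (tl ?xs) = pmf (map_pmf (\<lambda>(x, y, z). drop i (xsA x)) P) (drop i (xsA x))"
    unfolding l(3,4,5) by (subst PA_P) (simp only: l(4) case_prod_unfold)
  note pos = pmf_map_pos[OF assms(1), of "\<lambda>(x, y, z). (drop (i - 1) (xsA x), y (\<pi> m))"] pmf_map_pos[OF assms(1), of "\<lambda>(x, y, z). drop (i - 1) (xsA x)"]
    pmf_map_pos[OF assms(1), of "\<lambda>(x, y, z). (drop i (xsA x), y (\<pi> m))"] pmf_map_pos[OF assms(1), of "\<lambda>(x, y, z). drop i (xsA x)"]
  show "0 < lratio m ?xs (y (\<pi> m))" unfolding lratio_def 1 2 3 4 using pos by simp
  show "log 2 (lratio m (drop (i - 1) (xsA x)) (y (\<pi> m)))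
      = lg P (\<lambda>(x, y, z). (drop (i - 1) (xsA x), y (\<pi> m))) (x, y, z) - lg P (\<lambda>(x, y, z). drop (i - 1) (xsA x)) (x, y, z)
      - (lg P (\<lambda>(x, y, z). (drop i (xsA x), y (\<pi> m))) (x, y, z) - lg P (\<lambda>(x, y, z). drop i (xsA x)) (x, y, z))"
    unfolding lratio_def 1 2 3 4 lg_def using pos by (simp add: log_divide log_mult)
qed

text \<open>The terms telescope in \<open>i\<close>. This is the chain rule, with one term for each
  of the \<open>m - 1\<close> blocks from which position \<open>m\<close> decodes a message.\<close>

lemma df_rate:
  assumes "m \<in> {2..K1}"
  shows "(\<Sum>i\<in>{1..<m}. mean P (ylog m i)) = cmi P (Xs (\<pi> ` {1..m - 1})) (Ys {\<pi> m}) (Xs (\<pi> ` {m..K1}))"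
proof -
  define h where "h i = ent P (\<lambda>(x, y, z). drop i (xsA x)) - ent P (\<lambda>(x, y, z). (drop i (xsA x), y (\<pi> m)))" for i
  have "mean P (ylog m (Suc i)) = h i - h (Suc i)" if "i < m - 1" for i
  proof -
    have "mean P (ylog m (Suc i)) = mean P (\<lambda>\<omega>. lg P (\<lambda>(x, y, z). (drop i (xsA x), y (\<pi> m))) \<omega> - lg P (\<lambda>(x, y, z). drop i (xsA x)) \<omega>
      - (lg P (\<lambda>(x, y, z). (drop (Suc i) (xsA x), y (\<pi> m))) \<omega> - lg P (\<lambda>(x, y, z). drop (Suc i) (xsA x)) \<omega>))"
    proof (rule mean_cong)
      fix \<omega> assume w: "\<omega> \<in> set_pmf P"
      obtain x y z where e: "\<omega> = (x, y, z)" by (cases \<omega>)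
      have si: "Suc i \<in> {1..K1}" using that assms by auto
      show "ylog m (Suc i) \<omega> = lg P (\<lambda>(x, y, z). (drop i (xsA x), y (\<pi> m))) \<omega> - lg P (\<lambda>(x, y, z). drop i (xsA x)) \<omega>
      - (lg P (\<lambda>(x, y, z). (drop (Suc i) (xsA x), y (\<pi> m))) \<omega> - lg P (\<lambda>(x, y, z). drop (Suc i) (xsA x)) \<omega>)"
        using ratio_pos(2)[OF w[unfolded e] si, of m] by (simp add: ylog_def e)
    qed
    then show ?thesis by (simp add: h_def ent_def mean_diff)
  qed
  then have "(\<Sum>i<m - 1. mean P (ylog m (Suc i))) = (\<Sum>i<m - 1. h i - h (Suc i))" by simp
  also have "\<dots> = h 0 - h (m - 1)" by (rule sum_lessThan_telescope')
  also have "(\<Sum>i<m - 1. mean P (ylog m (Suc i))) = (\<Sum>i\<in>{1..<m}. mean P (ylog m i))"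
    by (rule sum.reindex_bij_witness[of _ "\<lambda>i. i - 1" Suc]) auto
  finally have 1: "(\<Sum>i\<in>{1..<m}. mean P (ylog m i)) = h 0 - h (m - 1)" .
  have m1: "1 \<le> m" using assms by simp
  have im: "\<pi> ` {1..K1} = \<pi> ` {1..m - 1} \<union> \<pi> ` {m..K1}"
    unfolding image_Un[symmetric] using assms by (intro arg_cong[where f="image \<pi>"]) auto
  have d0: "drop 0 (xsA x) = drop 0 (xsA x') \<longleftrightarrow> (\<forall>k\<in>\<pi> ` {1..K1}. x k = x' k)" for x x' :: "nat \<Rightarrow> 'x"
    using drop_xsA_eq_iff[of 1] by simp
  note dm = drop_xsA_eq_iff[OF m1]
  have "ent P (\<lambda>(x, y, z). drop 0 (xsA x)) = ent P (\<lambda>\<omega>. (Xs (\<pi> ` {1..m - 1}) \<omega>, Xs (\<pi> ` {m..K1}) \<omega>))"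
    by (rule ent_cong) (simp only: case_prod_unfold prod.inject d0 im sample_eq_iffs ball_Un)
  moreover have "ent P (\<lambda>(x, y, z). drop (m - 1) (xsA x)) = ent P (Xs (\<pi> ` {m..K1}))"
    by (rule ent_cong) (simp only: case_prod_unfold prod.inject dm sample_eq_iffs)
  moreover have "ent P (\<lambda>(x, y, z). (drop (m - 1) (xsA x), y (\<pi> m))) = ent P (\<lambda>\<omega>. (Ys {\<pi> m} \<omega>, Xs (\<pi> ` {m..K1}) \<omega>))"
    by (rule ent_cong) (auto simp only: case_prod_unfold prod.inject dm sample_eq_iffs)
  moreover have "ent P (\<lambda>(x, y, z). (drop 0 (xsA x), y (\<pi> m))) = ent P (\<lambda>\<omega>. (Xs (\<pi> ` {1..m - 1}) \<omega>, Ys {\<pi> m} \<omega>, Xs (\<pi> ` {m..K1}) \<omega>))"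
    by (rule ent_cong) (auto simp only: case_prod_unfold prod.inject d0 im sample_eq_iffs ball_Un)
  ultimately show ?thesis unfolding 1 by (subst cmi_eq) (simp_all add: h_def)
qed

lemma Xs_empty: "ent P (Xs {}) = 0"
proof -
  have "Xs {} = (\<lambda>_ :: ('x, 'y, 'z) sample. \<lambda>_. undefined)" by (auto simp: Xs_def fun_eq_iff)
  then show ?thesis by (simp add: ent_def lg_def[abs_def] map_pmf_const mean_def)
qed

end

context random_code begin

text \<open>The logarithm of \<open>q0\<close> splits into the terms of \<open>Xs F\<close>,
  \<open>xl1\<close> and \<open>zxl\<close>. The other two entropies are those of the whole test
  letter and of its part that is not fresh.\<close>

lemma pass_exp_eq:
  assumes F: "F \<subseteq> A" and S: "S \<subseteq> Q"
  shows "pass_exp F S = ent P (Xs F) + ent P (\<lambda>\<omega>. (Xs (A - F) \<omega>, Xs (Q - S) \<omega>, Zs (Q - S) \<omega>, Ys {K} \<omega>)) - hA Q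
    - (\<Sum>k\<in>S. mean P (xl1 k)) - (\<Sum>k\<in>S. mean P (zxl k))"
proof -
  define g where "g = (\<lambda>(x, y, z). asmb ((x, y), z)) \<circ> (\<lambda>\<omega> :: ('x, 'y, 'z) sample. \<omega>)"
  have TLg: "TL = map_pmf g P" unfolding TL_eq g_def by (simp add: o_def)
  have S2: "finite S" "S \<subseteq> T2" using S Q by (auto intro: finite_subset)
  let ?fr = "\<lambda>\<omega>. fr F S (g \<omega>)" and ?re = "\<lambda>\<omega>. re F S (g \<omega>)"
  have frg: "fr F S (g (x, y, z)) = ((restrict x F, restrict x S), restrict z S)" for x :: "nat \<Rightarrow> 'x" and y :: "nat \<Rightarrow> 'y" and z :: "nat \<Rightarrow> 'z"
    using F S by (auto simp: fr_def g_def asmb_def fun_eq_iff restrict_def)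
  have reg: "re F S (g (x, y, z)) = (restrict x (A - F), restrict x (Q - S), restrict z (Q - S), y K)" for x :: "nat \<Rightarrow> 'x" and y :: "nat \<Rightarrow> 'y" and z :: "nat \<Rightarrow> 'z"
    using F S by (auto simp: re_def g_def asmb_def fun_eq_iff restrict_def)
  have "pass_exp F S = mean P (\<lambda>\<omega>. log 2 (pass_ratio F S (?fr \<omega>) (?re \<omega>)))"
    unfolding pass_exp_def TLg by (rule mean_map) simp
  also have "\<dots> = mean P (\<lambda>\<omega>. lg P (\<lambda>\<omega>. (?fr \<omega>, ?re \<omega>)) \<omega> - (lg P (Xs F) \<omega> + (\<Sum>k\<in>S. xl1 k \<omega>) + (\<Sum>k\<in>S. zxl k \<omega>)) - lg P ?re \<omega>)"
  proof (rule mean_cong)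
    fix \<omega> assume w: "\<omega> \<in> set_pmf P"
    obtain x y z where e: "\<omega> = (x, y, z)" by (cases \<omega>)
    note q = q0_pmf_pos[OF F S w[unfolded e]]
    have J: "JJ F S = map_pmf (\<lambda>\<omega>. (?fr \<omega>, ?re \<omega>)) P" unfolding JJ_def TLg pmf.map_comp by (simp add: o_def)
    have J2: "map_pmf snd (JJ F S) = map_pmf ?re P" unfolding J pmf.map_comp by (simp add: o_def)
    have p1: "map_pmf (\<lambda>a. restrict a F) p1 = map_pmf (Xs F) P"
      unfolding map_A[symmetric] pmf.map_comp using F
      by (intro map_pmf_cong refl) (auto simp: Xs_def case_prod_unfold fun_eq_iff restrict_def)
    note pos = pmf_map_pos[OF w, of "\<lambda>\<omega>. (?fr \<omega>, ?re \<omega>)"] pmf_map_pos[OF w, of ?re] pmf_map_pos[OF w, of "Xs F"]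
    have px: "(\<Prod>k\<in>S. pmf (px k) (x k)) > 0" by (rule prod_pos) (use pz_pos(2)[OF w[unfolded e]] S2 in auto)
    have pzx: "(\<Prod>k\<in>S. pmf (pzx k (x k)) (z k)) > 0" by (rule prod_pos) (use pzx_pos[OF w[unfolded e]] S2 in auto)
    have lx: "log 2 (\<Prod>k\<in>S. pmf (px k) (x k)) = (\<Sum>k\<in>S. xl1 k \<omega>)"
      by (subst log_prod[OF S2(1)]) (use pz_pos(2)[OF w[unfolded e]] S2 in \<open>auto simp: xl1_def e\<close>)
    have lz: "log 2 (\<Prod>k\<in>S. pmf (pzx k (x k)) (z k)) = (\<Sum>k\<in>S. zxl k \<omega>)"
      by (subst log_prod[OF S2(1)]) (use pzx_pos[OF w[unfolded e]] S2 in \<open>auto simp: zxl_def e\<close>)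
    have "log 2 (pmf (q0 F S) (?fr \<omega>)) = lg P (Xs F) \<omega> + (\<Sum>k\<in>S. xl1 k \<omega>) + (\<Sum>k\<in>S. zxl k \<omega>)"
      unfolding e frg q(1) p1 using pos(3) px pzx lx lz unfolding e by (simp add: log_mult lg_def Xs_def)
    moreover have "pmf (q0 F S) (?fr \<omega>) > 0" unfolding e frg by (rule q(2))
    ultimately show "log 2 (pass_ratio F S (?fr \<omega>) (?re \<omega>)) = lg P (\<lambda>\<omega>. (?fr \<omega>, ?re \<omega>)) \<omega> - (lg P (Xs F) \<omega> + (\<Sum>k\<in>S. xl1 k \<omega>) + (\<Sum>k\<in>S. zxl k \<omega>)) - lg P ?re \<omega>"
      unfolding pass_ratio_def J2 unfolding J using pos by (simp add: log_divide log_mult lg_def)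
  qed
  also have "\<dots> = - ent P (\<lambda>\<omega>. (?fr \<omega>, ?re \<omega>)) + ent P (Xs F) - (\<Sum>k\<in>S. mean P (xl1 k)) - (\<Sum>k\<in>S. mean P (zxl k)) + ent P ?re"
    by (simp add: ent_def mean_diff mean_add mean_sum)
  also have "ent P (\<lambda>\<omega>. (?fr \<omega>, ?re \<omega>)) = hA Q"
    unfolding hA_def
  proof (rule ent_cong)
    fix \<omega> \<omega>' :: "('x, 'y, 'z) sample"
    obtain x y z x' y' z' where e: "\<omega> = (x, y, z)" "\<omega>' = (x', y', z')" by (cases \<omega>, cases \<omega>')
    have r: "restrict f V = restrict f' V \<longleftrightarrow> (\<forall>k\<in>V. f k = f' k)" for f f' :: "nat \<Rightarrow> 'b" and V
      by (auto simp: fun_eq_iff restrict_def)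
    show "((?fr \<omega>', ?re \<omega>') = (?fr \<omega>, ?re \<omega>)) \<longleftrightarrow> ((Xs A \<omega>', Xs Q \<omega>', Zs Q \<omega>', Ys {K} \<omega>') = (Xs A \<omega>, Xs Q \<omega>, Zs Q \<omega>, Ys {K} \<omega>))"
      unfolding e frg reg Xs_def Ys_def Zs_def prod.case prod.inject r using F S by blast
  qed
  also have "ent P ?re = ent P (\<lambda>\<omega>. (Xs (A - F) \<omega>, Xs (Q - S) \<omega>, Zs (Q - S) \<omega>, Ys {K} \<omega>))"
  proof (rule ent_cong)
    fix \<omega> \<omega>' :: "('x, 'y, 'z) sample"
    obtain x y z x' y' z' where e: "\<omega> = (x, y, z)" "\<omega>' = (x', y', z')" by (cases \<omega>, cases \<omega>')
    show "(?re \<omega>' = ?re \<omega>) \<longleftrightarrow> ((Xs (A - F) \<omega>', Xs (Q - S) \<omega>', Zs (Q - S) \<omega>', Ys {K} \<omega>') = (Xs (A - F) \<omega>, Xs (Q - S) \<omega>, Zs (Q - S) \<omega>, Ys {K} \<omega>))"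
      unfolding e reg Xs_def Zs_def prod.case prod.inject by (auto simp: Ys_def fun_eq_iff)
  qed
  finally show ?thesis by simp
qed

lemma cc_ak: "S \<subseteq> Q \<Longrightarrow> - (\<Sum>k\<in>S. mean P (xl1 k)) - (\<Sum>k\<in>S. mean P (zxl k)) = (\<Sum>k\<in>Q. cc k) - (\<Sum>k\<in>Q - S. cc k) + (\<Sum>k\<in>S. qrate k)"
  by (subst sum.subset_diff[of S Q]) (auto simp: cc_def qrate_def sum_subtractf sum_negf)

text \<open>The sum of \<open>qrate\<close> is gained because wrong indices bring independent
  quantization codebooks. It cancels against the number of index tuples in the union bound, up to
  the excess rates.\<close>

lemma pass_exp_A: "S \<subseteq> Q \<Longrightarrow> pass_exp A S = ent P (Xs A) + FB (Q - S) - FA Q + (\<Sum>k\<in>S. qrate k)"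
proof -
  assume S: "S \<subseteq> Q"
  have "ent P (\<lambda>\<omega>. (Xs (A - A) \<omega>, Xs (Q - S) \<omega>, Zs (Q - S) \<omega>, Ys {K} \<omega>)) = hB (Q - S)"
    unfolding hB_def by (rule ent_cong) (auto simp: sample_eq_iffs)
  then show ?thesis using pass_exp_eq[OF _ S, of A] cc_ak[OF S] by (simp add: FA_def FB_def)
qed

lemma pass_exp_empty: "S \<subseteq> Q \<Longrightarrow> pass_exp {} S = FA (Q - S) - FA Q + (\<Sum>k\<in>S. qrate k)"
  using pass_exp_eq[of "{}" S] cc_ak[of S] by (simp add: FA_def hA_def Xs_empty)

end

section \<open>The scheme given by a codebook\<close>

context relay_law begin

abbreviation snnc_code :: "nat \<Rightarrow> nat set \<Rightarrow> ('x, 'y, 'z) scheme \<Rightarrow> ('x, 'y) code" where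
  "snnc_code M Q s \<equiv> \<lparr>src = snnc_src K1 s, rel = snnc_rel \<pi> K1 P s, dec = snnc_dec Ch \<pi> K1 Q P M s\<rparr>"

lemma set_pipeline:
  assumes "1 \<le> nmsg s" "\<And>j. j \<in> {1..scheme.nb s} \<Longrightarrow> w j \<in> {1..nmsg s}"
  shows "set (pipeline K1 s w m c) \<subseteq> {1..nmsg s}"
  using assms by (auto simp: pipeline_def Let_def simp del: upt_Suc)

lemma length_pipeline [simp]: "length (pipeline K1 s w m c) = Suc K1 - m"
  by (simp add: pipeline_def del: upt_Suc)

lemma qidx_range: "k \<in> T2 \<Longrightarrow> 1 \<le> nidx s k \<Longrightarrow> qidx P s k ys c \<in> {1..nidx s k}"
proof (cases c)
  case (Suc b)
  assume k: "1 \<le> nidx s k"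
  define good where "good l \<longleftrightarrow> l \<in> {1..nidx s k} \<and>
            typical (scheme.dq s) (map_pmf (\<lambda>(x, y, z). (x k, y k, z k)) P)
              (zip (qx s k (Suc b) (qidx P s k ys b)) (zip (block (bl s) ys (Suc b)) (qz s k (Suc b) l (qidx P s k ys b))))" for l
  have "qidx P s k ys c = (if \<exists>l. good l then LEAST l. good l else 1)"
    unfolding Suc qidx.simps Let_def good_def ..
  moreover have "(LEAST l. good l) \<in> {1..nidx s k}" if "\<exists>l. good l"
    using LeastI_ex[OF that] by (simp add: good_def)
  ultimately show ?thesis using k by (auto split: if_splits)
qed simp

lemma block_index:
  assumes "\<tau> < b * (N::nat)"
  shows "\<tau> div N + 1 \<in> {1..b}" "\<tau> mod N < N"
proof -
  have "\<tau> div N < b" using assms by (simp add: less_mult_imp_div_less)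
  then show "\<tau> div N + 1 \<in> {1..b}" by simp
  show "\<tau> mod N < N" using assms by (cases "N = 0") auto
qed

context
  fixes M s assumes v: "valid_scheme Ch \<pi> K1 Z M s"
begin

lemma valid_cx:
  assumes "m \<in> {1..K1}" "c \<in> {1..blocks K1 s}" "t < bl s" "\<And>j. j \<in> {1..scheme.nb s} \<Longrightarrow> w j \<in> {1..nmsg s}"
  shows "cx s m c (pipeline K1 s w m c) ! t \<in> inp Ch (\<pi> m)"
proof -
  have "1 \<le> nmsg s" using v by (simp add: valid_scheme_def Let_def)
  from set_pipeline[of s w m c, OF this assms(4)]
  have "length (cx s m c (pipeline K1 s w m c)) = bl s \<and> set (cx s m c (pipeline K1 s w m c)) \<subseteq> inp Ch (\<pi> m)"
    using v assms(1,2) unfolding valid_scheme_def Let_def by (simp add: Suc_diff_le)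
  then show ?thesis using assms(3) by (metis nth_mem subsetD)
qed

lemma valid_src:
  assumes "W \<in> {1..M}" "1 \<le> i"
  shows "snnc_src K1 s W i \<in> inp Ch 1"
proof (cases "i \<le> main_length K1 s")
  case True
  have "i - 1 < blocks K1 s * bl s" using True assms by (simp add: main_length_def)
  note b = block_index[OF this]
  have "cx s 1 ((i - 1) div bl s + 1) (pipeline K1 s (split s W) 1 ((i - 1) div bl s + 1)) ! ((i - 1) mod bl s) \<in> inp Ch (\<pi> 1)"
    by (rule valid_cx) (use K1 b assms v in \<open>auto simp: valid_scheme_def Let_def\<close>)
  then show ?thesis using True unfolding perm(2) by (simp add: snnc_src_def Let_def)
next
  case False
  then show ?thesis using v by (simp add: snnc_src_def valid_scheme_def Let_def)
qed

lemma valid_rel: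
  assumes "k \<in> relays Ch"
  shows "snnc_rel \<pi> K1 P s k ys \<in> inp Ch k"
proof (cases "length ys < main_length K1 s")
  case True
  let ?c = "length ys div bl s + 1" and ?t = "length ys mod bl s"
  note b = block_index[OF True[unfolded main_length_def]]
  show ?thesis
  proof (cases "k \<in> DF_relays \<pi> K1")
    case DF: True
    then obtain m where m: "k = \<pi> m" "m \<in> {2..K1}" by (auto simp: DF_relays_def)
    have "cx s m ?c (pipeline K1 s w m ?c) ! ?t \<in> inp Ch (\<pi> m)" if "\<And>j. j \<in> {1..scheme.nb s} \<Longrightarrow> w j \<in> {1..nmsg s}" for w
      by (rule valid_cx) (use m b that in auto)
    moreover have "dfd s m j zs \<in> {1..nmsg s}" if "j \<in> {1..scheme.nb s}" for j zs
      using v m(2) that by (simp add: valid_scheme_def Let_def)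
    ultimately show ?thesis using True DF m by (simp add: snnc_rel_def Let_def)
  next
    case False
    then have k: "k \<in> T2" using assms by (simp add: QF_relays_def)
    then have "1 \<le> nidx s k" using v by (simp add: valid_scheme_def Let_def)
    from qidx_range[OF k this] have q: "qidx P s k ys (?c - 1) \<in> {1..nidx s k}" .
    have "length (qx s k ?c (qidx P s k ys (?c - 1))) = bl s \<and> set (qx s k ?c (qidx P s k ys (?c - 1))) \<subseteq> inp Ch k"
      using v k b(1) q unfolding valid_scheme_def Let_def by blast
    then have "qx s k ?c (qidx P s k ys (?c - 1)) ! ?t \<in> inp Ch k" using b(2) by (metis nth_mem subsetD)
    then show ?thesis using True False by (simp add: snnc_rel_def Let_def)
  qed
next
  case False
  then show ?thesis using v assms by (simp add: snnc_rel_def valid_scheme_def Let_def)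
qed

lemma valid_inputs: "W \<in> {1..M} \<Longrightarrow> inputs Ch (snnc_code M Q s) W ys \<in> XX"
  using valid_src[of W "length ys + 1"] valid_rel
  by (auto simp: inputs_def senders_def relays_def PiE_iff)

lemma valid_is_code: "is_code Ch n M (snnc_code M Q s)"
  using valid_src valid_rel by (auto simp: is_code_def)

end

end

section \<open>Decoding at the decode-forward relays\<close>

context random_code begin

text \<open>Short message \<open>j\<close> is encoded at position \<open>i\<close> in block
  \<open>j + i - 1\<close>; the product runs over the positions before \<open>m\<close>, hence over
  the blocks \<open>j, ..., j + m - 2\<close>.\<close>

definition score :: "('x, 'y, 'z) outcome \<Rightarrow> nat \<Rightarrow> nat \<Rightarrow> (nat \<Rightarrow> nat) \<Rightarrow> nat \<Rightarrow> (nat \<Rightarrow> nat \<Rightarrow> 'y) \<Rightarrow> real" where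
  "score \<omega> m j w v y = (\<Prod>(i, t)\<in>{1..<m} \<times> {..<N}.
      lratio m (cw \<omega> (j + i - 1) t (v # pipe w (Suc i) (j + i - 1))) (y (j + i - 1) t))"

lemma pipe_cong:
  assumes "\<And>j. j \<in> {1..nb} \<Longrightarrow> j + i \<le> c + 1 \<Longrightarrow> c + 1 \<le> j + K1 \<Longrightarrow> w j = w' j"
  shows "pipe w i c = pipe w' i c"
  unfolding pipe_def Let_def by (intro map_cong refl) (use assms in \<open>auto simp del: upt_Suc\<close>)

text \<open>The recursion keeps all earlier decisions, as they enter the score of the next message.
  Undecided entries and failed decisions are \<open>1\<close>, so the values are always valid
  messages.\<close>

primrec est :: "('x, 'y, 'z) outcome \<Rightarrow> real \<Rightarrow> nat \<Rightarrow> (nat \<Rightarrow> nat \<Rightarrow> 'y) \<Rightarrow> nat \<Rightarrow> nat \<Rightarrow> nat" where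
  "est \<omega> \<theta> m y 0 = (\<lambda>_. 1)"
| "est \<omega> \<theta> m y (Suc j) = (let w = est \<omega> \<theta> m y j; ok = (\<lambda>v. v \<in> {1..msg} \<and> \<theta> \<le> score \<omega> m (Suc j) w v y)
     in w(Suc j := if \<exists>v. ok v then SOME v. ok v else 1))"

lemma est_range: "est \<omega> \<theta> m y j j' \<in> {1..msg}"
proof (induction j arbitrary: j')
  case 0
  then show ?case using msg by simp
next
  case (Suc j)
  define ok where "ok v \<longleftrightarrow> v \<in> {1..msg} \<and> \<theta> \<le> score \<omega> m (Suc j) (est \<omega> \<theta> m y j) v y" for v
  have e: "est \<omega> \<theta> m y (Suc j) = (est \<omega> \<theta> m y j)(Suc j := if \<exists>v. ok v then SOME v. ok v else 1)"
    unfolding est.simps Let_def ok_def ..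
  have "(SOME v. ok v) \<in> {1..msg}" if "\<exists>v. ok v" using someI_ex[OF that] by (simp add: ok_def)
  then show ?case unfolding e using Suc msg by simp
qed

lemma score_cong:
  assumes "\<And>j'. j' \<in> {1..nb} \<Longrightarrow> j' < j \<Longrightarrow> w j' = w' j'"
    and "\<And>c t. j \<le> c \<Longrightarrow> c + 2 \<le> j + m \<Longrightarrow> t < N \<Longrightarrow> y c t = y' c t" and "1 \<le> j"
  shows "score \<omega> m j w v y = score \<omega> m j w' v y'"
  unfolding score_def
proof (intro prod.cong refl, clarify)
  fix i t assume it: "i \<in> {1..<m}" "t < N"
  have "pipe w (Suc i) (j + i - 1) = pipe w' (Suc i) (j + i - 1)"
    by (rule pipe_cong) (use assms(1,3) in auto)
  moreover have "y (j + i - 1) t = y' (j + i - 1) t" by (rule assms(2)) (use it assms(3) in auto)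
  ultimately show "lratio m (cw \<omega> (j + i - 1) t (v # pipe w (Suc i) (j + i - 1))) (y (j + i - 1) t)
    = lratio m (cw \<omega> (j + i - 1) t (v # pipe w' (Suc i) (j + i - 1))) (y' (j + i - 1) t)" by simp
qed

text \<open>Correct earlier decisions make the score equal to that of the genie, for which, outside
  \<open>BadR\<close>, only the true message reaches the threshold.\<close>

lemma est_correct:
  assumes m: "m \<in> {2..K1}" and J: "J \<le> nb" and w: "\<And>j. j \<in> {1..nb} \<Longrightarrow> w j \<in> {1..msg}" and bad: "\<not> BadR w \<theta> \<omega>"
    and true: "\<And>j. j \<in> {1..J} \<Longrightarrow> \<theta> \<le> score \<omega> m j w (w j) (\<lambda>c t. genie_out w \<omega> c t (\<pi> m))"
    and y: "\<And>c t. 1 \<le> c \<Longrightarrow> c + 2 \<le> J + m \<Longrightarrow> t < N \<Longrightarrow> y c t = genie_out w \<omega> c t (\<pi> m)"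
    and j: "j \<in> {1..J}"
  shows "est \<omega> \<theta> m y J j = w j"
  using J true y j
proof (induction J arbitrary: j)
  case (Suc J)
  have IH: "est \<omega> \<theta> m y J j = w j" if "j \<in> {1..J}" for j
    by (rule Suc.IH) (use Suc.prems that in auto)
  have SJ: "Suc J \<in> {1..nb}" using Suc.prems by simp
  have sc: "score \<omega> m (Suc J) (est \<omega> \<theta> m y J) v y = score \<omega> m (Suc J) w v (\<lambda>c t. genie_out w \<omega> c t (\<pi> m))" for v
    by (rule score_cong) (use IH Suc.prems(3) in auto)
  have ok: "v \<in> {1..msg} \<and> \<theta> \<le> score \<omega> m (Suc J) (est \<omega> \<theta> m y J) v y \<longleftrightarrow> v = w (Suc J)" for v
    unfolding sc
  proof
    assume v: "v \<in> {1..msg} \<and> \<theta> \<le> score \<omega> m (Suc J) w v (\<lambda>c t. genie_out w \<omega> c t (\<pi> m))"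
    show "v = w (Suc J)"
    proof (rule ccontr)
      assume "v \<noteq> w (Suc J)"
      then have "v \<in> {1..msg} - {w (Suc J)}" using v by simp
      with v have "BadR w \<theta> \<omega>"
        unfolding BadR_def score_def by (intro bexI[OF _ m] bexI[OF _ SJ] bexI[of _ v]) auto
      with bad show False by simp
    qed
  qed (use w[OF SJ] Suc.prems(2)[of "Suc J"] in auto)
  have "est \<omega> \<theta> m y (Suc J) = (est \<omega> \<theta> m y J)(Suc J := w (Suc J))"
    unfolding est.simps Let_def ok by simp
  then show ?case using IH[of j] Suc.prems(4) by (cases "j = Suc J") auto
qed simp

end

text \<open>\<open>sp\<close> splits the message, \<open>\<theta>\<close> is the threshold of the
  relays, and \<open>\<sigma>\<close> with \<open>g\<close> is a strategy and a decoder for a final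
  phase of length \<open>d\<close>. Its reliability enters as a hypothesis of
  \<open>message_error\<close>.\<close>

locale snnc = random_code Ch \<pi> K1 Z P p1 px pz N nb msg L Q dq dd
  for Ch :: "('x, 'y) relay_channel" and \<pi> K1 Z and P :: "('x, 'y, 'z) sample pmf" and p1 px pz N nb msg L Q dq dd +
  fixes M :: nat and sp :: "nat \<Rightarrow> nat \<Rightarrow> nat" and \<theta> :: real and d :: nat
    and \<sigma> :: "nat \<Rightarrow> nat \<Rightarrow> 'y list \<Rightarrow> 'x" and g :: "nat \<Rightarrow> 'y list \<Rightarrow> nat"
  assumes sp: "\<And>W j. W \<in> {1..M} \<Longrightarrow> j \<in> {1..nb} \<Longrightarrow> sp W j \<in> {1..msg}"
    and inj_sp: "inj_on (\<lambda>W. restrict (sp W) {1..nb}) {1..M}"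
    and strat: "strat \<sigma>" and g: "\<And>k ys. k \<in> Q \<Longrightarrow> g k ys \<in> {1..L k}" and \<theta>: "0 < \<theta>"
begin

text \<open>\<open>cx\<close> takes the head of \<open>cw\<close>, the letter of its own position.
  \<open>dfd\<close> repeats all decisions up to \<open>j\<close>, as its interface passes no
  earlier estimates. For the source only the length of the list given to \<open>\<sigma>\<close>
  matters, and at time \<open>t\<close> it is \<open>t - 1\<close>.\<close>

definition scheme_of :: "('x, 'y, 'z) outcome \<Rightarrow> ('x, 'y, 'z) scheme" where
  "scheme_of \<omega> = \<lparr>bl = N, nb = nb, xl = d, nmsg = msg, nidx = L, split = sp,
     cx = (\<lambda>m c u. map (\<lambda>t. hd (cw \<omega> c t u)) [0..<N]),
     dfd = (\<lambda>m j ys. est \<omega> \<theta> m (\<lambda>c t. ys ! ((c - 1) * N + t)) j j),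
     qx = (\<lambda>k c l. map (\<lambda>t. valX (\<omega> (RX c t k l))) [0..<N]),
     qz = (\<lambda>k c l l'. map (\<lambda>t. valZ (\<omega> (RZ c t k l l' (valX (\<omega> (RX c t k l')))))) [0..<N]),
     dq = dq, dd = dd,
     xsrc = (\<lambda>t. \<sigma> 1 0 (replicate (t - 1) undefined)), xrel = \<sigma>, xdec = (\<lambda>k ys. if k \<in> Q then g k ys else 1)\<rparr>"

lemma scheme_of_simps [simp]:
  "bl (scheme_of \<omega>) = N" "scheme.nb (scheme_of \<omega>) = nb" "xl (scheme_of \<omega>) = d" "nmsg (scheme_of \<omega>) = msg" "nidx (scheme_of \<omega>) = L" "split (scheme_of \<omega>) = sp"
  "cx (scheme_of \<omega>) m c u = map (\<lambda>t. hd (cw \<omega> c t u)) [0..<N]"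
  "dfd (scheme_of \<omega>) m j ys = est \<omega> \<theta> m (\<lambda>c t. ys ! ((c - 1) * N + t)) j j"
  "qx (scheme_of \<omega>) k c l = map (\<lambda>t. valX (\<omega> (RX c t k l))) [0..<N]"
  "qz (scheme_of \<omega>) k c l l' = map (\<lambda>t. valZ (\<omega> (RZ c t k l l' (valX (\<omega> (RX c t k l')))))) [0..<N]"
  "scheme.dq (scheme_of \<omega>) = dq" "scheme.dd (scheme_of \<omega>) = dd"
  "xsrc (scheme_of \<omega>) i = \<sigma> 1 0 (replicate (i - 1) undefined)" "xrel (scheme_of \<omega>) = \<sigma>"
  "xdec (scheme_of \<omega>) k ys = (if k \<in> Q then g k ys else 1)"
  by (simp_all add: scheme_of_def)

lemma scheme_of_blocks [simp]: "blocks K1 (scheme_of \<omega>) = B" "main_length K1 (scheme_of \<omega>) = B * N"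
  by (simp_all add: blocks_def B_def main_length_def)

lemma scheme_of_pipeline [simp]: "pipeline K1 (scheme_of \<omega>) = pipe"
  by (intro ext) (simp add: pipeline_def pipe_def)

text \<open>A letter in the support of its law lies in the right alphabet, so every outcome of
  positive probability gives a valid scheme.\<close>

lemma valid_mk:
  assumes \<omega>: "\<omega> \<in> set_pmf \<Omega>"
  shows "valid_scheme Ch \<pi> K1 Z M (scheme_of \<omega>)"
proof -
  have RX: "valX (\<omega> (RX c t k l)) \<in> inp Ch k" if "c \<in> {1..B}" "t < N" "k \<in> T2" "l \<in> {1..L k}" for c t k l
  proof -
    have "\<omega> (RX c t k l) \<in> set_pmf (lawI (RX c t k l))" by (rule set_\<Omega>[OF \<omega>]) (use that in simp)
    then show ?thesis using set_px[of k] that by auto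
  qed
  have RZ: "valZ (\<omega> (RZ c t k l l' (valX (\<omega> (RX c t k l'))))) \<in> Z k"
    if "c \<in> {1..B}" "t < N" "k \<in> T2" "l \<in> {1..L k}" "l' \<in> {1..L k}" for c t k l l'
  proof -
    have "valX (\<omega> (RX c t k l')) \<in> XS" using RX[of c t k l'] that by (auto simp: XS_def senders_eq)
    then have "\<omega> (RZ c t k l l' (valX (\<omega> (RX c t k l')))) \<in> set_pmf (lawI (RZ c t k l l' (valX (\<omega> (RX c t k l')))))"
      by (intro set_\<Omega>[OF \<omega>]) (use that in simp)
    then show ?thesis using subsetD[OF set_pzx[OF that(3)]] by auto
  qed
  have G: "hd (cw \<omega> c t u) \<in> inp Ch (\<pi> m)"
    if "c \<in> {1..B}" "t < N" "length u = K1 + 1 - m" "set u \<subseteq> {1..msg}" "m \<in> {1..K1}" for c t u m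
  proof -
    have l: "length u \<le> K1" "K1 - length u + 0 + 1 = m" "0 < length u" using that by auto
    have "cw \<omega> c t u \<in> set_pmf (map_pmf (\<lambda>\<omega>. cw \<omega> c t u) \<Omega>)" using \<omega> by simp
    also have "map_pmf (\<lambda>\<omega>. cw \<omega> c t u) \<Omega> = PA (length u)" by (rule cw_law[OF that(1,2,4) l(1)])
    finally have "cw \<omega> c t u ! 0 \<in> inp Ch (\<pi> m)" using PA_set(2)[OF _ l(1) l(3)] unfolding l(2) by blast
    moreover have "cw \<omega> c t u \<noteq> []" using l(3) by (metis length_cw list.size(3) less_irrefl)
    ultimately show ?thesis by (simp add: hd_conv_nth)
  qed
  have \<sigma>: "\<sigma> 1 0 ys \<in> inp Ch 1" "k \<in> relays Ch \<Longrightarrow> \<sigma> k l ys \<in> inp Ch k" for k l ys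
    using strat K2 unfolding strat_def senders_def relays_def by auto
  show ?thesis
    unfolding valid_scheme_def Let_def scheme_of_simps scheme_of_blocks
    using N nb msg L dq dd sp inj_sp est_range G RX RZ \<sigma> g
    by (intro conjI ballI allI impI) auto
qed

end

section \<open>The transmission over the random code\<close>

context snnc begin

text \<open>Erases the channel noise and keeps the codebooks, of which alone the scheme is a
  function.\<close>

definition cb :: "('x, 'y, 'z) outcome \<Rightarrow> ('x, 'y, 'z) outcome" where
  "cb \<omega> = (\<lambda>i. case i of RN c t x \<Rightarrow> undefined | _ \<Rightarrow> \<omega> i)"

lemma cb_simps [simp]:
  "cb \<omega> (RG c t u xs) = \<omega> (RG c t u xs)" "cb \<omega> (RX c t k l) = \<omega> (RX c t k l)"
  "cb \<omega> (RZ c t k l l' x) = \<omega> (RZ c t k l l' x)" "cb \<omega> (RN c t xv) = undefined"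
  by (simp_all add: cb_def)

lemma cw_cb [simp]: "cw (cb \<omega>) = cw \<omega>"
  by (simp add: cw_def[abs_def])

lemma est_cb: "est (cb \<omega>) \<theta> m y j = est \<omega> \<theta> m y j"
  by (induction j) (simp_all add: score_def)

lemma scheme_of_cb: "scheme_of (cb \<omega>) = scheme_of \<omega>"
  by (simp add: scheme_of_def est_cb)

definition inpt :: "('x, 'y, 'z) outcome \<Rightarrow> nat \<Rightarrow> (nat \<Rightarrow> 'y) list \<Rightarrow> nat \<Rightarrow> 'x" where
  "inpt \<omega> W = inputs Ch (snnc_code M Q (scheme_of \<omega>)) W"

lemma inpt_cb: "inpt (cb \<omega>) W = inpt \<omega> W" by (simp add: inpt_def scheme_of_cb)

text \<open>The channel answers with the noise letter prepared for the present block, time and input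
  vector. Each time has its own letters, so adaptive inputs cause no dependence.\<close>

primrec run :: "('x, 'y, 'z) outcome \<Rightarrow> nat \<Rightarrow> nat \<Rightarrow> (nat \<Rightarrow> 'y) list" where
  "run \<omega> W 0 = []"
| "run \<omega> W (Suc i) = (let ys = run \<omega> W i in ys @ [valY (\<omega> (RN (i div N + 1) (i mod N) (inpt \<omega> W ys)))])"

lemma length_run [simp]: "length (run \<omega> W i) = i" by (induction i) (simp_all add: Let_def)

lemma run_depends: "depends_on {r. \<forall>c t x. r = RN c t x \<longrightarrow> (c - 1) * N + t < i} (\<lambda>\<omega>. run \<omega> W i)"
proof (induction i)
  case 0
  then show ?case by (auto intro: depends_onI)
next
  case (Suc i)
  show ?case
  proof (rule depends_onI)
    fix a b :: "('x, 'y, 'z) outcome"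
    assume ab: "\<And>r. r \<in> {r. \<forall>c t x. r = RN c t x \<longrightarrow> (c - 1) * N + t < Suc i} \<Longrightarrow> a r = b r"
    have "run a W i = run b W i"
      by (rule depends_onD[OF Suc], rule ab) (use less_SucI in blast)
    moreover have "cb a = cb b"
    proof
      fix r show "cb a r = cb b r" by (cases r) (simp_all add: ab)
    qed
    then have "inpt a W = inpt b W" using inpt_cb by metis
    moreover have "a (RN (i div N + 1) (i mod N) x) = b (RN (i div N + 1) (i mod N) x)" for x
      by (rule ab) simp
    ultimately show "run a W (Suc i) = run b W (Suc i)" by (simp add: Let_def)
  qed
qed

text \<open>The letters \<open>RN\<close> are the channel noise: given the codebooks, \<open>run\<close> is a transmission over \<open>Ch\<close>.\<close>

lemma coupling:
  assumes W: "W \<in> {1..M}" and i: "i \<le> B * N"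
  shows "map_pmf (\<lambda>\<omega>. (cb \<omega>, run \<omega> W i)) \<Omega> = bind_pmf (map_pmf cb \<Omega>) (\<lambda>\<kappa>. map_pmf (Pair \<kappa>) (proc (inpt \<kappa> W) i))"
  using i
proof (induction i)
  case 0
  then show ?case by (simp add: pmf.map_comp o_def map_pmf_def[symmetric] map_pmf_def[of _ "return_pmf _"] bind_return_pmf)
next
  case (Suc i)
  let ?c = "i div N + 1" and ?t = "i mod N"
  define f where "f \<omega> = (cb \<omega>, run \<omega> W i)" for \<omega>
  define h where "h p \<omega> = valY (\<omega> (RN ?c ?t (inpt (fst p) W (snd p))))" for p and \<omega> :: "('x, 'y, 'z) outcome"
  \<comment> \<open>The noise letters of the present time, read neither by the codebooks nor by the
    earlier outputs.\<close>
  define D where "D = {r :: 'x ridx. \<exists>x. r = RN ?c ?t x}"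
  have ct: "?c \<in> {1..B}" "?t < N" using block_index[of i B N] Suc.prems by simp_all
  have IH: "map_pmf f \<Omega> = bind_pmf (map_pmf cb \<Omega>) (\<lambda>\<kappa>. map_pmf (Pair \<kappa>) (proc (inpt \<kappa> W) i))"
    unfolding f_def using Suc by simp
  have "map_pmf (\<lambda>\<omega>. (f \<omega>, h (f \<omega>) \<omega>)) \<Omega> = bind_pmf (map_pmf f \<Omega>) (\<lambda>p. map_pmf (\<lambda>\<omega>. (p, h p \<omega>)) \<Omega>)"
    unfolding \<Omega>_def
  proof (rule Pi_pmf_disintegrate[OF finite_IX, of D])
    show "depends_on (- D) f"
    proof (rule depends_onI)
      fix a b :: "('x, 'y, 'z) outcome" assume ab: "\<And>r. r \<in> - D \<Longrightarrow> a r = b r"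
      have "run a W i = run b W i"
      proof (rule depends_onD[OF run_depends], rule ab)
        fix r :: "'x ridx" assume r: "r \<in> {r. \<forall>c t x. r = RN c t x \<longrightarrow> (c - 1) * N + t < i}"
        show "r \<in> - D"
        proof
          assume "r \<in> D"
          then have "(?c - 1) * N + ?t < i" using r by (auto simp: D_def)
          then show False by simp
        qed
      qed
      moreover have "cb a = cb b"
      proof
        fix r show "cb a r = cb b r" by (cases r) (simp_all add: ab D_def)
      qed
      ultimately show "f a = f b" by (simp add: f_def)
    qed
    show "depends_on D (h p)" for p by (rule depends_onI) (simp add: h_def D_def)
  qed
  also have "\<dots> = bind_pmf (map_pmf f \<Omega>) (\<lambda>p. map_pmf (Pair p) (law Ch (inpt (fst p) W (snd p))))"
  proof (rule bind_pmf_cong[OF refl])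
    fix p assume "p \<in> set_pmf (map_pmf f \<Omega>)"
    then obtain \<omega> where \<omega>: "\<omega> \<in> set_pmf \<Omega>" "p = f \<omega>" by auto
    have "inpt (fst p) W (snd p) \<in> XX"
      unfolding inpt_def \<omega>(2) f_def fst_conv scheme_of_cb by (rule valid_inputs[OF valid_mk[OF \<omega>(1)] W])
    then have "RN ?c ?t (inpt (fst p) W (snd p)) \<in> IX" using ct by simp
    then have "map_pmf (\<lambda>a. (p, valY a)) (map_pmf (\<lambda>\<omega>. \<omega> (RN ?c ?t (inpt (fst p) W (snd p)))) \<Omega>)
      = map_pmf (Pair p) (law Ch (inpt (fst p) W (snd p)))"
      by (simp add: \<Omega>_component pmf.map_comp o_def)
    then show "map_pmf (\<lambda>\<omega>. (p, h p \<omega>)) \<Omega> = map_pmf (Pair p) (law Ch (inpt (fst p) W (snd p)))"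
      by (simp add: h_def pmf.map_comp o_def)
  qed
  finally have 1: "map_pmf (\<lambda>\<omega>. (f \<omega>, h (f \<omega>) \<omega>)) \<Omega>
      = bind_pmf (map_pmf f \<Omega>) (\<lambda>p. map_pmf (Pair p) (law Ch (inpt (fst p) W (snd p))))" .
  have "map_pmf (\<lambda>\<omega>. (cb \<omega>, run \<omega> W (Suc i))) \<Omega>
    = map_pmf (\<lambda>((\<kappa>, ys), y). (\<kappa>, ys @ [y])) (map_pmf (\<lambda>\<omega>. (f \<omega>, h (f \<omega>) \<omega>)) \<Omega>)"
    unfolding pmf.map_comp by (intro map_pmf_cong refl) (simp add: f_def h_def inpt_cb Let_def)
  also have "\<dots> = bind_pmf (map_pmf cb \<Omega>) (\<lambda>\<kappa>. map_pmf (Pair \<kappa>) (proc (inpt \<kappa> W) (Suc i)))"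
    unfolding 1 IH by (simp add: bind_assoc_pmf map_bind_pmf bind_map_pmf pmf.map_comp o_def)
  finally show ?case .
qed

lemma xsA_tx: "length u = K1 \<Longrightarrow> xsA (tx \<omega> c t u l') = cw \<omega> c t u"
  using xsA_toA[of "cw \<omega> c t u"] xsA_cong[of "tx \<omega> c t u l'" "toA (cw \<omega> c t u)"] by (simp add: tx_cw)

lemma tx_pi:
  assumes "m \<in> {1..K1}"
  shows "tx \<omega> c t (pipe w 1 c) l' (\<pi> m) = hd (cw \<omega> c t (pipe w m c))"
proof -
  have "tx \<omega> c t (pipe w 1 c) l' (\<pi> m) = xsA (tx \<omega> c t (pipe w 1 c) l') ! (m - 1)" by (rule xsA_nth[OF assms, symmetric])
  also have "\<dots> = hd (drop (m - 1) (cw \<omega> c t (pipe w 1 c)))"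
  proof -
    have "m - 1 < length (cw \<omega> c t (pipe w 1 c))" using assms by auto
    then show ?thesis by (subst xsA_tx) (simp_all only: hd_drop_conv_nth length_pipe diff_Suc_1 One_nat_def)
  qed
  also have "\<dots> = hd (cw \<omega> c t (pipe w m c))" using assms by (simp add: drop_cw drop_pipe)
  finally show ?thesis .
qed

lemma mean_PXY: "mean PXY f = mean P (\<lambda>(x, y, z). f (x, y))"
  unfolding map_PXY[symmetric] by (subst mean_map) (simp_all add: case_prod_unfold)

text \<open>Outside \<open>Bad1\<close> the inputs and outputs of a block are typical, so the
  product of ratios over that block is close to its exponent; the blocks multiply.\<close>

lemma score_true:
  assumes m: "m \<in> {2..K1}" and j: "j \<in> {1..nb}" and good: "\<And>c. c \<in> {1..B} \<Longrightarrow> \<not> BadB w c \<omega>"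
  shows "2 powr (real N * (\<Sum>i\<in>{1..<m}. mean P (ylog m i) - dd * mean P (\<lambda>\<omega>. \<bar>ylog m i \<omega>\<bar>)))
    \<le> score \<omega> m j w (w j) (\<lambda>c t. genie_out w \<omega> c t (\<pi> m))"
proof -
  have *: "2 powr (real N * (mean P (ylog m i) - dd * mean P (\<lambda>\<omega>. \<bar>ylog m i \<omega>\<bar>)))
    \<le> (\<Prod>t<N. lratio m (cw \<omega> (j + i - 1) t (w j # pipe w (Suc i) (j + i - 1))) (genie_out w \<omega> (j + i - 1) t (\<pi> m)))"
    if i: "i \<in> {1..<m}" for i
  proof -
    let ?c = "j + i - 1"
    let ?u = "pipe w 1 ?c" and ?l = "genie_idx w \<omega> (?c - 1)"
    define r where "r = (\<lambda>(x, y). lratio m (drop (i - 1) (xsA x)) (y (\<pi> m)))"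
    have "?c \<in> {1..B}" using i j m by (auto simp: B_def)
    then have "typical dd PXY (map (\<lambda>t. (tx \<omega> ?c t ?u ?l, ty \<omega> ?c t ?u ?l)) [0..<N])"
      using good[of ?c] unfolding BadB_def Let_def Bad1_def by blast
    moreover have "0 < r a" if "a \<in> set_pmf PXY" for a
    proof -
      obtain x y z where "a = (x, y)" "(x, y, z) \<in> set_pmf P" using \<open>a \<in> set_pmf PXY\<close> unfolding map_PXY[symmetric] by auto
      then show ?thesis using ratio_pos(1)[of x y z i m] i m by (simp add: r_def)
    qed
    ultimately have "2 powr (real N * (mean PXY (\<lambda>a. log 2 (r a)) - dd * mean PXY (\<lambda>a. \<bar>log 2 (r a)\<bar>)))
      \<le> (\<Prod>t<N. r (tx \<omega> ?c t ?u ?l, ty \<omega> ?c t ?u ?l))"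
      by (rule typical_prod(1)[OF _ finite_PXY])
    moreover have "mean PXY (\<lambda>a. log 2 (r a)) = mean P (ylog m i)" "mean PXY (\<lambda>a. \<bar>log 2 (r a)\<bar>) = mean P (\<lambda>\<omega>. \<bar>ylog m i \<omega>\<bar>)"
      unfolding mean_PXY by (intro arg_cong[where f="mean P"], auto simp: fun_eq_iff ylog_def r_def)+
    moreover have "w j # pipe w (Suc i) ?c = drop (i - 1) ?u"
      using i m j by (simp add: drop_pipe pipe_Cons[of i])
    then have "r (tx \<omega> ?c t ?u ?l, ty \<omega> ?c t ?u ?l) = lratio m (cw \<omega> ?c t (w j # pipe w (Suc i) ?c)) (genie_out w \<omega> ?c t (\<pi> m))" for t
      by (simp add: r_def xsA_tx drop_cw genie_out_def del: drop_pipe)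
    ultimately show ?thesis by simp
  qed
  have "2 powr (real N * (\<Sum>i\<in>{1..<m}. mean P (ylog m i) - dd * mean P (\<lambda>\<omega>. \<bar>ylog m i \<omega>\<bar>)))
    = (\<Prod>i\<in>{1..<m}. 2 powr (real N * (mean P (ylog m i) - dd * mean P (\<lambda>\<omega>. \<bar>ylog m i \<omega>\<bar>))))"
    by (simp add: sum_distrib_left powr_sum)
  also have "\<dots> \<le> (\<Prod>i\<in>{1..<m}. \<Prod>t<N. lratio m (cw \<omega> (j + i - 1) t (w j # pipe w (Suc i) (j + i - 1))) (genie_out w \<omega> (j + i - 1) t (\<pi> m)))"
    by (intro prod_mono conjI *) simp_all
  also have "\<dots> = score \<omega> m j w (w j) (\<lambda>c t. genie_out w \<omega> c t (\<pi> m))"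
    unfolding score_def by (rule prod.cartesian_product)
  finally show ?thesis .
qed

text \<open>The outputs of the genie-aided transmission in the format of \<open>run\<close>, with
  which they will be identified.\<close>

definition path :: "('x, 'y, 'z) outcome \<Rightarrow> (nat \<Rightarrow> nat) \<Rightarrow> nat \<Rightarrow> (nat \<Rightarrow> 'y) list" where
  "path \<omega> w i = map (\<lambda>\<tau> k. genie_out w \<omega> (\<tau> div N + 1) (\<tau> mod N) k) [0..<i]"

lemma length_path [simp]: "length (path \<omega> w i) = i" by (simp add: path_def)

lemma path_nth: "1 \<le> c \<Longrightarrow> t < N \<Longrightarrow> c * N \<le> i + N - Suc t \<Longrightarrow> path \<omega> w i ! ((c - 1) * N + t) = genie_out w \<omega> c t"
proof -
  assume c: "1 \<le> c" and t: "t < N" and i: "c * N \<le> i + N - Suc t"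
  obtain b where b: "c = Suc b" using c by (cases c) auto
  have "(c - 1) * N + t < i" using i t unfolding b by simp
  then show ?thesis unfolding path_def using t by (simp add: b)
qed

lemma block_path:
  assumes "1 \<le> c" "c * N \<le> i"
  shows "block N (map (\<lambda>y. y k) (path \<omega> w i)) c = map (\<lambda>t. genie_out w \<omega> c t k) [0..<N]"
proof (rule nth_equalityI)
  obtain b where b: "c = Suc b" using assms(1) by (cases c) auto
  show l: "length (block N (map (\<lambda>y. y k) (path \<omega> w i)) c) = length (map (\<lambda>t. genie_out w \<omega> c t k) [0..<N])"
    using assms(2) by (simp add: block_def b)
  fix t assume "t < length (block N (map (\<lambda>y. y k) (path \<omega> w i)) c)"
  then have t: "t < N" unfolding l by simp
  have "c * N \<le> i + N - Suc t" using assms t by simp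
  note p = path_nth[OF assms(1) t this, of \<omega> w]
  have "(c - 1) * N + t < i" using assms(2) t unfolding b by simp
  then show "block N (map (\<lambda>y. y k) (path \<omega> w i)) c ! t = map (\<lambda>t. genie_out w \<omega> c t k) [0..<N] ! t"
    using t p by (simp add: block_def)
qed

lemma qidx_path:
  assumes k: "k \<in> T2" and c: "c * N \<le> i"
  shows "qidx P (scheme_of \<omega>) k (map (\<lambda>y. y k) (path \<omega> w i)) c = genie_idx w \<omega> c k"
  using c
proof (induction c)
  case (Suc c)
  let ?u = "pipe w 1 (Suc c)"
  have IH: "qidx P (scheme_of \<omega>) k (map (\<lambda>y. y k) (path \<omega> w i)) c = genie_idx w \<omega> c k" using Suc by simp
  have bl: "block N (map (\<lambda>y. y k) (path \<omega> w i)) (Suc c) = map (\<lambda>t. genie_out w \<omega> (Suc c) t k) [0..<N]"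
    by (rule block_path) (use Suc.prems in simp_all)
  have "typical dq (map_pmf (\<lambda>(x, y, z). (x k, y k, z k)) P)
      (zip (qx (scheme_of \<omega>) k (Suc c) (genie_idx w \<omega> c k)) (zip (map (\<lambda>t. genie_out w \<omega> (Suc c) t k) [0..<N]) (qz (scheme_of \<omega>) k (Suc c) l (genie_idx w \<omega> c k))))
    \<longleftrightarrow> qtyp k (\<lambda>t. tx \<omega> (Suc c) t ?u (genie_idx w \<omega> c)) (\<lambda>t. ty \<omega> (Suc c) t ?u (genie_idx w \<omega> c)) (\<lambda>t. tz \<omega> (Suc c) t (genie_idx w \<omega> c) (tx \<omega> (Suc c) t ?u (genie_idx w \<omega> c)) k l)" for l
    unfolding qtyp_def PXYZ_def by (simp only: scheme_of_simps zip_map_map zip_same_conv_map list.map_comp)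
      (simp add: o_def tz_def tx_T2[OF k] genie_out_def)
  then have good: "(\<lambda>l. l \<in> {1..nidx (scheme_of \<omega>) k} \<and> typical (scheme.dq (scheme_of \<omega>)) (map_pmf (\<lambda>(x, y, z). (x k, y k, z k)) P)
      (zip (qx (scheme_of \<omega>) k (Suc c) (genie_idx w \<omega> c k)) (zip (block (bl (scheme_of \<omega>)) (map (\<lambda>y. y k) (path \<omega> w i)) (Suc c)) (qz (scheme_of \<omega>) k (Suc c) l (genie_idx w \<omega> c k)))))
     = qgood \<omega> (Suc c) ?u (genie_idx w \<omega> c) k"
    unfolding qgood_def[abs_def] scheme_of_simps(1,5,11) bl by (simp only:)
  show ?case
    unfolding qidx.simps IH Let_def good genie_idx.simps qindex_def ..
qed simp

definition good :: "nat \<Rightarrow> ('x, 'y, 'z) outcome \<Rightarrow> bool" where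
  "good W \<omega> \<longleftrightarrow> \<not> BadR (sp W) \<theta> \<omega> \<and> (\<forall>c\<in>{1..B}. \<not> BadB (sp W) c \<omega>)"

context
  fixes W \<omega>
  assumes W: "W \<in> {1..M}" and good: "good W \<omega>"
    and \<theta>_le: "\<And>m. m \<in> {2..K1} \<Longrightarrow> \<theta> \<le> 2 powr (real N * (\<Sum>i\<in>{1..<m}. mean P (ylog m i) - dd * mean P (\<lambda>\<omega>. \<bar>ylog m i \<omega>\<bar>)))"
begin

text \<open>Given the outputs of the genie, every sender acts as with the genie: a decode-forward
  relay because its estimates are correct, a quantize-forward relay because its index is determined
  by those outputs.\<close>

lemma inpt_path:
  assumes i: "i < B * N"
  shows "inpt \<omega> W (path \<omega> (sp W) i) = tx \<omega> (i div N + 1) (i mod N) (pipe (sp W) 1 (i div N + 1)) (genie_idx (sp W) \<omega> (i div N))"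
proof
  fix k
  let ?c = "i div N + 1" and ?t = "i mod N" and ?w = "sp W"
  let ?u = "pipe ?w 1 ?c" and ?ys = "map (\<lambda>y. y k) (path \<omega> ?w i)"
  note ct = block_index[OF i]
  have iN: "i div N * N \<le> i" by (rule div_times_less_eq_dividend)
  have sen: "senders Ch = {1} \<union> \<pi> ` {2..K1} \<union> T2" unfolding senders_eq A_eq DF_relays_def ..
  consider "k \<notin> senders Ch" | "k = 1" | m where "m \<in> {2..K1}" "k = \<pi> m" "k \<noteq> 1" | "k \<in> T2" "k \<noteq> 1"
    using sen by blast
  then show "inpt \<omega> W (path \<omega> ?w i) k = tx \<omega> ?c ?t ?u (genie_idx ?w \<omega> (i div N)) k"
  proof cases
    case 1
    then show ?thesis by (simp add: inpt_def inputs_def tx_def glue_def)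
  next
    case 2
    have "tx \<omega> ?c ?t ?u (genie_idx ?w \<omega> (i div N)) (\<pi> 1) = hd (cw \<omega> ?c ?t ?u)" by (rule tx_pi) (use K1 in simp)
    moreover have "k \<in> senders Ch" using 2 one_A A_senders by auto
    ultimately show ?thesis using 2 i ct unfolding perm(2)
      by (simp add: inpt_def inputs_def snnc_src_def Let_def)
  next
    case 3
    have ks: "k \<in> senders Ch" unfolding 3(2) by (rule pi_senders) (use 3(1) in auto)
    have kD: "k \<in> DF_relays \<pi> K1" unfolding 3(2) DF_relays_def using 3(1) by blast
    have inv: "inv \<pi> k = m" unfolding 3(2) by (rule inv_pi)
    let ?dec = "\<lambda>j. dfd (scheme_of \<omega>) m j (take ((j + m - 2) * N) ?ys)"
    have "pipe ?dec m ?c = pipe ?w m ?c"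
    proof (rule pipe_cong)
      fix j assume j: "j \<in> {1..nb}" "j + m \<le> ?c + 1"
      \<comment> \<open>Message \<open>j\<close> is decided from blocks up to
        \<open>j + m - 2\<close>. This is at most \<open>?c - 1\<close>, so all of these blocks have
        been received before block \<open>?c\<close> starts.\<close>
      have jm: "(j + m - 2) * N \<le> i"
        using j(2) by (intro order.trans[OF _ iN] mult_right_mono) auto
      have "est \<omega> \<theta> m (\<lambda>c t. take ((j + m - 2) * N) ?ys ! ((c - 1) * N + t)) j j = ?w j"
      proof (rule est_correct[OF 3(1)])
        show "\<theta> \<le> score \<omega> m j' ?w (?w j') (\<lambda>c t. genie_out ?w \<omega> c t (\<pi> m))" if "j' \<in> {1..j}" for j'
          by (rule order.trans[OF \<theta>_le[OF 3(1)] score_true[OF 3(1)]]) (use that j good in \<open>auto simp: good_def\<close>)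
        fix c t assume c: "1 \<le> c" "c + 2 \<le> j + m" and t: "t < N"
        obtain b where b: "c = Suc b" using c(1) by (cases c) auto
        have "c * N \<le> (j + m - 2) * N" using c(2) by (intro mult_right_mono) auto
        then have cN: "c * N \<le> i" "(c - 1) * N + t < (j + m - 2) * N" "(c - 1) * N + t < i"
          using jm t by (auto simp: b)
        have "path \<omega> ?w i ! ((c - 1) * N + t) = genie_out ?w \<omega> c t" by (rule path_nth[OF c(1) t]) (use cN(1) t in simp)
        then show "take ((j + m - 2) * N) ?ys ! ((c - 1) * N + t) = genie_out ?w \<omega> c t (\<pi> m)"
          using cN 3(2) by simp
      qed (use j sp[OF W] good in \<open>auto simp: good_def\<close>)
      then show "?dec j = ?w j" by simp
    qed
    moreover have "tx \<omega> ?c ?t ?u (genie_idx ?w \<omega> (i div N)) (\<pi> m) = hd (cw \<omega> ?c ?t (pipe ?w m ?c))"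
      by (rule tx_pi) (use 3(1) in auto)
    ultimately show ?thesis
      using 3(3) i ct ks kD inv 3(2) by (simp add: inpt_def inputs_def snnc_rel_def Let_def)
  next
    case 4
    then have "k \<in> senders Ch" "k \<notin> DF_relays \<pi> K1" using senders_eq by (auto simp: QF_relays_def)
    then show ?thesis
      using 4(2) i ct qidx_path[OF 4(1) iN] by (simp add: inpt_def inputs_def snnc_rel_def Let_def tx_T2[OF 4(1)])
  qed
qed

text \<open>Induction over time: equal pasts give equal inputs, and these select the same noise
  letter.\<close>

lemma run_path: "i \<le> B * N \<Longrightarrow> run \<omega> W i = path \<omega> (sp W) i"
proof (induction i)
  case (Suc i)
  then have IH: "run \<omega> W i = path \<omega> (sp W) i" and i: "i < B * N" by simp_all
  show ?case
    unfolding run.simps Let_def IH inpt_path[OF i] by (simp add: path_def genie_out_def ty_def)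
qed (simp add: path_def)

lemma pipe_last:
  assumes j: "j = c + 1 - K1" "j \<in> {1..nb}"
  shows "pipe (w(j := v)) 1 c = butlast (pipe w 1 c) @ [v]" "last (pipe w 1 c) = w j"
proof -
  have u: "[1..<Suc K1] = [1..<K1] @ [K1]" using K1 by (simp add: upt_Suc_append)
  have e: "pipe w 1 c = map (\<lambda>i. let j = c + 1 - i in if j \<in> {1..nb} then w j else 1) [1..<K1] @ [w j]" for w
    unfolding pipe_def u using j by simp
  show "last (pipe w 1 c) = w j" unfolding e by simp
  show "pipe (w(j := v)) 1 c = butlast (pipe w 1 c) @ [v]"
    unfolding e butlast_append using j by (auto simp: Let_def)
qed

text \<open>Outside \<open>Bad2\<close> the quantizers of \<open>Q\<close> succeed, so their indices
  are covered by \<open>Bad3\<close> and the true pair passes; outside \<open>Bad4\<close> no other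
  pair does.\<close>

lemma genie_passes:
  assumes c: "c \<in> {1..B}"
  defines "w \<equiv> sp W" and "u \<equiv> pipe (sp W) 1 c" and "l' \<equiv> genie_idx (sp W) \<omega> (c - 1)"
  assumes v: "v \<in> {1..msg}" and m: "m \<in> PiE Q (\<lambda>k. {1..L k})"
  shows "typical dd TL (map (\<lambda>t. test_letter \<omega> c t (butlast u @ [v]) (upd l' m) (genie_idx w \<omega> c) (genie_out w \<omega> c t K)) [0..<N])
    \<longleftrightarrow> v = last u \<and> m = restrict l' Q"
proof -
  have bad: "\<not> Bad2 c u l' \<omega>" "\<not> Bad3 c u l' \<omega>" "\<not> Bad4 c u l' \<omega>"
    using good c unfolding good_def BadB_def Let_def u_def l'_def by blast+
  have genie_idx: "genie_idx w \<omega> c = qindex \<omega> c u l'" using c unfolding w_def u_def l'_def by (cases c) simp_all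
  have genie_out: "genie_out w \<omega> c t K = ty \<omega> c t u l' K" for t by (simp add: genie_out_def w_def u_def l'_def)
  have ne: "u \<noteq> []" using K1 by (metis length_pipe list.size(3) u_def diff_Suc_1 One_nat_def not_one_le_zero)
  have q: "qgood \<omega> c u l' k (qindex \<omega> c u l' k)" if "k \<in> Q" for k
  proof -
    have "\<exists>l. qgood \<omega> c u l' k l" using bad(1) that unfolding Bad2_def qgood_def by blast
    then show ?thesis unfolding qindex_def by (simp add: LeastI_ex)
  qed
  have "typical dd TL (map (\<lambda>t. test_letter \<omega> c t u l' (restrict (qindex \<omega> c u l') Q) (ty \<omega> c t u l' K)) [0..<N])"
  proof (rule ccontr)
    assume n: "\<not> ?thesis"
    have "restrict (qindex \<omega> c u l') Q \<in> PiE Q (\<lambda>k. {1..L k})" using qindex_range Q by auto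
    moreover have "\<forall>k\<in>Q. qtyp k (\<lambda>t. tx \<omega> c t u l') (\<lambda>t. ty \<omega> c t u l')
      (\<lambda>t. tz \<omega> c t l' (tx \<omega> c t u l') k (restrict (qindex \<omega> c u l') Q k))"
      using q unfolding qgood_def by simp
    ultimately have "Bad3 c u l' \<omega>" using n unfolding Bad3_def by blast
    with bad(2) show False by blast
  qed
  moreover have "test_letter \<omega> c t u l' (restrict (qindex \<omega> c u l') Q) y = test_letter \<omega> c t u l' (qindex \<omega> c u l') y" for t y
    unfolding test_letter_def by (auto simp: restrict_def fun_eq_iff)
  ultimately have t: "typical dd TL (map (\<lambda>t. test_letter \<omega> c t u l' (qindex \<omega> c u l') (ty \<omega> c t u l' K)) [0..<N])" by (simp only:)
  show ?thesis unfolding genie_idx genie_out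
  proof
    assume "typical dd TL (map (\<lambda>t. test_letter \<omega> c t (butlast u @ [v]) (upd l' m) (qindex \<omega> c u l') (ty \<omega> c t u l' K)) [0..<N])"
    then show "v = last u \<and> m = restrict l' Q" using bad(3) v m unfolding Bad4_def by blast
  next
    assume vm: "v = last u \<and> m = restrict l' Q"
    have "butlast u @ [v] = u" using vm ne by simp
    moreover have "upd l' m = l'" using vm by (auto simp: upd_def fun_eq_iff)
    ultimately show "typical dd TL (map (\<lambda>t. test_letter \<omega> c t (butlast u @ [v]) (upd l' m) (qindex \<omega> c u l') (ty \<omega> c t u l' K)) [0..<N])"
      using t by (simp only:)
  qed
qed

text \<open>The pipeline of block \<open>c\<close> ends with message \<open>j\<close>, and the
  messages after \<open>j\<close> are already decoded. So the hypothesized pipeline is the true one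
  with its last entry replaced.\<close>

lemma test_seq_tst:
  assumes c: "c \<in> {1..B}" and j: "j = c + 1 - K1" "j \<in> {1..nb}" and w': "\<And>j'. j' \<in> {j<..nb} \<Longrightarrow> w' j' = sp W j'"
  shows "test_seq \<pi> K1 Q (scheme_of \<omega>) (at_dest (path \<omega> (sp W) (B * N)) @ zs) c (w'(j := v)) (restrict l Q) m
    = map (\<lambda>t. test_letter \<omega> c t (butlast (pipe (sp W) 1 c) @ [v]) (upd l' m) l (genie_out (sp W) \<omega> c t K)) [0..<N]"
proof -
  have cN: "c * N \<le> B * N" using c by simp
  have "block N (at_dest (path \<omega> (sp W) (B * N)) @ zs) c = block N (at_dest (path \<omega> (sp W) (B * N))) c"
  proof -
    obtain b where "c = Suc b" using c by (cases c) auto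
    then show ?thesis using cN by (simp add: block_def)
  qed
  also have "\<dots> = map (\<lambda>t. genie_out (sp W) \<omega> c t K) [0..<N]" by (rule block_path) (use c cN in auto)
  finally have bl: "block N (at_dest (path \<omega> (sp W) (B * N)) @ zs) c = map (\<lambda>t. genie_out (sp W) \<omega> c t K) [0..<N]" .
  have "pipe (w'(j := v)) 1 c = pipe ((sp W)(j := v)) 1 c"
    by (rule pipe_cong) (use w' j in auto)
  also have "\<dots> = butlast (pipe (sp W) 1 c) @ [v]" by (rule pipe_last[OF j])
  finally have u: "butlast (pipe (sp W) 1 c) @ [v] = pipe (w'(j := v)) 1 c" ..
  show ?thesis
    unfolding test_seq_def scheme_of_simps(1) bl
  proof (rule map_upt_cong)
    fix t assume t: "t < N"
    let ?u = "pipe (w'(j := v)) 1 c"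
    have Q2: "k \<in> T2" if "k \<in> Q" for k using that Q by auto
    have X: "tx \<omega> c t ?u (upd l' m) k = valX (\<omega> (RX c t k (m k)))" if "k \<in> Q" for k
      using tx_T2[OF Q2[OF that]] that by (simp add: upd_def)
    have "(\<lambda>k\<in>\<pi> ` {1..K1} \<union> Q. if k \<in> Q then qx (scheme_of \<omega>) k c (m k) ! t
             else cx (scheme_of \<omega>) (inv \<pi> k) c (pipeline K1 (scheme_of \<omega>) (w'(j := v)) (inv \<pi> k) c) ! t) = restrict (tx \<omega> c t ?u (upd l' m)) (A \<union> Q)"
      (is "?L = ?R")
    proof
      fix k
      consider "k \<in> Q" | i where "i \<in> {1..K1}" "k = \<pi> i" "k \<notin> Q" | "k \<notin> A \<union> Q"
        unfolding A_def by blast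
      then show "?L k = ?R k"
      proof cases
        case 1
        then show ?thesis using X t by (simp add: A_def)
      next
        case 2
        have "tx \<omega> c t ?u (upd l' m) (\<pi> i) = hd (cw \<omega> c t (pipe (w'(j := v)) i c))" by (rule tx_pi[OF 2(1)])
        moreover have "\<pi> i \<in> A" "inv \<pi> (\<pi> i) = i" using 2(1) by (rule pi_A, simp)
        ultimately show ?thesis using 2(3) t unfolding 2(2) by (simp add: A_def)
      next
        case 3
        then show ?thesis by (simp add: A_def)
      qed
    qed
    moreover have "(\<lambda>k\<in>Q. qz (scheme_of \<omega>) k c (restrict l Q k) (m k) ! t) = (\<lambda>k\<in>Q. tz \<omega> c t (upd l' m) (tx \<omega> c t ?u (upd l' m)) k (l k))"
      using t X by (auto simp: tz_def upd_def fun_eq_iff restrict_def)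
    moreover have "map (\<lambda>t. genie_out (sp W) \<omega> c t K) [0..<N] ! t = genie_out (sp W) \<omega> c t K" using t by simp
    ultimately show "(\<lambda>k\<in>\<pi> ` {1..K1} \<union> Q. if k \<in> Q then qx (scheme_of \<omega>) k c (m k) ! t
             else cx (scheme_of \<omega>) (inv \<pi> k) c (pipeline K1 (scheme_of \<omega>) (w'(j := v)) (inv \<pi> k) c) ! t,
         \<lambda>k\<in>Q. qz (scheme_of \<omega>) k c (restrict l Q k) (m k) ! t,
         map (\<lambda>t. genie_out (sp W) \<omega> c t K) [0..<N] ! t)
      = test_letter \<omega> c t (butlast (pipe (sp W) 1 c) @ [v]) (upd l' m) l (genie_out (sp W) \<omega> c t K)"
      unfolding u test_letter_def by (simp only:)
  qed
qed

text \<open>A step needs the indices of its block and the later messages, and by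
  \<open>genie_passes\<close> it returns the previous indices and one more message. The final phase
  provides the start.\<close>

lemma backward_correct:
  assumes zs: "\<And>k. k \<in> Q \<Longrightarrow> g k zs = genie_idx (sp W) \<omega> B k" and i: "i \<le> nb"
  shows "\<exists>w'. backward Ch \<pi> K1 Q P (scheme_of \<omega>) (at_dest (path \<omega> (sp W) (B * N)) @ zs) i = (restrict (genie_idx (sp W) \<omega> (B - i)) Q, w')
    \<and> (\<forall>j\<in>{nb - i<..nb}. w' j = sp W j)"
  using i
proof (induction i)
  case 0
  have "drop (B * N) (at_dest (path \<omega> (sp W) (B * N)) @ zs) = zs" by simp
  then show ?case using zs by (auto simp: fun_eq_iff restrict_def)
next
  case (Suc i)
  let ?ys = "at_dest (path \<omega> (sp W) (B * N)) @ zs" and ?c = "B - i" and ?j = "B - i + 1 - K1"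
  obtain w' where bw: "backward Ch \<pi> K1 Q P (scheme_of \<omega>) ?ys i = (restrict (genie_idx (sp W) \<omega> (B - i)) Q, w')"
    and w': "\<And>j. j \<in> {nb - i<..nb} \<Longrightarrow> w' j = sp W j"
    using Suc.IH[OF Suc_leD[OF Suc.prems]] by blast
  have jc: "?j = nb - i" "?c \<in> {1..B}" "?j \<in> {1..nb}" using Suc.prems K1 by (auto simp: B_def)
  have SB: "?c - 1 = B - Suc i" by simp
  let ?good = "{(v, l'). v \<in> {1..msg} \<and> l' \<in> PiE Q (\<lambda>k. {1..L k}) \<and>
            typical dd TL (test_seq \<pi> K1 Q (scheme_of \<omega>) ?ys ?c (w'(?j := v)) (restrict (genie_idx (sp W) \<omega> ?c) Q) l')}"
  let ?l' = "restrict (genie_idx (sp W) \<omega> (B - Suc i)) Q"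
  have "test_seq \<pi> K1 Q (scheme_of \<omega>) ?ys ?c (w'(?j := v)) (restrict (genie_idx (sp W) \<omega> ?c) Q) m
    = map (\<lambda>t. test_letter \<omega> ?c t (butlast (pipe (sp W) 1 ?c) @ [v]) (upd (genie_idx (sp W) \<omega> (?c - 1)) m) (genie_idx (sp W) \<omega> ?c) (genie_out (sp W) \<omega> ?c t K)) [0..<N]" for v m
    by (rule test_seq_tst[OF jc(2) refl jc(3)]) (use w' jc(1) in auto)
  then have "p \<in> ?good \<longleftrightarrow> fst p \<in> {1..msg} \<and> snd p \<in> PiE Q (\<lambda>k. {1..L k}) \<and> p = (sp W ?j, ?l')" for p
    using genie_passes[OF jc(2), of "fst p" "snd p"] unfolding pipe_last(2)[OF refl jc(3)] SB
    by (cases p) auto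
  moreover have "sp W ?j \<in> {1..msg}" "?l' \<in> PiE Q (\<lambda>k. {1..L k})"
    using sp[OF W jc(3)] genie_idx_range Q by (auto simp del: genie_idx.simps)
  ultimately have good: "p \<in> ?good \<longleftrightarrow> p = (sp W ?j, ?l')" for p by auto
  have "backward Ch \<pi> K1 Q P (scheme_of \<omega>) ?ys (Suc i) = (?l', w'(?j := sp W ?j))"
    unfolding backward.simps bw Let_def prod.case scheme_of_blocks scheme_of_simps good by simp
  moreover have "(w'(?j := sp W ?j)) j = sp W j" if "j \<in> {nb - Suc i<..nb}" for j
    using w'[of j] that jc(1) by (cases "j = ?j") auto
  ultimately show ?case by blast
qed

lemma decoding_correct:
  assumes "\<And>k. k \<in> Q \<Longrightarrow> g k zs = genie_idx (sp W) \<omega> B k"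
  shows "snnc_dec Ch \<pi> K1 Q P M (scheme_of \<omega>) (at_dest (path \<omega> (sp W) (B * N)) @ zs) = W"
proof -
  obtain w' where bw: "snd (backward Ch \<pi> K1 Q P (scheme_of \<omega>) (at_dest (path \<omega> (sp W) (B * N)) @ zs) nb) = w'"
    and w': "\<forall>j\<in>{1..nb}. w' j = sp W j"
    using backward_correct[OF assms order_refl] by auto
  have "V \<in> {1..M} \<and> (\<forall>j\<in>{1..nb}. sp V j = w' j) \<longleftrightarrow> V = W" for V
    using W w' inj_onD[OF inj_sp, of V W] by (auto simp: fun_eq_iff restrict_def)
  then show ?thesis by (simp add: snnc_dec_def bw)
qed

end

end

section \<open>Average error probability over the random code\<close>

lemma prob_bind_pmf_bad:
  assumes "\<And>a. a \<in> set_pmf p \<Longrightarrow> a \<notin> X \<Longrightarrow> measure_pmf.prob (f a) E \<le> \<eta>" "0 \<le> \<eta>"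
  shows "measure_pmf.prob (bind_pmf p f) E \<le> measure_pmf.prob p X + \<eta>"
proof -
  have "measure_pmf.expectation p (\<lambda>a. measure_pmf.prob (f a) E) \<le> measure_pmf.expectation p (\<lambda>a. indicator X a + \<eta>)"
    using assms by (intro integral_mono_AE measure_pmf.integrable_const_bound[where B="1 + \<eta>"] AE_pmfI)
      (auto simp: indicator_def add_increasing2)
  also have "\<dots> = measure_pmf.expectation p (indicator X) + \<eta>"
    by (subst Bochner_Integration.integral_add)
      (auto intro!: measure_pmf.integrable_const_bound[where B=1])
  finally show ?thesis by (simp add: prob_bind_pmf)
qed

lemma (in relay_law) qidx_append:
  "c * bl s \<le> length ys \<Longrightarrow> qidx P s k (ys @ zs) c = qidx P s k ys c"
proof (induction c)
  case (Suc c)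
  then have IH: "qidx P s k (ys @ zs) c = qidx P s k ys c" by simp
  have "block (bl s) (ys @ zs) (Suc c) = block (bl s) ys (Suc c)" using Suc.prems by (simp add: block_def)
  then show ?case unfolding qidx.simps IH by (simp only:)
qed simp

context snnc begin

text \<open>The state with which a relay enters the final phase; for decode-forward relays
  \<open>1\<close> is the convention of \<open>snnc_rel\<close>.\<close>

definition st :: "('x, 'y, 'z) outcome \<Rightarrow> (nat \<Rightarrow> 'y) list \<Rightarrow> nat \<Rightarrow> nat" where
  "st \<omega> ys k = (if k \<in> DF_relays \<pi> K1 then 1 else qidx P (scheme_of \<omega>) k (map (\<lambda>y. y k) ys) B)"

lemma st_cb: "st (cb \<omega>) = st \<omega>" by (intro ext) (simp add: st_def scheme_of_cb)

lemma inpt_final: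
  assumes "length ys = B * N"
  shows "inpt \<omega> W (ys @ zs) = act \<sigma> (st \<omega> ys) zs"
proof
  fix k
  show "inpt \<omega> W (ys @ zs) k = act \<sigma> (st \<omega> ys) zs k"
  proof (cases "k \<in> senders Ch")
    case True
    have "\<sigma> 1 0 (replicate (length zs) undefined) = \<sigma> 1 s (map (\<lambda>y. y 1) zs)" for s
      using strat by (simp add: strat_def)
    moreover have "qidx P (scheme_of \<omega>) k (map (\<lambda>y. y k) (ys @ zs)) B = qidx P (scheme_of \<omega>) k (map (\<lambda>y. y k) ys) B"
      unfolding map_append by (rule qidx_append) (simp add: assms)
    ultimately show ?thesis
      using True assms by (auto simp: inpt_def inputs_def act_def st_def snnc_src_def snnc_rel_def Let_def)
  qed (simp add: inpt_def inputs_def act_def)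
qed

text \<open>By \<open>coupling\<close> the main part may be generated from the prepared noise, and
  on \<open>good\<close> it is the path of the genie. The final phase keeps its own channel noise
  and is bounded for each fixed tuple of last indices.\<close>

lemma message_error:
  assumes W: "W \<in> {1..M}"
    and \<theta>_le: "\<And>m. m \<in> {2..K1} \<Longrightarrow> \<theta> \<le> 2 powr (real N * (\<Sum>i\<in>{1..<m}. mean P (ylog m i) - dd * mean P (\<lambda>\<omega>. \<bar>ylog m i \<omega>\<bar>)))"
    and fin: "\<And>l. (\<And>k. k \<in> Q \<Longrightarrow> l k \<in> {1..L k}) \<Longrightarrow>
      measure_pmf.prob (proc (act \<sigma> l) d) {ys. \<exists>k\<in>Q. g k (at_dest ys) \<noteq> l k} \<le> \<eta>" and \<eta>: "0 \<le> \<eta>"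
  shows "measure_pmf.prob (bind_pmf \<Omega> (\<lambda>\<omega>. map_pmf (\<lambda>ys. snnc_dec Ch \<pi> K1 Q P M (scheme_of \<omega>) (at_dest ys))
      (outputs Ch (snnc_code M Q (scheme_of \<omega>)) W (B * N + d)))) {V. V \<noteq> W}
    \<le> real (K1 * nb * msg) / \<theta> + real B * (tailp N dd PXY + bb2 + bb3 + bb4) + \<eta>"
proof -
  let ?dec = "\<lambda>\<omega> ys. snnc_dec Ch \<pi> K1 Q P M (scheme_of \<omega>) (at_dest ys)"
  have "bind_pmf \<Omega> (\<lambda>\<omega>. map_pmf (?dec \<omega>) (outputs Ch (snnc_code M Q (scheme_of \<omega>)) W (B * N + d)))
    = bind_pmf (map_pmf cb \<Omega>) (\<lambda>\<kappa>. map_pmf (?dec \<kappa>) (proc (inpt \<kappa> W) (B * N + d)))"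
    by (simp add: bind_map_pmf scheme_of_cb inpt_cb outputs_eq_proc) (simp add: inpt_def)
  also have "\<dots> = bind_pmf (map_pmf cb \<Omega>) (\<lambda>\<kappa>. bind_pmf (proc (inpt \<kappa> W) (B * N))
      (\<lambda>ys. map_pmf (\<lambda>zs. ?dec \<kappa> (ys @ zs)) (proc (act \<sigma> (st \<kappa> ys)) d)))"
  proof (rule bind_pmf_cong[OF refl])
    fix \<kappa>
    show "map_pmf (?dec \<kappa>) (proc (inpt \<kappa> W) (B * N + d))
      = bind_pmf (proc (inpt \<kappa> W) (B * N)) (\<lambda>ys. map_pmf (\<lambda>zs. ?dec \<kappa> (ys @ zs)) (proc (act \<sigma> (st \<kappa> ys)) d))"
      unfolding proc_add map_bind_pmf pmf.map_comp
      by (intro bind_pmf_cong refl) (simp add: o_def inpt_final length_proc)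
  qed
  also have "\<dots> = bind_pmf (bind_pmf (map_pmf cb \<Omega>) (\<lambda>\<kappa>. map_pmf (Pair \<kappa>) (proc (inpt \<kappa> W) (B * N))))
      (\<lambda>(\<kappa>, ys). map_pmf (\<lambda>zs. ?dec \<kappa> (ys @ zs)) (proc (act \<sigma> (st \<kappa> ys)) d))"
    by (simp add: bind_assoc_pmf bind_map_pmf)
  also have "\<dots> = bind_pmf \<Omega> (\<lambda>\<omega>. map_pmf (\<lambda>zs. ?dec \<omega> (run \<omega> W (B * N) @ zs)) (proc (act \<sigma> (st \<omega> (run \<omega> W (B * N)))) d))"
    unfolding coupling[OF W order_refl, symmetric] by (simp add: bind_map_pmf scheme_of_cb st_cb)
  finally have eq: "bind_pmf \<Omega> (\<lambda>\<omega>. map_pmf (?dec \<omega>) (outputs Ch (snnc_code M Q (scheme_of \<omega>)) W (B * N + d)))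
    = bind_pmf \<Omega> (\<lambda>\<omega>. map_pmf (\<lambda>zs. ?dec \<omega> (run \<omega> W (B * N) @ zs)) (proc (act \<sigma> (st \<omega> (run \<omega> W (B * N)))) d))" .
  have "measure_pmf.prob (bind_pmf \<Omega> (\<lambda>\<omega>. map_pmf (\<lambda>zs. ?dec \<omega> (run \<omega> W (B * N) @ zs)) (proc (act \<sigma> (st \<omega> (run \<omega> W (B * N)))) d))) {V. V \<noteq> W}
    \<le> measure_pmf.prob \<Omega> {\<omega>. \<not> good W \<omega>} + \<eta>"
  proof (rule prob_bind_pmf_bad[OF _ \<eta>])
    fix \<omega> assume "\<omega> \<notin> {\<omega>. \<not> good W \<omega>}"
    then have gd: "good W \<omega>" by simp
    have run: "run \<omega> W (B * N) = path \<omega> (sp W) (B * N)" by (rule run_path[OF W gd \<theta>_le order_refl])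
    define l where "l = st \<omega> (path \<omega> (sp W) (B * N))"
    have l: "l k = genie_idx (sp W) \<omega> B k" if "k \<in> Q" for k
    proof -
      have "k \<in> T2" using that Q by blast
      then show ?thesis using qidx_path[of k B "B * N"] by (simp add: l_def st_def QF_relays_def)
    qed
    have "measure_pmf.prob (map_pmf (\<lambda>zs. ?dec \<omega> (path \<omega> (sp W) (B * N) @ zs)) (proc (act \<sigma> l) d)) {V. V \<noteq> W}
      \<le> measure_pmf.prob (proc (act \<sigma> l) d) {ys. \<exists>k\<in>Q. g k (at_dest ys) \<noteq> l k}"
      unfolding measure_map_pmf
    proof (rule prob_mono)
      fix zs assume "zs \<in> (\<lambda>zs. ?dec \<omega> (path \<omega> (sp W) (B * N) @ zs)) -` {V. V \<noteq> W}"
      then have "?dec \<omega> (path \<omega> (sp W) (B * N) @ zs) \<noteq> W" by simp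
      then show "zs \<in> {ys. \<exists>k\<in>Q. g k (at_dest ys) \<noteq> l k}"
        using decoding_correct[OF W gd \<theta>_le, of "at_dest zs"] l by (auto simp: map_append)
    qed
    also have "\<dots> \<le> \<eta>"
    proof (rule fin)
      fix k assume "k \<in> Q"
      then show "l k \<in> {1..L k}" unfolding l[OF \<open>k \<in> Q\<close>] using Q by (intro genie_idx_range) auto
    qed
    finally show "measure_pmf.prob (map_pmf (\<lambda>zs. ?dec \<omega> (run \<omega> W (B * N) @ zs)) (proc (act \<sigma> (st \<omega> (run \<omega> W (B * N)))) d)) {V. V \<noteq> W} \<le> \<eta>"
      unfolding run l_def .
  qed
  moreover have "measure_pmf.prob \<Omega> {\<omega>. \<not> good W \<omega>} \<le> real (K1 * nb * msg) / \<theta> + real B * (tailp N dd PXY + bb2 + bb3 + bb4)"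
    using prob_Bad[OF sp[OF W] \<theta>] by (simp add: good_def)
  ultimately show ?thesis unfolding eq by linarith
qed

text \<open>The averages over codebooks and messages commute, so a bound for each message bounds the
  mean over codebooks, and some codebook is no worse than the mean.\<close>

lemma exists_codebook:
  assumes M: "1 \<le> M"
    and \<theta>_le: "\<And>m. m \<in> {2..K1} \<Longrightarrow> \<theta> \<le> 2 powr (real N * (\<Sum>i\<in>{1..<m}. mean P (ylog m i) - dd * mean P (\<lambda>\<omega>. \<bar>ylog m i \<omega>\<bar>)))"
    and fin: "\<And>l. (\<And>k. k \<in> Q \<Longrightarrow> l k \<in> {1..L k}) \<Longrightarrow>
      measure_pmf.prob (proc (act \<sigma> l) d) {ys. \<exists>k\<in>Q. g k (at_dest ys) \<noteq> l k} \<le> \<eta>" and \<eta>: "0 \<le> \<eta>"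
  shows "\<exists>\<omega>\<in>set_pmf \<Omega>. error_prob Ch (B * N + d) M (snnc_code M Q (scheme_of \<omega>))
    \<le> real (K1 * nb * msg) / \<theta> + real B * (tailp N dd PXY + bb2 + bb3 + bb4) + \<eta>"
  unfolding error_prob_def
proof (rule exists_prob_le)
  have fin1: "finite {1..M}" "{1..M} \<noteq> {}" using M by auto
  show "measure_pmf.prob (bind_pmf \<Omega> (\<lambda>\<omega>. bind_pmf (pmf_of_set {1..M}) (\<lambda>W.
      map_pmf (\<lambda>ys. (W, dec (snnc_code M Q (scheme_of \<omega>)) (at_dest ys))) (outputs Ch (snnc_code M Q (scheme_of \<omega>)) W (B * N + d))))) {(w, v). v \<noteq> w}
    \<le> real (K1 * nb * msg) / \<theta> + real B * (tailp N dd PXY + bb2 + bb3 + bb4) + \<eta>"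
    unfolding bind_commute_pmf[of \<Omega>]
  proof (rule prob_bind_pmf_le)
    fix W assume "W \<in> set_pmf (pmf_of_set {1..M})"
    then have W: "W \<in> {1..M}" using fin1 by simp
    have "bind_pmf \<Omega> (\<lambda>\<omega>. map_pmf (\<lambda>ys. (W, dec (snnc_code M Q (scheme_of \<omega>)) (at_dest ys))) (outputs Ch (snnc_code M Q (scheme_of \<omega>)) W (B * N + d)))
      = map_pmf (Pair W) (bind_pmf \<Omega> (\<lambda>\<omega>. map_pmf (\<lambda>ys. snnc_dec Ch \<pi> K1 Q P M (scheme_of \<omega>) (at_dest ys)) (outputs Ch (snnc_code M Q (scheme_of \<omega>)) W (B * N + d))))"
      by (simp add: map_bind_pmf pmf.map_comp o_def)
    moreover have "Pair W -` {(w, v). v \<noteq> w} = {V. V \<noteq> W}" by auto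
    ultimately show "measure_pmf.prob (bind_pmf \<Omega> (\<lambda>\<omega>. map_pmf (\<lambda>ys. (W, dec (snnc_code M Q (scheme_of \<omega>)) (at_dest ys))) (outputs Ch (snnc_code M Q (scheme_of \<omega>)) W (B * N + d)))) {(w, v). v \<noteq> w}
      \<le> real (K1 * nb * msg) / \<theta> + real B * (tailp N dd PXY + bb2 + bb3 + bb4) + \<eta>"
      using message_error[OF W \<theta>_le fin \<eta>] by (simp only: measure_map_pmf)
  qed
qed

end

section \<open>Choice of the parameters\<close>

text \<open>Short messages will be the digits of \<open>W - 1\<close> in base \<open>msg\<close>;
  this makes the splitting injective.\<close>

lemma digits_inject:
  fixes m :: nat
  assumes "x < m ^ n" "y < m ^ n" "\<And>j. j < n \<Longrightarrow> (x div m ^ j) mod m = (y div m ^ j) mod m"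
  shows "x = y"
  using assms
proof (induction n arbitrary: x y)
  case (Suc n)
  have "x div m < m ^ n" "y div m < m ^ n"
    using Suc.prems(1,2) by (auto simp: less_mult_imp_div_less mult.commute)
  moreover have "(x div m div m ^ j) mod m = (y div m div m ^ j) mod m" if "j < n" for j
    using Suc.prems(3)[of "Suc j"] that by (simp add: div_mult2_eq)
  ultimately have "x div m = y div m" by (rule Suc.IH)
  moreover have "x mod m = y mod m" using Suc.prems(3)[of 0] by simp
  ultimately show ?case by (metis div_mult_mod_eq)
qed simp

lemma poly_exp_tendsto_0:
  assumes "0 < (c :: real)"
  shows "(\<lambda>N. real N ^ e * exp (- c * real N)) \<longlonglongrightarrow> 0"
  using assms by real_asymp

lemma exp_minus_le: "0 < x \<Longrightarrow> exp (- x) \<le> 1 / (x :: real)"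
proof -
  assume x: "0 < x"
  have "x \<le> exp x" using exp_ge_add_one_self[of x] by linarith
  then show ?thesis using x by (simp add: exp_minus field_simps)
qed

context relay_law begin

text \<open>\<open>qrate k\<close> is the conditional mutual information of \<open>Zs {k}\<close>
  and \<open>Ys {k}\<close> given \<open>Xs {k}\<close>. Nonnegativity keeps the nominal codebook
  sizes at least 1, so that rounding up at most doubles them.\<close>

lemma qrate_nonneg: "k \<in> T2 \<Longrightarrow> 0 \<le> qrate k"
proof -
  assume k: "k \<in> T2"
  have 1: "ent P (\<lambda>\<omega>. ((Xs {k} \<omega>, Ys {k} \<omega>), Zs {k} \<omega>)) = ent P (\<lambda>\<omega>. (Xs {k} \<omega>, Ys {k} \<omega>)) - (\<Sum>k\<in>{k}. mean P (zl k))"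
  proof (rule ent_markov[where q = "\<lambda>(xs, ys) k. (xs k, ys k)"])
    show "depends_on (- {k}) (\<lambda>z. (Xs {k} (x, y, z), Ys {k} (x, y, z)))" for x y
      by (rule depends_onI) (auto simp: Xs_def Ys_def)
  qed (use k in \<open>auto simp: Xs_def Ys_def\<close>)
  have "mean P (lg P (\<lambda>(x, y, z). (x k, z k))) = mean P (\<lambda>\<omega>. xl1 k \<omega> + zxl k \<omega>)"
  proof (rule mean_cong)
    fix \<omega> assume w: "\<omega> \<in> set_pmf P"
    obtain x y z where e: "\<omega> = (x, y, z)" by (cases \<omega>)
    show "lg P (\<lambda>(x, y, z). (x k, z k)) \<omega> = xl1 k \<omega> + zxl k \<omega>"
      unfolding lg_def map_XZ[OF k] using pz_pos(2)[OF w[unfolded e] k] pzx_pos[OF w[unfolded e] k]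
      by (simp add: e pmf_bind_map_Pair log_mult xl1_def zxl_def)
  qed
  then have "ent P (\<lambda>(x, y, z). (x k, z k)) = - mean P (xl1 k) - mean P (zxl k)" by (simp add: ent_def mean_add)
  moreover have "ent P (\<lambda>(x, y, z). (x k, z k)) = ent P (\<lambda>\<omega>. (Zs {k} \<omega>, Xs {k} \<omega>))"
    by (rule ent_cong) (auto simp: sample_eq_iffs)
  moreover have "ent P (Xs {k}) = - mean P (xl1 k)" using ent_X[of "{k}"] k by simp
  moreover have "ent P (\<lambda>\<omega>. ((Xs {k} \<omega>, Ys {k} \<omega>), Zs {k} \<omega>)) = ent P (\<lambda>\<omega>. (Zs {k} \<omega>, Ys {k} \<omega>, Xs {k} \<omega>))"
    by (rule ent_cong) auto
  moreover have "ent P (\<lambda>\<omega>. (Xs {k} \<omega>, Ys {k} \<omega>)) = ent P (\<lambda>\<omega>. (Ys {k} \<omega>, Xs {k} \<omega>))"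
    by (rule ent_cong) auto
  ultimately have "cmi P (Zs {k}) (Ys {k}) (Xs {k}) = qrate k"
    using 1 by (subst cmi_eq) (simp_all add: qrate_def)
  then show ?thesis using cmi_nonneg[of P "Zs {k}" "Ys {k}" "Xs {k}"] by simp
qed

end

context random_code begin

text \<open>For a wrong message the slack \<open>\<tau>\<close> is spent in quarters: excess rate of
  the short messages, deviation allowed by the test, excess quantization rates
  \<open>q * \<rho>\<close>, and the exponent that remains. In \<open>bb3\<close> the union bound
  consumes half of the tail exponent \<open>ct\<close>.\<close>

lemma error_exponents:
  fixes q :: real
  assumes \<tau>: "0 < \<tau>" and \<rho>: "0 < \<rho>"
    and Lb: "\<And>k. k \<in> Q \<Longrightarrow> 2 powr (real N * (qrate k + \<rho>)) \<le> real (L k)" "\<And>k. k \<in> Q \<Longrightarrow> real (L k) \<le> 2 * 2 powr (real N * (qrate k + \<rho>))"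
    and msgb: "real msg \<le> 2 * 2 powr (real N * (R + \<tau> / 4))"
    and dqb: "\<And>k. k \<in> Q \<Longrightarrow> dq * qdev k \<le> \<rho> / 2"
    and DA: "\<And>S. S \<subseteq> Q \<Longrightarrow> R + \<tau> \<le> pass_exp A S - (\<Sum>k\<in>S. qrate k)"
    and D0: "\<And>S. S \<subseteq> Q \<Longrightarrow> S \<noteq> {} \<Longrightarrow> \<tau> \<le> pass_exp {} S - (\<Sum>k\<in>S. qrate k)"
    and CCb: "\<And>S. S \<subseteq> Q \<Longrightarrow> dd * pass_dev A S \<le> \<tau> / 4" "\<And>S. S \<subseteq> Q \<Longrightarrow> dd * pass_dev {} S \<le> \<tau> / 4"
    and q: "q = real (card Q)" and q\<rho>: "q * \<rho> \<le> \<tau> / 4"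
    and tails: "tailp N dd PXY \<le> Ct * exp (- ct * real N)" "tailp N dd TL \<le> Ct * exp (- ct * real N)"
      "\<And>k. k \<in> Q \<Longrightarrow> tailp N dq (PXYZ k) \<le> Cq * exp (- cq * real N)"
    and c\<rho>: "q * (3 / 2 * \<rho>) * ln 2 \<le> ct / 2"
  shows "tailp N dd PXY + bb2 + bb3 + bb4
    \<le> Ct * exp (- ct * real N) + q * (2 * (Cq * exp (- cq * real N)) + 2 * 2 powr (- real N * (\<rho> / 2)))
      + 2 ^ card Q * Ct * exp (- (ct / 2) * real N) + 2 * (2 ^ card Q * 2 ^ card Q) * (2 powr (- real N * (\<tau> / 4)) + 2 powr (- real N * (\<tau> / 4)))"
proof -
  have finS: "finite S" "card S \<le> card Q" if "S \<subseteq> Q" for S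
    using that by (auto intro: finite_subset card_mono)
  have prodL: "(\<Prod>k\<in>S. real (L k)) \<le> 2 ^ card Q * 2 powr (real N * ((\<Sum>k\<in>S. qrate k) + q * \<rho>))" if S: "S \<subseteq> Q" for S
  proof -
    have "(\<Prod>k\<in>S. real (L k)) \<le> (\<Prod>k\<in>S. 2 * 2 powr (real N * (qrate k + \<rho>)))"
      by (rule prod_mono) (use Lb(2) S in auto)
    also have "\<dots> = 2 ^ card S * 2 powr (\<Sum>k\<in>S. real N * (qrate k + \<rho>))"
      by (simp add: prod.distrib powr_sum finS[OF S])
    also have "(\<Sum>k\<in>S. real N * (qrate k + \<rho>)) = real N * ((\<Sum>k\<in>S. qrate k) + real (card S) * \<rho>)"
      by (simp add: sum_distrib_left[symmetric] sum.distrib)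
    also have "2 ^ card S * 2 powr \<dots> \<le> 2 ^ card Q * 2 powr (real N * ((\<Sum>k\<in>S. qrate k) + q * \<rho>))"
      using finS[OF S] \<rho> by (intro mult_mono power_increasing powr_mono mult_left_mono add_left_mono mult_right_mono) (auto simp: q)
    finally show ?thesis .
  qed
  have tail0: "0 \<le> tailp N dd TL" by (simp add: tailp_def)
  have "bb2 \<le> (\<Sum>k\<in>Q. 2 * (Cq * exp (- cq * real N)) + 2 * 2 powr (- real N * (\<rho> / 2)))"
    unfolding bb2_def
  proof (rule sum_mono)
    fix k assume k: "k \<in> Q"
    let ?x = "2 powr (real N * (\<rho> / 2)) / 2"
    \<comment> \<open>The deviation uses at most half of the excess rate \<open>\<rho>\<close>, so
      the codebook exceeds the inverse success probability by an exponential factor.\<close>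
    have "real N * (qrate k + \<rho>) \<ge> real N * (\<rho> / 2) + real N * (qrate k + dq * qdev k)"
      unfolding distrib_left[symmetric] using dqb[OF k] by (intro mult_left_mono) auto
    then have "2 powr (real N * (\<rho> / 2)) * 2 powr (real N * (qrate k + dq * qdev k)) \<le> real (L k)"
      using Lb(1)[OF k] by (simp add: powr_add[symmetric]) (meson order_trans powr_mono one_le_numeral)
    then have "?x \<le> real (L k) / (2 * 2 powr (real N * (qrate k + dq * qdev k)))" by (simp add: field_simps)
    then have "exp (- (real (L k) / (2 * 2 powr (real N * (qrate k + dq * qdev k))))) \<le> exp (- ?x)" by simp
    also have "\<dots> \<le> 1 / ?x" by (rule exp_minus_le) simp
    also have "\<dots> = 2 * 2 powr (- real N * (\<rho> / 2))" by (simp add: powr_minus field_simps)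
    finally show "2 * tailp N dq (PXYZ k) + exp (- (real (L k) / (2 * 2 powr (real N * (qrate k + dq * qdev k)))))
        \<le> 2 * (Cq * exp (- cq * real N)) + 2 * 2 powr (- real N * (\<rho> / 2))"
      using tails(3)[OF k] by linarith
  qed
  then have 2: "bb2 \<le> q * (2 * (Cq * exp (- cq * real N)) + 2 * 2 powr (- real N * (\<rho> / 2)))" by (simp add: q)
  have 3: "bb3 \<le> 2 ^ card Q * Ct * exp (- (ct / 2) * real N)"
  proof -
    have "(\<Prod>k\<in>Q. real (L k)) * (\<Prod>k\<in>Q. 2 powr (- real N * (qrate k - dq * qdev k)))
      = (\<Prod>k\<in>Q. real (L k) * 2 powr (- real N * (qrate k - dq * qdev k)))" by (simp add: prod.distrib)
    \<comment> \<open>After \<open>qrate k\<close> has cancelled, each relay contributes the excess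
      rate \<open>\<rho>\<close> and a deviation of at most \<open>\<rho> / 2\<close>; the factor 2
      comes from rounding \<open>L k\<close> up.\<close>
    also have "\<dots> \<le> (\<Prod>k\<in>Q. 2 * 2 powr (real N * (3 / 2 * \<rho>)))"
    proof (rule prod_mono)
      fix k assume k: "k \<in> Q"
      have "real (L k) * 2 powr (- real N * (qrate k - dq * qdev k)) \<le> 2 * 2 powr (real N * (qrate k + \<rho>)) * 2 powr (- real N * (qrate k - dq * qdev k))"
        by (intro mult_right_mono Lb(2)[OF k]) auto
      also have "\<dots> = 2 * 2 powr (real N * (\<rho> + dq * qdev k))"
        by (simp add: powr_add[symmetric] algebra_simps)
      also have "\<dots> \<le> 2 * 2 powr (real N * (3 / 2 * \<rho>))"
        using dqb[OF k] by (intro mult_left_mono powr_mono) auto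
      finally show "0 \<le> real (L k) * 2 powr (- real N * (qrate k - dq * qdev k)) \<and>
        real (L k) * 2 powr (- real N * (qrate k - dq * qdev k)) \<le> 2 * 2 powr (real N * (3 / 2 * \<rho>))" by simp
    qed
    also have "\<dots> = 2 ^ card Q * 2 powr (real N * (q * (3 / 2 * \<rho>)))"
      by (simp add: power_mult_distrib powr_power q mult.left_commute)
    also have "2 powr (real N * (q * (3 / 2 * \<rho>))) = exp (real N * (q * (3 / 2 * \<rho>) * ln 2))"
      by (simp add: powr_def)
    also have "2 ^ card Q * \<dots> \<le> 2 ^ card Q * exp (real N * (ct / 2))"
      using c\<rho> by (intro mult_left_mono[OF iffD2[OF exp_le_cancel_iff mult_left_mono]]) auto
    finally have pr: "(\<Prod>k\<in>Q. real (L k)) * (\<Prod>k\<in>Q. 2 powr (- real N * (qrate k - dq * qdev k)))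
      \<le> 2 ^ card Q * exp (real N * (ct / 2))" .
    have "bb3 = (\<Prod>k\<in>Q. real (L k)) * (\<Prod>k\<in>Q. 2 powr (- real N * (qrate k - dq * qdev k))) * tailp N dd TL"
      by (simp only: bb3_def mult.assoc)
    also have "\<dots> \<le> 2 ^ card Q * exp (real N * (ct / 2)) * (Ct * exp (- ct * real N))"
      by (rule mult_mono[OF pr tails(2) _ tail0]) simp
    finally have "bb3 \<le> 2 ^ card Q * exp (real N * (ct / 2)) * (Ct * exp (- ct * real N))" .
    also have "2 ^ card Q * exp (real N * (ct / 2)) * (Ct * exp (- ct * real N)) = 2 ^ card Q * Ct * (exp (real N * (ct / 2)) * exp (- ct * real N))" by (simp only: mult_ac)
    also have "exp (real N * (ct / 2)) * exp (- ct * real N) = exp (- (ct / 2) * real N)"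
      by (simp add: exp_add[symmetric] field_simps)
    finally show ?thesis .
  qed
  have card_Pow: "real (card (Pow Q)) = 2 ^ card Q" by (simp add: card_Pow)
  have "(\<Sum>S\<in>Pow Q - {{}}. (\<Prod>k\<in>S. real (L k)) * 2 powr (- real N * (pass_exp {} S - dd * pass_dev {} S)))
    \<le> (\<Sum>S\<in>Pow Q - {{}}. 2 ^ card Q * 2 powr (- real N * (\<tau> / 4)))"
  proof (rule sum_mono)
    fix S assume "S \<in> Pow Q - {{}}"
    then have S: "S \<subseteq> Q" "S \<noteq> {}" by auto
    have "(\<Prod>k\<in>S. real (L k)) * 2 powr (- real N * (pass_exp {} S - dd * pass_dev {} S))
      \<le> 2 ^ card Q * 2 powr (real N * ((\<Sum>k\<in>S. qrate k) + q * \<rho>)) * 2 powr (- real N * (pass_exp {} S - dd * pass_dev {} S))"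
      by (intro mult_right_mono prodL[OF S(1)]) simp
    also have "\<dots> = 2 ^ card Q * 2 powr (real N * ((\<Sum>k\<in>S. qrate k) + q * \<rho> - pass_exp {} S + dd * pass_dev {} S))"
      by (simp add: powr_add[symmetric] algebra_simps)
    also have "\<dots> \<le> 2 ^ card Q * 2 powr (real N * (- \<tau> / 4))"
      using D0[OF S] CCb(2)[OF S(1)] q\<rho> \<tau> by (intro mult_left_mono powr_mono) auto
    finally show "(\<Prod>k\<in>S. real (L k)) * 2 powr (- real N * (pass_exp {} S - dd * pass_dev {} S)) \<le> 2 ^ card Q * 2 powr (- real N * (\<tau> / 4))" by simp
  qed
  also have "\<dots> \<le> (\<Sum>S\<in>Pow Q. 2 ^ card Q * 2 powr (- real N * (\<tau> / 4)))"
    by (rule sum_mono2) auto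
  also have "\<dots> = 2 ^ card Q * 2 ^ card Q * 2 powr (- real N * (\<tau> / 4))" by (simp add: card_Pow)
  also have "\<dots> \<le> 2 * (2 ^ card Q * 2 ^ card Q) * 2 powr (- real N * (\<tau> / 4))" by (intro mult_right_mono) auto
  finally have 4: "(\<Sum>S\<in>Pow Q - {{}}. (\<Prod>k\<in>S. real (L k)) * 2 powr (- real N * (pass_exp {} S - dd * pass_dev {} S)))
    \<le> 2 * (2 ^ card Q * 2 ^ card Q) * 2 powr (- real N * (\<tau> / 4))" .
  have "(\<Sum>S\<in>Pow Q. real msg * (\<Prod>k\<in>S. real (L k)) * 2 powr (- real N * (pass_exp A S - dd * pass_dev A S)))
    \<le> (\<Sum>S\<in>Pow Q. 2 * 2 ^ card Q * 2 powr (- real N * (\<tau> / 4)))"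
  proof (rule sum_mono)
    fix S assume "S \<in> Pow Q"
    then have S: "S \<subseteq> Q" by auto
    have "real msg * (\<Prod>k\<in>S. real (L k)) * 2 powr (- real N * (pass_exp A S - dd * pass_dev A S))
      \<le> (2 * 2 powr (real N * (R + \<tau> / 4))) * (2 ^ card Q * 2 powr (real N * ((\<Sum>k\<in>S. qrate k) + q * \<rho>))) * 2 powr (- real N * (pass_exp A S - dd * pass_dev A S))"
      by (intro mult_right_mono mult_mono prodL[OF S] msgb) (auto intro: prod_nonneg)
    also have "\<dots> = 2 * 2 ^ card Q * 2 powr (real N * (R + \<tau> / 4 + ((\<Sum>k\<in>S. qrate k) + q * \<rho>) - pass_exp A S + dd * pass_dev A S))"
      by (simp add: powr_add[symmetric] algebra_simps)
    also have "\<dots> \<le> 2 * 2 ^ card Q * 2 powr (real N * (- \<tau> / 4))"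
      using DA[OF S] CCb(1)[OF S] q\<rho> \<tau> by (intro mult_left_mono powr_mono) auto
    finally show "real msg * (\<Prod>k\<in>S. real (L k)) * 2 powr (- real N * (pass_exp A S - dd * pass_dev A S)) \<le> 2 * 2 ^ card Q * 2 powr (- real N * (\<tau> / 4))" by simp
  qed
  also have "\<dots> = 2 * (2 ^ card Q * 2 ^ card Q) * 2 powr (- real N * (\<tau> / 4))" by (simp add: card_Pow)
  finally have "bb4 \<le> 2 * (2 ^ card Q * 2 ^ card Q) * (2 powr (- real N * (\<tau> / 4)) + 2 powr (- real N * (\<tau> / 4)))"
    unfolding bb4_def distrib_left using 4 by linarith
  then show ?thesis using tails(1) 2 3 by linarith
qed

end

lemma typical_tail_family:
  assumes "finite I" "\<And>i. i \<in> I \<Longrightarrow> finite (set_pmf (p i))" "\<delta> > 0"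
  shows "\<exists>c>0. \<exists>C>0. \<forall>i\<in>I. \<forall>N. tailp N \<delta> (p i) \<le> C * exp (- c * real N)"
  using assms(1,2)
proof (induction I)
  case empty
  show ?case by (rule exI[of _ 1], simp, rule exI[of _ 1], simp)
next
  case (insert i I)
  obtain c C where 1: "c > 0" "C > 0" "\<And>i N. i \<in> I \<Longrightarrow> tailp N \<delta> (p i) \<le> C * exp (- c * real N)"
    using insert.IH insert.prems by blast
  obtain c' C' where 2: "c' > 0" "C' > 0" "\<And>N. tailp N \<delta> (p i) \<le> C' * exp (- c' * real N)"
    using typical_tail[of "p i" \<delta>] insert.prems assms(3) unfolding tailp_def by blast
  have "C * exp (- c * real N) \<le> max C C' * exp (- min c c' * real N)" "C' * exp (- c' * real N) \<le> max C C' * exp (- min c c' * real N)" for N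
    using 1 2 by (auto intro!: mult_mono mult_right_mono)
  then have "\<forall>j\<in>insert i I. \<forall>N. tailp N \<delta> (p j) \<le> max C C' * exp (- min c c' * real N)"
    using order_trans[OF 1(3)] order_trans[OF 2(3)] by blast
  moreover have "min c c' > 0" "max C C' > 0" using 1 2 by auto
  ultimately show ?case by blast
qed

lemma nat_ceiling_bounds:
  assumes "1 \<le> (x :: real)"
  shows "x \<le> real (nat \<lceil>x\<rceil>)" "real (nat \<lceil>x\<rceil>) \<le> 2 * x" "1 \<le> nat \<lceil>x\<rceil>"
proof -
  have "real (nat \<lceil>x\<rceil>) = of_int \<lceil>x\<rceil>" using assms by simp
  then show "x \<le> real (nat \<lceil>x\<rceil>)" "real (nat \<lceil>x\<rceil>) \<le> 2 * x" using assms ceiling_correct[of x] by linarith+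
  then show "1 \<le> nat \<lceil>x\<rceil>" using assms by linarith
qed

context relay_law begin

lemma num_messages_pos: "1 \<le> num_messages n R"
proof -
  have "0 < \<lceil>2 powr (real n * R)\<rceil>" by (simp add: zero_less_ceiling)
  then show ?thesis unfolding num_messages_def by linarith
qed

text \<open>For such rates there is a single message, and the decoder can only answer
  \<open>1\<close>. What remains is to exhibit a valid scheme with sufficiently many blocks.\<close>

lemma achievable_nonpos:
  assumes "R \<le> 0"
  shows "snnc_df_achievable Ch \<pi> K1 Z P R"
  unfolding snnc_df_achievable_def achievable_within_def
proof (intro allI impI)
  fix \<epsilon> :: real and n0 :: nat assume \<epsilon>: "\<epsilon> > 0"
  define b where "b = max 1 (max n0 (nat \<lceil>1 / \<epsilon>\<rceil>))"
  have b: "1 \<le> b" "n0 \<le> b" "1 \<le> \<epsilon> * real b"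
  proof -
    have "1 / \<epsilon> \<le> real b" unfolding b_def by linarith
    then show "1 \<le> \<epsilon> * real b" using \<epsilon> by (simp add: field_simps)
  qed (simp_all add: b_def)
  obtain x where x: "x \<in> XX" using exists_XX by blast
  \<comment> \<open>Blocks of length 1, one short message, one index per relay, empty
    \<open>Q\<close> and an empty final phase; the \<open>b\<close> messages meet the demands of
    accuracy \<open>\<epsilon>\<close> and length \<open>n0\<close>.\<close>
  interpret s: snnc Ch \<pi> K1 Z P p1 px pz 1 b 1 "\<lambda>_. 1" "{}" \<epsilon> \<epsilon> 1 "\<lambda>_ _. 1" 1 0 "\<lambda>k _ _. x k" "\<lambda>_ _. 1"
    by unfold_locales (use b(1) \<epsilon> x in \<open>auto simp: strat_def\<close>)
  obtain \<omega> where \<omega>: "\<omega> \<in> set_pmf s.\<Omega>" using set_pmf_not_empty[of s.\<Omega>] by blast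
  define S n where "S = s.scheme_of \<omega>" and "n = s.B"
  let ?s = S and ?n = n
  have v: "valid_scheme Ch \<pi> K1 Z 1 ?s" unfolding S_def by (rule s.valid_mk[OF \<omega>])
  have S: "n = main_length K1 S + xl S" "scheme.nb S = b" "scheme.dq S = \<epsilon>" "scheme.dd S = \<epsilon>" "xl S = 0"
    unfolding S_def n_def s.scheme_of_simps s.scheme_of_blocks by simp_all
  have B: "b \<le> n" using K1 by (simp add: n_def s.B_def)
  have M: "num_messages ?n R = 1"
  proof -
    have "2 powr (real ?n * R) \<le> 2 powr 0" using assms by (intro powr_mono mult_nonneg_nonpos) auto
    then have "num_messages ?n R \<le> 1" unfolding num_messages_def by (simp add: ceiling_le_one)
    then show ?thesis using num_messages_pos[of ?n R] by simp
  qed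
  have dec: "snnc_dec Ch \<pi> K1 {} P 1 ?s ys = 1" for ys
    by (auto simp: snnc_dec_def Let_def)
  have "error_prob Ch ?n 1 (snnc_code 1 {} ?s) \<le> 0"
    unfolding error_prob_def
  proof (rule prob_bind_pmf_le)
    fix w assume "w \<in> set_pmf (pmf_of_set {1..1 :: nat})"
    then have "w = 1" by simp
    have "(\<lambda>ys. (w, dec (snnc_code 1 {} ?s) (at_dest ys))) -` {(w, v). v \<noteq> w} = {}"
      unfolding code.simps dec \<open>w = 1\<close> by simp
    then show "measure_pmf.prob (map_pmf (\<lambda>ys. (w, dec (snnc_code 1 {} ?s) (at_dest ys))) (outputs Ch (snnc_code 1 {} ?s) w ?n)) {(w, v). v \<noteq> w} \<le> 0"
      by (simp only: measure_map_pmf measure_empty order_refl)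
  qed
  then have "error_prob Ch ?n 1 (snnc_code 1 {} ?s) \<le> \<epsilon>" using \<epsilon> by linarith
  moreover have "snnc_df_code Ch \<pi> K1 Z P \<epsilon> ?n 1 (snnc_code 1 {} ?s)"
    unfolding snnc_df_code_def using v b \<epsilon> S by (intro exI[of _ ?s] exI[of _ "{}"]) auto
  ultimately show "\<exists>n\<ge>n0. \<exists>f. is_code Ch n (num_messages n R) f \<and> snnc_df_code Ch \<pi> K1 Z P \<epsilon> n (num_messages n R) f
      \<and> error_prob Ch n (num_messages n R) f \<le> \<epsilon>"
    using valid_is_code[OF v, of ?n "{}"] order.trans[OF b(2) B] unfolding M[symmetric] by blast
qed

text \<open>The order of choices matters: the slack \<open>\<tau>\<close> depends on the joint law
  and \<open>R\<close> only; then come the tolerance \<open>dd\<close>, the tail exponent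
  \<open>ct\<close> that it yields, the excess rate \<open>\<rho>\<close>, the tolerance
  \<open>dq\<close>, and finally the block length \<open>N\<close>.\<close>

lemma achievable_pos:
  assumes R: "0 < R"
    and df: "\<And>m. m \<in> {2..K1} \<Longrightarrow> R < (\<Sum>i\<in>{1..<m}. mean P (ylog m i))"
    and qf: "\<And>S. S \<subseteq> T2 \<Longrightarrow> R < ent P (Xs A) + FB (T2 - S) - FA T2"
  shows "snnc_df_achievable Ch \<pi> K1 Z P R"
proof -
  obtain Q where Q: "Q \<subseteq> T2" and QA: "\<And>U. U \<subseteq> Q \<Longrightarrow> R < ent P (Xs A) + FB U - FA Q"
    and Q0: "\<And>U. U \<subset> Q \<Longrightarrow> FA Q < FA U"
    using exists_Q[OF qf] by blast
  have finQ: "finite Q" using Q by (rule finite_subset) simp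
  have infl: "influences S (insert K (Q - S))" if S: "S \<subseteq> Q" "S \<noteq> {}" for S
  proof (rule ccontr)
    assume "\<not> ?thesis"
    then have "FA (Q - S) \<le> FA Q" by (rule FA_unreachable[OF S(1) Q])
    moreover have "FA Q < FA (Q - S)" by (rule Q0) (use S in blast)
    ultimately show False by simp
  qed
  \<comment> \<open>An instance with dummy sizes, for access to \<open>TL\<close>,
    \<open>pass_dev\<close>, \<open>qdev\<close> and the identities for \<open>pass_exp\<close>,
    which do not involve block length or codebook sizes.\<close>
  interpret rc: random_code Ch \<pi> K1 Z P p1 px pz 1 1 1 "\<lambda>_. 1" Q 1 1
    by unfold_locales (use Q in auto)
  define sl where "sl = (\<lambda>U. ent P (Xs A) + FB U - FA Q - R) ` Pow Q \<union> (\<lambda>U. FA U - FA Q) ` (Pow Q - {Q})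
    \<union> (\<lambda>m. (\<Sum>i\<in>{1..<m}. mean P (ylog m i)) - R) ` {2..K1}"
  \<comment> \<open>There are finitely many strict inequalities, so one slack serves all of them;
    the inserted \<open>1\<close> makes the set visibly nonempty.\<close>
  define \<tau> where "\<tau> = Min (insert 1 sl)"
  have finsl: "finite (insert 1 sl)" using finQ by (simp add: sl_def)
  have "FA Q < FA U" if "U \<subseteq> Q" "U \<noteq> Q" for U using that by (intro Q0) blast
  then have "\<forall>x\<in>sl. 0 < x" unfolding sl_def ball_Un Set.ball_simps(9)
    by (intro conjI ballI) (simp_all add: QA df[simplified])
  then have "\<forall>x\<in>insert 1 sl. 0 < x" by simp
  then have \<tau>: "0 < \<tau>" unfolding \<tau>_def using finsl by (subst Min_gr_iff) auto
  have \<tau>_le: "\<tau> \<le> x" if "x \<in> sl" for x unfolding \<tau>_def using finsl that by (intro Min_le) auto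
  have \<tau>A: "R + \<tau> \<le> ent P (Xs A) + FB U - FA Q" if "U \<subseteq> Q" for U
    using \<tau>_le[of "ent P (Xs A) + FB U - FA Q - R"] that by (force simp: sl_def)
  have \<tau>0: "\<tau> \<le> FA U - FA Q" if "U \<subset> Q" for U
    using that by (intro \<tau>_le) (auto simp: sl_def)
  have \<tau>D: "R + \<tau> \<le> (\<Sum>i\<in>{1..<m}. mean P (ylog m i))" if "m \<in> {2..K1}" for m
    using \<tau>_le[of "(\<Sum>i\<in>{1..<m}. mean P (ylog m i)) - R"] that by (force simp: sl_def)
  define Y where "Y m = (\<Sum>i\<in>{1..<m}. mean P (\<lambda>\<omega>. \<bar>ylog m i \<omega>\<bar>))" for m
  \<comment> \<open>A common bound for all deviations that get multiplied by \<open>dd\<close>; the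
    summand \<open>1\<close> allows division by it.\<close>
  define X where "X = 1 + (\<Sum>S\<in>Pow Q. rc.pass_dev A S) + (\<Sum>S\<in>Pow Q. rc.pass_dev {} S) + (\<Sum>m\<in>{2..K1}. Y m)"
  have CC0: "0 \<le> rc.pass_dev F S" for F S unfolding rc.pass_dev_def by (rule mean_nonneg) simp
  have Y0: "0 \<le> Y m" for m unfolding Y_def by (intro sum_nonneg mean_nonneg) simp
  have pos: "0 \<le> (\<Sum>S\<in>Pow Q. rc.pass_dev A S)" "0 \<le> (\<Sum>S\<in>Pow Q. rc.pass_dev {} S)" "0 \<le> (\<Sum>m\<in>{2..K1}. Y m)"
    by (intro sum_nonneg CC0 Y0)+
  have X1: "1 \<le> X" unfolding X_def using pos by linarith
  have XCC: "rc.pass_dev A S \<le> X" "rc.pass_dev {} S \<le> X" if "S \<subseteq> Q" for S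
    using member_le_sum[of S "Pow Q" "rc.pass_dev A"] member_le_sum[of S "Pow Q" "rc.pass_dev {}"] that finQ CC0 pos
    unfolding X_def by auto
  have XY: "Y m \<le> X" if "m \<in> {2..K1}" for m
    using member_le_sum[of m "{2..K1}" Y] that Y0 pos unfolding X_def by auto
  define q where "q = real (card Q)"
  have q0: "0 \<le> q" by (simp add: q_def)
  have conv: "\<And>k. k \<in> Q \<Longrightarrow> conveys k" by (rule conveys_all[OF Q infl])
  \<comment> \<open>Bits per index and unit of block length: rounding the codebook size up costs at
    most one bit, \<open>\<rho> \<le> \<tau>\<close>, and a further unit makes the bound on
    \<open>L k\<close> strict.\<close>
  define b where "b = 2 + nat \<lceil>(\<Sum>k\<in>Q. qrate k) + \<tau>\<rceil>"
  obtain C e where fp: "\<forall>N\<ge>1. \<forall>L :: nat \<Rightarrow> nat. (\<forall>k\<in>Q. 1 \<le> L k \<and> L k < 2 ^ (b * N)) \<longrightarrow>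
      (\<exists>d \<sigma> g. real d \<le> real (C * N ^ e) \<and> strat \<sigma> \<and> (\<forall>k\<in>Q. \<forall>ys. g k ys \<in> {1..L k}) \<and>
      (\<forall>l. (\<forall>k\<in>Q. l k \<in> {1..L k}) \<longrightarrow>
        measure_pmf.prob (proc (act \<sigma> l) d) {ys. \<exists>k\<in>Q. g k (at_dest ys) \<noteq> l k} \<le> real C / real N))"
    by (rule exE[OF final_phase[OF Q conv, where b=b]]) (assumption | erule exE | rule that)+
  show ?thesis
    unfolding snnc_df_achievable_def achievable_within_def
  proof (intro allI impI)
    fix \<epsilon> :: real and n0 :: nat assume \<epsilon>: "\<epsilon> > 0"
    define dd where "dd = min \<epsilon> (\<tau> / (4 * X))"
    have dd: "0 < dd" "dd \<le> \<epsilon>" using \<epsilon> \<tau> X1 by (auto simp: dd_def)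
    have ddX: "dd * x \<le> \<tau> / 4" if "x \<le> X" for x
    proof -
      have "dd * x \<le> dd * X" using that dd by (intro mult_left_mono) auto
      also have "\<dots> \<le> \<tau> / (4 * X) * X" using X1 by (intro mult_right_mono) (auto simp: dd_def)
      finally show ?thesis using X1 by simp
    qed
    obtain c1 C1 where t1: "c1 > 0" "C1 > 0" "\<And>N. tailp N dd PXY \<le> C1 * exp (- c1 * real N)"
      using typical_tail[of PXY dd] dd unfolding tailp_def by auto
    obtain c2 C2 where t2: "c2 > 0" "C2 > 0" "\<And>N. tailp N dd rc.TL \<le> C2 * exp (- c2 * real N)"
      using typical_tail[of rc.TL dd] dd unfolding tailp_def by auto
    define ct Ct where "ct = min c1 c2" "Ct = max C1 C2"
    have ct: "0 < ct" "0 < Ct" using t1 t2 by (auto simp: ct_Ct_def)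
    have "C1 * exp (- c1 * real N) \<le> Ct * exp (- ct * real N)" "C2 * exp (- c2 * real N) \<le> Ct * exp (- ct * real N)" for N
      using t1 t2 by (auto simp: ct_Ct_def intro!: mult_mono mult_right_mono)
    then have tt: "tailp N dd PXY \<le> Ct * exp (- ct * real N)" "tailp N dd rc.TL \<le> Ct * exp (- ct * real N)" for N
      using t1(3) t2(3) by (blast intro: order_trans)+
    \<comment> \<open>Small against \<open>\<tau>\<close> for the wrong hypotheses and against
      \<open>ct\<close> for the union bound in \<open>bb3\<close>; \<open>q + 1\<close> avoids a
      division by zero for empty \<open>Q\<close>.\<close>
    define \<rho> where "\<rho> = min \<tau> ct / (4 * (q + 1))"
    have \<rho>: "0 < \<rho>" using \<tau> ct q0 by (auto simp: \<rho>_def)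
    have \<rho>4: "(q + 1) * \<rho> = min \<tau> ct / 4" using q0 by (simp add: \<rho>_def field_simps)
    have q\<rho>: "q * \<rho> \<le> \<tau> / 4" "\<rho> \<le> \<tau>" "q * \<rho> \<le> ct / 4"
    proof -
      have "q * \<rho> + \<rho> = min \<tau> ct / 4" "0 \<le> q * \<rho>" using \<rho>4 q0 \<rho> by (auto simp: algebra_simps)
      then show "q * \<rho> \<le> \<tau> / 4" "\<rho> \<le> \<tau>" "q * \<rho> \<le> ct / 4" using \<rho> \<tau> by linarith+
    qed
    have c\<rho>: "q * (3 / 2 * \<rho>) * ln 2 \<le> ct / 2"
    proof -
      have "ln 2 \<le> (1 :: real)" using ln_le_minus_one[of 2] by simp
      then have "q * (3 / 2 * \<rho>) * ln 2 \<le> q * (3 / 2 * \<rho>) * 1" using q0 \<rho> by (intro mult_left_mono) auto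
      also have "\<dots> = 3 / 2 * (q * \<rho>)" by simp
      finally show ?thesis using q\<rho>(3) ct by linarith
    qed
    define V where "V = 1 + (\<Sum>k\<in>Q. rc.qdev k)"
    have Ck0: "0 \<le> rc.qdev k" for k unfolding rc.qdev_def by (rule mean_nonneg) simp
    then have V1: "1 \<le> V" unfolding V_def by (simp add: sum_nonneg)
    define dq where "dq = min \<epsilon> (\<rho> / (2 * V))"
    have dq: "0 < dq" "dq \<le> \<epsilon>" using \<epsilon> \<rho> V1 by (auto simp: dq_def)
    have dqC: "dq * rc.qdev k \<le> \<rho> / 2" if "k \<in> Q" for k
    proof -
      have "rc.qdev k \<le> V" using member_le_sum[of k Q rc.qdev] that finQ Ck0 unfolding V_def by auto
      then have "dq * rc.qdev k \<le> dq * V" using dq by (intro mult_left_mono) auto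
      also have "\<dots> \<le> \<rho> / (2 * V) * V" using V1 by (intro mult_right_mono) (auto simp: dq_def)
      finally show ?thesis using V1 by simp
    qed
    obtain cq Cq where tq: "cq > 0" "Cq > 0" "\<And>k N. k \<in> Q \<Longrightarrow> tailp N dq (rc.PXYZ k) \<le> Cq * exp (- cq * real N)"
      using typical_tail_family[OF finQ, of rc.PXYZ dq] dq by auto
    define G where "G N = Ct * exp (- ct * real N) + q * (2 * (Cq * exp (- cq * real N)) + 2 * 2 powr (- real N * (\<rho> / 2)))
      + 2 ^ card Q * Ct * exp (- (ct / 2) * real N) + 2 * (2 ^ card Q * 2 ^ card Q) * (2 powr (- real N * (\<tau> / 4)) + 2 powr (- real N * (\<tau> / 4)))" for N
    have G0: "0 \<le> G N" for N unfolding G_def using ct tq q0 by (intro add_nonneg_nonneg mult_nonneg_nonneg) auto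
    \<comment> \<open>The terms stem from the decode-forward relays, the blocks and the final phase;
      \<open>K1 * N ^ Suc e\<close> bounds the number of blocks.\<close>
    define E where "E N = real K1 * real N ^ Suc e * (2 * 2 powr (- real N * (\<tau> / 4))) + real K1 * real N ^ Suc e * G N + real C / real N" for N
    have "E \<longlonglongrightarrow> 0"
    proof -
      define h where "h c N = real N ^ Suc e * exp (- c * real N)" for c N
      have h: "h c \<longlonglongrightarrow> 0" if "0 < c" for c unfolding h_def[abs_def] by (rule poly_exp_tendsto_0[OF that])
      have p: "2 powr (- real N * a) = exp (- (a * ln 2) * real N)" for a N by (simp add: powr_def mult_ac)
      have E: "E = (\<lambda>N. real K1 * (2 * h (\<tau> / 4 * ln 2) N) + real K1 * (Ct * h ct N + q * (2 * (Cq * h cq N) + 2 * h (\<rho> / 2 * ln 2) N)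
        + 2 ^ card Q * Ct * h (ct / 2) N + 2 * (2 ^ card Q * 2 ^ card Q) * (h (\<tau> / 4 * ln 2) N + h (\<tau> / 4 * ln 2) N)) + real C * (1 / real N))"
        unfolding E_def[abs_def] G_def h_def p by (simp add: algebra_simps)
      have "E \<longlonglongrightarrow> real K1 * (2 * 0) + real K1 * (Ct * 0 + q * (2 * (Cq * 0) + 2 * 0)
        + 2 ^ card Q * Ct * 0 + 2 * (2 ^ card Q * 2 ^ card Q) * (0 + 0)) + real C * 0"
        unfolding E using ct tq \<rho> \<tau> by (intro tendsto_intros h lim_1_over_n) auto
      then show ?thesis by simp
    qed
    then have "eventually (\<lambda>N. E N < \<epsilon>) sequentially" using \<epsilon> by (rule order_tendstoD)
    \<comment> \<open>The three summands of the lower bound on \<open>N\<close> control the rate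
      lost to flushing and the final phase, the share of the final phase in the length, and the
      number of short messages.\<close>
    then have "eventually (\<lambda>N. E N < \<epsilon> \<and> max 1 (max n0 (nat \<lceil>(real K1 + real C) * R * 4 / \<tau> + real C / \<epsilon> + 1 / \<epsilon>\<rceil>)) \<le> N) sequentially"
      by (intro eventually_conj eventually_ge_at_top)
    then obtain N where EN: "E N < \<epsilon>" and N: "1 \<le> N" "n0 \<le> N"
      and N': "(real K1 + real C) * R * 4 / \<tau> + real C / \<epsilon> + 1 / \<epsilon> \<le> real N"
      unfolding eventually_sequentially by (metis max.bounded_iff order_refl nat_ceiling_le_eq)
    \<comment> \<open>One power of \<open>N\<close> more than the length of the final phase.\<close>
    define nb where "nb = N ^ Suc e"
    define msg where "msg = nat \<lceil>2 powr (real N * (R + \<tau> / 4))\<rceil>"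
    define L where "L k = (if k \<in> Q then nat \<lceil>2 powr (real N * (qrate k + \<rho>))\<rceil> else 1)" for k
    \<comment> \<open>Above the rate \<open>R + \<tau> / 4\<close> of the wrong short messages and
      below the exponent \<open>R + 3 * \<tau> / 4\<close> that the true message attains.\<close>
    define \<theta> where "\<theta> = 2 powr (real N * (R + \<tau> / 2))"
    have nb: "1 \<le> nb" "N \<le> nb" using N(1) by (auto simp: nb_def)
    have "1 \<le> 2 powr (real N * (R + \<tau> / 4))" using R \<tau> by (intro ge_one_powr_ge_zero) auto
    note msg = nat_ceiling_bounds[OF this, folded msg_def]
    have "1 \<le> 2 powr (real N * (qrate k + \<rho>))" if "k \<in> Q" for k
      using qrate_nonneg[of k] Q that \<rho> by (intro ge_one_powr_ge_zero mult_nonneg_nonneg) auto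
    note Lb = nat_ceiling_bounds[OF this]
    have L1: "1 \<le> L k" for k using Lb(3)[of k] by (simp add: L_def)
    have LQ: "2 powr (real N * (qrate k + \<rho>)) \<le> real (L k)" "real (L k) \<le> 2 * 2 powr (real N * (qrate k + \<rho>))" if "k \<in> Q" for k
      using Lb(1,2)[OF that] that by (simp_all add: L_def)
    have Lbits: "1 \<le> L k \<and> L k < 2 ^ (b * N)" if k: "k \<in> Q" for k
    proof -
      have "qrate k \<le> (\<Sum>k\<in>Q. qrate k)" using k finQ Q qrate_nonneg by (intro member_le_sum) auto
      then have b: "1 + (qrate k + \<rho>) < real b" using q\<rho>(2) unfolding b_def by linarith
      have "real (L k) \<le> 2 powr (1 + real N * (qrate k + \<rho>))" using LQ(2)[OF k] by (simp add: powr_add)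
      also have "\<dots> \<le> 2 powr (real N * (1 + (qrate k + \<rho>)))" using N(1) by (intro powr_mono) (auto simp: distrib_left)
      also have "\<dots> < 2 powr (real N * real b)" using b N(1) by (intro powr_less_mono mult_strict_left_mono) auto
      also have "\<dots> = real (2 ^ (b * N))" by (simp add: powr_realpow[symmetric] mult.commute)
      finally show ?thesis using L1[of k] by (simp only: of_nat_less_iff)
    qed
    obtain d \<sigma> g where d: "real d \<le> real (C * N ^ e)" and \<sigma>: "strat \<sigma>" and g: "\<And>k ys. k \<in> Q \<Longrightarrow> g k ys \<in> {1..L k}"
      and fin: "\<And>l. (\<And>k. k \<in> Q \<Longrightarrow> l k \<in> {1..L k}) \<Longrightarrow>
        measure_pmf.prob (proc (act \<sigma> l) d) {ys. \<exists>k\<in>Q. g k (at_dest ys) \<noteq> l k} \<le> real C / real N"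
      using fp[rule_format, of N L, OF N(1)] Lbits by blast
    define n where "n = (nb + K1 - 1) * N + d"
    define M where "M = num_messages n R"
    define sp where "sp W j = 1 + ((W - 1) div msg ^ (j - 1)) mod msg" for W j :: nat
    have Nb: "(real K1 + real C) * R \<le> real N * (\<tau> / 4)" "real C \<le> \<epsilon> * real N" "1 \<le> \<epsilon> * real N"
    proof -
      have 0: "0 \<le> (real K1 + real C) * R * 4 / \<tau>" "0 \<le> real C / \<epsilon>" "0 \<le> 1 / \<epsilon>" using R \<tau> \<epsilon> by auto
      have "(real K1 + real C) * R * 4 / \<tau> \<le> real N" using N' 0 by linarith
      then show "(real K1 + real C) * R \<le> real N * (\<tau> / 4)" using \<tau> by (simp add: field_simps)
      have "real C / \<epsilon> \<le> real N" using N' 0 by linarith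
      then show "real C \<le> \<epsilon> * real N" using \<epsilon> by (simp add: field_simps)
      have "1 / \<epsilon> \<le> real N" using N' 0 by linarith
      then show "1 \<le> \<epsilon> * real N" using \<epsilon> by (simp add: field_simps)
    qed
    have nn: "real n \<le> real nb * real N + real K1 * real nb + real C * real nb" "nb * N \<le> n"
    proof -
      have "real (nb + K1 - 1) \<le> real nb + real K1" by linarith
      then have "real (nb + K1 - 1) * real N \<le> (real nb + real K1) * real N" by (intro mult_right_mono) auto
      also have "\<dots> \<le> real nb * real N + real K1 * real nb"
        using nb(2) by (auto simp: distrib_right intro!: mult_left_mono)
      finally have "real (nb + K1 - 1) * real N \<le> real nb * real N + real K1 * real nb" .
      moreover have "real d \<le> real C * real nb"
      proof -
        have "N ^ e \<le> nb" unfolding nb_def using N(1) by (intro power_increasing) auto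
        then have "C * N ^ e \<le> C * nb" by simp
        then have "real (C * N ^ e) \<le> real (C * nb)" by (simp only: of_nat_le_iff)
        with d show ?thesis by simp
      qed
      ultimately show "real n \<le> real nb * real N + real K1 * real nb + real C * real nb"
        unfolding n_def by simp
      have "nb * N \<le> (nb + K1 - 1) * N" using K1 by (intro mult_right_mono) auto
      then show "nb * N \<le> n" unfolding n_def by (rule trans_le_add1)
    qed
    \<comment> \<open>Flushing blocks and the final phase lengthen the code by at most
      \<open>(K1 + C) * nb\<close> uses, which the excess rate \<open>\<tau> / 4\<close> of the
      short messages makes up for.\<close>
    have Mle: "M \<le> msg ^ nb"
    proof -
      have "real n * R \<le> (real nb * real N + (real K1 + real C) * real nb) * R"
        using nn(1) R by (intro mult_right_mono) (auto simp: algebra_simps)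
      also have "\<dots> = real nb * (real N * R + (real K1 + real C) * R)" by (simp add: algebra_simps)
      also have "\<dots> \<le> real nb * (real N * R + real N * (\<tau> / 4))" using Nb(1) by (intro mult_left_mono add_left_mono) auto
      also have "\<dots> = real N * (R + \<tau> / 4) * real nb" by (simp add: algebra_simps)
      finally have "2 powr (real n * R) \<le> 2 powr (real N * (R + \<tau> / 4) * real nb)" by (intro powr_mono) auto
      also have "\<dots> = (2 powr (real N * (R + \<tau> / 4))) ^ nb"
        by (simp add: powr_powr[symmetric] powr_realpow)
      also have "\<dots> \<le> real msg ^ nb" using msg(1) by (intro power_mono) auto
      finally have "2 powr (real n * R) \<le> real (msg ^ nb)" by simp
      then show ?thesis unfolding M_def num_messages_def by (simp add: ceiling_le_iff nat_le_iff)
    qed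
    have sp_msg: "sp W j \<in> {1..msg}" for W j
      using mod_less_divisor[of msg "(W - 1) div msg ^ (j - 1)"] msg(3) by (auto simp: sp_def Suc_le_eq)
    have sp_inj: "inj_on (\<lambda>W. restrict (sp W) {1..nb}) {1..M}"
    proof (rule inj_onI)
      fix W W' assume W: "W \<in> {1..M}" "W' \<in> {1..M}" "restrict (sp W) {1..nb} = restrict (sp W') {1..nb}"
      have "W - 1 = W' - 1"
      proof (rule digits_inject)
        show "W - 1 < msg ^ nb" "W' - 1 < msg ^ nb" using W(1,2) Mle by auto
        fix j assume "j < nb"
        then show "((W - 1) div msg ^ j) mod msg = ((W' - 1) div msg ^ j) mod msg"
          using fun_cong[OF W(3), of "Suc j"] by (simp add: sp_def)
      qed
      then show "W = W'" using W(1,2) by auto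
    qed
    interpret s: snnc Ch \<pi> K1 Z P p1 px pz N nb msg L Q dq dd M sp \<theta> d \<sigma> g
      by unfold_locales (use Q N(1) nb(1) msg(3) L1 dq(1) dd(1) sp_msg sp_inj \<sigma> g in \<open>auto simp: L_def \<theta>_def\<close>)
    have n_eq: "s.B * N + d = n" by (simp add: n_def s.B_def)
    have M1: "1 \<le> M" unfolding M_def by (rule num_messages_pos)
    have \<theta>_le: "\<theta> \<le> 2 powr (real N * (\<Sum>i\<in>{1..<m}. mean P (ylog m i) - dd * mean P (\<lambda>\<omega>. \<bar>ylog m i \<omega>\<bar>)))" if m: "m \<in> {2..K1}" for m
    proof -
      have "(\<Sum>i\<in>{1..<m}. mean P (ylog m i) - dd * mean P (\<lambda>\<omega>. \<bar>ylog m i \<omega>\<bar>)) = (\<Sum>i\<in>{1..<m}. mean P (ylog m i)) - dd * Y m"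
        by (simp add: sum_subtractf sum_distrib_left Y_def)
      then show ?thesis unfolding \<theta>_def using \<tau>D[OF m] ddX[OF XY[OF m]] \<tau> by (intro powr_mono mult_left_mono) auto
    qed
    obtain \<omega> where \<omega>: "\<omega> \<in> set_pmf s.\<Omega>" and err: "error_prob Ch n M (snnc_code M Q (s.scheme_of \<omega>))
        \<le> real (K1 * nb * msg) / \<theta> + real s.B * (tailp N dd PXY + s.bb2 + s.bb3 + s.bb4) + real C / real N"
      using s.exists_codebook[OF M1 \<theta>_le fin] unfolding n_eq by auto
    have "tailp N dd PXY + s.bb2 + s.bb3 + s.bb4 \<le> G N"
      unfolding G_def
    proof (rule s.error_exponents[OF \<tau> \<rho> LQ msg(2) dqC _ _ _ _ q_def q\<rho>(1) tt tq(3) c\<rho>])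
      show "R + \<tau> \<le> rc.pass_exp A S - (\<Sum>k\<in>S. qrate k)" if "S \<subseteq> Q" for S
        using \<tau>A[of "Q - S"] rc.pass_exp_A[OF that] by auto
      show "\<tau> \<le> rc.pass_exp {} S - (\<Sum>k\<in>S. qrate k)" if "S \<subseteq> Q" "S \<noteq> {}" for S
        using \<tau>0[of "Q - S"] rc.pass_exp_empty[OF that(1)] that by auto
    qed (use ddX XCC in auto)
    moreover have "real s.B \<le> real K1 * real N ^ Suc e"
    proof -
      have "s.B \<le> nb + (K1 - 1) * nb"
        using mult_le_mono2[OF nb(1), of "K1 - 1"] K1 unfolding s.B_def by linarith
      also have "\<dots> = K1 * nb" using K1(1) by (cases K1) auto
      finally have "real s.B \<le> real (K1 * nb)" by (simp only: of_nat_le_iff)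
      then show ?thesis by (simp add: nb_def)
    qed
    ultimately have "real s.B * (tailp N dd PXY + s.bb2 + s.bb3 + s.bb4) \<le> real K1 * real N ^ Suc e * G N"
      using G0[of N] by (meson mult_left_mono mult_right_mono of_nat_0_le_iff order_trans)
    moreover have "real (K1 * nb * msg) / \<theta> \<le> real K1 * real N ^ Suc e * (2 * 2 powr (- real N * (\<tau> / 4)))"
    proof -
      have "real msg / \<theta> \<le> 2 * 2 powr (real N * (R + \<tau> / 4)) / \<theta>" using msg(2) by (intro divide_right_mono) (auto simp: \<theta>_def)
      also have "\<dots> = 2 * (2 powr (real N * (R + \<tau> / 4)) / 2 powr (real N * (R + \<tau> / 2)))" by (simp add: \<theta>_def)
      also have "\<dots> = 2 * 2 powr (- real N * (\<tau> / 4))"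
        unfolding powr_diff[symmetric] by (simp add: algebra_simps)
      finally have "real (K1 * nb) * (real msg / \<theta>) \<le> real (K1 * nb) * (2 * 2 powr (- real N * (\<tau> / 4)))" by (intro mult_left_mono) auto
      then show ?thesis by (simp add: nb_def)
    qed
    ultimately have "error_prob Ch n M (snnc_code M Q (s.scheme_of \<omega>)) \<le> E N" using err unfolding E_def by linarith
    then have error: "error_prob Ch n M (snnc_code M Q (s.scheme_of \<omega>)) \<le> \<epsilon>" using EN by linarith
    have v: "valid_scheme Ch \<pi> K1 Z M (s.scheme_of \<omega>)" by (rule s.valid_mk[OF \<omega>])
    have "1 \<le> \<epsilon> * real nb"
      using Nb(3) nb(2) \<epsilon> by (meson mult_left_mono of_nat_mono order_less_imp_le order_trans)
    moreover have "real d \<le> \<epsilon> * real n"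
    proof -
      have "real d \<le> real C * real N ^ e" using d by simp
      also have "\<dots> \<le> \<epsilon> * real N * real N ^ e" using Nb(2) by (intro mult_right_mono) auto
      also have "\<dots> = \<epsilon> * real nb" by (simp add: nb_def)
      also have "\<dots> \<le> \<epsilon> * real n"
      proof -
        have "nb \<le> nb * N" using N(1) by simp
        then have "nb \<le> n" using nn(2) by (rule order.trans)
        then show ?thesis using \<epsilon> by simp
      qed
      finally show ?thesis .
    qed
    moreover have "n = main_length K1 (s.scheme_of \<omega>) + xl (s.scheme_of \<omega>)" by (simp add: n_eq)
    ultimately have "snnc_df_code Ch \<pi> K1 Z P \<epsilon> n M (snnc_code M Q (s.scheme_of \<omega>))"
      unfolding snnc_df_code_def using v Q dq(2) dd(2) by (intro exI[of _ "s.scheme_of \<omega>"] exI[of _ Q]) auto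
    moreover have "n0 \<le> n"
    proof -
      have "N \<le> nb * N" using nb(1) by simp
      then show ?thesis using nn(2) N(2) by linarith
    qed
    ultimately show "\<exists>n\<ge>n0. \<exists>f. is_code Ch n (num_messages n R) f \<and> snnc_df_code Ch \<pi> K1 Z P \<epsilon> n (num_messages n R) f
      \<and> error_prob Ch n (num_messages n R) f \<le> \<epsilon>"
      using valid_is_code[OF v] error unfolding M_def by blast
  qed
qed

end

theorem theorem2:
  fixes Ch :: "('x, 'y) relay_channel"
    and K K1 :: nat
    and \<pi> :: "nat \<Rightarrow> nat"
    and Z :: "nat \<Rightarrow> 'z set"
    and P :: "('x, 'y, 'z) sample pmf"
    and T T1 T2 :: "nat set"
    and R :: real
  defines "K \<equiv> last_node Ch"
    and "T \<equiv> relays Ch"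
    and "T1 \<equiv> DF_relays \<pi> K1"
    and "T2 \<equiv> QF_relays Ch \<pi> K1"
  assumes channel: "relay_channel Ch"
    and connected: "multihop_rate Ch 1 K > 0"
    and perm: "\<pi> permutes {1..K}" "\<pi> 1 = 1" "\<pi> K = K"
    and K1: "1 \<le> K1" "K1 \<le> K - 1"
    and quantizers: "\<forall>k\<in>T2. finite (Z k)"
    and joint: "joint_law Ch \<pi> K1 Z P"
    and decode_forward:
      "\<forall>k\<in>{1..K1 - 1}. R < cmi P (Xs (\<pi> ` {1..k})) (Ys {\<pi> (k + 1)}) (Xs (\<pi> ` {k + 1..K1}))"
    and quantize_forward:
      "\<forall>S\<subseteq>T2. R <
         cmi P (Xs ({1} \<union> T1 \<union> S)) (\<lambda>\<omega>. (Zs (T2 - S) \<omega>, Ys {K} \<omega>)) (Xs (T2 - S))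
         - cmi P (Zs S) (Ys S) (\<lambda>\<omega>. (Xs ({1} \<union> T) \<omega>, Zs (T2 - S) \<omega>, Ys {K} \<omega>))"
  shows "snnc_df_achievable Ch \<pi> K1 Z P R"
proof -
  obtain p1 :: "(nat \<Rightarrow> 'x) pmf" and px :: "nat \<Rightarrow> 'x pmf" and pz :: "nat \<Rightarrow> 'y \<Rightarrow> 'x \<Rightarrow> 'z pmf" where
    P: "set_pmf P \<subseteq> PiE (senders Ch) (inp Ch) \<times> PiE (receivers Ch) (outp Ch) \<times> PiE T2 Z"
    "\<And>x y z. x \<in> PiE (senders Ch) (inp Ch) \<Longrightarrow> y \<in> PiE (receivers Ch) (outp Ch) \<Longrightarrow> z \<in> PiE T2 Z \<Longrightarrow>
      pmf P (x, y, z) = pmf p1 (restrict x ({1} \<union> T1)) * (\<Prod>k\<in>T2. pmf (px k) (x k) * pmf (pz k (y k) (x k)) (z k)) * pmf (law Ch x) y"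
    using joint unfolding joint_law_def Let_def T1_def T2_def by blast
  interpret relay_law Ch \<pi> K1 Z P p1 px pz
    by unfold_locales
      (use channel perm K1 quantizers P in \<open>simp_all add: K_def T1_def T2_def\<close>)
  show ?thesis
  proof (cases "R \<le> 0")
    case False
    show ?thesis
    proof (rule achievable_pos)
      fix m assume m: "m \<in> {2..K1}"
      \<comment> \<open>The theorem counts by the last position \<open>k\<close> that helps, the
        relays by the decoding position \<open>m = k + 1\<close>.\<close>
      then have "m - 1 \<in> {1..K1 - 1}" "m - 1 + 1 = m" by auto
      then have "R < cmi P (Xs (\<pi> ` {1..m - 1})) (Ys {\<pi> m}) (Xs (\<pi> ` {m..K1}))"
        using decode_forward by metis
      then show "R < (\<Sum>i\<in>{1..<m}. mean P (ylog m i))" unfolding df_rate[OF m] .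
    next
      fix S assume S: "S \<subseteq> QF_relays Ch \<pi> K1"
      show "R < ent P (Xs A) + FB (QF_relays Ch \<pi> K1 - S) - FA (QF_relays Ch \<pi> K1)"
        using quantize_forward S unfolding rate_eq[OF S, symmetric] K_def T_def T1_def T2_def by blast
    qed (use False in simp)
  qed (rule achievable_nonpos)
qed

end
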